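(* There exists an absolute constant $c > 0$ such that the following holds. Let $n, m, k \in \mathbb{N}$ be arbitrary, let $A = (a_{ij}) \in \mathbb{R}_{\ge 0}^{m \times n}$, let $\mathbf{p} = (p_1,\dots,p_n) \in [0,1]^n$ and let $\mathbf{\Delta} = (\Delta_1,\dots,\Delta_m) \in \mathbb{R}_{>0}^m$. For each $i \in [m]$ define \[ \mathrm{prob}^{bad}_i := c \exp\!\left( -\frac{1}{c} \cdot \min\!\left( \frac{\Delta_i^2}{\sum_{j \in [n]} a_{ij}^2},\; \frac{\Delta_i k}{\sum_{j \in [n]} p_j a_{ij}} \right) \right). \] Then there exists a deterministic parallel algorithm with $\tilde{O}(\max(\mathrm{nnz}(A), n, m)\operatorname{poly}(k))$ work and $\operatorname{poly}(\log(nm), k)$ depth that outputs a vector $\mathbf{q} \in \{0,1\}^n$ and a set $I^{bad} \subseteq [m]$ with $|I^{bad}| \le \sum_{i \in [m]} \mathrm{prob}^{bad}_i$ such that for every $i \in [m] \setminus I^{bad}$, \[ \Big| \sum_{j \in [n]} a_{ij}(p_j - q_j) \Big| \le \Delta_i. \]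
   Context: $[n] = \{1,\dots,n\}$. $\mathrm{nnz}(A)$ denotes the number of nonzero entries of the matrix $A$. Parallel algorithms are measured in the work/depth (PRAM) model: work is the total number of operations and depth is the length of the longest chain of sequentially dependent operations. $\tilde{O}(\cdot)$ hides factors polylogarithmic in the input size (in $n$ and $m$). *)

theory Defs
  imports Complex_Main "HOL-Library.Extended_Real" "Jordan_Normal_Form.Matrix"
begin

section \<open>A work/depth machine with shared memory\<close>

text \<open>
  Programs of the work/depth model: a sequential language over registers and shared memory,
  extended by a nestable parallel loop. There are two sorts of data: machine words (naturals below
  a bound \<open>B\<close> that is a parameter of the semantics), used for indices and control, and real numbers
  with exact unit-cost arithmetic and comparison. Real data never flow back into words except
  through comparisons (there is no rounding), and a program contains no real constants, so that no
  information can be hidden in the digits of a constant.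
  The first argument of an assignment is the destination register; in the store instructions it is
  the register that holds the address.
\<close>

datatype wop = WAdd | WSub | WMul | WDiv | WMod

datatype rop = RAdd | RSub | RMul | RDiv

datatype test = WLess nat nat | RLess nat nat

datatype com =
    Skip
  | WConst nat nat
  | WOp wop nat nat nat
  | WLoad nat nat
  | WStore nat nat
  | ROfW nat nat
  | ROp rop nat nat nat
  | RLoad nat nat
  | RStore nat nat
  | Seq com com
  | Cond test com com
  | While test com
  | ParFor nat nat com

record state =
  wreg :: "nat \<Rightarrow> nat"
  rreg :: "nat \<Rightarrow> real"
  wmem :: "nat \<Rightarrow> nat"
  rmem :: "nat \<Rightarrow> real"

datatype loc = WLoc nat | RLoc nat

fun wop_val :: "wop \<Rightarrow> nat \<Rightarrow> nat \<Rightarrow> nat" where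
  "wop_val WAdd x y = x + y"
| "wop_val WSub x y = x - y"
| "wop_val WMul x y = x * y"
| "wop_val WDiv x y = x div y"
| "wop_val WMod x y = x mod y"

fun rop_val :: "rop \<Rightarrow> real \<Rightarrow> real \<Rightarrow> real" where
  "rop_val RAdd x y = x + y"
| "rop_val RSub x y = x - y"
| "rop_val RMul x y = x * y"
| "rop_val RDiv x y = x / y"

fun test_val :: "test \<Rightarrow> state \<Rightarrow> bool" where
  "test_val (WLess x y) s \<longleftrightarrow> wreg s x < wreg s y"
| "test_val (RLess x y) s \<longleftrightarrow> rreg s x < rreg s y"

text \<open>
  Shared memory after \<open>N\<close> parallel iterations, where iteration \<open>i\<close> ends in state \<open>t i\<close> and has
  written the cells \<open>ws i\<close>. Registers are private to an iteration and are discarded.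
\<close>

definition merge :: "nat \<Rightarrow> state \<Rightarrow> (nat \<Rightarrow> state) \<Rightarrow> (nat \<Rightarrow> loc set) \<Rightarrow> state" where
  "merge N s t ws = s\<lparr>
     wmem := (\<lambda>a. if \<exists>i<N. WLoc a \<in> ws i
                  then wmem (t (THE i. i < N \<and> WLoc a \<in> ws i)) a else wmem s a),
     rmem := (\<lambda>a. if \<exists>i<N. RLoc a \<in> ws i
                  then rmem (t (THE i. i < N \<and> RLoc a \<in> ws i)) a else rmem s a)\<rparr>"

text \<open>
  \<open>exec B c s t rs ws w d\<close>: started in \<open>s\<close>, the program \<open>c\<close> terminates in \<open>t\<close>, having read the
  shared cells \<open>rs\<close> and written the shared cells \<open>ws\<close>, with work \<open>w\<close> and depth \<open>d\<close>. There is no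
  such execution if some word operation produces a value \<open>\<ge> B\<close>, or if a cell that is
  written by one iteration of a parallel loop is read or written by another iteration (concurrent
  reads are allowed). Hence the iterations of a parallel loop do not depend on each other, and the
  depth of the loop is governed by its deepest iteration.
\<close>

inductive exec ::
  "nat \<Rightarrow> com \<Rightarrow> state \<Rightarrow> state \<Rightarrow> loc set \<Rightarrow> loc set \<Rightarrow> nat \<Rightarrow> nat \<Rightarrow> bool"
  for B :: nat where
  Skip: "exec B Skip s s {} {} 1 1"
| WConst: "a < B \<Longrightarrow>
    exec B (WConst x a) s (s\<lparr>wreg := (wreg s)(x := a)\<rparr>) {} {} 1 1"
| WOp: "wop_val f (wreg s y) (wreg s z) < B \<Longrightarrow>
    exec B (WOp f x y z) s
      (s\<lparr>wreg := (wreg s)(x := wop_val f (wreg s y) (wreg s z))\<rparr>) {} {} 1 1"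
| WLoad:
    "exec B (WLoad x y) s
      (s\<lparr>wreg := (wreg s)(x := wmem s (wreg s y))\<rparr>) {WLoc (wreg s y)} {} 1 1"
| WStore:
    "exec B (WStore y x) s
      (s\<lparr>wmem := (wmem s)(wreg s y := wreg s x)\<rparr>) {} {WLoc (wreg s y)} 1 1"
| ROfW:
    "exec B (ROfW x y) s (s\<lparr>rreg := (rreg s)(x := real (wreg s y))\<rparr>) {} {} 1 1"
| ROp:
    "exec B (ROp g x y z) s
      (s\<lparr>rreg := (rreg s)(x := rop_val g (rreg s y) (rreg s z))\<rparr>) {} {} 1 1"
| RLoad:
    "exec B (RLoad x y) s
      (s\<lparr>rreg := (rreg s)(x := rmem s (wreg s y))\<rparr>) {RLoc (wreg s y)} {} 1 1"
| RStore:
    "exec B (RStore y x) s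
      (s\<lparr>rmem := (rmem s)(wreg s y := rreg s x)\<rparr>) {} {RLoc (wreg s y)} 1 1"
| Seq:
    "\<lbrakk>exec B c1 s s' rs1 ws1 w1 d1; exec B c2 s' s'' rs2 ws2 w2 d2\<rbrakk> \<Longrightarrow>
     exec B (Seq c1 c2) s s'' (rs1 \<union> rs2) (ws1 \<union> ws2) (w1 + w2) (d1 + d2)"
| CondTrue:
    "\<lbrakk>test_val b s; exec B c1 s s' rs ws w d\<rbrakk> \<Longrightarrow>
     exec B (Cond b c1 c2) s s' rs ws (1 + w) (1 + d)"
| CondFalse:
    "\<lbrakk>\<not> test_val b s; exec B c2 s s' rs ws w d\<rbrakk> \<Longrightarrow>
     exec B (Cond b c1 c2) s s' rs ws (1 + w) (1 + d)"
| WhileFalse: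
    "\<not> test_val b s \<Longrightarrow> exec B (While b c) s s {} {} 1 1"
| WhileTrue:
    "\<lbrakk>test_val b s; exec B c s s' rs1 ws1 w1 d1;
      exec B (While b c) s' s'' rs2 ws2 w2 d2\<rbrakk> \<Longrightarrow>
     exec B (While b c) s s'' (rs1 \<union> rs2) (ws1 \<union> ws2) (1 + w1 + w2) (1 + d1 + d2)"
| ParFor:
    "\<lbrakk>N = wreg s y;
      \<And>i. i < N \<Longrightarrow> exec B c (s\<lparr>wreg := (wreg s)(x := i)\<rparr>) (t i) (rs i) (ws i) (w i) (d i);
      \<And>i j. \<lbrakk>i < N; j < N; i \<noteq> j\<rbrakk> \<Longrightarrow> ws i \<inter> (rs j \<union> ws j) = {}\<rbrakk> \<Longrightarrow>
     exec B (ParFor x y c) s (merge N s t ws) (\<Union>i<N. rs i) (\<Union>i<N. ws i)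
       (1 + (\<Sum>i<N. w i)) (1 + Max (insert 0 (d ` {..<N})))"

inductive_cases exec_SkipE: "exec B Skip s t rs ws w d"
inductive_cases exec_WConstE: "exec B (WConst x a) s t rs ws w d"
inductive_cases exec_WOpE: "exec B (WOp f x y z) s t rs ws w d"
inductive_cases exec_WLoadE: "exec B (WLoad x y) s t rs ws w d"
inductive_cases exec_WStoreE: "exec B (WStore x y) s t rs ws w d"
inductive_cases exec_ROfWE: "exec B (ROfW x y) s t rs ws w d"
inductive_cases exec_ROpE: "exec B (ROp f x y z) s t rs ws w d"
inductive_cases exec_RLoadE: "exec B (RLoad x y) s t rs ws w d"
inductive_cases exec_RStoreE: "exec B (RStore x y) s t rs ws w d"
inductive_cases exec_SeqE: "exec B (Seq c1 c2) s t rs ws w d"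
inductive_cases exec_CondE: "exec B (Cond b c1 c2) s t rs ws w d"
inductive_cases exec_WhileE: "exec B (While b c) s t rs ws w d"
inductive_cases exec_ParForE: "exec B (ParFor x y c) s t rs ws w d"

lemma merge_cong:
  assumes "\<And>i. i < N \<Longrightarrow> t i = t' i" and ws: "\<And>i. i < N \<Longrightarrow> ws i = ws' i"
    and disj: "\<And>i j. \<lbrakk>i < N; j < N; i \<noteq> j\<rbrakk> \<Longrightarrow> ws i \<inter> ws j = {}"
  shows "merge N s t ws = merge N s t' ws'"
proof -
  have same: "t (THE i. i < N \<and> l \<in> ws i) = t' (THE i. i < N \<and> l \<in> ws i)"
    if "\<exists>i<N. l \<in> ws i" for l
  proof -
    from that disj have "\<exists>!i. i < N \<and> l \<in> ws i" by blast
    then have "(THE i. i < N \<and> l \<in> ws i) < N" by (metis (mono_tags, lifting) theI')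
    then show ?thesis by (rule assms(1))
  qed
  have eq: "(i < N \<and> l \<in> ws' i) = (i < N \<and> l \<in> ws i)" for i l
    using ws by blast
  have w: "(if \<exists>i<N. WLoc a \<in> ws i then wmem (t (THE i. i < N \<and> WLoc a \<in> ws i)) a else wmem s a) =
      (if \<exists>i<N. WLoc a \<in> ws i then wmem (t' (THE i. i < N \<and> WLoc a \<in> ws i)) a else wmem s a)" for a
    by (rule if_cong[OF refl]) (simp_all only: same)
  have r: "(if \<exists>i<N. RLoc a \<in> ws i then rmem (t (THE i. i < N \<and> RLoc a \<in> ws i)) a else rmem s a) =
      (if \<exists>i<N. RLoc a \<in> ws i then rmem (t' (THE i. i < N \<and> RLoc a \<in> ws i)) a else rmem s a)" for a
    by (rule if_cong[OF refl]) (simp_all only: same)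
  show ?thesis
    unfolding merge_def eq w r ..
qed

theorem exec_deterministic:
  "exec B c s t rs ws w d \<Longrightarrow> exec B c s t' rs' ws' w' d' \<Longrightarrow>
   t' = t \<and> rs' = rs \<and> ws' = ws \<and> w' = w \<and> d' = d"
proof (induction arbitrary: t' rs' ws' w' d' rule: exec.induct)
  case (Seq c1 s s' rs1 ws1 w1 d1 c2 s'' rs2 ws2 w2 d2)
  from Seq.prems show ?case by (rule exec_SeqE) (use Seq.IH in blast)
next
  case (CondTrue b s c1 s' rs ws w d c2)
  from CondTrue.prems show ?case
    by (rule exec_CondE) (auto simp: CondTrue.hyps(1) dest!: CondTrue.IH)
next
  case (CondFalse b s c2 s' rs ws w d c1)
  from CondFalse.prems show ?case
    by (rule exec_CondE) (auto simp: CondFalse.hyps(1) dest!: CondFalse.IH)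
next
  case (WhileFalse b s c)
  from WhileFalse.prems show ?case
    by (rule exec_WhileE) (auto simp: WhileFalse.hyps(1))
next
  case (WhileTrue b s c s' rs1 ws1 w1 d1 s'' rs2 ws2 w2 d2)
  from WhileTrue.prems show ?case
    by (rule exec_WhileE) (auto simp: WhileTrue.hyps(1) dest!: WhileTrue.IH)
next
  case (ParFor N s y c x t rs ws w d)
  from ParFor.prems show ?case
  proof (rule exec_ParForE)
    fix t1 rs1 ws1 w1 d1
    assume eqs: "t' = merge (wreg s y) s t1 ws1" "rs' = \<Union> (rs1 ` {..<wreg s y})"
        "ws' = \<Union> (ws1 ` {..<wreg s y})"
        "w' = Suc (sum w1 {..<wreg s y})" "d' = Suc (Max (insert 0 (d1 ` {..<wreg s y})))"
      and run: "\<And>i. i < wreg s y \<Longrightarrow>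
        exec B c (s\<lparr>wreg := (wreg s)(x := i)\<rparr>) (t1 i) (rs1 i) (ws1 i) (w1 i) (d1 i)"
    have N: "wreg s y = N" using ParFor.hyps by simp
    have same: "t1 i = t i \<and> rs1 i = rs i \<and> ws1 i = ws i \<and> w1 i = w i \<and> d1 i = d i"
      if "i < N" for i
      using ParFor.IH[OF that run] that N by simp
    have disj: "ws i \<inter> ws j = {}" if "i < N" "j < N" "i \<noteq> j" for i j
      using ParFor.hyps(3)[OF that] by blast
    have "merge N s t ws = merge N s t1 ws1"
      by (rule merge_cong) (simp_all add: same disj)
    moreover have "d1 ` {..<N} = d ` {..<N}" using same by (intro image_cong) auto
    ultimately show ?thesis using eqs same unfolding N by simp
  qed
qed (auto elim: exec_SkipE exec_WConstE exec_WOpE exec_WLoadE exec_WStoreE exec_ROfWE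
       exec_ROpE exec_RLoadE exec_RStoreE)

definition runs :: "nat \<Rightarrow> com \<Rightarrow> state \<Rightarrow> state \<Rightarrow> nat \<Rightarrow> nat \<Rightarrow> bool" where
  "runs B alg s t work depth \<longleftrightarrow> (\<exists>rs ws. exec B alg s t rs ws work depth)"


section \<open>Rounding instances\<close>

definition support :: "real mat \<Rightarrow> (nat \<times> nat) set" where
  "support A = {(i, j). i < dim_row A \<and> j < dim_col A \<and> A $$ (i, j) \<noteq> 0}"

definition nnz :: "real mat \<Rightarrow> nat" where
  "nnz A = card (support A)"

text \<open>
  The matrix is given as a list \<open>es\<close> of the positions of its nonzero entries, in arbitrary order.
  Word memory: \<open>n\<close>, \<open>m\<close>, \<open>k\<close>, the length of \<open>es\<close>, and then row and column of each position in
  turn. Real memory: the nonzero entries in the order of \<open>es\<close>, then \<open>p\<close>, then \<open>\<Delta>\<close>.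
\<close>

definition input_words :: "nat \<Rightarrow> nat \<Rightarrow> nat \<Rightarrow> (nat \<times> nat) list \<Rightarrow> nat list" where
  "input_words n m k es = [n, m, k, length es] @ concat (map (\<lambda>(i, j). [i, j]) es)"

definition input_reals :: "real mat \<Rightarrow> real vec \<Rightarrow> real vec \<Rightarrow> (nat \<times> nat) list \<Rightarrow> real list" where
  "input_reals A p \<Delta> es = map (\<lambda>(i, j). A $$ (i, j)) es @ list_of_vec p @ list_of_vec \<Delta>"

definition load :: "'a::zero list \<Rightarrow> nat \<Rightarrow> 'a" where
  "load xs a = (if a < length xs then xs ! a else 0)"

definition input_state ::
  "nat \<Rightarrow> real mat \<Rightarrow> real vec \<Rightarrow> real vec \<Rightarrow> (nat \<times> nat) list \<Rightarrow> state" where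
  "input_state k A p \<Delta> es =
     \<lparr>wreg = (\<lambda>_. 0), rreg = (\<lambda>_. 0),
      wmem = load (input_words (dim_col A) (dim_row A) k es),
      rmem = load (input_reals A p \<Delta> es)\<rparr>"

text \<open>
  Outputs are read off the word memory: first the \<open>n\<close> entries of the vector, then the
  characteristic vector of a subset of the \<open>m\<close> row indices.
\<close>

definition output_vec :: "nat \<Rightarrow> state \<Rightarrow> real vec" where
  "output_vec n s = vec n (\<lambda>j. real (wmem s j))"

definition output_set :: "nat \<Rightarrow> nat \<Rightarrow> state \<Rightarrow> nat set" where
  "output_set n m s = {i. i < m \<and> wmem s (n + i) \<noteq> 0}"

text \<open>
  A quotient with denominator \<open>0\<close> is read as \<open>\<infinity>\<close>, and \<open>exp (-\<infinity>) = 0\<close>.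
\<close>

definition quot :: "real \<Rightarrow> real \<Rightarrow> ereal" where
  "quot x y = (if y = 0 then \<infinity> else ereal (x / y))"

definition exp_minus :: "ereal \<Rightarrow> real" where
  "exp_minus x = (if x = \<infinity> then 0 else exp (- real_of_ereal x))"

definition prob_bad :: "real \<Rightarrow> nat \<Rightarrow> real mat \<Rightarrow> real vec \<Rightarrow> real vec \<Rightarrow> nat \<Rightarrow> real" where
  "prob_bad c k A p \<Delta> i =
     c * exp_minus (ereal (1 / c) *
       min (quot ((\<Delta> $ i)\<^sup>2) (\<Sum>j<dim_col A. (A $$ (i, j))\<^sup>2))
           (quot (\<Delta> $ i * real k) (\<Sum>j<dim_col A. p $ j * A $$ (i, j))))"

end

theory Submission
  imports Defs
begin

text \<open>
  The rounding is a derandomised random walk. In each of \<open>T = O(K\<^sup>2 log (n + m))\<close> steps, where \<open>K\<close> is of order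
  \<open>k + log (n + m)\<close>, every coordinate moves from \<open>p j\<close> to \<open>p j \<plusminus> p j (1 - p j) / K\<close>. A weight \<open>W r\<close> is attached
  to every row of the matrix and to its negation; it is multiplied by \<open>(1 + y + y\<^sup>2) / (1 + \<Sum> \<beta>\<^sup>2)\<close>, where \<open>y\<close> is the
  change of the row under the chosen signs and \<open>\<beta>\<close> are its coefficients. This factor is at least the
  exponential of the change, up to second order terms that telescope along the walk. A row is frozen and
  declared bad when its weight reaches \<open>1\<close>, so that the initial weights, which are about \<open>2 powr (- \<lambda> \<Delta> / 4)\<close> for a
  suitable scale \<open>\<lambda>\<close>, bound the number of bad rows. One further row per variable gains weight whenever
  \<open>p j (1 - p j)\<close> fails to decay, which forces near-integrality after \<open>T\<close> steps.

  The update is quadratic in the signs, hence its mean over pairwise independent signs is \<open>1\<close>. The sign of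
  \<open>j\<close> is taken to be the product of signs \<open>\<sigma> b\<close> over the bits \<open>b\<close> set in \<open>j\<close>; the \<open>\<sigma> b\<close> are fixed one after the
  other by conditional expectations, which are computed by folding the rows level by level along a
  sparse binary tree. This takes polylogarithmic depth and almost linear work.
\<close>

section \<open>A structured language on top of the machine\<close>

text \<open>Pairwise independent signs control second moments only, so \<open>exp y\<close> is
  replaced by \<open>1 + y + y^2\<close>, which dominates it for y <= 1. This restriction dictates
  the step size: after scaling, an active row has \<open>\<Sum> b p <= k\<close> at the start, and
  as long as its weight is below 1 the sum has grown by O(log (n + m)) only, so steps of relative
  size 1 / K keep y <= 1. A row that reaches weight 1 loses this control, hence the freezing. The
  loss \<open>\<Sum> \<beta>^2\<close> is charged to the change of
  \<open>2 * \<Sum> b^2 p^2\<close>, which stays bounded over the whole walk because p <= 1. Near 0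
  and 1 the mean of p (1 - p) hardly decays, but that of its square root loses a factor 1 - const /
  K^2 everywhere; therefore the weight belonging to a variable is compared with that square root,
  and T is of order K^2 times a logarithm. The machine has no exponential, no rounding and no real
  constants: scales, weights and signs come from arithmetic and comparisons alone. It also forbids
  concurrent writes, which is why row sums go through a tree with one designated writer per
  node.\<close>

text \<open>
  Expressions are evaluated in abstract states whose memory consists of a raw part (the cells
  below an offset \<open>Z\<close>, which contain input and output) and of sixteen arrays per sort,
  interleaved above \<open>Z\<close>: cell \<open>i\<close> of array \<open>a\<close> has address \<open>Z + 16 * i + a\<close>. The machine registers
  below \<open>20\<close> are program variables (register \<open>0\<close> holds \<open>Z\<close>), the others are scratch.
\<close>

datatype wexp =
    WC nat | WR nat | WM wexp | WA nat wexp | WB wop wexp wexp | WIf texp wexp wexp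
and rexp =
    RR nat | RM wexp | RA nat wexp | RB rop rexp rexp | RW wexp | RIf texp rexp rexp
and texp = TW wexp wexp | TR rexp rexp

record hst =
  hw :: "nat \<Rightarrow> nat"
  hr :: "nat \<Rightarrow> real"
  wraw :: "nat \<Rightarrow> nat"
  rraw :: "nat \<Rightarrow> real"
  wa :: "nat \<Rightarrow> nat \<Rightarrow> nat"
  ra :: "nat \<Rightarrow> nat \<Rightarrow> real"

datatype hloc = WRaw nat | WArr nat nat | RRaw nat | RArr nat nat

primrec lc :: "nat \<Rightarrow> hloc \<Rightarrow> loc" where
  "lc Z (WRaw a) = WLoc a"
| "lc Z (WArr a i) = WLoc (Z + 16 * i + a)"
| "lc Z (RRaw a) = RLoc a"
| "lc Z (RArr a i) = RLoc (Z + 16 * i + a)"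

primrec wv :: "hst \<Rightarrow> wexp \<Rightarrow> nat" and rv :: "hst \<Rightarrow> rexp \<Rightarrow> real"
  and tv :: "hst \<Rightarrow> texp \<Rightarrow> bool" where
  "wv s (WC a) = a"
| "wv s (WR x) = hw s x"
| "wv s (WM e) = wraw s (wv s e)"
| "wv s (WA a e) = wa s a (wv s e)"
| "wv s (WB f e1 e2) = wop_val f (wv s e1) (wv s e2)"
| "wv s (WIf b e1 e2) = (if tv s b then wv s e1 else wv s e2)"
| "rv s (RR x) = hr s x"
| "rv s (RM e) = rraw s (wv s e)"
| "rv s (RA a e) = ra s a (wv s e)"
| "rv s (RB f e1 e2) = rop_val f (rv s e1) (rv s e2)"
| "rv s (RW e) = real (wv s e)"
| "rv s (RIf b e1 e2) = (if tv s b then rv s e1 else rv s e2)"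
| "tv s (TW e1 e2) = (wv s e1 < wv s e2)"
| "tv s (TR e1 e2) = (rv s e1 < rv s e2)"

primrec wrd :: "hst \<Rightarrow> wexp \<Rightarrow> hloc set" and rrd :: "hst \<Rightarrow> rexp \<Rightarrow> hloc set"
  and trd :: "hst \<Rightarrow> texp \<Rightarrow> hloc set" where
  "wrd s (WC a) = {}"
| "wrd s (WR x) = {}"
| "wrd s (WM e) = insert (WRaw (wv s e)) (wrd s e)"
| "wrd s (WA a e) = insert (WArr a (wv s e)) (wrd s e)"
| "wrd s (WB f e1 e2) = wrd s e1 \<union> wrd s e2"
| "wrd s (WIf b e1 e2) = trd s b \<union> (if tv s b then wrd s e1 else wrd s e2)"
| "rrd s (RR x) = {}"
| "rrd s (RM e) = insert (RRaw (wv s e)) (wrd s e)"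
| "rrd s (RA a e) = insert (RArr a (wv s e)) (wrd s e)"
| "rrd s (RB f e1 e2) = rrd s e1 \<union> rrd s e2"
| "rrd s (RW e) = wrd s e"
| "rrd s (RIf b e1 e2) = trd s b \<union> (if tv s b then rrd s e1 else rrd s e2)"
| "trd s (TW e1 e2) = wrd s e1 \<union> wrd s e2"
| "trd s (TR e1 e2) = rrd s e1 \<union> rrd s e2"

text \<open>The bounds are those that the compiled code runs into: a word register is copied by
  adding it to 0, so its value must lie below \<open>B\<close>; an array access forms
  \<open>Z + 16 * i + a\<close>, with 16 as a constant, and \<open>Z + 16 * i + 16 < B\<close>
  covers every intermediate value. Copying a real register starts from the word constant 0, whence
  \<open>0 < B\<close>.\<close>

primrec wok :: "nat \<Rightarrow> nat \<Rightarrow> hst \<Rightarrow> wexp \<Rightarrow> bool" and rok :: "nat \<Rightarrow> nat \<Rightarrow> hst \<Rightarrow> rexp \<Rightarrow> bool"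
  and tok :: "nat \<Rightarrow> nat \<Rightarrow> hst \<Rightarrow> texp \<Rightarrow> bool" where
  "wok B Z s (WC a) = (a < B)"
| "wok B Z s (WR x) = (x < 20 \<and> hw s x < B)"
| "wok B Z s (WM e) = (wok B Z s e \<and> wv s e < Z)"
| "wok B Z s (WA a e) = (wok B Z s e \<and> a < 16 \<and> Z + 16 * wv s e + 16 < B)"
| "wok B Z s (WB f e1 e2) = (wok B Z s e1 \<and> wok B Z s e2 \<and> wop_val f (wv s e1) (wv s e2) < B)"
| "wok B Z s (WIf b e1 e2) = (tok B Z s b \<and> (if tv s b then wok B Z s e1 else wok B Z s e2))"
| "rok B Z s (RR x) = (x < 20 \<and> 0 < B)"
| "rok B Z s (RM e) = (wok B Z s e \<and> wv s e < Z)"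
| "rok B Z s (RA a e) = (wok B Z s e \<and> a < 16 \<and> Z + 16 * wv s e + 16 < B)"
| "rok B Z s (RB f e1 e2) = (rok B Z s e1 \<and> rok B Z s e2)"
| "rok B Z s (RW e) = wok B Z s e"
| "rok B Z s (RIf b e1 e2) = (tok B Z s b \<and> (if tv s b then rok B Z s e1 else rok B Z s e2))"
| "tok B Z s (TW e1 e2) = (wok B Z s e1 \<and> wok B Z s e2)"
| "tok B Z s (TR e1 e2) = (rok B Z s e1 \<and> rok B Z s e2)"

primrec wcost :: "wexp \<Rightarrow> nat" and rcost :: "rexp \<Rightarrow> nat" and tcost :: "texp \<Rightarrow> nat" where
  "wcost (WC a) = 1"
| "wcost (WR x) = 2"
| "wcost (WM e) = wcost e + 1"
| "wcost (WA a e) = wcost e + 6"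
| "wcost (WB f e1 e2) = wcost e1 + wcost e2 + 1"
| "wcost (WIf b e1 e2) = tcost b + wcost e1 + wcost e2 + 1"
| "rcost (RR x) = 3"
| "rcost (RM e) = wcost e + 1"
| "rcost (RA a e) = wcost e + 6"
| "rcost (RB f e1 e2) = rcost e1 + rcost e2 + 1"
| "rcost (RW e) = wcost e + 1"
| "rcost (RIf b e1 e2) = tcost b + rcost e1 + rcost e2 + 1"
| "tcost (TW e1 e2) = wcost e1 + wcost e2"
| "tcost (TR e1 e2) = rcost e1 + rcost e2"

definition addr_code :: "nat \<Rightarrow> nat \<Rightarrow> com" where
  "addr_code t a = Seq (WConst (t + 1) 16) (Seq (WOp WMul t t (t + 1))
     (Seq (WConst (t + 1) a) (Seq (WOp WAdd t t (t + 1)) (WOp WAdd t t 0))))"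

primrec ctst :: "nat \<Rightarrow> nat \<Rightarrow> texp \<Rightarrow> test" where
  "ctst t q (TW e1 e2) = WLess t (t + 1)"
| "ctst t q (TR e1 e2) = RLess q (q + 1)"

text \<open>\<open>t\<close> and \<open>q\<close> are the tops of two stacks of scratch registers;
  the result is left at the top and everything below survives. Registers are copied by adding them
  to zero, and the real zero is the conversion of the word 0, since programs contain no real
  constants.\<close>

primrec cw :: "wexp \<Rightarrow> nat \<Rightarrow> nat \<Rightarrow> com" and cr :: "rexp \<Rightarrow> nat \<Rightarrow> nat \<Rightarrow> com"
  and cpre :: "texp \<Rightarrow> nat \<Rightarrow> nat \<Rightarrow> com" where
  "cw (WC a) = (\<lambda>t q. WConst t a)"
| "cw (WR x) = (\<lambda>t q. Seq (WConst t 0) (WOp WAdd t t x))"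
| "cw (WM e) = (\<lambda>t q. Seq (cw e t q) (WLoad t t))"
| "cw (WA a e) = (\<lambda>t q. Seq (cw e t q) (Seq (addr_code t a) (WLoad t t)))"
| "cw (WB f e1 e2) = (\<lambda>t q. Seq (cw e1 t q) (Seq (cw e2 (t + 1) q) (WOp f t t (t + 1))))"
| "cw (WIf b e1 e2) = (\<lambda>t q. Seq (cpre b t q) (Cond (ctst t q b) (cw e1 t q) (cw e2 t q)))"
| "cr (RR x) = (\<lambda>t q. Seq (WConst t 0) (Seq (ROfW q t) (ROp RAdd q q x)))"
| "cr (RM e) = (\<lambda>t q. Seq (cw e t q) (RLoad q t))"
| "cr (RA a e) = (\<lambda>t q. Seq (cw e t q) (Seq (addr_code t a) (RLoad q t)))"
| "cr (RB f e1 e2) = (\<lambda>t q. Seq (cr e1 t q) (Seq (cr e2 t (q + 1)) (ROp f q q (q + 1))))"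
| "cr (RW e) = (\<lambda>t q. Seq (cw e t q) (ROfW q t))"
| "cr (RIf b e1 e2) = (\<lambda>t q. Seq (cpre b t q) (Cond (ctst t q b) (cr e1 t q) (cr e2 t q)))"
| "cpre (TW e1 e2) = (\<lambda>t q. Seq (cw e1 t q) (cw e2 (t + 1) q))"
| "cpre (TR e1 e2) = (\<lambda>t q. Seq (cr e1 t q) (cr e2 t (q + 1)))"

text \<open>Registers from 20 on are left unconstrained, so scratch values never enter an abstract
  state and compiled expressions preserve the relation for free.\<close>

definition rel :: "nat \<Rightarrow> hst \<Rightarrow> state \<Rightarrow> bool" where
  "rel Z h s \<longleftrightarrow> hw h 0 = Z \<and> (\<forall>x<20. wreg s x = hw h x \<and> rreg s x = hr h x) \<and>
     (\<forall>a<Z. wmem s a = wraw h a \<and> rmem s a = rraw h a) \<and>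
     (\<forall>a<16. \<forall>i. wmem s (Z + 16 * i + a) = wa h a i \<and> rmem s (Z + 16 * i + a) = ra h a i)"

definition eqv :: "nat \<Rightarrow> nat \<Rightarrow> state \<Rightarrow> state \<Rightarrow> bool" where
  "eqv t q s s' \<longleftrightarrow> wmem s' = wmem s \<and> rmem s' = rmem s \<and>
     (\<forall>x<t. wreg s' x = wreg s x) \<and> (\<forall>x<q. rreg s' x = rreg s x)"

lemma rel_eqv: "\<lbrakk>rel Z h s; eqv t q s s'; 20 \<le> t; 20 \<le> q\<rbrakk> \<Longrightarrow> rel Z h s'"
  by (simp add: rel_def eqv_def)

lemma eqv_trans: "\<lbrakk>eqv t q s s'; eqv t' q' s' s''; t \<le> t'; q \<le> q'\<rbrakk> \<Longrightarrow> eqv t q s s''"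
  by (simp add: eqv_def)

lemma exec_Seq_pure:
  "\<lbrakk>exec B c1 s s' rs1 {} w1 d1; exec B c2 s' s'' rs2 {} w2 d2\<rbrakk> \<Longrightarrow>
   exec B (Seq c1 c2) s s'' (rs1 \<union> rs2) {} (w1 + w2) (d1 + d2)"
  using exec.Seq[of B c1 s s' rs1 "{}" w1 d1 c2 s'' rs2 "{}" w2 d2] by simp

lemma exec_addr_code:
  assumes "Z + 16 * wreg s t + 16 < B" "a < 16" "wreg s 0 = Z" "0 < t"
  shows "\<exists>s'. exec B (addr_code t a) s s' {} {} 5 5 \<and> eqv t q s s' \<and>
    wreg s' t = Z + 16 * wreg s t + a"
proof -
  let ?i = "wreg s t"
  let ?s1 = "s\<lparr>wreg := (wreg s)(t + 1 := 16)\<rparr>"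
  let ?s2 = "?s1\<lparr>wreg := (wreg ?s1)(t := wop_val WMul (wreg ?s1 t) (wreg ?s1 (t + 1)))\<rparr>"
  let ?s3 = "?s2\<lparr>wreg := (wreg ?s2)(t + 1 := a)\<rparr>"
  let ?s4 = "?s3\<lparr>wreg := (wreg ?s3)(t := wop_val WAdd (wreg ?s3 t) (wreg ?s3 (t + 1)))\<rparr>"
  let ?s5 = "?s4\<lparr>wreg := (wreg ?s4)(t := wop_val WAdd (wreg ?s4 t) (wreg ?s4 0))\<rparr>"
  have e1: "exec B (WConst (t + 1) 16) s ?s1 {} {} 1 1" by (rule exec.WConst) (use assms in simp)
  have e2: "exec B (WOp WMul t t (t + 1)) ?s1 ?s2 {} {} 1 1"
    by (rule exec.WOp) (use assms in simp)
  have e3: "exec B (WConst (t + 1) a) ?s2 ?s3 {} {} 1 1" by (rule exec.WConst) (use assms in simp)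
  have e4: "exec B (WOp WAdd t t (t + 1)) ?s3 ?s4 {} {} 1 1"
    by (rule exec.WOp) (use assms in simp)
  have e5: "exec B (WOp WAdd t t 0) ?s4 ?s5 {} {} 1 1"
    by (rule exec.WOp) (use assms in simp)
  have five: "1 + (1 + (1 + (1 + 1))) = (5::nat)" by simp
  have "exec B (addr_code t a) s ?s5 {} {} 5 5"
    using exec_Seq_pure[OF e1 exec_Seq_pure[OF e2 exec_Seq_pure[OF e3 exec_Seq_pure[OF e4 e5]]]]
    unfolding addr_code_def five Un_empty_left .
  moreover have "wreg ?s5 t = Z + 16 * wreg s t + a" using assms by simp
  moreover have "eqv t q s ?s5" by (simp add: eqv_def)
  ultimately show ?thesis by blast
qed

definition computes :: "nat \<Rightarrow> com \<Rightarrow> state \<Rightarrow> loc set \<Rightarrow> nat \<Rightarrow> (state \<Rightarrow> bool) \<Rightarrow> bool" where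
  "computes B c s RS k Q \<longleftrightarrow>
     (\<exists>s' rs w d. exec B c s s' rs {} w d \<and> rs \<subseteq> RS \<and> w \<le> k \<and> d \<le> k \<and> Q s')"

lemma computes_mono:
  "\<lbrakk>computes B c s RS k Q; RS \<subseteq> RS'; k \<le> k'; \<And>s'. Q s' \<Longrightarrow> Q' s'\<rbrakk> \<Longrightarrow> computes B c s RS' k' Q'"
  unfolding computes_def by (meson order_trans)

lemma computes_Seq:
  assumes "computes B c1 s RS1 k1 Q" "\<And>s'. Q s' \<Longrightarrow> computes B c2 s' RS2 k2 Q'"
    "RS1 \<union> RS2 \<subseteq> RS" "k1 + k2 \<le> k"
  shows "computes B (Seq c1 c2) s RS k Q'"
proof -
  obtain s' rs1 w1 d1 where 1: "exec B c1 s s' rs1 {} w1 d1" "rs1 \<subseteq> RS1" "w1 \<le> k1" "d1 \<le> k1" "Q s'"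
    using assms(1) unfolding computes_def by blast
  obtain s'' rs2 w2 d2 where 2: "exec B c2 s' s'' rs2 {} w2 d2" "rs2 \<subseteq> RS2" "w2 \<le> k2" "d2 \<le> k2" "Q' s''"
    using assms(2)[OF 1(5)] unfolding computes_def by blast
  have "exec B (Seq c1 c2) s s'' (rs1 \<union> rs2) {} (w1 + w2) (d1 + d2)"
    by (rule exec_Seq_pure[OF 1(1) 2(1)])
  moreover have "rs1 \<union> rs2 \<subseteq> RS" using assms(3) 1 2 by blast
  ultimately show ?thesis unfolding computes_def using 1 2 assms(4)
    by (meson add_mono order_trans)
qed

lemma computes_Cond:
  assumes "test_val b s \<Longrightarrow> computes B c1 s RS k1 Q" "\<not> test_val b s \<Longrightarrow> computes B c2 s RS k2 Q"
    "k1 + k2 + 1 \<le> k"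
  shows "computes B (Cond b c1 c2) s RS k Q"
proof (cases "test_val b s")
  case True
  obtain s' rs w d where 1: "exec B c1 s s' rs {} w d" "rs \<subseteq> RS" "w \<le> k1" "d \<le> k1" "Q s'"
    using assms(1)[OF True] unfolding computes_def by blast
  have "exec B (Cond b c1 c2) s s' rs {} (1 + w) (1 + d)" by (rule exec.CondTrue[OF True 1(1)])
  moreover have "1 + w \<le> k" "1 + d \<le> k" using 1 assms(3) by auto
  ultimately show ?thesis unfolding computes_def using 1 by blast
next
  case False
  obtain s' rs w d where 1: "exec B c2 s s' rs {} w d" "rs \<subseteq> RS" "w \<le> k2" "d \<le> k2" "Q s'"
    using assms(2)[OF False] unfolding computes_def by blast
  have "exec B (Cond b c1 c2) s s' rs {} (1 + w) (1 + d)" by (rule exec.CondFalse[OF False 1(1)])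
  moreover have "1 + w \<le> k" "1 + d \<le> k" using 1 assms(3) by auto
  ultimately show ?thesis unfolding computes_def using 1 by blast
qed

lemma computes_WConst:
  "\<lbrakk>a < B; Q (s\<lparr>wreg := (wreg s)(x := a)\<rparr>)\<rbrakk> \<Longrightarrow> computes B (WConst x a) s {} 1 Q"
  unfolding computes_def using exec.WConst[of a B x s] by blast

lemma computes_WOp:
  "\<lbrakk>wop_val f (wreg s y) (wreg s z) < B;
    Q (s\<lparr>wreg := (wreg s)(x := wop_val f (wreg s y) (wreg s z))\<rparr>)\<rbrakk> \<Longrightarrow> computes B (WOp f x y z) s {} 1 Q"
  unfolding computes_def using exec.WOp[of f s y z B x] by blast

lemma computes_WLoad:
  "Q (s\<lparr>wreg := (wreg s)(x := wmem s (wreg s y))\<rparr>) \<Longrightarrow>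
   computes B (WLoad x y) s {WLoc (wreg s y)} 1 Q"
  unfolding computes_def using exec.WLoad[of B x y s] by blast

lemma computes_RLoad:
  "Q (s\<lparr>rreg := (rreg s)(x := rmem s (wreg s y))\<rparr>) \<Longrightarrow>
   computes B (RLoad x y) s {RLoc (wreg s y)} 1 Q"
  unfolding computes_def using exec.RLoad[of B x y s] by blast

lemma computes_ROfW:
  "Q (s\<lparr>rreg := (rreg s)(x := real (wreg s y))\<rparr>) \<Longrightarrow> computes B (ROfW x y) s {} 1 Q"
  unfolding computes_def using exec.ROfW[of B x y s] by blast

lemma computes_ROp:
  "Q (s\<lparr>rreg := (rreg s)(x := rop_val g (rreg s y) (rreg s z))\<rparr>) \<Longrightarrow> computes B (ROp g x y z) s {} 1 Q"
  unfolding computes_def using exec.ROp[of B g x y z s] by blast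

lemma computes_addr_code:
  assumes "Z + 16 * wreg s t + 16 < B" "a < 16" "wreg s 0 = Z" "0 < t"
    "\<And>s'. eqv t q s s' \<Longrightarrow> wreg s' t = Z + 16 * wreg s t + a \<Longrightarrow> Q s'"
  shows "computes B (addr_code t a) s {} 5 Q"
  using exec_addr_code[OF assms(1-4), of q] assms(5) unfolding computes_def by blast

lemma rel_Z: "rel Z h s \<Longrightarrow> wreg s 0 = Z"
  by (simp add: rel_def)

text \<open>The quantification over \<open>t\<close> and \<open>q\<close> inside the induction is
  essential: the second operand is evaluated one register higher than the first, where
  \<open>eqv\<close> protects the value already computed.\<close>

lemma compile_correct:
  shows "\<forall>t q s. 20 \<le> t \<longrightarrow> 20 \<le> q \<longrightarrow> wok B Z h e \<longrightarrow> rel Z h s \<longrightarrow>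
      computes B (cw e t q) s (lc Z ` wrd h e) (wcost e)
        (\<lambda>s'. rel Z h s' \<and> eqv t q s s' \<and> wreg s' t = wv h e)"
    and "\<forall>t q s. 20 \<le> t \<longrightarrow> 20 \<le> q \<longrightarrow> rok B Z h r \<longrightarrow> rel Z h s \<longrightarrow>
      computes B (cr r t q) s (lc Z ` rrd h r) (rcost r)
        (\<lambda>s'. rel Z h s' \<and> eqv t q s s' \<and> rreg s' q = rv h r)"
    and "\<forall>t q s. 20 \<le> t \<longrightarrow> 20 \<le> q \<longrightarrow> tok B Z h b \<longrightarrow> rel Z h s \<longrightarrow>
      computes B (cpre b t q) s (lc Z ` trd h b) (tcost b)
        (\<lambda>s'. rel Z h s' \<and> eqv t q s s' \<and> test_val (ctst t q b) s' = tv h b)"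
proof (induction e and r and b)
  case (WC a)
  show ?case
    by (auto intro!: computes_mono[OF computes_WConst[where Q = "\<lambda>s'. s' = _"]] intro: rel_eqv simp: eqv_def)
next
  case (WR x)
  show ?case
    by (auto intro!: computes_Seq[OF computes_WConst[where Q = "\<lambda>s'. s' = _", OF _ refl]]
          computes_WOp simp: eqv_def rel_def)
next
  case (WM e)
  show ?case
  proof (intro allI impI)
    fix t q :: nat and s assume h: "20 \<le> t" "20 \<le> q" "wok B Z h (WM e)" "rel Z h s"
    have "computes B (cw e t q) s (lc Z ` wrd h e) (wcost e)
        (\<lambda>s'. rel Z h s' \<and> eqv t q s s' \<and> wreg s' t = wv h e)"
      using WM h by simp
    then show "computes B (cw (WM e) t q) s (lc Z ` wrd h (WM e)) (wcost (WM e))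
        (\<lambda>s'. rel Z h s' \<and> eqv t q s s' \<and> wreg s' t = wv h (WM e))"
      unfolding cw.simps
    proof (rule computes_Seq)
      fix s' assume s': "rel Z h s' \<and> eqv t q s s' \<and> wreg s' t = wv h e"
      then have "wmem s' (wreg s' t) = wraw h (wv h e)" using h by (simp add: rel_def)
      then show "computes B (WLoad t t) s' {WLoc (wv h e)} 1
        (\<lambda>s'. rel Z h s' \<and> eqv t q s s' \<and> wreg s' t = wv h (WM e))"
        using s' h computes_WLoad[where s = s' and x = t and y = t and B = B and
          Q = "\<lambda>s'. rel Z h s' \<and> eqv t q s s' \<and> wreg s' t = wv h (WM e)"]
        by (auto simp: eqv_def rel_def)
    qed auto
  qed
next
  case (WA a e)
  show ?case
  proof (intro allI impI)
    fix t q :: nat and s assume h: "20 \<le> t" "20 \<le> q" "wok B Z h (WA a e)" "rel Z h s"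
    have "computes B (cw e t q) s (lc Z ` wrd h e) (wcost e)
        (\<lambda>s'. rel Z h s' \<and> eqv t q s s' \<and> wreg s' t = wv h e)"
      using WA h by simp
    then show "computes B (cw (WA a e) t q) s (lc Z ` wrd h (WA a e)) (wcost (WA a e))
        (\<lambda>s'. rel Z h s' \<and> eqv t q s s' \<and> wreg s' t = wv h (WA a e))"
      unfolding cw.simps
    proof (rule computes_Seq)
      fix s' assume s': "rel Z h s' \<and> eqv t q s s' \<and> wreg s' t = wv h e"
      have "computes B (addr_code t a) s' {} 5 (\<lambda>s''. rel Z h s'' \<and> eqv t q s s'' \<and> wreg s'' t = Z + 16 * wv h e + a)"
        by (rule computes_addr_code[where q = q and Z = Z])
           (use s' h in \<open>auto simp: rel_Z intro: rel_eqv eqv_trans\<close>)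
      then show "computes B (Seq (addr_code t a) (WLoad t t)) s' {WLoc (Z + 16 * wv h e + a)} 6
        (\<lambda>s'. rel Z h s' \<and> eqv t q s s' \<and> wreg s' t = wv h (WA a e))"
      proof (rule computes_Seq)
        fix s'' assume s'': "rel Z h s'' \<and> eqv t q s s'' \<and> wreg s'' t = Z + 16 * wv h e + a"
        then have "wmem s'' (wreg s'' t) = wa h a (wv h e)" using h by (simp add: rel_def)
        then show "computes B (WLoad t t) s'' {WLoc (Z + 16 * wv h e + a)} 1
          (\<lambda>s'. rel Z h s' \<and> eqv t q s s' \<and> wreg s' t = wv h (WA a e))"
          using s'' h computes_WLoad[where s = s'' and x = t and y = t and B = B and
            Q = "\<lambda>s'. rel Z h s' \<and> eqv t q s s' \<and> wreg s' t = wv h (WA a e)"]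
          by (auto simp: eqv_def rel_def)
      qed auto
    qed auto
  qed
next
  case (WB f e1 e2)
  show ?case
  proof (intro allI impI)
    fix t q :: nat and s assume h: "20 \<le> t" "20 \<le> q" "wok B Z h (WB f e1 e2)" "rel Z h s"
    have "computes B (cw e1 t q) s (lc Z ` wrd h e1) (wcost e1)
        (\<lambda>s'. rel Z h s' \<and> eqv t q s s' \<and> wreg s' t = wv h e1)"
      using WB h by simp
    then show "computes B (cw (WB f e1 e2) t q) s (lc Z ` wrd h (WB f e1 e2)) (wcost (WB f e1 e2))
        (\<lambda>s'. rel Z h s' \<and> eqv t q s s' \<and> wreg s' t = wv h (WB f e1 e2))"
      unfolding cw.simps
    proof (rule computes_Seq)
      fix s' assume s': "rel Z h s' \<and> eqv t q s s' \<and> wreg s' t = wv h e1"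
      have "computes B (cw e2 (t + 1) q) s' (lc Z ` wrd h e2) (wcost e2)
        (\<lambda>s''. rel Z h s'' \<and> eqv (t + 1) q s' s'' \<and> wreg s'' (t + 1) = wv h e2)"
        using WB h s' by simp
      then show "computes B (Seq (cw e2 (t + 1) q) (WOp f t t (t + 1))) s' (lc Z ` wrd h e2) (wcost e2 + 1)
        (\<lambda>s'. rel Z h s' \<and> eqv t q s s' \<and> wreg s' t = wv h (WB f e1 e2))"
      proof (rule computes_Seq)
        fix s'' assume s'': "rel Z h s'' \<and> eqv (t + 1) q s' s'' \<and> wreg s'' (t + 1) = wv h e2"
        then have "wreg s'' t = wv h e1" using s' by (simp add: eqv_def)
        then show "computes B (WOp f t t (t + 1)) s'' {} 1
          (\<lambda>s'. rel Z h s' \<and> eqv t q s s' \<and> wreg s' t = wv h (WB f e1 e2))"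
          using s'' s' h by (intro computes_WOp) (auto simp: eqv_def rel_def)
      qed auto
    qed auto
  qed
next
  case (WIf b e1 e2)
  show ?case
  proof (intro allI impI)
    fix t q :: nat and s assume h: "20 \<le> t" "20 \<le> q" "wok B Z h (WIf b e1 e2)" "rel Z h s"
    let ?Q = "\<lambda>s'. rel Z h s' \<and> eqv t q s s' \<and> wreg s' t = wv h (WIf b e1 e2)"
    have "computes B (cpre b t q) s (lc Z ` trd h b) (tcost b)
        (\<lambda>s'. rel Z h s' \<and> eqv t q s s' \<and> test_val (ctst t q b) s' = tv h b)"
      using WIf h by simp
    then show "computes B (cw (WIf b e1 e2) t q) s (lc Z ` wrd h (WIf b e1 e2)) (wcost (WIf b e1 e2)) ?Q"
      unfolding cw.simps
    proof (rule computes_Seq)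
      fix s' assume s': "rel Z h s' \<and> eqv t q s s' \<and> test_val (ctst t q b) s' = tv h b"
      show "computes B (Cond (ctst t q b) (cw e1 t q) (cw e2 t q)) s'
        (lc Z ` (if tv h b then wrd h e1 else wrd h e2)) (wcost e1 + wcost e2 + 1) ?Q"
      proof (rule computes_Cond)
        assume "test_val (ctst t q b) s'"
        then have tv: "tv h b" using s' by simp
        then have "computes B (cw e1 t q) s' (lc Z ` wrd h e1) (wcost e1)
          (\<lambda>s''. rel Z h s'' \<and> eqv t q s' s'' \<and> wreg s'' t = wv h e1)" using WIf h s' by simp
        then show "computes B (cw e1 t q) s' (lc Z ` (if tv h b then wrd h e1 else wrd h e2)) (wcost e1) ?Q"
          by (rule computes_mono) (use tv s' in \<open>auto intro: eqv_trans\<close>)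
      next
        assume "\<not> test_val (ctst t q b) s'"
        then have tv: "\<not> tv h b" using s' by simp
        then have "computes B (cw e2 t q) s' (lc Z ` wrd h e2) (wcost e2)
          (\<lambda>s''. rel Z h s'' \<and> eqv t q s' s'' \<and> wreg s'' t = wv h e2)" using WIf h s' by simp
        then show "computes B (cw e2 t q) s' (lc Z ` (if tv h b then wrd h e1 else wrd h e2)) (wcost e2) ?Q"
          by (rule computes_mono) (use tv s' in \<open>auto intro: eqv_trans\<close>)
      qed auto
    qed auto
  qed
next
  case (RR x)
  show ?case
    by (auto intro!: computes_Seq[OF computes_WConst[where Q = "\<lambda>s'. s' = _", OF _ refl]]
          computes_Seq[OF computes_ROfW[where Q = "\<lambda>s'. s' = _", OF refl]] computes_ROp simp: eqv_def rel_def)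
next
  case (RM e)
  show ?case
  proof (intro allI impI)
    fix t q :: nat and s assume h: "20 \<le> t" "20 \<le> q" "rok B Z h (RM e)" "rel Z h s"
    have "computes B (cw e t q) s (lc Z ` wrd h e) (wcost e)
        (\<lambda>s'. rel Z h s' \<and> eqv t q s s' \<and> wreg s' t = wv h e)"
      using RM h by simp
    then show "computes B (cr (RM e) t q) s (lc Z ` rrd h (RM e)) (rcost (RM e))
        (\<lambda>s'. rel Z h s' \<and> eqv t q s s' \<and> rreg s' q = rv h (RM e))"
      unfolding cr.simps
    proof (rule computes_Seq)
      fix s' assume s': "rel Z h s' \<and> eqv t q s s' \<and> wreg s' t = wv h e"
      then have "rmem s' (wreg s' t) = rraw h (wv h e)" using h by (simp add: rel_def)
      then show "computes B (RLoad q t) s' {RLoc (wv h e)} 1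
        (\<lambda>s'. rel Z h s' \<and> eqv t q s s' \<and> rreg s' q = rv h (RM e))"
        using s' h computes_RLoad[where s = s' and x = q and y = t and B = B and
          Q = "\<lambda>s'. rel Z h s' \<and> eqv t q s s' \<and> rreg s' q = rv h (RM e)"]
        by (auto simp: eqv_def rel_def)
    qed auto
  qed
next
  case (RA a e)
  show ?case
  proof (intro allI impI)
    fix t q :: nat and s assume h: "20 \<le> t" "20 \<le> q" "rok B Z h (RA a e)" "rel Z h s"
    have "computes B (cw e t q) s (lc Z ` wrd h e) (wcost e)
        (\<lambda>s'. rel Z h s' \<and> eqv t q s s' \<and> wreg s' t = wv h e)"
      using RA h by simp
    then show "computes B (cr (RA a e) t q) s (lc Z ` rrd h (RA a e)) (rcost (RA a e))
        (\<lambda>s'. rel Z h s' \<and> eqv t q s s' \<and> rreg s' q = rv h (RA a e))"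
      unfolding cr.simps
    proof (rule computes_Seq)
      fix s' assume s': "rel Z h s' \<and> eqv t q s s' \<and> wreg s' t = wv h e"
      have "computes B (addr_code t a) s' {} 5 (\<lambda>s''. rel Z h s'' \<and> eqv t q s s'' \<and> wreg s'' t = Z + 16 * wv h e + a)"
        by (rule computes_addr_code[where q = q and Z = Z])
           (use s' h in \<open>auto simp: rel_Z intro: rel_eqv eqv_trans\<close>)
      then show "computes B (Seq (addr_code t a) (RLoad q t)) s' {RLoc (Z + 16 * wv h e + a)} 6
        (\<lambda>s'. rel Z h s' \<and> eqv t q s s' \<and> rreg s' q = rv h (RA a e))"
      proof (rule computes_Seq)
        fix s'' assume s'': "rel Z h s'' \<and> eqv t q s s'' \<and> wreg s'' t = Z + 16 * wv h e + a"
        then have "rmem s'' (wreg s'' t) = ra h a (wv h e)" using h by (simp add: rel_def)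
        then show "computes B (RLoad q t) s'' {RLoc (Z + 16 * wv h e + a)} 1
          (\<lambda>s'. rel Z h s' \<and> eqv t q s s' \<and> rreg s' q = rv h (RA a e))"
          using s'' h computes_RLoad[where s = s'' and x = q and y = t and B = B and
            Q = "\<lambda>s'. rel Z h s' \<and> eqv t q s s' \<and> rreg s' q = rv h (RA a e)"]
          by (auto simp: eqv_def rel_def)
      qed auto
    qed auto
  qed
next
  case (RB f e1 e2)
  show ?case
  proof (intro allI impI)
    fix t q :: nat and s assume h: "20 \<le> t" "20 \<le> q" "rok B Z h (RB f e1 e2)" "rel Z h s"
    have "computes B (cr e1 t q) s (lc Z ` rrd h e1) (rcost e1)
        (\<lambda>s'. rel Z h s' \<and> eqv t q s s' \<and> rreg s' q = rv h e1)"
      using RB h by simp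
    then show "computes B (cr (RB f e1 e2) t q) s (lc Z ` rrd h (RB f e1 e2)) (rcost (RB f e1 e2))
        (\<lambda>s'. rel Z h s' \<and> eqv t q s s' \<and> rreg s' q = rv h (RB f e1 e2))"
      unfolding cr.simps
    proof (rule computes_Seq)
      fix s' assume s': "rel Z h s' \<and> eqv t q s s' \<and> rreg s' q = rv h e1"
      have "computes B (cr e2 t (q + 1)) s' (lc Z ` rrd h e2) (rcost e2)
        (\<lambda>s''. rel Z h s'' \<and> eqv t (q + 1) s' s'' \<and> rreg s'' (q + 1) = rv h e2)"
        using RB h s' by simp
      then show "computes B (Seq (cr e2 t (q + 1)) (ROp f q q (q + 1))) s' (lc Z ` rrd h e2) (rcost e2 + 1)
        (\<lambda>s'. rel Z h s' \<and> eqv t q s s' \<and> rreg s' q = rv h (RB f e1 e2))"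
      proof (rule computes_Seq)
        fix s'' assume s'': "rel Z h s'' \<and> eqv t (q + 1) s' s'' \<and> rreg s'' (q + 1) = rv h e2"
        then have "rreg s'' q = rv h e1" using s' by (simp add: eqv_def)
        then show "computes B (ROp f q q (q + 1)) s'' {} 1
          (\<lambda>s'. rel Z h s' \<and> eqv t q s s' \<and> rreg s' q = rv h (RB f e1 e2))"
          using s'' s' h by (intro computes_ROp) (auto simp: eqv_def rel_def)
      qed auto
    qed auto
  qed
next
  case (RW e)
  show ?case
  proof (intro allI impI)
    fix t q :: nat and s assume h: "20 \<le> t" "20 \<le> q" "rok B Z h (RW e)" "rel Z h s"
    have "computes B (cw e t q) s (lc Z ` wrd h e) (wcost e)
        (\<lambda>s'. rel Z h s' \<and> eqv t q s s' \<and> wreg s' t = wv h e)"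
      using RW h by simp
    then show "computes B (cr (RW e) t q) s (lc Z ` rrd h (RW e)) (rcost (RW e))
        (\<lambda>s'. rel Z h s' \<and> eqv t q s s' \<and> rreg s' q = rv h (RW e))"
      unfolding cr.simps
    proof (rule computes_Seq)
      fix s' assume "rel Z h s' \<and> eqv t q s s' \<and> wreg s' t = wv h e"
      then show "computes B (ROfW q t) s' {} 1
        (\<lambda>s'. rel Z h s' \<and> eqv t q s s' \<and> rreg s' q = rv h (RW e))"
        using h by (intro computes_ROfW) (auto simp: eqv_def rel_def)
    qed auto
  qed
next
  case (RIf b e1 e2)
  show ?case
  proof (intro allI impI)
    fix t q :: nat and s assume h: "20 \<le> t" "20 \<le> q" "rok B Z h (RIf b e1 e2)" "rel Z h s"
    let ?Q = "\<lambda>s'. rel Z h s' \<and> eqv t q s s' \<and> rreg s' q = rv h (RIf b e1 e2)"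
    have "computes B (cpre b t q) s (lc Z ` trd h b) (tcost b)
        (\<lambda>s'. rel Z h s' \<and> eqv t q s s' \<and> test_val (ctst t q b) s' = tv h b)"
      using RIf h by simp
    then show "computes B (cr (RIf b e1 e2) t q) s (lc Z ` rrd h (RIf b e1 e2)) (rcost (RIf b e1 e2)) ?Q"
      unfolding cr.simps
    proof (rule computes_Seq)
      fix s' assume s': "rel Z h s' \<and> eqv t q s s' \<and> test_val (ctst t q b) s' = tv h b"
      show "computes B (Cond (ctst t q b) (cr e1 t q) (cr e2 t q)) s'
        (lc Z ` (if tv h b then rrd h e1 else rrd h e2)) (rcost e1 + rcost e2 + 1) ?Q"
      proof (rule computes_Cond)
        assume "test_val (ctst t q b) s'"
        then have tv: "tv h b" using s' by simp
        then have "computes B (cr e1 t q) s' (lc Z ` rrd h e1) (rcost e1)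
          (\<lambda>s''. rel Z h s'' \<and> eqv t q s' s'' \<and> rreg s'' q = rv h e1)" using RIf h s' by simp
        then show "computes B (cr e1 t q) s' (lc Z ` (if tv h b then rrd h e1 else rrd h e2)) (rcost e1) ?Q"
          by (rule computes_mono) (use tv s' in \<open>auto intro: eqv_trans\<close>)
      next
        assume "\<not> test_val (ctst t q b) s'"
        then have tv: "\<not> tv h b" using s' by simp
        then have "computes B (cr e2 t q) s' (lc Z ` rrd h e2) (rcost e2)
          (\<lambda>s''. rel Z h s'' \<and> eqv t q s' s'' \<and> rreg s'' q = rv h e2)" using RIf h s' by simp
        then show "computes B (cr e2 t q) s' (lc Z ` (if tv h b then rrd h e1 else rrd h e2)) (rcost e2) ?Q"
          by (rule computes_mono) (use tv s' in \<open>auto intro: eqv_trans\<close>)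
      qed auto
    qed auto
  qed
next
  case (TW e1 e2)
  show ?case
  proof (intro allI impI)
    fix t q :: nat and s assume h: "20 \<le> t" "20 \<le> q" "tok B Z h (TW e1 e2)" "rel Z h s"
    have "computes B (cw e1 t q) s (lc Z ` wrd h e1) (wcost e1)
        (\<lambda>s'. rel Z h s' \<and> eqv t q s s' \<and> wreg s' t = wv h e1)"
      using TW h by simp
    then show "computes B (cpre (TW e1 e2) t q) s (lc Z ` trd h (TW e1 e2)) (tcost (TW e1 e2))
        (\<lambda>s'. rel Z h s' \<and> eqv t q s s' \<and> test_val (ctst t q (TW e1 e2)) s' = tv h (TW e1 e2))"
      unfolding cpre.simps
    proof (rule computes_Seq)
      fix s' assume s': "rel Z h s' \<and> eqv t q s s' \<and> wreg s' t = wv h e1"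
      have "computes B (cw e2 (t + 1) q) s' (lc Z ` wrd h e2) (wcost e2)
        (\<lambda>s''. rel Z h s'' \<and> eqv (t + 1) q s' s'' \<and> wreg s'' (t + 1) = wv h e2)"
        using TW h s' by simp
      then show "computes B (cw e2 (t + 1) q) s' (lc Z ` wrd h e2) (wcost e2)
        (\<lambda>s'. rel Z h s' \<and> eqv t q s s' \<and> test_val (ctst t q (TW e1 e2)) s' = tv h (TW e1 e2))"
        by (rule computes_mono) (use s' in \<open>auto simp: eqv_def\<close>)
    qed auto
  qed
next
  case (TR e1 e2)
  show ?case
  proof (intro allI impI)
    fix t q :: nat and s assume h: "20 \<le> t" "20 \<le> q" "tok B Z h (TR e1 e2)" "rel Z h s"
    have "computes B (cr e1 t q) s (lc Z ` rrd h e1) (rcost e1)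
        (\<lambda>s'. rel Z h s' \<and> eqv t q s s' \<and> rreg s' q = rv h e1)"
      using TR h by simp
    then show "computes B (cpre (TR e1 e2) t q) s (lc Z ` trd h (TR e1 e2)) (tcost (TR e1 e2))
        (\<lambda>s'. rel Z h s' \<and> eqv t q s s' \<and> test_val (ctst t q (TR e1 e2)) s' = tv h (TR e1 e2))"
      unfolding cpre.simps
    proof (rule computes_Seq)
      fix s' assume s': "rel Z h s' \<and> eqv t q s s' \<and> rreg s' q = rv h e1"
      have "computes B (cr e2 t (q + 1)) s' (lc Z ` rrd h e2) (rcost e2)
        (\<lambda>s''. rel Z h s'' \<and> eqv t (q + 1) s' s'' \<and> rreg s'' (q + 1) = rv h e2)"
        using TR h s' by simp
      then show "computes B (cr e2 t (q + 1)) s' (lc Z ` rrd h e2) (rcost e2)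
        (\<lambda>s'. rel Z h s' \<and> eqv t q s s' \<and> test_val (ctst t q (TR e1 e2)) s' = tv h (TR e1 e2))"
        by (rule computes_mono) (use s' in \<open>auto simp: eqv_def\<close>)
    qed auto
  qed
qed

section \<open>Guarded stores as bodies of parallel loops\<close>

datatype tgt = SRA nat wexp rexp | SWA nat wexp wexp | SWM wexp wexp

primrec cstore :: "tgt \<Rightarrow> com" where
  "cstore (SRA a e v) = Seq (cw e 20 20) (Seq (addr_code 20 a) (Seq (cr v 21 20) (RStore 20 20)))"
| "cstore (SWA a e v) = Seq (cw e 20 20) (Seq (addr_code 20 a) (Seq (cw v 21 20) (WStore 20 21)))"
| "cstore (SWM e v) = Seq (cw e 20 20) (Seq (cw v 21 20) (WStore 20 21))"

primrec sloc :: "hst \<Rightarrow> tgt \<Rightarrow> hloc" where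
  "sloc h (SRA a e v) = RArr a (wv h e)"
| "sloc h (SWA a e v) = WArr a (wv h e)"
| "sloc h (SWM e v) = WRaw (wv h e)"

primrec sval :: "hst \<Rightarrow> tgt \<Rightarrow> real" where
  "sval h (SRA a e v) = rv h v"
| "sval h (SWA a e v) = real (wv h v)"
| "sval h (SWM e v) = real (wv h v)"

primrec srd :: "hst \<Rightarrow> tgt \<Rightarrow> hloc set" where
  "srd h (SRA a e v) = wrd h e \<union> rrd h v"
| "srd h (SWA a e v) = wrd h e \<union> wrd h v"
| "srd h (SWM e v) = wrd h e \<union> wrd h v"

primrec sok :: "nat \<Rightarrow> nat \<Rightarrow> hst \<Rightarrow> tgt \<Rightarrow> bool" where
  "sok B Z h (SRA a e v) = (wok B Z h e \<and> rok B Z h v \<and> a < 16 \<and> Z + 16 * wv h e + 16 < B)"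
| "sok B Z h (SWA a e v) = (wok B Z h e \<and> wok B Z h v \<and> a < 16 \<and> Z + 16 * wv h e + 16 < B)"
| "sok B Z h (SWM e v) = (wok B Z h e \<and> wok B Z h v \<and> wv h e < Z)"

primrec scost :: "tgt \<Rightarrow> nat" where
  "scost (SRA a e v) = wcost e + rcost v + 6"
| "scost (SWA a e v) = wcost e + wcost v + 6"
| "scost (SWM e v) = wcost e + wcost v + 1"

text \<open>An iteration performs at most one store, and only after all of its reads. Exclusive
  access thereby reduces to conditions on a single written location per iteration.\<close>

definition gbody :: "texp \<Rightarrow> tgt \<Rightarrow> com" where
  "gbody b g = Seq (cpre b 20 20) (Cond (ctst 20 20 b) (cstore g) Skip)"

definition gcost :: "texp \<Rightarrow> tgt \<Rightarrow> nat" where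
  "gcost b g = tcost b + scost g + 2"

text \<open>Words are embedded into the reals so that both memories can be treated by one function
  on locations.\<close>

primrec memval :: "state \<Rightarrow> loc \<Rightarrow> real" where
  "memval s (WLoc a) = real (wmem s a)"
| "memval s (RLoc a) = rmem s a"

primrec lv :: "hst \<Rightarrow> hloc \<Rightarrow> real" where
  "lv h (WRaw a) = real (wraw h a)"
| "lv h (WArr a i) = real (wa h a i)"
| "lv h (RRaw a) = rraw h a"
| "lv h (RArr a i) = ra h a i"

primrec valid :: "nat \<Rightarrow> hloc \<Rightarrow> bool" where
  "valid Z (WRaw a) = (a < Z)"
| "valid Z (WArr a i) = (a < 16)"
| "valid Z (RRaw a) = (a < Z)"
| "valid Z (RArr a i) = (a < 16)"

lemma arr_addr_inj:
  fixes a b i j :: nat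
  assumes "16 * i + a = 16 * j + b" "a < 16" "b < 16"
  shows "a = b \<and> i = j"
  using assms by presburger

lemma lc_inj: "\<lbrakk>lc Z l = lc Z l'; valid Z l; valid Z l'\<rbrakk> \<Longrightarrow> l = l'"
  by (cases l; cases l') (auto dest: arr_addr_inj)

lemma addr_split: "Z \<le> (a::nat) \<Longrightarrow> a = Z + 16 * ((a - Z) div 16) + (a - Z) mod 16"
  by simp

text \<open>Together with \<open>lc_inj\<close> this makes abstract locations coordinates of the
  whole machine memory; surjectivity is what allows the cells that no iteration writes to be
  compared as well.\<close>

lemma lc_surj: "\<exists>l. valid Z l \<and> lc Z l = x"
proof (cases x)
  case (WLoc a)
  show ?thesis
  proof (cases "a < Z")
    case True then show ?thesis using WLoc by (intro exI[of _ "WRaw a"]) simp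
  next
    case False
    then show ?thesis using WLoc addr_split[of Z a]
      by (intro exI[of _ "WArr ((a - Z) mod 16) ((a - Z) div 16)"]) simp
  qed
next
  case (RLoc a)
  show ?thesis
  proof (cases "a < Z")
    case True then show ?thesis using RLoc by (intro exI[of _ "RRaw a"]) simp
  next
    case False
    then show ?thesis using RLoc addr_split[of Z a]
      by (intro exI[of _ "RArr ((a - Z) mod 16) ((a - Z) div 16)"]) simp
  qed
qed

lemma rel_memval: "\<lbrakk>rel Z h s; valid Z l\<rbrakk> \<Longrightarrow> memval s (lc Z l) = lv h l"
  by (cases l) (auto simp: rel_def)

lemma ok_reads_valid:
  shows "wok B Z h e \<Longrightarrow> l \<in> wrd h e \<Longrightarrow> valid Z l"
    and "rok B Z h r \<Longrightarrow> l \<in> rrd h r \<Longrightarrow> valid Z l"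
    and "tok B Z h b \<Longrightarrow> l \<in> trd h b \<Longrightarrow> valid Z l"
  by (induction e and r and b) (auto split: if_splits)

lemma sok_reads_valid: "sok B Z h g \<Longrightarrow> l \<in> srd h g \<Longrightarrow> valid Z l"
  by (cases g) (auto dest: ok_reads_valid)

lemma sok_loc_valid: "sok B Z h g \<Longrightarrow> valid Z (sloc h g)"
  by (cases g) auto

lemma computesE:
  assumes "computes B c s RS k Q"
  obtains s' rs w d where "exec B c s s' rs {} w d" "rs \<subseteq> RS" "w \<le> k" "d \<le> k" "Q s'"
  using assms unfolding computes_def by blast

lemmas cw_correct = compile_correct(1)[rule_format]
lemmas cr_correct = compile_correct(2)[rule_format]
lemmas cpre_correct = compile_correct(3)[rule_format]

lemma computes_addr:
  assumes "wok B Z h e" "a < 16" "Z + 16 * wv h e + 16 < B" "rel Z h s"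
  shows "computes B (Seq (cw e 20 20) (addr_code 20 a)) s (lc Z ` wrd h e) (wcost e + 5)
     (\<lambda>s'. rel Z h s' \<and> wreg s' 20 = Z + 16 * wv h e + a)"
proof (rule computes_Seq[OF cw_correct[OF _ _ assms(1,4), of 20 20]])
  fix s' assume s': "rel Z h s' \<and> eqv 20 20 s s' \<and> wreg s' 20 = wv h e"
  show "computes B (addr_code 20 a) s' {} 5 (\<lambda>s'. rel Z h s' \<and> wreg s' 20 = Z + 16 * wv h e + a)"
    by (rule computes_addr_code[where q = 20 and Z = Z])
       (use s' assms in \<open>auto simp: rel_Z intro: rel_eqv\<close>)
qed auto

lemma exec_Seq_assoc:
  assumes "exec B (Seq (Seq c1 c2) c3) s t rs ws w d"
  shows "exec B (Seq c1 (Seq c2 c3)) s t rs ws w d"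
  using assms
  by (elim exec_SeqE) (auto simp: Un_assoc add.assoc intro!: exec.Seq)

lemma cstore_correct:
  assumes ok: "sok B Z h g" and rel: "rel Z h s"
  shows "\<exists>s' rs w d. exec B (cstore g) s s' rs {lc Z (sloc h g)} w d \<and> rs \<subseteq> lc Z ` srd h g \<and>
    w \<le> scost g \<and> d \<le> scost g \<and> memval s' (lc Z (sloc h g)) = sval h g"
proof (cases g)
  case (SRA a e v)
  have "computes B (Seq (cw e 20 20) (addr_code 20 a)) s (lc Z ` wrd h e) (wcost e + 5)
     (\<lambda>s'. rel Z h s' \<and> wreg s' 20 = Z + 16 * wv h e + a)"
    by (rule computes_addr) (use ok rel SRA in auto)
  then obtain s1 rs1 w1 d1 where 1: "exec B (Seq (cw e 20 20) (addr_code 20 a)) s s1 rs1 {} w1 d1"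
    "rs1 \<subseteq> lc Z ` wrd h e" "w1 \<le> wcost e + 5" "d1 \<le> wcost e + 5"
    "rel Z h s1" "wreg s1 20 = Z + 16 * wv h e + a" by (auto elim!: computesE)
  have "computes B (cr v 21 20) s1 (lc Z ` rrd h v) (rcost v)
        (\<lambda>s'. rel Z h s' \<and> eqv 21 20 s1 s' \<and> rreg s' 20 = rv h v)"
    by (rule cr_correct) (use ok 1 SRA in auto)
  then obtain s2 rs2 w2 d2 where 2: "exec B (cr v 21 20) s1 s2 rs2 {} w2 d2"
    "rs2 \<subseteq> lc Z ` rrd h v" "w2 \<le> rcost v" "d2 \<le> rcost v" "eqv 21 20 s1 s2" "rreg s2 20 = rv h v"
    by (auto elim!: computesE)
  have w: "wreg s2 20 = Z + 16 * wv h e + a" using 2 1 by (simp add: eqv_def)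
  note x = exec.Seq[OF 1(1) exec.Seq[OF 2(1) exec.RStore[of B 20 20 s2]]]
  have "exec B (cstore g) s (s2\<lparr>rmem := (rmem s2)(wreg s2 20 := rreg s2 20)\<rparr>) (rs1 \<union> (rs2 \<union> {}))
     ({} \<union> ({} \<union> {RLoc (wreg s2 20)})) (w1 + (w2 + 1)) (d1 + (d2 + 1))"
    using exec_Seq_assoc[OF x] SRA by simp
  moreover have "({} \<union> ({} \<union> {RLoc (wreg s2 20)})) = {lc Z (sloc h g)}" using w SRA by simp
  moreover have "memval (s2\<lparr>rmem := (rmem s2)(wreg s2 20 := rreg s2 20)\<rparr>) (lc Z (sloc h g)) = sval h g"
    using w 2 SRA by simp
  moreover have "rs1 \<union> (rs2 \<union> {}) \<subseteq> lc Z ` srd h g" using 1 2 SRA by auto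
  moreover have "w1 + (w2 + 1) \<le> scost g" "d1 + (d2 + 1) \<le> scost g" using 1 2 SRA by auto
  ultimately show ?thesis by metis
next
  case (SWA a e v)
  have "computes B (Seq (cw e 20 20) (addr_code 20 a)) s (lc Z ` wrd h e) (wcost e + 5)
     (\<lambda>s'. rel Z h s' \<and> wreg s' 20 = Z + 16 * wv h e + a)"
    by (rule computes_addr) (use ok rel SWA in auto)
  then obtain s1 rs1 w1 d1 where 1: "exec B (Seq (cw e 20 20) (addr_code 20 a)) s s1 rs1 {} w1 d1"
    "rs1 \<subseteq> lc Z ` wrd h e" "w1 \<le> wcost e + 5" "d1 \<le> wcost e + 5"
    "rel Z h s1" "wreg s1 20 = Z + 16 * wv h e + a" by (auto elim!: computesE)
  have "computes B (cw v 21 20) s1 (lc Z ` wrd h v) (wcost v)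
        (\<lambda>s'. rel Z h s' \<and> eqv 21 20 s1 s' \<and> wreg s' 21 = wv h v)"
    by (rule cw_correct) (use ok 1 SWA in auto)
  then obtain s2 rs2 w2 d2 where 2: "exec B (cw v 21 20) s1 s2 rs2 {} w2 d2"
    "rs2 \<subseteq> lc Z ` wrd h v" "w2 \<le> wcost v" "d2 \<le> wcost v" "eqv 21 20 s1 s2" "wreg s2 21 = wv h v"
    by (auto elim!: computesE)
  have w: "wreg s2 20 = Z + 16 * wv h e + a" using 2 1 by (simp add: eqv_def)
  note x = exec.Seq[OF 1(1) exec.Seq[OF 2(1) exec.WStore[of B 20 21 s2]]]
  have "exec B (cstore g) s (s2\<lparr>wmem := (wmem s2)(wreg s2 20 := wreg s2 21)\<rparr>) (rs1 \<union> (rs2 \<union> {}))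
     ({} \<union> ({} \<union> {WLoc (wreg s2 20)})) (w1 + (w2 + 1)) (d1 + (d2 + 1))"
    using exec_Seq_assoc[OF x] SWA by simp
  moreover have "({} \<union> ({} \<union> {WLoc (wreg s2 20)})) = {lc Z (sloc h g)}" using w SWA by simp
  moreover have "memval (s2\<lparr>wmem := (wmem s2)(wreg s2 20 := wreg s2 21)\<rparr>) (lc Z (sloc h g)) = sval h g"
    using w 2 SWA by simp
  moreover have "rs1 \<union> (rs2 \<union> {}) \<subseteq> lc Z ` srd h g" using 1 2 SWA by auto
  moreover have "w1 + (w2 + 1) \<le> scost g" "d1 + (d2 + 1) \<le> scost g" using 1 2 SWA by auto
  ultimately show ?thesis by metis
next
  case (SWM e v)
  have "computes B (cw e 20 20) s (lc Z ` wrd h e) (wcost e)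
     (\<lambda>s'. rel Z h s' \<and> eqv 20 20 s s' \<and> wreg s' 20 = wv h e)"
    by (rule cw_correct) (use ok rel SWM in auto)
  then obtain s1 rs1 w1 d1 where 1: "exec B (cw e 20 20) s s1 rs1 {} w1 d1"
    "rs1 \<subseteq> lc Z ` wrd h e" "w1 \<le> wcost e" "d1 \<le> wcost e"
    "rel Z h s1" "wreg s1 20 = wv h e" by (auto elim!: computesE)
  have "computes B (cw v 21 20) s1 (lc Z ` wrd h v) (wcost v)
        (\<lambda>s'. rel Z h s' \<and> eqv 21 20 s1 s' \<and> wreg s' 21 = wv h v)"
    by (rule cw_correct) (use ok 1 SWM in auto)
  then obtain s2 rs2 w2 d2 where 2: "exec B (cw v 21 20) s1 s2 rs2 {} w2 d2"
    "rs2 \<subseteq> lc Z ` wrd h v" "w2 \<le> wcost v" "d2 \<le> wcost v" "eqv 21 20 s1 s2" "wreg s2 21 = wv h v"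
    by (auto elim!: computesE)
  have w: "wreg s2 20 = wv h e" using 2 1 by (simp add: eqv_def)
  note x = exec.Seq[OF 1(1) exec.Seq[OF 2(1) exec.WStore[of B 20 21 s2]]]
  have "exec B (cstore g) s (s2\<lparr>wmem := (wmem s2)(wreg s2 20 := wreg s2 21)\<rparr>) (rs1 \<union> (rs2 \<union> {}))
     ({} \<union> ({} \<union> {WLoc (wreg s2 20)})) (w1 + (w2 + 1)) (d1 + (d2 + 1))"
    using x SWM by simp
  moreover have "({} \<union> ({} \<union> {WLoc (wreg s2 20)})) = {lc Z (sloc h g)}" using w SWM by simp
  moreover have "memval (s2\<lparr>wmem := (wmem s2)(wreg s2 20 := wreg s2 21)\<rparr>) (lc Z (sloc h g)) = sval h g"
    using w 2 SWM by simp
  moreover have "rs1 \<union> (rs2 \<union> {}) \<subseteq> lc Z ` srd h g" using 1 2 SWM by auto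
  moreover have "w1 + (w2 + 1) \<le> scost g" "d1 + (d2 + 1) \<le> scost g" using 1 2 SWM by auto
  ultimately show ?thesis by metis
qed

lemma gbody_correct:
  assumes ok: "tok B Z h b" "tv h b \<Longrightarrow> sok B Z h g" and rel: "rel Z h s"
  shows "\<exists>s' rs w d. exec B (gbody b g) s s' rs (if tv h b then {lc Z (sloc h g)} else {}) w d \<and>
    rs \<subseteq> lc Z ` (trd h b \<union> (if tv h b then srd h g else {})) \<and> w \<le> gcost b g \<and> d \<le> gcost b g \<and>
    (tv h b \<longrightarrow> memval s' (lc Z (sloc h g)) = sval h g)"
proof -
  obtain s1 rs1 w1 d1 where 1: "exec B (cpre b 20 20) s s1 rs1 {} w1 d1" "rs1 \<subseteq> lc Z ` trd h b"
    "w1 \<le> tcost b" "d1 \<le> tcost b" "rel Z h s1" "test_val (ctst 20 20 b) s1 = tv h b"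
    using cpre_correct[OF _ _ ok(1) rel, of 20 20] by (auto elim!: computesE)
  show ?thesis
  proof (cases "tv h b")
    case True
    obtain s2 rs2 w2 d2 where 2: "exec B (cstore g) s1 s2 rs2 {lc Z (sloc h g)} w2 d2"
      "rs2 \<subseteq> lc Z ` srd h g" "w2 \<le> scost g" "d2 \<le> scost g" "memval s2 (lc Z (sloc h g)) = sval h g"
      using cstore_correct[OF ok(2)[OF True] 1(5)] by blast
    have "exec B (gbody b g) s s2 (rs1 \<union> rs2) ({} \<union> {lc Z (sloc h g)}) (w1 + (1 + w2)) (d1 + (1 + d2))"
      unfolding gbody_def by (rule exec.Seq[OF 1(1) exec.CondTrue[OF _ 2(1)]]) (use True 1 in simp)
    moreover have "rs1 \<union> rs2 \<subseteq> lc Z ` (trd h b \<union> srd h g)" using 1 2 by auto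
    moreover have "w1 + (1 + w2) \<le> gcost b g" "d1 + (1 + d2) \<le> gcost b g" using 1 2 by (auto simp: gcost_def)
    ultimately show ?thesis unfolding if_P[OF True] Un_empty_left using 2(5) by blast
  next
    case False
    have "\<not> test_val (ctst 20 20 b) s1" using 1(6) False by simp
    then have "exec B (Cond (ctst 20 20 b) (cstore g) Skip) s1 s1 {} {} (1 + 1) (1 + 1)"
      by (rule exec.CondFalse[OF _ exec.Skip])
    from exec.Seq[OF 1(1) this]
    have "exec B (gbody b g) s s1 (rs1 \<union> {}) ({} \<union> {}) (w1 + (1 + 1)) (d1 + (1 + 1))"
      unfolding gbody_def .
    moreover have "rs1 \<union> {} \<subseteq> lc Z ` (trd h b \<union> {})" using 1 by auto
    moreover have "w1 + (1 + 1) \<le> gcost b g" "d1 + (1 + 1) \<le> gcost b g" using 1 by (auto simp: gcost_def)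
    ultimately show ?thesis unfolding if_not_P[OF False] Un_empty_left using False by blast
  qed
qed

text \<open>The final state \<open>s1\<close> is prescribed and compared with the iterations cell by
  cell. Disjointness of the write sets makes the writer of a cell unique, which evaluates the
  \<open>THE\<close> in \<open>merge\<close>.\<close>

lemma exec_ParFor_mem:
  assumes N: "wreg s y = N"
    and run: "\<And>i. i < N \<Longrightarrow> \<exists>s' rs w d. exec B c (s\<lparr>wreg := (wreg s)(x := i)\<rparr>) s' rs (ws i) w d \<and>
      rs \<subseteq> RS i \<and> w \<le> k \<and> d \<le> k \<and> (\<forall>l\<in>ws i. memval s' l = memval s1 l)"
    and disj: "\<And>i j. \<lbrakk>i < N; j < N; i \<noteq> j\<rbrakk> \<Longrightarrow> ws i \<inter> (RS j \<union> ws j) = {}"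
    and rest: "\<And>l. (\<And>i. i < N \<Longrightarrow> l \<notin> ws i) \<Longrightarrow> memval s1 l = memval s l"
    and regs: "wreg s1 = wreg s" "rreg s1 = rreg s"
  shows "\<exists>rs' ws' w d. exec B (ParFor x y c) s s1 rs' ws' w d \<and> w \<le> 1 + N * k \<and> d \<le> 1 + k"
proof -
  have "\<forall>i. \<exists>s' rs w d. i < N \<longrightarrow> exec B c (s\<lparr>wreg := (wreg s)(x := i)\<rparr>) s' rs (ws i) w d \<and>
      rs \<subseteq> RS i \<and> w \<le> k \<and> d \<le> k \<and> (\<forall>l\<in>ws i. memval s' l = memval s1 l)"
    using run by blast
  then obtain t rs w d where r: "\<And>i. i < N \<Longrightarrow> exec B c (s\<lparr>wreg := (wreg s)(x := i)\<rparr>) (t i) (rs i) (ws i) (w i) (d i) \<and>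
      rs i \<subseteq> RS i \<and> w i \<le> k \<and> d i \<le> k \<and> (\<forall>l\<in>ws i. memval (t i) l = memval s1 l)"
    by metis
  have d': "ws i \<inter> (rs j \<union> ws j) = {}" if "i < N" "j < N" "i \<noteq> j" for i j
    using disj[OF that] r[OF that(2)] by blast
  have the: "(THE i. i < N \<and> l \<in> ws i) = i" if "i < N" "l \<in> ws i" for l i
    using that d' by blast
  have "merge N s t ws = s1"
  proof (rule state.equality)
    show "wmem (merge N s t ws) = wmem s1"
    proof
      fix a
      show "wmem (merge N s t ws) a = wmem s1 a"
      proof (cases "\<exists>i<N. WLoc a \<in> ws i")
        case True
        then obtain i where i: "i < N" "WLoc a \<in> ws i" by blast
        have "memval (t i) (WLoc a) = memval s1 (WLoc a)" using r[OF i(1)] i(2) by blast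
        then show ?thesis using i the[OF i] by (auto simp: merge_def)
      next
        case False
        then have "memval s1 (WLoc a) = memval s (WLoc a)" by (intro rest) blast
        then show ?thesis using False by (auto simp: merge_def)
      qed
    qed
    show "rmem (merge N s t ws) = rmem s1"
    proof
      fix a
      show "rmem (merge N s t ws) a = rmem s1 a"
      proof (cases "\<exists>i<N. RLoc a \<in> ws i")
        case True
        then obtain i where i: "i < N" "RLoc a \<in> ws i" by blast
        have "memval (t i) (RLoc a) = memval s1 (RLoc a)" using r[OF i(1)] i(2) by blast
        then show ?thesis using i the[OF i] by (auto simp: merge_def)
      next
        case False
        then have "memval s1 (RLoc a) = memval s (RLoc a)" by (intro rest) blast
        then show ?thesis using False by (auto simp: merge_def)
      qed
    qed
  qed (simp_all add: merge_def regs)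
  moreover have "exec B (ParFor x y c) s (merge N s t ws) (\<Union>i<N. rs i) (\<Union>i<N. ws i)
       (1 + (\<Sum>i<N. w i)) (1 + Max (insert 0 (d ` {..<N})))"
    by (rule exec.ParFor) (use N r d' in auto)
  moreover have "(\<Sum>i<N. w i) \<le> N * k"
    using sum_bounded_above[of "{..<N}" w k] r by auto
  moreover have "Max (insert 0 (d ` {..<N})) \<le> k" using r by auto
  ultimately show ?thesis by (metis add_left_mono)
qed

text \<open>
  In \<open>hx B Z X c h D Q\<close>, the bound \<open>D\<close> on the depth also bounds the work, up to a factor \<open>X\<close> that
  is an upper bound on the number of iterations of the parallel loops.
\<close>

definition hx :: "nat \<Rightarrow> nat \<Rightarrow> nat \<Rightarrow> com \<Rightarrow> hst \<Rightarrow> nat \<Rightarrow> (hst \<Rightarrow> bool) \<Rightarrow> bool" where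
  "hx B Z X c h D Q \<longleftrightarrow> (\<exists>h'. Q h' \<and> (\<forall>s. rel Z h s \<longrightarrow>
     (\<exists>s' rs ws w d. exec B c s s' rs ws w d \<and> rel Z h' s' \<and> w \<le> X * D \<and> d \<le> D)))"

lemma hx_mono: "\<lbrakk>hx B Z X c h D Q; D \<le> D'; \<And>h'. Q h' \<Longrightarrow> Q' h'\<rbrakk> \<Longrightarrow> hx B Z X c h D' Q'"
  unfolding hx_def by (meson order_trans mult_le_mono2)

lemma hx_Seq:
  assumes "hx B Z X c1 h D1 Q1" "\<And>h1. Q1 h1 \<Longrightarrow> hx B Z X c2 h1 D2 Q2"
  shows "hx B Z X (Seq c1 c2) h (D1 + D2) Q2"
proof -
  obtain h1 where h1: "Q1 h1" "\<And>s. rel Z h s \<Longrightarrow>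
     \<exists>s' rs ws w d. exec B c1 s s' rs ws w d \<and> rel Z h1 s' \<and> w \<le> X * D1 \<and> d \<le> D1"
    using assms(1) unfolding hx_def by blast
  obtain h2 where h2: "Q2 h2" "\<And>s. rel Z h1 s \<Longrightarrow>
     \<exists>s' rs ws w d. exec B c2 s s' rs ws w d \<and> rel Z h2 s' \<and> w \<le> X * D2 \<and> d \<le> D2"
    using assms(2)[OF h1(1)] unfolding hx_def by blast
  show ?thesis unfolding hx_def
  proof (intro exI[of _ h2] conjI h2(1) allI impI)
    fix s assume "rel Z h s"
    then obtain s1 rs1 ws1 w1 d1 where 1: "exec B c1 s s1 rs1 ws1 w1 d1" "rel Z h1 s1" "w1 \<le> X * D1" "d1 \<le> D1"
      using h1(2) by blast
    then obtain s2 rs2 ws2 w2 d2 where 2: "exec B c2 s1 s2 rs2 ws2 w2 d2" "rel Z h2 s2" "w2 \<le> X * D2" "d2 \<le> D2"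
      using h2(2) by blast
    have "w1 + w2 \<le> X * (D1 + D2)" "d1 + d2 \<le> D1 + D2" using 1 2 by (auto simp: algebra_simps)
    then show "\<exists>s' rs ws w d. exec B (Seq c1 c2) s s' rs ws w d \<and> rel Z h2 s' \<and> w \<le> X * (D1 + D2) \<and> d \<le> D1 + D2"
      using exec.Seq[OF 1(1) 2(1)] 2(2) by blast
  qed
qed

lemma hx_WhileFalse:
  assumes "x < 20" "y < 20" "\<not> hw h x < hw h y" "Q h" "1 \<le> X"
  shows "hx B Z X (While (WLess x y) c) h 1 Q"
  unfolding hx_def
proof (intro exI[of _ h] conjI assms allI impI)
  fix s assume r: "rel Z h s"
  then have "\<not> test_val (WLess x y) s" using assms by (simp add: rel_def)
  then show "\<exists>s' rs ws w d. exec B (While (WLess x y) c) s s' rs ws w d \<and> rel Z h s' \<and> w \<le> X * 1 \<and> d \<le> 1"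
    using exec.WhileFalse[of "WLess x y" s B c] r assms(5) by (metis le_refl mult.right_neutral)
qed

lemma hx_WhileTrue:
  assumes "x < 20" "y < 20" "hw h x < hw h y" "1 \<le> X" "hx B Z X c h D1 Q1"
    "\<And>h1. Q1 h1 \<Longrightarrow> hx B Z X (While (WLess x y) c) h1 D2 Q"
  shows "hx B Z X (While (WLess x y) c) h (1 + D1 + D2) Q"
proof -
  obtain h1 where h1: "Q1 h1" "\<And>s. rel Z h s \<Longrightarrow>
     \<exists>s' rs ws w d. exec B c s s' rs ws w d \<and> rel Z h1 s' \<and> w \<le> X * D1 \<and> d \<le> D1"
    using assms(5) unfolding hx_def by blast
  obtain h2 where h2: "Q h2" "\<And>s. rel Z h1 s \<Longrightarrow>
     \<exists>s' rs ws w d. exec B (While (WLess x y) c) s s' rs ws w d \<and> rel Z h2 s' \<and> w \<le> X * D2 \<and> d \<le> D2"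
    using assms(6)[OF h1(1)] unfolding hx_def by blast
  show ?thesis unfolding hx_def
  proof (intro exI[of _ h2] conjI h2(1) allI impI)
    fix s assume r: "rel Z h s"
    then obtain s1 rs1 ws1 w1 d1 where 1: "exec B c s s1 rs1 ws1 w1 d1" "rel Z h1 s1" "w1 \<le> X * D1" "d1 \<le> D1"
      using h1(2) by blast
    then obtain s2 rs2 ws2 w2 d2 where 2: "exec B (While (WLess x y) c) s1 s2 rs2 ws2 w2 d2" "rel Z h2 s2" "w2 \<le> X * D2" "d2 \<le> D2"
      using h2(2) by blast
    have t: "test_val (WLess x y) s" using assms r by (simp add: rel_def)
    have "1 + w1 + w2 \<le> X * (1 + D1 + D2)" "1 + d1 + d2 \<le> 1 + D1 + D2"
      using 1 2 assms(4) by (auto simp: algebra_simps)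
    then show "\<exists>s' rs ws w d. exec B (While (WLess x y) c) s s' rs ws w d \<and> rel Z h2 s' \<and>
        w \<le> X * (1 + D1 + D2) \<and> d \<le> 1 + D1 + D2"
      using exec.WhileTrue[OF t 1(1) 2(1)] 2(2) by blast
  qed
qed

text \<open>The number of rounds is fixed in advance and indexes the invariant, so termination and
  the depth bound come out of one induction; each round pays one extra unit for its test.\<close>

lemma hx_While:
  assumes xy: "x < 20" "y < 20" "1 \<le> X"
    and step: "\<And>i h. \<lbrakk>i < n; Inv i h\<rbrakk> \<Longrightarrow> hw h x < hw h y \<and> hx B Z X c h D (Inv (Suc i))"
    and fin: "\<And>h. Inv n h \<Longrightarrow> \<not> hw h x < hw h y"
    and init: "Inv 0 h"
  shows "hx B Z X (While (WLess x y) c) h (1 + n * (D + 1)) (Inv n)"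
proof -
  have "hx B Z X (While (WLess x y) c) h (1 + r * (D + 1)) (Inv n)" if "Inv i h" "i + r = n" for i r h
    using that
  proof (induction r arbitrary: i h)
    case 0
    then show ?case using hx_WhileFalse[of x y h "Inv n" X B Z c] xy fin by simp
  next
    case (Suc r)
    have "hx B Z X (While (WLess x y) c) h (1 + D + (1 + r * (D + 1))) (Inv n)"
      by (rule hx_WhileTrue[where ?Q1.0 = "Inv (Suc i)", OF xy(1,2) _ xy(3)])
         (use step[of i h] Suc in auto)
    then show ?case by (simp add: algebra_simps)
  qed
  from this[OF init] show ?thesis by simp
qed

definition wset :: "nat \<Rightarrow> wexp \<Rightarrow> com" where
  "wset x e = Seq (cw e 20 20) (Seq (WConst x 0) (WOp WAdd x x 20))"

definition rset :: "nat \<Rightarrow> rexp \<Rightarrow> com" where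
  "rset x e = Seq (cr e 20 20) (Seq (WConst 20 0) (Seq (ROfW x 20) (ROp RAdd x x 20)))"

lemma hxI_computes:
  assumes "\<And>s. rel Z h s \<Longrightarrow> computes B c s UNIV D (rel Z h')" "Q h'" "1 \<le> X"
  shows "hx B Z X c h D Q"
  unfolding hx_def
proof (intro exI[of _ h'] conjI assms(2) allI impI)
  fix s assume "rel Z h s"
  then obtain s' rs w d where 1: "exec B c s s' rs {} w d" "w \<le> D" "d \<le> D" "rel Z h' s'"
    using computesE[OF assms(1)] by metis
  have "w \<le> X * D" using 1(2) assms(3) by (metis le_trans mult_le_mono1 mult_1)
  then show "\<exists>s' rs ws w d. exec B c s s' rs ws w d \<and> rel Z h' s' \<and> w \<le> X * D \<and> d \<le> D"
    using 1 by blast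
qed

lemma hx_wset:
  assumes "wok B Z h e" "wv h e < B" "0 < x" "x < 20" "1 \<le> X" "Q (h\<lparr>hw := (hw h)(x := wv h e)\<rparr>)"
  shows "hx B Z X (wset x e) h (wcost e + 2) Q"
proof (rule hxI_computes[where h' = "h\<lparr>hw := (hw h)(x := wv h e)\<rparr>"])
  fix s assume r: "rel Z h s"
  show "computes B (wset x e) s UNIV (wcost e + 2) (rel Z (h\<lparr>hw := (hw h)(x := wv h e)\<rparr>))"
    unfolding wset_def
  proof (rule computes_Seq[OF cw_correct[OF _ _ assms(1) r, of 20 20]])
    fix s' assume s': "rel Z h s' \<and> eqv 20 20 s s' \<and> wreg s' 20 = wv h e"
    show "computes B (Seq (WConst x 0) (WOp WAdd x x 20)) s' UNIV 2 (rel Z (h\<lparr>hw := (hw h)(x := wv h e)\<rparr>))"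
    proof (rule computes_Seq[OF computes_WConst[where Q = "\<lambda>t. t = s'\<lparr>wreg := (wreg s')(x := 0)\<rparr>"]])
      fix t assume t: "t = s'\<lparr>wreg := (wreg s')(x := 0)\<rparr>"
      show "computes B (WOp WAdd x x 20) t {} 1 (rel Z (h\<lparr>hw := (hw h)(x := wv h e)\<rparr>))"
        by (rule computes_WOp) (use s' t assms in \<open>auto simp: rel_def\<close>)
    qed (use assms in auto)
  qed auto
qed (use assms in auto)

lemma hx_rset:
  assumes "rok B Z h e" "0 < B" "x < 20" "1 \<le> X" "Q (h\<lparr>hr := (hr h)(x := rv h e)\<rparr>)"
  shows "hx B Z X (rset x e) h (rcost e + 3) Q"
proof (rule hxI_computes[where h' = "h\<lparr>hr := (hr h)(x := rv h e)\<rparr>"])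
  fix s assume r: "rel Z h s"
  show "computes B (rset x e) s UNIV (rcost e + 3) (rel Z (h\<lparr>hr := (hr h)(x := rv h e)\<rparr>))"
    unfolding rset_def
  proof (rule computes_Seq[OF cr_correct[OF _ _ assms(1) r, of 20 20]])
    fix s' assume s': "rel Z h s' \<and> eqv 20 20 s s' \<and> rreg s' 20 = rv h e"
    show "computes B (Seq (WConst 20 0) (Seq (ROfW x 20) (ROp RAdd x x 20))) s' UNIV 3
      (rel Z (h\<lparr>hr := (hr h)(x := rv h e)\<rparr>))"
    proof (rule computes_Seq[OF computes_WConst[where Q = "\<lambda>t. t = s'\<lparr>wreg := (wreg s')(20 := 0)\<rparr>"]])
      fix t assume t: "t = s'\<lparr>wreg := (wreg s')(20 := 0)\<rparr>"
      show "computes B (Seq (ROfW x 20) (ROp RAdd x x 20)) t {} 2 (rel Z (h\<lparr>hr := (hr h)(x := rv h e)\<rparr>))"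
      proof (rule computes_Seq[OF computes_ROfW[where Q = "\<lambda>u. u = t\<lparr>rreg := (rreg t)(x := real (wreg t 20))\<rparr>"]])
        fix u assume u: "u = t\<lparr>rreg := (rreg t)(x := real (wreg t 20))\<rparr>"
        show "computes B (ROp RAdd x x 20) u {} 1 (rel Z (h\<lparr>hr := (hr h)(x := rv h e)\<rparr>))"
          by (rule computes_ROp) (use s' t u assms in \<open>auto simp: rel_def\<close>)
      qed auto
    qed (use assms in auto)
  qed auto
qed (use assms in auto)

definition condc :: "texp \<Rightarrow> com \<Rightarrow> com \<Rightarrow> com" where
  "condc b c1 c2 = Seq (cpre b 20 20) (Cond (ctst 20 20 b) c1 c2)"

lemma hx_condc:
  assumes "tok B Z h b" "1 \<le> X" "tv h b \<Longrightarrow> hx B Z X c1 h D Q" "\<not> tv h b \<Longrightarrow> hx B Z X c2 h D Q"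
  shows "hx B Z X (condc b c1 c2) h (tcost b + 1 + D) Q"
proof -
  let ?c = "if tv h b then c1 else c2"
  have "hx B Z X ?c h D Q" using assms by auto
  then obtain h' where h': "Q h'" "\<And>s. rel Z h s \<Longrightarrow>
     \<exists>s' rs ws w d. exec B ?c s s' rs ws w d \<and> rel Z h' s' \<and> w \<le> X * D \<and> d \<le> D"
    unfolding hx_def by blast
  show ?thesis unfolding hx_def
  proof (intro exI[of _ h'] conjI h'(1) allI impI)
    fix s assume r: "rel Z h s"
    obtain s1 rs1 w1 d1 where 1: "exec B (cpre b 20 20) s s1 rs1 {} w1 d1"
      "w1 \<le> tcost b" "d1 \<le> tcost b" "rel Z h s1" "test_val (ctst 20 20 b) s1 = tv h b"
      using cpre_correct[OF _ _ assms(1) r, of 20 20] by (auto elim!: computesE)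
    obtain s2 rs2 ws2 w2 d2 where 2: "exec B ?c s1 s2 rs2 ws2 w2 d2" "rel Z h' s2" "w2 \<le> X * D" "d2 \<le> D"
      using h'(2)[OF 1(4)] by blast
    have 3: "exec B (Cond (ctst 20 20 b) c1 c2) s1 s2 rs2 ws2 (1 + w2) (1 + d2)"
      using exec.CondTrue[of "ctst 20 20 b" s1 B c1 s2 rs2 ws2 w2 d2 c2]
        exec.CondFalse[of "ctst 20 20 b" s1 B c2 s2 rs2 ws2 w2 d2 c1] 2(1) 1(5)
      by (cases "tv h b") auto
    have "w1 \<le> X * tcost b" using 1(2) assms(2) by (metis le_trans mult_le_mono1 mult_1)
    then have "w1 + (1 + w2) \<le> X * (tcost b + 1 + D)" "d1 + (1 + d2) \<le> tcost b + 1 + D"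
      using 1 2 assms(2) by (auto simp: algebra_simps)
    then show "\<exists>s' rs ws w d. exec B (condc b c1 c2) s s' rs ws w d \<and> rel Z h' s' \<and>
        w \<le> X * (tcost b + 1 + D) \<and> d \<le> tcost b + 1 + D"
      using exec.Seq[OF 1(1) 3] 2(2) unfolding condc_def by blast
  qed
qed

definition ini :: "hst \<Rightarrow> nat \<Rightarrow> nat \<Rightarrow> hst" where
  "ini h x i = h\<lparr>hw := (hw h)(x := i)\<rparr>"

lemma ini_simps [simp]:
  "hw (ini h x i) = (hw h)(x := i)" "hr (ini h x i) = hr h" "wraw (ini h x i) = wraw h"
  "rraw (ini h x i) = rraw h" "wa (ini h x i) = wa h" "ra (ini h x i) = ra h"
  by (simp_all add: ini_def)

text \<open>The access conditions of a parallel loop are stated for abstract locations; injectivity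
  of \<open>lc\<close> on valid locations transports them to machine cells.\<close>

lemma hx_par:
  assumes x: "0 < x" "x < 20" "y < 20" and N: "hw h y = N" "N \<le> X" "1 \<le> X"
    and ok: "\<And>i. i < N \<Longrightarrow> tok B Z (ini h x i) b"
      "\<And>i. \<lbrakk>i < N; tv (ini h x i) b\<rbrakk> \<Longrightarrow> sok B Z (ini h x i) g"
    and inj: "\<And>i j. \<lbrakk>i < N; j < N; i \<noteq> j; tv (ini h x i) b; tv (ini h x j) b\<rbrakk> \<Longrightarrow>
        sloc (ini h x i) g \<noteq> sloc (ini h x j) g"
    and rd: "\<And>i j. \<lbrakk>i < N; j < N; i \<noteq> j; tv (ini h x i) b\<rbrakk> \<Longrightarrow> sloc (ini h x i) g \<notin> trd (ini h x j) b"
      "\<And>i j. \<lbrakk>i < N; j < N; i \<noteq> j; tv (ini h x i) b; tv (ini h x j) b\<rbrakk> \<Longrightarrow>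
        sloc (ini h x i) g \<notin> srd (ini h x j) g"
    and val: "\<And>i. \<lbrakk>i < N; tv (ini h x i) b\<rbrakk> \<Longrightarrow> lv h' (sloc (ini h x i) g) = sval (ini h x i) g"
    and rest: "\<And>l. (\<And>i. \<lbrakk>i < N; tv (ini h x i) b\<rbrakk> \<Longrightarrow> sloc (ini h x i) g \<noteq> l) \<Longrightarrow> lv h' l = lv h l"
    and regs: "hw h' = hw h" "hr h' = hr h" and Q: "Q h'"
  shows "hx B Z X (ParFor x y (gbody b g)) h (1 + gcost b g) Q"
  unfolding hx_def
proof (intro exI[of _ h'] conjI Q allI impI)
  fix s assume r: "rel Z h s"
  \<comment> \<open>Addresses from \<open>Z\<close> on are decoded into array number and index by
    remainder and quotient modulo 16.\<close>
  let ?s1 = "s\<lparr>wmem := \<lambda>a. if a < Z then wraw h' a else wa h' ((a - Z) mod 16) ((a - Z) div 16),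
     rmem := \<lambda>a. if a < Z then rraw h' a else ra h' ((a - Z) mod 16) ((a - Z) div 16)\<rparr>"
  have r1: "rel Z h' ?s1" using r regs by (auto simp: rel_def)
  let ?ws = "\<lambda>i. if tv (ini h x i) b then {lc Z (sloc (ini h x i) g)} else {}"
  let ?RS = "\<lambda>i. lc Z ` (trd (ini h x i) b \<union> (if tv (ini h x i) b then srd (ini h x i) g else {}))"
  have vl: "valid Z (sloc (ini h x i) g)" if "i < N" "tv (ini h x i) b" for i
    using sok_loc_valid[OF ok(2)[OF that]] .
  have "\<exists>rs' ws' w d. exec B (ParFor x y (gbody b g)) s ?s1 rs' ws' w d \<and>
      w \<le> 1 + N * gcost b g \<and> d \<le> 1 + gcost b g"
  proof (rule exec_ParFor_mem[where ws = ?ws and RS = ?RS])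
    show "wreg s y = N" using r N x by (simp add: rel_def)
  next
    fix i assume i: "i < N"
    have ri: "rel Z (ini h x i) (s\<lparr>wreg := (wreg s)(x := i)\<rparr>)" using r x by (simp add: rel_def)
    have "memval ?s1 (lc Z (sloc (ini h x i) g)) = sval (ini h x i) g" if "tv (ini h x i) b"
      using rel_memval[OF r1 vl[OF i that]] val[OF i that] by simp
    then show "\<exists>s' rs w d. exec B (gbody b g) (s\<lparr>wreg := (wreg s)(x := i)\<rparr>) s' rs (?ws i) w d \<and>
      rs \<subseteq> ?RS i \<and> w \<le> gcost b g \<and> d \<le> gcost b g \<and> (\<forall>l\<in>?ws i. memval s' l = memval ?s1 l)"
      using gbody_correct[OF ok(1)[OF i] ok(2)[OF i] ri] by (auto split: if_splits)
  next
    fix i j assume ij: "i < N" "j < N" "i \<noteq> j"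
    have rv: "valid Z l" if "l \<in> trd (ini h x j) b \<union> (if tv (ini h x j) b then srd (ini h x j) g else {})" for l
      using that ok(1)[OF ij(2)] ok(2)[OF ij(2)]
      by (auto dest: ok_reads_valid sok_reads_valid split: if_splits)
    show "?ws i \<inter> (?RS j \<union> ?ws j) = {}"
    proof (cases "tv (ini h x i) b")
      case True
      have "lc Z (sloc (ini h x i) g) \<notin> ?RS j"
      proof
        assume "lc Z (sloc (ini h x i) g) \<in> ?RS j"
        then obtain l where l: "l \<in> trd (ini h x j) b \<union> (if tv (ini h x j) b then srd (ini h x j) g else {})"
          "lc Z (sloc (ini h x i) g) = lc Z l" by blast
        have "sloc (ini h x i) g = l" by (rule lc_inj[OF l(2) vl[OF ij(1) True] rv[OF l(1)]])
        then show False using l(1) rd(1)[OF ij True] rd(2)[OF ij True] by (auto split: if_splits)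
      qed
      moreover have "lc Z (sloc (ini h x i) g) \<noteq> lc Z (sloc (ini h x j) g)" if "tv (ini h x j) b"
        using lc_inj[OF _ vl[OF ij(1) True] vl[OF ij(2) that]] inj[OF ij True that] by blast
      ultimately show ?thesis using True by (auto split: if_splits)
    qed simp
  next
    fix l assume l: "\<And>i. i < N \<Longrightarrow> l \<notin> ?ws i"
    obtain l' where l': "valid Z l'" "lc Z l' = l" using lc_surj by blast
    have "lv h' l' = lv h l'"
    proof (rule rest)
      fix i assume "i < N" "tv (ini h x i) b"
      then show "sloc (ini h x i) g \<noteq> l'" using l[of i] l' by auto
    qed
    then show "memval ?s1 l = memval s l" using rel_memval[OF r1 l'(1)] rel_memval[OF r l'(1)] l'(2) by simp
  qed simp_all
  then obtain rs' ws' w d where e: "exec B (ParFor x y (gbody b g)) s ?s1 rs' ws' w d"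
      "w \<le> 1 + N * gcost b g" "d \<le> 1 + gcost b g" by blast
  have "N * gcost b g \<le> X * gcost b g" using N(2) by simp
  then have "w \<le> X * (1 + gcost b g)" using e(2) N(3) unfolding distrib_left mult_1_right by linarith
  then show "\<exists>s' rs ws w d. exec B (ParFor x y (gbody b g)) s s' rs ws w d \<and> rel Z h' s' \<and>
      w \<le> X * (1 + gcost b g) \<and> d \<le> 1 + gcost b g"
    using e r1 by blast
qed

text \<open>\<open>F\<close> is the new content of the whole array as a function of the cell rather
  than of the iteration; later invariants can then treat arrays as mathematical functions.\<close>

lemma hx_par_real:
  assumes x: "0 < x" "x < 20" "y < 20" and N: "hw h y = N" "N \<le> X" "1 \<le> X"
    and G: "\<And>i. i < N \<Longrightarrow> tv (ini h x i) b = G i"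
    and g: "\<And>i. \<lbrakk>i < N; G i\<rbrakk> \<Longrightarrow> wv (ini h x i) ie = g i"
    and v: "\<And>i. \<lbrakk>i < N; G i\<rbrakk> \<Longrightarrow> rv (ini h x i) ve = F (g i)"
    and ok: "\<And>i. i < N \<Longrightarrow> tok B Z (ini h x i) b"
      "\<And>i. \<lbrakk>i < N; G i\<rbrakk> \<Longrightarrow> sok B Z (ini h x i) (SRA a ie ve)"
    and inj: "\<And>i j. \<lbrakk>i < N; j < N; G i; G j; g i = g j\<rbrakk> \<Longrightarrow> i = j"
    and rd: "\<And>i j. \<lbrakk>i < N; j < N; i \<noteq> j; G i\<rbrakk> \<Longrightarrow> RArr a (g i) \<notin> trd (ini h x j) b"
      "\<And>i j. \<lbrakk>i < N; j < N; i \<noteq> j; G i; G j\<rbrakk> \<Longrightarrow> RArr a (g i) \<notin> wrd (ini h x j) ie \<union> rrd (ini h x j) ve"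
    and rest: "\<And>l. (\<And>i. \<lbrakk>i < N; G i\<rbrakk> \<Longrightarrow> g i \<noteq> l) \<Longrightarrow> F l = ra h a l"
    and Q: "Q (h\<lparr>ra := (ra h)(a := F)\<rparr>)"
  shows "hx B Z X (ParFor x y (gbody b (SRA a ie ve))) h (1 + gcost b (SRA a ie ve)) Q"
proof (rule hx_par[OF x N, where h' = "h\<lparr>ra := (ra h)(a := F)\<rparr>"])
  fix i j assume *: "i < N" "j < N" "i \<noteq> j" "tv (ini h x i) b" "tv (ini h x j) b"
  then show "sloc (ini h x i) (SRA a ie ve) \<noteq> sloc (ini h x j) (SRA a ie ve)"
    using inj[of i j] G g by auto
  show "sloc (ini h x i) (SRA a ie ve) \<notin> srd (ini h x j) (SRA a ie ve)"
    using rd(2)[of i j] * G g by auto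
next
  fix i j assume *: "i < N" "j < N" "i \<noteq> j" "tv (ini h x i) b"
  then show "sloc (ini h x i) (SRA a ie ve) \<notin> trd (ini h x j) b" using rd(1)[of i j] G g by auto
next
  fix l assume l: "\<And>i. \<lbrakk>i < N; tv (ini h x i) b\<rbrakk> \<Longrightarrow> sloc (ini h x i) (SRA a ie ve) \<noteq> l"
  show "lv (h\<lparr>ra := (ra h)(a := F)\<rparr>) l = lv h l"
  proof (cases l)
    case (RArr a' i)
    show ?thesis
    proof (cases "a' = a")
      case True
      have "F i = ra h a i" by (rule rest) (use l RArr True G g in auto)
      then show ?thesis using RArr True by simp
    qed (use RArr in simp)
  qed simp_all
qed (use G g v ok Q in auto)

lemma hx_par_word:
  assumes x: "0 < x" "x < 20" "y < 20" and N: "hw h y = N" "N \<le> X" "1 \<le> X"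
    and G: "\<And>i. i < N \<Longrightarrow> tv (ini h x i) b = G i"
    and g: "\<And>i. \<lbrakk>i < N; G i\<rbrakk> \<Longrightarrow> wv (ini h x i) ie = g i"
    and v: "\<And>i. \<lbrakk>i < N; G i\<rbrakk> \<Longrightarrow> wv (ini h x i) ve = F (g i)"
    and ok: "\<And>i. i < N \<Longrightarrow> tok B Z (ini h x i) b"
      "\<And>i. \<lbrakk>i < N; G i\<rbrakk> \<Longrightarrow> sok B Z (ini h x i) (SWA a ie ve)"
    and inj: "\<And>i j. \<lbrakk>i < N; j < N; G i; G j; g i = g j\<rbrakk> \<Longrightarrow> i = j"
    and rd: "\<And>i j. \<lbrakk>i < N; j < N; i \<noteq> j; G i\<rbrakk> \<Longrightarrow> WArr a (g i) \<notin> trd (ini h x j) b"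
      "\<And>i j. \<lbrakk>i < N; j < N; i \<noteq> j; G i; G j\<rbrakk> \<Longrightarrow> WArr a (g i) \<notin> wrd (ini h x j) ie \<union> wrd (ini h x j) ve"
    and rest: "\<And>l. (\<And>i. \<lbrakk>i < N; G i\<rbrakk> \<Longrightarrow> g i \<noteq> l) \<Longrightarrow> F l = wa h a l"
    and Q: "Q (h\<lparr>wa := (wa h)(a := F)\<rparr>)"
  shows "hx B Z X (ParFor x y (gbody b (SWA a ie ve))) h (1 + gcost b (SWA a ie ve)) Q"
proof (rule hx_par[OF x N, where h' = "h\<lparr>wa := (wa h)(a := F)\<rparr>"])
  fix i j assume *: "i < N" "j < N" "i \<noteq> j" "tv (ini h x i) b" "tv (ini h x j) b"
  then show "sloc (ini h x i) (SWA a ie ve) \<noteq> sloc (ini h x j) (SWA a ie ve)"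
    using inj[of i j] G g by auto
  show "sloc (ini h x i) (SWA a ie ve) \<notin> srd (ini h x j) (SWA a ie ve)"
    using rd(2)[of i j] * G g by auto
next
  fix i j assume *: "i < N" "j < N" "i \<noteq> j" "tv (ini h x i) b"
  then show "sloc (ini h x i) (SWA a ie ve) \<notin> trd (ini h x j) b" using rd(1)[of i j] G g by auto
next
  fix l assume l: "\<And>i. \<lbrakk>i < N; tv (ini h x i) b\<rbrakk> \<Longrightarrow> sloc (ini h x i) (SWA a ie ve) \<noteq> l"
  show "lv (h\<lparr>wa := (wa h)(a := F)\<rparr>) l = lv h l"
  proof (cases l)
    case (WArr a' i)
    show ?thesis
    proof (cases "a' = a")
      case True
      have "F i = wa h a i" by (rule rest) (use l WArr True G g in auto)
      then show ?thesis using WArr True by simp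
    qed (use WArr in simp)
  qed simp_all
qed (use G g v ok Q in auto)

lemma hx_par_raw:
  assumes x: "0 < x" "x < 20" "y < 20" and N: "hw h y = N" "N \<le> X" "1 \<le> X"
    and G: "\<And>i. i < N \<Longrightarrow> tv (ini h x i) b"
    and g: "\<And>i. i < N \<Longrightarrow> wv (ini h x i) ie = g i"
    and v: "\<And>i. i < N \<Longrightarrow> wv (ini h x i) ve = F (g i)"
    and ok: "\<And>i. i < N \<Longrightarrow> tok B Z (ini h x i) b"
      "\<And>i. i < N \<Longrightarrow> sok B Z (ini h x i) (SWM ie ve)"
    and inj: "\<And>i j. \<lbrakk>i < N; j < N; g i = g j\<rbrakk> \<Longrightarrow> i = j"
    and rd: "\<And>i j. \<lbrakk>i < N; j < N; i \<noteq> j\<rbrakk> \<Longrightarrow>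
      WRaw (g i) \<notin> trd (ini h x j) b \<union> wrd (ini h x j) ie \<union> wrd (ini h x j) ve"
    and rest: "\<And>l. (\<And>i. i < N \<Longrightarrow> g i \<noteq> l) \<Longrightarrow> F l = wraw h l"
    and Q: "Q (h\<lparr>wraw := F\<rparr>)"
  shows "hx B Z X (ParFor x y (gbody b (SWM ie ve))) h (1 + gcost b (SWM ie ve)) Q"
proof (rule hx_par[OF x N, where h' = "h\<lparr>wraw := F\<rparr>"])
  fix i j assume *: "i < N" "j < N" "i \<noteq> j" "tv (ini h x i) b" "tv (ini h x j) b"
  then show "sloc (ini h x i) (SWM ie ve) \<noteq> sloc (ini h x j) (SWM ie ve)"
    using inj[of i j] g by auto
  show "sloc (ini h x i) (SWM ie ve) \<notin> srd (ini h x j) (SWM ie ve)"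
    using rd[of i j] * g by auto
next
  fix i j assume *: "i < N" "j < N" "i \<noteq> j" "tv (ini h x i) b"
  then show "sloc (ini h x i) (SWM ie ve) \<notin> trd (ini h x j) b" using rd[of i j] g by auto
next
  fix l assume l: "\<And>i. \<lbrakk>i < N; tv (ini h x i) b\<rbrakk> \<Longrightarrow> sloc (ini h x i) (SWM ie ve) \<noteq> l"
  show "lv (h\<lparr>wraw := F\<rparr>) l = lv h l"
  proof (cases l)
    case (WRaw i)
    have "F i = wraw h i" by (rule rest) (use l WRaw G g in auto)
    then show ?thesis using WRaw by simp
  qed simp_all
qed (use G g v ok Q in auto)

section \<open>Folding a row of a matrix\<close>

text \<open>The Walsh function of index \<open>j\<close> at the sign vector \<open>\<sigma>\<close>.
  Under uniform independent signs distinct indices are uncorrelated, and index 0 gives the constant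
  1, which leaves room for a constant column.\<close>

definition chi :: "(nat \<Rightarrow> real) \<Rightarrow> nat \<Rightarrow> nat \<Rightarrow> real" where
  "chi \<sigma> c j = (\<Prod>b<c. if odd (j div 2 ^ b) then \<sigma> b else 1)"

lemma chi_Suc_low: "j < 2 ^ c \<Longrightarrow> chi \<sigma> (Suc c) j = chi \<sigma> c j"
  by (simp add: chi_def)

lemma chi_Suc_high:
  assumes "j < 2 ^ c"
  shows "chi \<sigma> (Suc c) (2 ^ c + j) = \<sigma> c * chi \<sigma> c j"
proof -
  have "odd ((2 ^ c + j) div 2 ^ b) = odd (j div 2 ^ b)" if "b < c" for b
  proof -
    have "2 ^ c = 2 ^ b * 2 * (2 ^ (c - Suc b) :: nat)"
      using that by (metis Suc_leI le_add_diff_inverse power_Suc power_add mult.commute)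
    then have "(2 ^ c + j) div 2 ^ b = 2 * 2 ^ (c - Suc b) + j div 2 ^ b"
      by (metis (no_types, lifting) add.commute div_mult_self2 mult.assoc power_not_zero zero_neq_numeral)
    then show ?thesis by simp
  qed
  then have "(\<Prod>b<c. if odd ((2 ^ c + j) div 2 ^ b) then \<sigma> b else 1) = chi \<sigma> c j"
    unfolding chi_def by (intro prod.cong) auto
  moreover have "(2 ^ c + j) div 2 ^ c = 1" using assms by simp
  ultimately show ?thesis by (simp add: chi_def)
qed

lemma chi_square: "(\<And>b. b < c \<Longrightarrow> \<sigma> b = 1 \<or> \<sigma> b = - 1) \<Longrightarrow> chi \<sigma> c j = 1 \<or> chi \<sigma> c j = - 1"
proof (induction c)
  case (Suc c)
  have "\<sigma> c = 1 \<or> \<sigma> c = - 1" using Suc.prems by simp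
  moreover have "chi \<sigma> c j = 1 \<or> chi \<sigma> c j = - 1" using Suc by simp
  ultimately show ?case by (auto simp: chi_def)
qed (simp add: chi_def)

lemma sum_lessThan_add:
  fixes g :: "nat \<Rightarrow> 'a::comm_monoid_add"
  shows "(\<Sum>j<M + N. g j) = (\<Sum>j<M. g j) + (\<Sum>j<N. g (M + j))"
  by (induction N) (simp_all add: add.assoc)

text \<open>Descending from \<open>y\<close>, the first branching decides the highest bit of
  \<open>j\<close>. A node whose children have height \<open>t\<close> thus combines them with
  \<open>\<sigma> t\<close>, and the induction peels off the top bit.\<close>

lemma fold_block:
  fixes f :: "nat \<Rightarrow> real"
  assumes "\<And>t z. \<lbrakk>t < c; y * 2 ^ (c - Suc t) \<le> z; z < (y + 1) * 2 ^ (c - Suc t)\<rbrakk> \<Longrightarrow>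
    f z = f (2 * z) + \<sigma> t * f (2 * z + 1)"
  shows "f y = (\<Sum>j<2 ^ c. chi \<sigma> c j * f (y * 2 ^ c + j))"
  using assms
proof (induction c arbitrary: y)
  case 0
  show ?case by (simp add: chi_def)
next
  case (Suc c)
  have sub: "f w = (\<Sum>j<2 ^ c. chi \<sigma> c j * f (w * 2 ^ c + j))" if w: "w = 2 * y \<or> w = 2 * y + 1" for w
  proof (rule Suc.IH)
    fix t z assume t: "t < c" "w * 2 ^ (c - Suc t) \<le> z" "z < (w + 1) * 2 ^ (c - Suc t)"
    have e: "2 ^ (Suc c - Suc t) = 2 * (2 ^ (c - Suc t) :: nat)"
      using t(1) by (metis Suc_diff_Suc diff_Suc_Suc power_Suc)
    show "f z = f (2 * z) + \<sigma> t * f (2 * z + 1)"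
    proof (rule Suc.prems)
      let ?q = "2 ^ (c - Suc t) :: nat"
      have "2 * y * ?q \<le> w * ?q" "(w + 1) * ?q \<le> (2 * y + 2) * ?q"
        using w by (auto intro!: mult_right_mono)
      then have "2 * y * ?q \<le> z" "z < (2 * y + 2) * ?q" using t by linarith+
      then show "y * 2 ^ (Suc c - Suc t) \<le> z" "z < (y + 1) * 2 ^ (Suc c - Suc t)"
        unfolding e by (simp_all add: algebra_simps)
    qed (use t in simp)
  qed
  have "f y = f (2 * y) + \<sigma> c * f (2 * y + 1)" by (rule Suc.prems[of c]) auto
  also have "f (2 * y) = (\<Sum>j<2 ^ c. chi \<sigma> (Suc c) j * f (y * 2 ^ Suc c + j))"
    unfolding sub[of "2 * y", OF disjI1[OF refl]] by (intro sum.cong) (auto simp: chi_Suc_low algebra_simps)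
  also have "\<sigma> c * f (2 * y + 1) = (\<Sum>j<2 ^ c. chi \<sigma> (Suc c) (2 ^ c + j) * f (y * 2 ^ Suc c + (2 ^ c + j)))"
    unfolding sub[of "2 * y + 1", OF disjI2[OF refl]] sum_distrib_left
  proof (rule sum.cong[OF refl])
    fix j :: nat assume "j \<in> {..<2 ^ c}"
    then have j: "j < 2 ^ c" by simp
    have e: "(2 * y + 1) * 2 ^ c + j = y * 2 ^ Suc c + (2 ^ c + j)" by simp
    show "\<sigma> c * (chi \<sigma> c j * f ((2 * y + 1) * 2 ^ c + j)) =
        chi \<sigma> (Suc c) (2 ^ c + j) * f (y * 2 ^ Suc c + (2 ^ c + j))"
      unfolding chi_Suc_high[OF j] e by (simp only: mult.assoc)
  qed
  finally show ?case using sum_lessThan_add[of "\<lambda>j. chi \<sigma> (Suc c) j * f (y * 2 ^ Suc c + j)" "2 ^ c" "2 ^ c"]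
    by (simp add: mult_2)
qed

text \<open>Plain summation is the fold with all signs equal to 1.\<close>

lemma sum_block:
  fixes f :: "nat \<Rightarrow> real"
  assumes "\<And>t z. \<lbrakk>t < c; y * 2 ^ t \<le> z; z < (y + 1) * 2 ^ t\<rbrakk> \<Longrightarrow> f z = f (2 * z) + f (2 * z + 1)"
  shows "f y = (\<Sum>j<2 ^ c. f (y * 2 ^ c + j))"
proof -
  have "f y = (\<Sum>j<2 ^ c. chi (\<lambda>_. 1) c j * f (y * 2 ^ c + j))"
  proof (rule fold_block)
    fix t z assume "t < c" "y * 2 ^ (c - Suc t) \<le> z" "z < (y + 1) * 2 ^ (c - Suc t)"
    then show "f z = f (2 * z) + 1 * f (2 * z + 1)" using assms[of "c - Suc t" z] by simp
  qed
  moreover have "chi (\<lambda>_. 1) c j = 1" for j by (simp add: chi_def)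
  ultimately show ?thesis by simp
qed

lemma sum_children:
  fixes g :: "nat \<Rightarrow> real"
  shows "(\<Sum>x\<in>{2 * M..<2 * N}. g x) = (\<Sum>y\<in>{M..<N}. g (2 * y) + g (2 * y + 1))"
proof (cases "M \<le> N")
  case True
  then show ?thesis
  proof (induction N rule: dec_induct)
    case (step N)
    have "{2 * M..<2 * Suc N} = insert (2 * N + 1) (insert (2 * N) {2 * M..<2 * N})" using step by auto
    then show ?case using step by simp
  qed simp
qed simp

text \<open>
  One level of the fold: the two signs average to the previous value, so the sign that makes the
  cross term nonpositive does not increase it.
\<close>

lemma fold_level:
  fixes f w :: "nat \<Rightarrow> real"
  assumes s: "s = 1 \<or> s = - 1"
    and cross: "s * (\<Sum>y\<in>{M..<N}. w y * f (2 * y) * f (2 * y + 1)) \<le> 0"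
    and f: "\<And>y. y \<in> {M..<N} \<Longrightarrow> f y = f (2 * y) + s * f (2 * y + 1)"
    and w': "\<And>y. y \<in> {M..<N} \<Longrightarrow> w' (2 * y) = w y \<and> w' (2 * y + 1) = w y"
  shows "(\<Sum>y\<in>{M..<N}. w y * (f y)\<^sup>2) \<le> (\<Sum>x\<in>{2 * M..<2 * N}. w' x * (f x)\<^sup>2)"
proof -
  have "(\<Sum>y\<in>{M..<N}. w y * (f y)\<^sup>2) =
    (\<Sum>y\<in>{M..<N}. w' (2 * y) * (f (2 * y))\<^sup>2 + w' (2 * y + 1) * (f (2 * y + 1))\<^sup>2 +
       2 * s * (w y * f (2 * y) * f (2 * y + 1)))"
  proof (rule sum.cong[OF refl])
    fix y assume y: "y \<in> {M..<N}"
    have "s\<^sup>2 = 1" using s by auto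
    then show "w y * (f y)\<^sup>2 = w' (2 * y) * (f (2 * y))\<^sup>2 + w' (2 * y + 1) * (f (2 * y + 1))\<^sup>2 +
       2 * s * (w y * f (2 * y) * f (2 * y + 1))"
      unfolding f[OF y] using w'[OF y] by (simp add: power2_sum power_mult_distrib algebra_simps)
  qed
  also have "\<dots> = (\<Sum>x\<in>{2 * M..<2 * N}. w' x * (f x)\<^sup>2) +
      2 * (s * (\<Sum>y\<in>{M..<N}. w y * f (2 * y) * f (2 * y + 1)))"
    unfolding sum_children sum.distrib by (simp add: sum_distrib_left mult.assoc)
  finally show ?thesis using cross by linarith
qed

section \<open>The random walk\<close>

text \<open>For negative y = -z the quadratic Taylor bound for exp z is multiplied by 1 - z + z^2;
  the product is 1 + z^2/2 + z^3/2 + z^4/2, hence at least 1.\<close>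

lemma exp_le_quadratic:
  fixes y :: real
  assumes "y \<le> 1"
  shows "exp y \<le> 1 + y + y\<^sup>2"
proof (cases "0 \<le> y")
  case True
  then show ?thesis using exp_bound[of y] assms by simp
next
  case False
  define z where "z = - y"
  have z: "0 \<le> z" using False by (simp add: z_def)
  have "1 + z + z\<^sup>2 / 2 \<le> exp z" using exp_lower_Taylor_quadratic[OF z] by simp
  moreover have "0 \<le> 1 - z + z\<^sup>2"
  proof -
    have "1 - z + z\<^sup>2 = (z - 1/2)\<^sup>2 + 3/4" by (simp add: power2_eq_square algebra_simps)
    then show ?thesis by simp
  qed
  ultimately have "(1 + z + z\<^sup>2 / 2) * (1 - z + z\<^sup>2) \<le> exp z * (1 - z + z\<^sup>2)"
    by (rule mult_right_mono)
  moreover have "(1 + z + z\<^sup>2 / 2) * (1 - z + z\<^sup>2) = 1 + z\<^sup>2 / 2 + z ^ 3 / 2 + z ^ 4 / 2"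
    by (simp add: field_simps power2_eq_square power3_eq_cube power4_eq_xxxx)
  ultimately have "1 \<le> exp z * (1 - z + z\<^sup>2)" using z by (simp add: add_nonneg_nonneg order_trans[rotated])
  then have "exp (- z) * 1 \<le> exp (- z) * (exp z * (1 - z + z\<^sup>2))" by (intro mult_left_mono) auto
  also have "\<dots> = 1 - z + z\<^sup>2" by (simp add: mult.assoc[symmetric] exp_add[symmetric])
  finally show ?thesis by (simp add: z_def)
qed

text \<open>Rows below \<open>2 * m\<close> carry the potential b p - 2 b^2 p^2 per coordinate; its
  derivative b - 4 b^2 p times the step size is \<open>\<beta>\<close>. In the row of a variable,
  \<open>\<beta>\<close> is half the relative derivative (1 - 2 p) / K of p (1 - p), because the
  square of that row's weight is to follow p (1 - p). The fractions in \<open>W_step\<close> are 1 +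
  \<Sum> \<beta>^2 and 1 + y + y^2, written as 3/4 plus a quantity that the program obtains from the
  tree.\<close>

locale walk =
  fixes n m T :: nat and K k \<Lambda> :: real and b :: "nat \<Rightarrow> nat \<Rightarrow> real"
    and p W sg :: "nat \<Rightarrow> nat \<Rightarrow> real" and \<beta> :: "nat \<Rightarrow> nat \<Rightarrow> nat \<Rightarrow> real"
  assumes K3: "3 \<le> K" and k0: "0 \<le> k" and \<Lambda>0: "0 \<le> \<Lambda>" and K: "2 * (k + \<Lambda>) \<le> K"
    and b_small: "\<And>r j. \<lbrakk>r < 2 * m; 1 \<le> j; j \<le> n\<rbrakk> \<Longrightarrow> \<bar>b r j\<bar> \<le> 1 / 16"
    and p0: "\<And>j. \<lbrakk>1 \<le> j; j \<le> n\<rbrakk> \<Longrightarrow> 0 \<le> p 0 j \<and> p 0 j \<le> 1"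
    and W0: "\<And>r. r < 2 * m + n \<Longrightarrow> 0 < W 0 r"
    and sg: "\<And>t j. \<lbrakk>t < T; 1 \<le> j; j \<le> n\<rbrakk> \<Longrightarrow> sg t j = 1 \<or> sg t j = - 1"
    and \<beta>: "\<And>t r j. \<lbrakk>t < T; r < 2 * m + n; 1 \<le> j; j \<le> n\<rbrakk> \<Longrightarrow> \<beta> t r j =
      (if r < 2 * m then if W t r < 1 then p t j * (1 - p t j) / K * (b r j - 4 * (b r j)\<^sup>2 * p t j) else 0
       else if j = r - 2 * m + 1 then (1 - 2 * p t j) / (2 * K) else 0)"
    and p_step: "\<And>t j. \<lbrakk>t < T; 1 \<le> j; j \<le> n\<rbrakk> \<Longrightarrow> p (Suc t) j = p t j + sg t j * (p t j * (1 - p t j) / K)"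
    and W_step: "\<And>t r. \<lbrakk>t < T; r < 2 * m + n\<rbrakk> \<Longrightarrow> W (Suc t) r =
      W t r / (3/4 + (1/4 + (\<Sum>j=1..n. (\<beta> t r j)\<^sup>2))) * (3/4 + (1/2 + (\<Sum>j=1..n. sg t j * \<beta> t r j))\<^sup>2)"
    and W_sum: "\<And>t. t < T \<Longrightarrow> (\<Sum>r<2 * m + n. W (Suc t) r) \<le> (\<Sum>r<2 * m + n. W t r)"
begin

lemma p_range: "\<lbrakk>t \<le> T; 1 \<le> j; j \<le> n\<rbrakk> \<Longrightarrow> 0 \<le> p t j \<and> p t j \<le> 1"
proof (induction t)
  case (Suc t)
  then have IH: "0 \<le> p t j" "p t j \<le> 1" by auto
  define q where "q = p t j"
  have q: "0 \<le> q" "q \<le> 1" using IH by (auto simp: q_def)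
  have "q * (1 - q) / K \<le> q * (1 - q) / 1" using K3 q by (intro divide_left_mono) auto
  moreover have "0 \<le> q * (1 - q) / K" using K3 q by simp
  moreover have "q * (1 - q) \<le> q * 1" "q * (1 - q) \<le> 1 * (1 - q)" using q by (intro mult_mono; simp)+
  moreover have "p (Suc t) j = q + q * (1 - q) / K \<or> p (Suc t) j = q - q * (1 - q) / K"
    using p_step[of t j] sg[of t j] Suc.prems unfolding q_def by auto
  ultimately show ?case by auto
qed (use p0 in auto)

lemma W_pos: "\<lbrakk>t \<le> T; r < 2 * m + n\<rbrakk> \<Longrightarrow> 0 < W t r"
proof (induction t)
  case (Suc t)
  have "0 \<le> (\<Sum>j=1..n. (\<beta> t r j)\<^sup>2)" by (intro sum_nonneg) auto
  then show ?case using Suc W_step[of t r]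
    by (auto intro!: mult_pos_pos divide_pos_pos add_pos_nonneg)
qed (use W0 in auto)

lemma W_total: "t \<le> T \<Longrightarrow> (\<Sum>r<2 * m + n. W t r) \<le> (\<Sum>r<2 * m + n. W 0 r)"
proof (induction t)
  case (Suc t)
  then show ?case using W_sum[of t] by simp
qed simp

lemma frozen:
  assumes "t < T" "r < 2 * m" "1 \<le> W t r"
  shows "W (Suc t) r = W t r"
proof -
  have "\<beta> t r j = 0" if "j \<in> {1..n}" for j using \<beta>[of t r j] assms that by auto
  then show ?thesis using W_step[of t r] assms by (simp add: power2_eq_square)
qed

text \<open>With all coefficients zero both brackets of the update equal 1, so weights from 1 on are
  absorbing. Read backwards, a row that ends below 1 was active at all times.\<close>

lemma active:
  assumes "t \<le> t'" "t' \<le> T" "r < 2 * m" "W t' r < 1"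
  shows "W t r < 1"
  using assms
proof (induction t' rule: dec_induct)
  case (step t')
  then show ?case using frozen[of t' r] by fastforce
qed simp

text \<open>Per coordinate the potential changes by exactly sg \<beta> - 2 b^2 s^2 with s = p (1 -
  p) / K, because the sign squares to 1, and \<beta>^2 <= 2 b^2 s^2. The exponent is therefore at
  most y - \<Sum> \<beta>^2. Unlike the right-hand side, the left-hand exponent telescopes over the
  steps.\<close>

lemma W_growth:
  assumes t: "t < T" "r < 2 * m" "W t r < 1" and y: "(\<Sum>j=1..n. sg t j * \<beta> t r j) \<le> 1"
  shows "W t r * exp ((\<Sum>j=1..n. b r j * (p (Suc t) j - p t j)) -
      2 * (\<Sum>j=1..n. (b r j)\<^sup>2 * ((p (Suc t) j)\<^sup>2 - (p t j)\<^sup>2))) \<le> W (Suc t) r"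
proof -
  let ?y = "\<Sum>j=1..n. sg t j * \<beta> t r j" and ?g = "\<Sum>j=1..n. (\<beta> t r j)\<^sup>2"
  have g0: "0 \<le> ?g" by (intro sum_nonneg) auto
  have W0: "0 < W t r" using W_pos t by simp
  have "(\<Sum>j=1..n. b r j * (p (Suc t) j - p t j)) -
      2 * (\<Sum>j=1..n. (b r j)\<^sup>2 * ((p (Suc t) j)\<^sup>2 - (p t j)\<^sup>2)) =
      (\<Sum>j=1..n. b r j * (p (Suc t) j - p t j) - 2 * ((b r j)\<^sup>2 * ((p (Suc t) j)\<^sup>2 - (p t j)\<^sup>2)))"
    by (simp add: sum_subtractf sum_distrib_left)
  also have "\<dots> \<le> (\<Sum>j=1..n. sg t j * \<beta> t r j - (\<beta> t r j)\<^sup>2)"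
  proof (rule sum_mono)
    fix j assume j: "j \<in> {1..n}"
    define s where "s = p t j * (1 - p t j) / K"
    define c where "c = b r j"
    define q where "q = p t j"
    have q: "0 \<le> q" "q \<le> 1" using p_range[of t j] t j by (auto simp: q_def)
    have be: "\<beta> t r j = s * (c - 4 * c\<^sup>2 * q)" using \<beta>[of t r j] t j by (simp add: s_def c_def q_def)
    have ps: "p (Suc t) j = q + sg t j * s" using p_step[of t j] t j by (simp add: s_def q_def)
    have s2: "(sg t j)\<^sup>2 = 1" using sg[of t j] t j by auto
    \<comment> \<open>The bound 1/16 on the coefficients enters here: the correction factor is at
      most 5/4, and its square is below 2.\<close>
    have "\<bar>4 * c * q\<bar> \<le> 1 / 4" using b_small[of r j] t j q mult_mono[of "\<bar>c\<bar>" "1/16" q 1]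
      by (auto simp: c_def abs_mult)
    then have "\<bar>1 - 4 * c * q\<bar> \<le> 5 / 4" by linarith
    then have "(1 - 4 * c * q)\<^sup>2 \<le> (5/4)\<^sup>2" by (metis abs_le_square_iff abs_of_pos zero_less_divide_iff zero_less_numeral)
    then have "(1 - 4 * c * q)\<^sup>2 \<le> 2" by (simp add: power2_eq_square)
    then have "(s * c)\<^sup>2 * (1 - 4 * c * q)\<^sup>2 \<le> (s * c)\<^sup>2 * 2" by (intro mult_left_mono) auto
    moreover have "(\<beta> t r j)\<^sup>2 = (s * c)\<^sup>2 * (1 - 4 * c * q)\<^sup>2"
      unfolding be by (simp add: power2_eq_square algebra_simps)
    ultimately have "(\<beta> t r j)\<^sup>2 \<le> 2 * c\<^sup>2 * s\<^sup>2" by (simp add: power_mult_distrib algebra_simps)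
    moreover have "c * (p (Suc t) j - q) - 2 * (c\<^sup>2 * ((p (Suc t) j)\<^sup>2 - q\<^sup>2)) =
      sg t j * \<beta> t r j - 2 * c\<^sup>2 * ((sg t j)\<^sup>2 * s\<^sup>2)"
      unfolding be ps by (simp add: power2_eq_square algebra_simps)
    ultimately show "b r j * (p (Suc t) j - p t j) - 2 * ((b r j)\<^sup>2 * ((p (Suc t) j)\<^sup>2 - (p t j)\<^sup>2))
        \<le> sg t j * \<beta> t r j - (\<beta> t r j)\<^sup>2"
      unfolding c_def[symmetric] q_def[symmetric] s2 by simp
  qed
  also have "\<dots> = ?y - ?g" by (simp add: sum_subtractf)
  finally have "W t r * exp ((\<Sum>j=1..n. b r j * (p (Suc t) j - p t j)) -
      2 * (\<Sum>j=1..n. (b r j)\<^sup>2 * ((p (Suc t) j)\<^sup>2 - (p t j)\<^sup>2))) \<le> W t r * exp (?y - ?g)"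
    using W0 by simp
  also have "\<dots> = W t r * (exp ?y / exp ?g)" by (simp add: exp_diff)
  \<comment> \<open>The numerator is enlarged by the quadratic bound, which is where y <= 1 is used;
    the denominator is shrunk by 1 + g <= exp g.\<close>
  also have "\<dots> \<le> W t r * ((1 + ?y + ?y\<^sup>2) / (1 + ?g))"
  proof (intro mult_left_mono frac_le)
    show "exp ?y \<le> 1 + ?y + ?y\<^sup>2" using exp_le_quadratic[OF y] .
    show "1 + ?g \<le> exp ?g" by (rule exp_ge_add_one_self)
    show "0 \<le> 1 + ?y + ?y\<^sup>2" using exp_le_quadratic[OF y] exp_ge_zero[of ?y] by linarith
  qed (use g0 W0 in auto)
  also have "\<dots> = W (Suc t) r"
  proof -
    have "3/4 + (1/2 + ?y)\<^sup>2 = 1 + ?y + ?y\<^sup>2" by (simp add: power2_eq_square algebra_simps)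
    moreover have "3/4 + (1/4 + ?g) = 1 + ?g" by simp
    ultimately show ?thesis using W_step[of t r] t by simp
  qed
  finally show ?thesis .
qed

text \<open>The bound on the deviation and the applicability of \<open>W_growth\<close> are proved
  together. While the row and its negation are below weight 1, their lower bounds confine the
  deviation; this keeps \<Sum> b p near k, hence y <= 1 in the next step, hence the lower bounds
  persist.\<close>

lemma row_deviation:
  assumes i: "i < m" and w: "W 0 i = w" "W 0 (m + i) = w" and l0: "0 < l" and wl: "exp (- l / 4) \<le> w"
    and l: "l \<le> \<Lambda>" and b0: "\<And>j. \<lbrakk>1 \<le> j; j \<le> n\<rbrakk> \<Longrightarrow> 0 \<le> b i j \<and> b (m + i) j = - b i j"
    and bsq: "(\<Sum>j=1..n. (b i j)\<^sup>2) \<le> l / 128" and bp: "(\<Sum>j=1..n. b i j * p 0 j) \<le> k"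
    and fin: "W T i < 1" "W T (m + i) < 1" and t: "t \<le> T"
  shows "\<bar>\<Sum>j=1..n. b i j * (p t j - p 0 j)\<bar> \<le> 17 / 64 * l"
proof -
  let ?x = "\<lambda>t. \<Sum>j=1..n. b i j * (p t j - p 0 j)"
  let ?v = "\<lambda>t. 2 * (\<Sum>j=1..n. (b i j)\<^sup>2 * ((p t j)\<^sup>2 - (p 0 j)\<^sup>2))"
  have act: "W t i < 1" "W t (m + i) < 1" if "t \<le> T" for t
    using active[OF that _ _ fin(1)] active[OF that _ _ fin(2)] i by auto
  have vb: "?v t \<le> l / 64" if "t \<le> T" for t
  proof -
    have "(\<Sum>j=1..n. (b i j)\<^sup>2 * ((p t j)\<^sup>2 - (p 0 j)\<^sup>2)) \<le> (\<Sum>j=1..n. (b i j)\<^sup>2 * 1)"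
    proof (intro sum_mono mult_left_mono)
      fix j assume "j \<in> {1..n}"
      then have "0 \<le> p t j \<and> p t j \<le> 1" using p_range[OF that, of j] by auto
      then have "(p t j)\<^sup>2 \<le> 1" by (simp add: power_le_one)
      then show "(p t j)\<^sup>2 - (p 0 j)\<^sup>2 \<le> 1" by (metis diff_le_eq add_increasing2 zero_le_power2)
    qed auto
    then show ?thesis using bsq by simp
  qed
  \<comment> \<open>17/64 = 1/4 + 1/64: the first part pays for the initial weight exp (-l/4), the
    second for the accumulated second order terms.\<close>
  have dev: "\<bar>?x t\<bar> \<le> 17 / 64 * l"
    if "t \<le> T" "w * exp (?x t - ?v t) \<le> W t i" "w * exp (- ?x t - ?v t) \<le> W t (m + i)" for t
  proof -
    have *: "z \<le> 17 / 64 * l" if "w * exp (z - ?v t) < 1" for z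
    proof -
      have "exp (- l / 4) * exp (z - ?v t) \<le> w * exp (z - ?v t)" using wl by simp
      then have "exp (- l / 4) * exp (z - ?v t) < exp 0" using that unfolding exp_zero by linarith
      then have "exp (- l / 4 + (z - ?v t)) < exp 0" unfolding exp_add .
      then have "- l / 4 + (z - ?v t) < 0" by (simp only: exp_less_cancel_iff)
      then show ?thesis using vb[OF \<open>t \<le> T\<close>] by linarith
    qed
    have "?x t \<le> 17 / 64 * l" "- ?x t \<le> 17 / 64 * l"
      using *[of "?x t"] *[of "- ?x t"] that act[OF that(1)] by auto
    then show ?thesis by linarith
  qed
  have main: "w * exp (?x t - ?v t) \<le> W t i \<and> w * exp (- ?x t - ?v t) \<le> W t (m + i)" if "t \<le> T" for t
    using that
  proof (induction t)
    case 0
    then show ?case using w by simp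
  next
    case (Suc t)
    then have t: "t < T" "t \<le> T" and IH: "w * exp (?x t - ?v t) \<le> W t i" "w * exp (- ?x t - ?v t) \<le> W t (m + i)" by auto
    have X: "\<bar>?x t\<bar> \<le> 17 / 64 * l" by (rule dev[OF t(2) IH])
    have y: "(\<Sum>j=1..n. sg t j * \<beta> t r j) \<le> 1" if r: "r = i \<or> r = m + i" for r
    proof -
      have "(\<Sum>j=1..n. sg t j * \<beta> t r j) \<le> (\<Sum>j=1..n. 5 / (4 * K) * (b i j * p t j))"
      proof (rule sum_mono)
        fix j assume j: "j \<in> {1..n}"
        define q where "q = p t j"
        have q: "0 \<le> q" "q \<le> 1" using p_range[of t j] t j by (auto simp: q_def)
        define c where "c = b r j"
        have c: "\<bar>c\<bar> = b i j" using b0[of j] j r by (auto simp: c_def)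
        have c16: "\<bar>c\<bar> \<le> 1 / 16" using b_small[of r j] r i j by (auto simp: c_def)
        have be: "\<beta> t r j = q * (1 - q) / K * (c * (1 - 4 * c * q))"
          using \<beta>[of t r j] t j r i act[OF t(2)] by (auto simp: c_def q_def power2_eq_square algebra_simps)
        have "\<bar>4 * c * q\<bar> \<le> 1 / 4" using c16 q mult_mono[of "\<bar>c\<bar>" "1/16" q 1] by (auto simp: abs_mult)
        then have 1: "\<bar>1 - 4 * c * q\<bar> \<le> 5 / 4" by linarith
        have "sg t j * \<beta> t r j \<le> \<bar>\<beta> t r j\<bar>" using sg[of t j] t j by auto
        also have "\<dots> = (q * (1 - q)) / K * (b i j * \<bar>1 - 4 * c * q\<bar>)"
          unfolding be using q K3 c by (simp add: abs_mult)
        also have "\<dots> \<le> (q * 1) / K * (b i j * (5 / 4))"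
        proof -
          have "0 \<le> b i j" using c by linarith
          then show ?thesis using q K3 1 by (intro mult_mono divide_right_mono mult_left_mono) auto
        qed
        finally show "sg t j * \<beta> t r j \<le> 5 / (4 * K) * (b i j * p t j)"
          by (simp add: q_def mult_ac)
      qed
      also have "\<dots> = 5 / (4 * K) * (\<Sum>j=1..n. b i j * p 0 j + b i j * (p t j - p 0 j))"
        by (simp add: sum_distrib_left algebra_simps)
      also have "\<dots> = 5 / (4 * K) * ((\<Sum>j=1..n. b i j * p 0 j) + ?x t)" by (simp add: sum.distrib)
      \<comment> \<open>k + 17/64 l <= k + \<Lambda> <= K / 2, by the choice of K. The total change
        is thus at most 5/8.\<close>
      also have "\<dots> \<le> 5 / (4 * K) * (K / 2)"
        using bp X K l l0 k0 K3 by (intro mult_left_mono) auto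
      also have "\<dots> \<le> 1" using K3 by simp
      finally show ?thesis .
    qed
    have ri: "i < 2 * m" "m + i < 2 * m" using i by auto
    let ?dx = "\<Sum>j=1..n. b i j * (p (Suc t) j - p t j)"
    let ?dv = "2 * (\<Sum>j=1..n. (b i j)\<^sup>2 * ((p (Suc t) j)\<^sup>2 - (p t j)\<^sup>2))"
    have ex: "?x (Suc t) = ?x t + ?dx" "?v (Suc t) = ?v t + ?dv"
      unfolding distrib_left[symmetric] sum.distrib[symmetric] by (simp_all add: algebra_simps)
    have w0: "0 \<le> w" using wl exp_ge_zero[of "- l / 4"] by linarith
    have "w * exp (?x (Suc t) - ?v (Suc t)) = w * exp (?x t - ?v t) * exp (?dx - ?dv)"
      unfolding ex by (simp add: exp_add[symmetric] algebra_simps)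
    also have "\<dots> \<le> W t i * exp (?dx - ?dv)" using IH(1) by (intro mult_right_mono) auto
    also have "\<dots> \<le> W (Suc t) i" using W_growth[OF t(1) ri(1) act(1)[OF t(2)] y] by simp
    finally have 1: "w * exp (?x (Suc t) - ?v (Suc t)) \<le> W (Suc t) i" .
    have "(\<Sum>j=1..n. b (m + i) j * (p (Suc t) j - p t j)) = (\<Sum>j=1..n. - (b i j * (p (Suc t) j - p t j)))"
      by (rule sum.cong) (use b0 in auto)
    then have ms: "(\<Sum>j=1..n. b (m + i) j * (p (Suc t) j - p t j)) = - ?dx" by (simp add: sum_negf)
    have mv: "2 * (\<Sum>j=1..n. (b (m + i) j)\<^sup>2 * ((p (Suc t) j)\<^sup>2 - (p t j)\<^sup>2)) = ?dv"
      using b0 by (simp cong: sum.cong_simp)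
    have "w * exp (- ?x (Suc t) - ?v (Suc t)) = w * exp (- ?x t - ?v t) * exp (- ?dx - ?dv)"
      unfolding ex by (simp add: exp_add[symmetric] algebra_simps)
    also have "\<dots> \<le> W t (m + i) * exp (- ?dx - ?dv)" using IH(2) by (intro mult_right_mono) auto
    also have "\<dots> \<le> W (Suc t) (m + i)"
      using W_growth[OF t(1) ri(2) act(2)[OF t(2)] y] unfolding ms mv by simp
    finally show ?case using 1 by blast
  qed
  show ?thesis using dev[OF t] main[OF t] by blast
qed

text \<open>
  With \<open>v = \<plusminus>(1 - 2 p) / (2 K)\<close>, a step multiplies \<open>p (1 - p)\<close> by exactly
  \<open>(1 + v)\<^sup>2 - 1 / (4 K\<^sup>2)\<close>, while the weight of the row that belongs to the variable is multiplied by
  \<open>1 + v / (1 + v\<^sup>2)\<close>.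
\<close>

lemma variance_step:
  assumes t: "t < T" and j: "1 \<le> j" "j \<le> n"
  defines "r \<equiv> 2 * m + (j - 1)"
  shows "p (Suc t) j * (1 - p (Suc t) j) * (W t r)\<^sup>2 \<le> (1 - 1 / (16 * K\<^sup>2)) * (p t j * (1 - p t j)) * (W (Suc t) r)\<^sup>2"
proof -
  define q where "q = p t j"
  have q: "0 \<le> q" "q \<le> 1" using p_range[of t j] t j by (auto simp: q_def)
  define v where "v = sg t j * ((1 - 2 * q) / (2 * K))"
  define u where "u = v / (1 + v\<^sup>2)"
  have r: "r < 2 * m + n" "\<not> r < 2 * m" using j by (auto simp: r_def)
  have sgj: "sg t j = 1 \<or> sg t j = - 1" using sg t j by auto
  have s2: "(sg t j)\<^sup>2 = 1" using sgj by auto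
  have be: "\<beta> t r i = (if i = j then (1 - 2 * q) / (2 * K) else 0)" if "i \<in> {1..n}" for i
    using \<beta>[of t r i] t r that j by (auto simp: r_def q_def)
  have "(\<Sum>i=1..n. (\<beta> t r i)\<^sup>2) = (\<Sum>i=1..n. if i = j then ((1 - 2 * q) / (2 * K))\<^sup>2 else 0)"
    by (rule sum.cong) (auto simp: be)
  then have g: "(\<Sum>i=1..n. (\<beta> t r i)\<^sup>2) = v\<^sup>2" using j by (simp add: v_def power_mult_distrib power_divide s2)
  have "(\<Sum>i=1..n. sg t i * \<beta> t r i) = (\<Sum>i=1..n. if i = j then v else 0)"
    by (rule sum.cong) (auto simp: be v_def)
  then have y: "(\<Sum>i=1..n. sg t i * \<beta> t r i) = v" using j by simp
  have v2: "0 < 1 + v\<^sup>2" by (simp add: add_pos_nonneg)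
  have "W (Suc t) r = W t r / (1 + v\<^sup>2) * (1 + v + v\<^sup>2)"
    using W_step[OF t r(1)] unfolding g y by (simp add: power2_eq_square algebra_simps)
  also have "\<dots> = W t r * (1 + u)" using v2 by (simp add: u_def field_simps)
  finally have WS: "W (Suc t) r = W t r * (1 + u)" .
  have pp: "p (Suc t) j * (1 - p (Suc t) j) = q * (1 - q) * ((1 + v)\<^sup>2 - 1 / (4 * K\<^sup>2))"
  proof -
    define s where "s = sg t j"
    have ss: "s * s = 1" using s2 by (simp add: s_def power2_eq_square)
    define h where "h = 1 / K"
    have pS: "p (Suc t) j = q + s * q * (1 - q) * h" using p_step[of t j] t j
      by (simp add: q_def s_def h_def)
    have v': "v = s * (1 - 2 * q) * h / 2" by (simp add: v_def s_def h_def)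
    have k': "1 / (4 * K\<^sup>2) = h * h / 4" by (simp add: h_def power2_eq_square)
    have 1: "p (Suc t) j * (1 - p (Suc t) j) = q * (1 - q) * (1 + s * (1 - 2 * q) * h - s * s * (q * (1 - q) * h * h))"
      unfolding pS by (simp add: algebra_simps)
    have 2: "(1 + v)\<^sup>2 - 1 / (4 * K\<^sup>2) = 1 + s * (1 - 2 * q) * h + s * s * ((1 - 2 * q) * (1 - 2 * q) * h * h / 4) - h * h / 4"
      unfolding v' k' by (simp add: power2_eq_square algebra_simps)
    have 3: "1 + s * (1 - 2 * q) * h - 1 * (q * (1 - q) * h * h) =
        1 + s * (1 - 2 * q) * h + 1 * ((1 - 2 * q) * (1 - 2 * q) * h * h / 4) - h * h / 4"
      by (simp add: field_simps)
    show ?thesis unfolding 1 2 ss 3 ..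
  qed
  have av: "\<bar>v\<bar> \<le> 1 / (2 * K)"
  proof -
    have "\<bar>v\<bar> = \<bar>1 - 2 * q\<bar> / (2 * K)" using sgj K3 by (auto simp: v_def abs_mult)
    also have "\<dots> \<le> 1 / (2 * K)" using q K3 by (intro divide_right_mono) auto
    finally show ?thesis .
  qed
  have K6: "1 / (2 * K) \<le> 1 / 6" using K3 by (simp add: field_simps)
  have v16: "\<bar>v\<bar> \<le> 1 / 6" using av K6 by linarith
  have uv: "\<bar>u\<bar> \<le> \<bar>v\<bar>"
  proof -
    have "\<bar>u\<bar> = \<bar>v\<bar> / (1 + v\<^sup>2)" using v2 by (simp add: u_def)
    also have "\<dots> \<le> \<bar>v\<bar> / 1" using v2 by (intro divide_left_mono) auto
    finally show ?thesis by simp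
  qed
  have "v - u = v * (v\<^sup>2 / (1 + v\<^sup>2))" using v2 by (simp add: u_def field_simps)
  then have "\<bar>v - u\<bar> = \<bar>v\<bar> * (v\<^sup>2 / (1 + v\<^sup>2))" using v2 by (simp add: abs_mult)
  also have "\<dots> \<le> 1 / 6 * (1 / (4 * K\<^sup>2))"
  proof (rule mult_mono)
    have "v\<^sup>2 / (1 + v\<^sup>2) \<le> v\<^sup>2 / 1" using v2 by (intro divide_left_mono) auto
    also have "\<dots> \<le> (1 / (2 * K))\<^sup>2" using power_mono[OF av, of 2] by simp
    finally show "v\<^sup>2 / (1 + v\<^sup>2) \<le> 1 / (4 * K\<^sup>2)" by (simp add: power2_eq_square)
  qed (use v16 v2 in auto)
  finally have vu: "\<bar>v - u\<bar> \<le> 1 / (24 * K\<^sup>2)" by simp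
  \<comment> \<open>The gain 1 / (4 K^2) is split. Replacing v by u costs at most |v - u| * 3 <= 1 /
    (8 K^2), as v - u is cubic in v; the other half is turned into the factor 1 - 1 / (16 K^2) by
    means of (1 + u)^2 <= 2.\<close>
  have "(1 + v)\<^sup>2 - (1 + u)\<^sup>2 = (v - u) * (2 + v + u)" by (simp add: power2_eq_square algebra_simps)
  also have "\<dots> \<le> \<bar>v - u\<bar> * (2 + v + u)" using uv v16 by (intro mult_right_mono) auto
  also have "\<dots> \<le> 1 / (24 * K\<^sup>2) * 3" using vu uv v16 by (intro mult_mono) auto
  finally have "(1 + v)\<^sup>2 - (1 + u)\<^sup>2 \<le> 1 / (8 * K\<^sup>2)" by simp
  moreover have "1 / (4 * K\<^sup>2) = 1 / (8 * K\<^sup>2) + 1 / (8 * K\<^sup>2)" by simp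
  ultimately have A: "(1 + v)\<^sup>2 - 1 / (4 * K\<^sup>2) \<le> (1 + u)\<^sup>2 - 1 / (8 * K\<^sup>2)" by linarith
  have "(1 + u)\<^sup>2 \<le> (1 + 1 / 6)\<^sup>2" using uv v16 by (intro power_mono) auto
  then have "(1 + u)\<^sup>2 \<le> 2" by (simp add: power2_eq_square)
  then have "1 / (16 * K\<^sup>2) * (1 + u)\<^sup>2 \<le> 1 / (16 * K\<^sup>2) * 2" by (intro mult_left_mono) auto
  then have Bd: "(1 + v)\<^sup>2 - 1 / (4 * K\<^sup>2) \<le> (1 - 1 / (16 * K\<^sup>2)) * (1 + u)\<^sup>2" using A
    by (simp add: left_diff_distrib)
  have "p (Suc t) j * (1 - p (Suc t) j) * (W t r)\<^sup>2 = (q * (1 - q)) * (W t r)\<^sup>2 * ((1 + v)\<^sup>2 - 1 / (4 * K\<^sup>2))"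
    unfolding pp by (simp only: mult_ac)
  also have "\<dots> \<le> (q * (1 - q)) * (W t r)\<^sup>2 * ((1 - 1 / (16 * K\<^sup>2)) * (1 + u)\<^sup>2)"
    using Bd q by (intro mult_left_mono) auto
  also have "\<dots> = (1 - 1 / (16 * K\<^sup>2)) * (q * (1 - q)) * (W (Suc t) r)\<^sup>2"
    unfolding WS by (simp add: power_mult_distrib mult_ac)
  finally show ?thesis by (simp add: q_def)
qed

text \<open>The ratio of p (1 - p) to the squared weight contracts in every step. The inequality is
  kept multiplied out, and the positive intermediate weight is cancelled at the end.\<close>

lemma variance_decay:
  assumes j: "1 \<le> j" "j \<le> n" and t: "t \<le> T"
  defines "r \<equiv> 2 * m + (j - 1)"
  shows "p t j * (1 - p t j) * (W 0 r)\<^sup>2 \<le> (1 - 1 / (16 * K\<^sup>2)) ^ t * (W t r)\<^sup>2"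
  using t
proof (induction t)
  case 0
  have "0 \<le> p 0 j" "p 0 j \<le> 1" using p0 j by auto
  then have "p 0 j * (1 - p 0 j) \<le> 1 * 1" by (intro mult_mono) auto
  then have "p 0 j * (1 - p 0 j) * (W 0 r)\<^sup>2 \<le> 1 * 1 * (W 0 r)\<^sup>2" by (rule mult_right_mono) simp
  then show ?case by simp
next
  case (Suc t)
  have r: "r < 2 * m + n" using j by (auto simp: r_def)
  have Wt: "0 < (W t r)\<^sup>2" using W_pos[of t r] Suc r by simp
  define \<rho> where "\<rho> = 1 - 1 / (16 * K\<^sup>2)"
  have "1 \<le> K\<^sup>2" using K3 by (simp add: one_le_power)
  then have "1 / (16 * K\<^sup>2) \<le> 1" by (simp add: divide_le_eq)
  then have \<rho>: "0 \<le> \<rho>" by (simp add: \<rho>_def)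
  have "p (Suc t) j * (1 - p (Suc t) j) * (W 0 r)\<^sup>2 * (W t r)\<^sup>2 \<le>
      \<rho> * (p t j * (1 - p t j)) * (W (Suc t) r)\<^sup>2 * (W 0 r)\<^sup>2"
    using mult_right_mono[OF variance_step[of t j], of "(W 0 r)\<^sup>2"] Suc j
    by (simp add: r_def \<rho>_def mult_ac)
  also have "\<dots> = \<rho> * (W (Suc t) r)\<^sup>2 * (p t j * (1 - p t j) * (W 0 r)\<^sup>2)" by (simp add: mult_ac)
  also have "\<dots> \<le> \<rho> * (W (Suc t) r)\<^sup>2 * (\<rho> ^ t * (W t r)\<^sup>2)"
    using Suc \<rho> by (intro mult_left_mono) (auto simp: \<rho>_def)
  also have "\<dots> = \<rho> ^ Suc t * (W (Suc t) r)\<^sup>2 * (W t r)\<^sup>2" by (simp add: mult_ac)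
  finally show ?case using Wt unfolding \<rho>_def by (simp add: mult_le_cancel_right)
qed

end

section \<open>Weights and rounding\<close>

locale rounding =
  fixes n m k L :: nat and a :: "nat \<Rightarrow> nat \<Rightarrow> real" and p0 \<Delta> :: "nat \<Rightarrow> real"
  assumes n1: "1 \<le> n" and m1: "1 \<le> m" and size: "2 * m + n + 2 \<le> 2 ^ L"
    and a0: "\<And>i j. \<lbrakk>i < m; 1 \<le> j; j \<le> n\<rbrakk> \<Longrightarrow> 0 \<le> a i j"
    and p01: "\<And>j. \<lbrakk>1 \<le> j; j \<le> n\<rbrakk> \<Longrightarrow> 0 \<le> p0 j \<and> p0 j \<le> 1"
    and \<Delta>0: "\<And>i. i < m \<Longrightarrow> 0 < \<Delta> i"
begin

definition A2 :: "nat \<Rightarrow> real" where "A2 i = (\<Sum>j=1..n. a i j * a i j)"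

definition mu :: "nat \<Rightarrow> real" where "mu i = (\<Sum>j=1..n. p0 j * a i j)"

text \<open>With \<open>lam\<close> below, this yields the minimum of 4 (L + 5) / \<Delta>, \<Delta>
  / (128 A2) and k / mu. The second bounds the second order terms, the third the drift \<Sum> b p;
  times \<Delta> these two are, up to constants, the two quotients in the target probability. The
  first caps the number of halvings. The minima are taken by comparing products, so a division by
  \<open>A2\<close> or \<open>mu\<close> is only chosen where the divisor is positive.\<close>

definition lam1 :: "nat \<Rightarrow> real" where
  "lam1 i = (if \<Delta> i < 128 * (real (4 * (L + 5)) / \<Delta> i) * A2 i then \<Delta> i / (128 * A2 i)
     else real (4 * (L + 5)) / \<Delta> i)"

definition lam :: "nat \<Rightarrow> real" where
  "lam i = (if real k < lam1 i * mu i then real k / mu i else lam1 i)"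

text \<open>The walk requires coefficients of size at most 1/16. Larger entries are left out; their
  effect on the rounding error is estimated separately through lam a <= 16 (lam a)^2.\<close>

definition coef :: "nat \<Rightarrow> nat \<Rightarrow> real" where
  "coef r j = (if 1 / 16 < lam (r mod m) * a (r mod m) j then 0
     else if r < m then lam (r mod m) * a (r mod m) j else 0 - lam (r mod m) * a (r mod m) j)"

text \<open>This is the minimum of L + 5 and the integer part of lam \<Delta> / 4, in a form that
  only takes comparisons.\<close>

definition halvings :: "nat \<Rightarrow> nat" where
  "halvings i = card {d \<in> {1..L + 5}. \<not> lam i * \<Delta> i < real (4 * d)}"

text \<open>The rows of the variables together start with weight at most 1/2, too little to account
  for even one bad row, while each of them starts only polynomially small, so that it still limits
  the final p (1 - p).\<close>

definition wgt :: "nat \<Rightarrow> real" where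
  "wgt r = (if r < 2 * m then (1 / 2) ^ halvings (r mod m) else 1 / real (2 * 2 ^ L))"

lemma A2_nonneg: "0 \<le> A2 i"
  unfolding A2_def by (intro sum_nonneg) simp

lemma mu_nonneg: "i < m \<Longrightarrow> 0 \<le> mu i"
  unfolding mu_def by (intro sum_nonneg mult_nonneg_nonneg) (use a0 p01 in auto)

lemma lam1_props:
  assumes i: "i < m"
  shows "0 \<le> lam1 i" "lam1 i * \<Delta> i \<le> real (4 * (L + 5))" "128 * lam1 i * A2 i \<le> \<Delta> i"
    "lam1 i = real (4 * (L + 5)) / \<Delta> i \<or> (0 < A2 i \<and> lam1 i = \<Delta> i / (128 * A2 i))"
proof -
  let ?l = "real (4 * (L + 5)) / \<Delta> i"
  have d: "0 < \<Delta> i" using \<Delta>0 i by simp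
  have l: "0 < ?l" using d by simp
  consider "\<Delta> i < 128 * ?l * A2 i" "0 < A2 i" "lam1 i = \<Delta> i / (128 * A2 i)" |
    "128 * ?l * A2 i \<le> \<Delta> i" "lam1 i = ?l"
  proof (cases "\<Delta> i < 128 * ?l * A2 i")
    case True
    have "A2 i \<noteq> 0"
    proof
      assume "A2 i = 0"
      then show False using True d by simp
    qed
    then have "0 < A2 i" using A2_nonneg[of i] by simp
    then show ?thesis using True that(1) by (simp add: lam1_def)
  next
    case False
    then show ?thesis using that(2) by (auto simp: lam1_def not_less)
  qed
  then have "0 \<le> lam1 i \<and> lam1 i * \<Delta> i \<le> real (4 * (L + 5)) \<and> 128 * lam1 i * A2 i \<le> \<Delta> i \<and>
      (lam1 i = ?l \<or> (0 < A2 i \<and> lam1 i = \<Delta> i / (128 * A2 i)))"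
  proof cases
    case 1
    have "\<Delta> i / (128 * A2 i) < ?l" using 1 by (simp add: field_simps)
    then have "lam1 i * \<Delta> i \<le> ?l * \<Delta> i" using 1 d by (intro mult_right_mono) auto
    then show ?thesis using 1 d by simp
  next
    case 2
    then show ?thesis using d l by simp
  qed
  then show "0 \<le> lam1 i" "lam1 i * \<Delta> i \<le> real (4 * (L + 5))" "128 * lam1 i * A2 i \<le> \<Delta> i"
    "lam1 i = ?l \<or> (0 < A2 i \<and> lam1 i = \<Delta> i / (128 * A2 i))" by auto
qed

lemma lam_props:
  assumes i: "i < m"
  shows "0 \<le> lam i" "lam i \<le> lam1 i" "lam i * mu i \<le> real k"
    "lam i = lam1 i \<or> (0 < mu i \<and> lam i = real k / mu i)"
proof -
  note l1 = lam1_props[OF i] and mu0 = mu_nonneg[OF i]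
  consider "real k < lam1 i * mu i" "0 < mu i" "lam i = real k / mu i" | "lam1 i * mu i \<le> real k" "lam i = lam1 i"
  proof (cases "real k < lam1 i * mu i")
    case True
    then have "0 < lam1 i * mu i" using of_nat_0_le_iff[of k] by linarith
    then have "0 < mu i" using l1 mu0 by (auto simp: zero_less_mult_iff)
    then show ?thesis using True that(1) by (simp add: lam_def)
  next
    case False
    then show ?thesis using that(2) by (auto simp: lam_def)
  qed
  then have "0 \<le> lam i \<and> lam i \<le> lam1 i \<and> lam i * mu i \<le> real k \<and>
    (lam i = lam1 i \<or> (0 < mu i \<and> lam i = real k / mu i))"
  proof cases
    case 1
    then show ?thesis by (simp add: divide_le_eq)
  next
    case 2
    then show ?thesis using l1 by simp
  qed
  then show "0 \<le> lam i" "lam i \<le> lam1 i" "lam i * mu i \<le> real k"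
    "lam i = lam1 i \<or> (0 < mu i \<and> lam i = real k / mu i)" by auto
qed

lemma lam_bounds:
  assumes i: "i < m"
  shows "lam i * \<Delta> i \<le> real (4 * (L + 5))" "128 * lam i * A2 i \<le> \<Delta> i"
proof -
  have "lam i * \<Delta> i \<le> lam1 i * \<Delta> i" using lam_props[OF i] \<Delta>0[OF i] by (intro mult_right_mono) auto
  then show "lam i * \<Delta> i \<le> real (4 * (L + 5))" using lam1_props[OF i] by linarith
  have "128 * lam i * A2 i \<le> 128 * lam1 i * A2 i" using lam_props[OF i] A2_nonneg by (intro mult_right_mono) auto
  then show "128 * lam i * A2 i \<le> \<Delta> i" using lam1_props[OF i] by linarith
qed

lemma halvings_le: "i < m \<Longrightarrow> real (halvings i) \<le> lam i * \<Delta> i / 4"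
proof -
  assume i: "i < m"
  let ?l = "lam i * \<Delta> i"
  have l0: "0 \<le> ?l" using lam_props[OF i] \<Delta>0[OF i] by simp
  have "{d \<in> {1..L + 5}. \<not> ?l < real (4 * d)} \<subseteq> {1..nat \<lfloor>?l / 4\<rfloor>}"
    by (auto simp: le_nat_iff le_floor_iff not_less)
  then have "halvings i \<le> nat \<lfloor>?l / 4\<rfloor>" unfolding halvings_def
    using card_mono[of "{1..nat \<lfloor>?l / 4\<rfloor>}"] by fastforce
  then show ?thesis using l0 by (simp add: le_nat_floor nat_le_iff le_floor_iff le_nat_iff)
qed

lemma halvings_ge: "\<lbrakk>i < m; lam i * \<Delta> i < real (4 * (L + 5))\<rbrakk> \<Longrightarrow> lam i * \<Delta> i / 4 - 1 \<le> real (halvings i)"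
proof -
  assume i: "i < m" and lt: "lam i * \<Delta> i < real (4 * (L + 5))"
  let ?l = "lam i * \<Delta> i"
  have l0: "0 \<le> ?l" using lam_props[OF i] \<Delta>0[OF i] by simp
  have "{1..nat \<lfloor>?l / 4\<rfloor>} \<subseteq> {d \<in> {1..L + 5}. \<not> ?l < real (4 * d)}"
  proof
    fix d assume "d \<in> {1..nat \<lfloor>?l / 4\<rfloor>}"
    then have d: "1 \<le> d" "real d \<le> ?l / 4" using l0 by (auto simp: le_nat_iff le_floor_iff)
    then have "real d < real (L + 5)" using lt by simp
    then show "d \<in> {d \<in> {1..L + 5}. \<not> ?l < real (4 * d)}" using d by auto
  qed
  then have "nat \<lfloor>?l / 4\<rfloor> \<le> halvings i" unfolding halvings_def
    using card_mono[of "{d \<in> {1..L + 5}. \<not> ?l < real (4 * d)}" "{1..nat \<lfloor>?l / 4\<rfloor>}"] by simp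
  moreover have "?l / 4 - 1 \<le> real (nat \<lfloor>?l / 4\<rfloor>)" using l0 by linarith
  ultimately show ?thesis by linarith
qed

lemma halvings_capped: "\<lbrakk>i < m; \<not> lam i * \<Delta> i < real (4 * (L + 5))\<rbrakk> \<Longrightarrow> halvings i = L + 5"
proof -
  assume i: "i < m" and "\<not> lam i * \<Delta> i < real (4 * (L + 5))"
  then have "{d \<in> {1..L + 5}. \<not> lam i * \<Delta> i < real (4 * d)} = {1..L + 5}" by auto
  then show ?thesis by (simp add: halvings_def)
qed

text \<open>From 2 <= e and 1/2 <= exp (-1/2). Powers of 1/2, which the machine can produce, replace
  exponentials at the price of a factor 2 in the exponent.\<close>

lemma half_power_exp: "exp (- real h) \<le> (1 / 2) ^ h" "(1 / 2) ^ h \<le> exp (- (real h / 2))"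
proof -
  have e1: "exp (- 1) \<le> (1 / 2 :: real)"
    using exp_ge_add_one_self[of "1::real"] by (simp add: exp_minus field_simps)
  have "(1 / 2 :: real) \<le> exp (- (1 / 2))" using exp_ge_add_one_self[of "- (1/2) :: real"] by simp
  then have "(1 / 2 :: real) ^ h \<le> exp (- (1 / 2)) ^ h" by (intro power_mono) auto
  also have "\<dots> = exp (real h * - (1 / 2))" by (rule exp_of_nat_mult[symmetric])
  finally show "(1 / 2) ^ h \<le> exp (- (real h / 2))" by simp
  have "exp (real h * - 1) = exp (- 1) ^ h" by (rule exp_of_nat_mult)
  also have "\<dots> \<le> (1 / 2) ^ h" using e1 by (intro power_mono) auto
  finally show "exp (- real h) \<le> (1 / 2) ^ h" by simp
qed

lemma coef_abs: "\<lbrakk>r < 2 * m; 1 \<le> j; j \<le> n\<rbrakk> \<Longrightarrow> \<bar>coef r j\<bar> \<le> 1 / 16"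
proof -
  assume r: "r < 2 * m" "1 \<le> j" "j \<le> n"
  have i: "r mod m < m" using m1 by simp
  have "0 \<le> lam (r mod m) * a (r mod m) j" using lam_props[OF i] a0[OF i r(2,3)] by simp
  then show ?thesis by (auto simp: coef_def)
qed

lemma P_real: "real (2 * m + n + 2) \<le> 2 ^ L"
  using size by (metis of_nat_le_iff of_nat_numeral of_nat_power)

end

locale rounding_run = rounding n m k L a p0 \<Delta> +
  walk n m T "real KN" "real k" "real (4 * (L + 5))" coef p W sg \<beta>
  for n m k L a p0 \<Delta> KN T p W sg \<beta> +
  assumes KN_eq: "KN = 2 * (k + 4 * (L + 5))" and T_eq: "T = 128 * KN * KN * L"
    and init_p: "\<And>j. \<lbrakk>1 \<le> j; j \<le> n\<rbrakk> \<Longrightarrow> p 0 j = p0 j"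
    and init_W: "\<And>r. r < 2 * m + n \<Longrightarrow> W 0 r = wgt r"
begin

definition q :: "nat \<Rightarrow> real" where "q j = (if p T j < 1 / 2 then 0 else 1)"

lemma total_weight: "(\<Sum>r<2 * m + n. W 0 r) = 2 * (\<Sum>i<m. (1 / 2) ^ halvings i) + real n / (2 * 2 ^ L)"
proof -
  have "(\<Sum>r<2 * m + n. W 0 r) = (\<Sum>r<2 * m + n. wgt r)" by (intro sum.cong) (auto simp: init_W)
  also have "\<dots> = (\<Sum>r<2 * m. wgt r) + (\<Sum>j<n. wgt (2 * m + j))"
    by (rule sum_lessThan_add)
  also have "(\<Sum>r<2 * m. wgt r) = (\<Sum>i<m. wgt i) + (\<Sum>i<m. wgt (m + i))"
    unfolding mult_2 by (rule sum_lessThan_add)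
  also have "(\<Sum>i<m. wgt i) = (\<Sum>i<m. (1 / 2) ^ halvings i)" by (intro sum.cong) (auto simp: wgt_def)
  also have "(\<Sum>i<m. wgt (m + i)) = (\<Sum>i<m. (1 / 2) ^ halvings i)" by (intro sum.cong) (auto simp: wgt_def)
  also have "(\<Sum>j<n. wgt (2 * m + j)) = real n / (2 * 2 ^ L)" by (simp add: wgt_def)
  finally show ?thesis by simp
qed

lemma n_frac: "real n / (2 * 2 ^ L) \<le> 1 / 2"
  using size by (simp add: field_simps)

lemma total_weight_le: "(\<Sum>r<2 * m + n. W 0 r) \<le> 2 ^ L"
proof -
  have "(\<Sum>i<m. (1 / 2 :: real) ^ halvings i) \<le> (\<Sum>i<m. 1)" by (intro sum_mono power_le_one) auto
  then have "(\<Sum>i<m. (1 / 2 :: real) ^ halvings i) \<le> real m" by simp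
  moreover have "2 * real m + real n + 2 \<le> 2 ^ L" using P_real by simp
  moreover note n_frac
  ultimately show ?thesis unfolding total_weight by linarith
qed

text \<open>With P = 2^L, the weight of the variable's row grows from 1 / (2 P) to at most the total
  P. The decay over T steps is at least P^8, so p (1 - p) <= 4 P^4 / P^8 = 4 / P^4, and the distance
  to the nearer integer is at most twice that.\<close>

lemma near_integral:
  assumes j: "1 \<le> j" "j \<le> n"
  shows "\<bar>p T j - q j\<bar> \<le> 1 / (4 * 2 ^ L)"
proof -
  define P :: real where "P = 2 ^ L"
  have P5: "5 \<le> P" using P_real n1 m1 by (simp add: P_def)
  let ?r = "2 * m + (j - 1)"
  have r: "?r < 2 * m + n" "\<not> ?r < 2 * m" using j by auto
  have WT: "W T ?r \<le> P"
  proof -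
    have "W T ?r \<le> (\<Sum>r<2 * m + n. W T r)"
      using r W_pos[of T] by (intro member_le_sum) (auto intro: less_imp_le)
    then show ?thesis using W_total[of T] total_weight_le by (simp add: P_def)
  qed
  have W0r: "W 0 ?r = 1 / (2 * P)" using init_W[OF r(1)] r by (simp add: wgt_def P_def)
  define v where "v = p T j * (1 - p T j)"
  have pr: "0 \<le> p T j" "p T j \<le> 1" using p_range[of T j] j by auto
  have v0: "0 \<le> v" using pr by (simp add: v_def)
  define K where "K = real KN"
  have K1: "3 \<le> K" using K3 by (simp add: K_def)
  have K2: "1 \<le> K\<^sup>2" using K1 by (simp add: one_le_power)
  have "1 - 1 / (16 * K\<^sup>2) \<le> exp (- (1 / (16 * K\<^sup>2)))" using exp_ge_add_one_self[of "- (1 / (16 * K\<^sup>2))"] by simp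
  moreover have "0 \<le> 1 - 1 / (16 * K\<^sup>2)" using K2 by (simp add: divide_le_eq)
  ultimately have "(1 - 1 / (16 * K\<^sup>2)) ^ T \<le> exp (- (1 / (16 * K\<^sup>2))) ^ T" by (intro power_mono)
  also have "\<dots> = exp (real T * - (1 / (16 * K\<^sup>2)))" by (rule exp_of_nat_mult[symmetric])
  \<comment> \<open>The constant 128 in T is 8 times the 16 of the decay rate.\<close>
  also have "real T * - (1 / (16 * K\<^sup>2)) = - real (8 * L)"
  proof -
    have "real T = 128 * K\<^sup>2 * real L" by (simp add: T_eq K_def power2_eq_square)
    moreover have "K \<noteq> 0" using K1 by simp
    ultimately show ?thesis by (simp add: field_simps)
  qed
  also have "exp (- real (8 * L)) \<le> (1 / 2) ^ (8 * L)" by (rule half_power_exp)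
  also have "\<dots> = 1 / P ^ 8" by (simp add: P_def power_divide power_mult[symmetric] mult.commute)
  finally have dec: "(1 - 1 / (16 * K\<^sup>2)) ^ T \<le> 1 / P ^ 8" .
  have "v * (1 / (2 * P))\<^sup>2 \<le> (1 - 1 / (16 * K\<^sup>2)) ^ T * (W T ?r)\<^sup>2"
    using variance_decay[OF j, of T] unfolding W0r v_def K_def by simp
  also have "\<dots> \<le> 1 / P ^ 8 * P\<^sup>2" using dec WT W_pos[of T ?r] r P5
    by (intro mult_mono power_mono) auto
  finally have "v * (1 / (2 * P))\<^sup>2 \<le> 1 / P ^ 8 * P\<^sup>2" .
  then have "v * (1 / (2 * P))\<^sup>2 * (4 * P\<^sup>2) \<le> 1 / P ^ 8 * P\<^sup>2 * (4 * P\<^sup>2)" by (rule mult_right_mono) simp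
  moreover have "v * (1 / (2 * P))\<^sup>2 * (4 * P\<^sup>2) = v" using P5 by (simp add: power2_eq_square field_simps)
  moreover have "1 / P ^ 8 * P\<^sup>2 * (4 * P\<^sup>2) = 4 / P ^ 4" using P5 by (simp add: field_simps power_numeral_reduce)
  ultimately have v: "v \<le> 4 / P ^ 4" by simp
  \<comment> \<open>P >= 5 because 2 m + n + 2 >= 5, hence P^3 >= 125.\<close>
  have "32 * P \<le> P ^ 4"
  proof -
    have "32 \<le> (5::real) ^ 3" by simp
    also have "\<dots> \<le> P ^ 3" using P5 by (intro power_mono) auto
    finally have "32 * P \<le> P ^ 3 * P" using P5 by (intro mult_right_mono) auto
    then show ?thesis by (simp add: power_numeral_reduce mult_ac)
  qed
  then have "4 / P ^ 4 \<le> 4 / (32 * P)" using P5 by (intro divide_left_mono) auto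
  then have v2: "2 * v \<le> 1 / (4 * P)" using v by simp
  show ?thesis
  proof (cases "p T j < 1 / 2")
    case True
    then have "p T j * (1 / 2) \<le> v" unfolding v_def using pr by (intro mult_left_mono) auto
    then show ?thesis using True v2 pr by (simp add: q_def P_def)
  next
    case False
    then have "1 / 2 * (1 - p T j) \<le> v" unfolding v_def using pr by (intro mult_right_mono) auto
    then show ?thesis using False v2 pr by (simp add: q_def P_def)
  qed
qed

text \<open>In units of l = lam \<Delta>: the walk on the small entries moves the row by at most
  17/64, rounding the near-integral values costs at most 1/4, and the large entries cost at most 16
  lam^2 A2 <= l / 8. The sum is 41/64.\<close>

lemma good_row:
  assumes i: "i < m" and good: "W T i < 1" "W T (m + i) < 1"
  shows "\<bar>\<Sum>j=1..n. a i j * (p0 j - q j)\<bar> \<le> \<Delta> i"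
proof -
  define l where "l = lam i * \<Delta> i"
  have D: "0 < \<Delta> i" using \<Delta>0 i by simp
  note lp = lam_props[OF i] and lb = lam_bounds[OF i]
  \<comment> \<open>A row that was never frozen started below weight 1, so it was halved at least
    once; this forces l >= 4 and rules out lam = 0.\<close>
  have "W 0 i < 1" using active[of 0 T i] good i by simp
  then have "(1 / 2 :: real) ^ halvings i < 1" using init_W[of i] i by (simp add: wgt_def)
  then have "1 \<le> halvings i" by (cases "halvings i") auto
  then have "1 \<le> real (halvings i)" by simp
  then have l4: "4 \<le> l" using halvings_le[OF i] by (simp add: l_def)
  then have lam0: "0 < lam i" using D lp(1) by (cases "lam i = 0") (auto simp: l_def)
  let ?b = "\<lambda>j. coef i j"
  have ci: "coef i j = (if 1 / 16 < lam i * a i j then 0 else lam i * a i j)" for j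
    using i by (simp add: coef_def)
  have la0: "0 \<le> lam i * a i j" if "j \<in> {1..n}" for j using a0[OF i, of j] lam0 that by simp
  have X: "\<bar>\<Sum>j=1..n. coef i j * (p T j - p 0 j)\<bar> \<le> 17 / 64 * l"
  proof (rule row_deviation[OF i, where w = "(1 / 2) ^ halvings i"])
    show "W 0 i = (1 / 2) ^ halvings i" "W 0 (m + i) = (1 / 2) ^ halvings i"
      using init_W[of i] init_W[of "m + i"] i by (simp_all add: wgt_def)
    show "exp (- l / 4) \<le> (1 / 2) ^ halvings i"
    proof -
      have "exp (- l / 4) \<le> exp (- real (halvings i))" using halvings_le[OF i] by (simp add: l_def)
      then show ?thesis using half_power_exp(1)[of "halvings i"] by linarith
    qed
    show "0 \<le> coef i j \<and> coef (m + i) j = - coef i j" if "1 \<le> j" "j \<le> n" for j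
      using la0[of j] that i by (auto simp: coef_def)
    have "(coef i j)\<^sup>2 \<le> (lam i * a i j)\<^sup>2" for j by (auto simp: ci)
    then have "(\<Sum>j=1..n. (coef i j)\<^sup>2) \<le> (\<Sum>j=1..n. (lam i * a i j)\<^sup>2)" by (rule sum_mono)
    also have "\<dots> = (\<Sum>j=1..n. (lam i)\<^sup>2 * (a i j * a i j))"
      by (simp add: power2_eq_square mult_ac)
    also have "\<dots> = lam i * (lam i * A2 i)" by (simp add: A2_def sum_distrib_left power2_eq_square mult_ac)
    also have "\<dots> \<le> lam i * (\<Delta> i / 128)" using lb(2) lam0 by (intro mult_left_mono) auto
    finally show "(\<Sum>j=1..n. (coef i j)\<^sup>2) \<le> l / 128" by (simp add: l_def)
    have "(\<Sum>j=1..n. coef i j * p 0 j) \<le> (\<Sum>j=1..n. lam i * (p0 j * a i j))"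
    proof (rule sum_mono)
      fix j assume j: "j \<in> {1..n}"
      have "coef i j * p 0 j \<le> lam i * a i j * p 0 j"
        using la0[OF j] p01[of j] init_p[of j] j by (intro mult_right_mono) (auto simp: ci)
      then show "coef i j * p 0 j \<le> lam i * (p0 j * a i j)" using init_p[of j] j by (simp add: mult_ac)
    qed
    then show "(\<Sum>j=1..n. coef i j * p 0 j) \<le> real k" using lp(3) by (simp add: mu_def sum_distrib_left)
    show "l \<le> real (4 * (L + 5))" using lb(1) by (simp only: l_def)
  qed (use l4 good in auto)
  \<comment> \<open>A single larger entry would already give A2 > \<Delta>^2, whereas 128 lam A2 <=
    \<Delta> and l >= 4.\<close>
  have aD: "a i j \<le> \<Delta> i" if j: "j \<in> {1..n}" for j
  proof (rule ccontr)
    assume "\<not> a i j \<le> \<Delta> i"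
    then have gt: "\<Delta> i < a i j" by simp
    have "\<Delta> i * \<Delta> i < a i j * a i j" using gt D by (intro mult_strict_mono) auto
    also have "\<dots> \<le> A2 i" unfolding A2_def using j by (intro member_le_sum[of j]) auto
    finally have "128 * lam i * (\<Delta> i * \<Delta> i) \<le> 128 * lam i * A2 i" using lam0 by (intro mult_left_mono) auto
    then have "128 * l * \<Delta> i \<le> \<Delta> i" using lb(2) by (simp add: l_def mult_ac)
    moreover have "128 * 4 * \<Delta> i \<le> 128 * l * \<Delta> i" using l4 D by (intro mult_right_mono) auto
    ultimately show False using D by simp
  qed
  have qb: "\<bar>p0 j - q j\<bar> \<le> 1" if "j \<in> {1..n}" for j using p01[of j] that by (auto simp: q_def)
  \<comment> \<open>Adding the movement of the walk cancels p0 against p T on small entries, leaving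
    only p T - q there; on large entries the coefficient is 0 and the full rounding error
    remains.\<close>
  have "\<bar>(\<Sum>j=1..n. lam i * a i j * (p0 j - q j)) + (\<Sum>j=1..n. coef i j * (p T j - p 0 j))\<bar>
      = \<bar>\<Sum>j=1..n. lam i * a i j * (p0 j - q j) + coef i j * (p T j - p 0 j)\<bar>"
    by (simp add: sum.distrib)
  also have "\<dots> \<le> (\<Sum>j=1..n. \<bar>lam i * a i j * (p0 j - q j) + coef i j * (p T j - p 0 j)\<bar>)"
    by (rule sum_abs)
  also have "\<dots> \<le> (\<Sum>j=1..n. 16 * (lam i)\<^sup>2 * (a i j * a i j) + l / (4 * 2 ^ L))"
  proof (rule sum_mono)
    fix j assume j: "j \<in> {1..n}"
    show "\<bar>lam i * a i j * (p0 j - q j) + coef i j * (p T j - p 0 j)\<bar> \<le>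
        16 * (lam i)\<^sup>2 * (a i j * a i j) + l / (4 * 2 ^ L)"
    proof (cases "1 / 16 < lam i * a i j")
      case True
      have "\<bar>lam i * a i j * (p0 j - q j) + coef i j * (p T j - p 0 j)\<bar> = lam i * a i j * \<bar>p0 j - q j\<bar>"
        using True by (simp add: ci abs_mult[of "lam i * a i j"])
      also have "\<dots> \<le> lam i * a i j * 1" using qb[OF j] la0[OF j] by (intro mult_left_mono) auto
      also have "\<dots> \<le> lam i * a i j * (16 * (lam i * a i j))" using True la0[OF j] by (intro mult_left_mono) auto
      also have "\<dots> = 16 * (lam i)\<^sup>2 * (a i j * a i j)" by (simp add: power2_eq_square)
      also have "\<dots> \<le> 16 * (lam i)\<^sup>2 * (a i j * a i j) + l / (4 * 2 ^ L)" using l4 by simp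
      finally show ?thesis .
    next
      case False
      have "lam i * a i j * (p0 j - q j) + coef i j * (p T j - p 0 j) = lam i * a i j * (p T j - q j)"
        using False init_p[of j] j by (simp add: ci right_diff_distrib)
      then have "\<bar>lam i * a i j * (p0 j - q j) + coef i j * (p T j - p 0 j)\<bar> = lam i * a i j * \<bar>p T j - q j\<bar>"
        using la0[OF j] by (simp add: abs_mult[of "lam i * a i j"])
      also have "\<dots> \<le> (lam i * \<Delta> i) * (1 / (4 * 2 ^ L))"
        using near_integral[of j] j aD[OF j] a0[OF i, of j] lam0 D by (intro mult_mono) auto
      also have "\<dots> \<le> 16 * (lam i)\<^sup>2 * (a i j * a i j) + l / (4 * 2 ^ L)" by (simp add: l_def)
      finally show ?thesis .
    qed
  qed
  also have "\<dots> = 16 * lam i * (lam i * A2 i) + real n * (l / (4 * 2 ^ L))"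
    by (simp add: sum.distrib A2_def sum_distrib_left power2_eq_square mult_ac)
  also have "\<dots> \<le> 16 * lam i * (\<Delta> i / 128) + l / 4"
  proof (rule add_mono)
    show "16 * lam i * (lam i * A2 i) \<le> 16 * lam i * (\<Delta> i / 128)"
      using lb(2) lam0 by (intro mult_left_mono) auto
    have "real n / 2 ^ L \<le> 1" using size by (simp add: field_simps)
    then have "real n / 2 ^ L * (l / 4) \<le> 1 * (l / 4)" using l4 by (intro mult_right_mono) auto
    then show "real n * (l / (4 * 2 ^ L)) \<le> l / 4" by (simp add: field_simps)
  qed
  finally have "\<bar>(\<Sum>j=1..n. lam i * a i j * (p0 j - q j)) + (\<Sum>j=1..n. coef i j * (p T j - p 0 j))\<bar> \<le> 3 / 8 * l"
    by (simp add: l_def mult.commute)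
  then have "\<bar>\<Sum>j=1..n. lam i * a i j * (p0 j - q j)\<bar> \<le> l" using X l4 by linarith
  moreover have "(\<Sum>j=1..n. lam i * a i j * (p0 j - q j)) = lam i * (\<Sum>j=1..n. a i j * (p0 j - q j))"
    by (simp add: sum_distrib_left mult.assoc)
  ultimately have "lam i * \<bar>\<Sum>j=1..n. a i j * (p0 j - q j)\<bar> \<le> lam i * \<Delta> i"
    using lam0 by (simp add: abs_mult l_def)
  then show ?thesis using lam0 by simp
qed

text \<open>Every bad row holds weight at least 1 in one of its two copies, so the count is at most
  the initial total. The additive 1/2 of the variables and the rows at the cap cannot be charged to
  \<open>pb\<close>, which may be tiny for the latter; they are absorbed because a nonempty set has
  at least one element.\<close>

lemma bad_count:
  assumes pb0: "\<And>i. i < m \<Longrightarrow> 0 \<le> pb i"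
    and pb: "\<And>i. \<lbrakk>i < m; lam i * \<Delta> i < real (4 * (L + 5))\<rbrakk> \<Longrightarrow> 16 * exp (- (lam i * \<Delta> i / 8)) \<le> pb i"
  shows "real (card {i. i < m \<and> \<not> (W T i < 1 \<and> W T (m + i) < 1)}) \<le> (\<Sum>i<m. pb i)"
proof (cases "{i. i < m \<and> \<not> (W T i < 1 \<and> W T (m + i) < 1)} = {}")
  case True
  show ?thesis unfolding True using sum_nonneg[of "{..<m}" pb] pb0 by simp
next
  case False
  let ?I = "{i. i < m \<and> \<not> (W T i < 1 \<and> W T (m + i) < 1)}"
  let ?w = "\<lambda>i. (1 / 2 :: real) ^ halvings i"
  have fin: "finite ?I" by simp
  then have c1: "1 \<le> real (card ?I)" using False by (simp add: Suc_leI card_gt_0_iff)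
  have pos: "0 \<le> W T r" if "r < 2 * m + n" for r using W_pos[of T r] that by simp
  have "real (card ?I) = (\<Sum>i\<in>?I. 1)" by simp
  also have "\<dots> \<le> (\<Sum>i\<in>?I. W T i + W T (m + i))"
  proof (rule sum_mono)
    fix i assume i: "i \<in> ?I"
    then have "0 \<le> W T i" "0 \<le> W T (m + i)" using pos by auto
    then show "1 \<le> W T i + W T (m + i)" using i by auto
  qed
  also have "\<dots> \<le> (\<Sum>i<m. W T i + W T (m + i))" using pos by (intro sum_mono2) auto
  also have "\<dots> = (\<Sum>r<2 * m. W T r)" unfolding mult_2 sum_lessThan_add sum.distrib ..
  also have "\<dots> \<le> (\<Sum>r<2 * m + n. W T r)" using pos by (intro sum_mono2) auto
  also have "\<dots> \<le> 2 * (\<Sum>i<m. ?w i) + real n / (2 * 2 ^ L)" using W_total[of T] total_weight by simp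
  also have "\<dots> \<le> 2 * (\<Sum>i<m. ?w i) + 1 / 2" using n_frac by simp
  finally have card: "real (card ?I) \<le> 2 * (\<Sum>i<m. ?w i) + 1 / 2" .
  let ?U = "{i. i < m \<and> lam i * \<Delta> i < real (4 * (L + 5))}"
  \<comment> \<open>A row at the cap has weight (1/2)^(L + 5) = 1 / (32 * 2^L), and there are at
    most 2^L rows.\<close>
  have "(\<Sum>i<m. ?w i) \<le> (\<Sum>i<m. (if i \<in> ?U then ?w i else 0) + 1 / (32 * 2 ^ L))"
  proof (rule sum_mono)
    fix i assume "i \<in> {..<m}"
    then show "?w i \<le> (if i \<in> ?U then ?w i else 0) + 1 / (32 * 2 ^ L)"
      using halvings_capped[of i] by (auto simp: power_divide power_add)
  qed
  also have "\<dots> = (\<Sum>i<m. if i \<in> ?U then ?w i else 0) + real m / (32 * 2 ^ L)" by (simp add: sum.distrib)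
  also have "real m / (32 * 2 ^ L) \<le> 1 / 32" using size by (simp add: field_simps)
  finally have split: "(\<Sum>i<m. ?w i) \<le> (\<Sum>i<m. if i \<in> ?U then ?w i else 0) + 1 / 32" by simp
  \<comment> \<open>At least one bad row forces the uncapped part S to be at least 7/32, and then 2
    S + 1/16 + 1/2 <= 5 S.\<close>
  then have "1 / 4 - 1 / 32 \<le> (\<Sum>i<m. if i \<in> ?U then ?w i else 0)" using card c1 by linarith
  then have "real (card ?I) \<le> 5 * (\<Sum>i<m. if i \<in> ?U then ?w i else 0)" using card split by linarith
  also have "\<dots> = (\<Sum>i<m. 5 * (if i \<in> ?U then ?w i else 0))" by (simp add: sum_distrib_left)
  also have "\<dots> \<le> (\<Sum>i<m. pb i)"
  proof (rule sum_mono)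
    fix i assume "i \<in> {..<m}"
    then have i: "i < m" by simp
    show "5 * (if i \<in> ?U then ?w i else 0) \<le> pb i"
    proof (cases "i \<in> ?U")
      case True
      then have lt: "lam i * \<Delta> i < real (4 * (L + 5))" by simp
      have "?w i \<le> exp (- (real (halvings i) / 2))" by (rule half_power_exp)
      also have "\<dots> \<le> exp (1 / 2 + - (lam i * \<Delta> i / 8))" using halvings_ge[OF i lt] by simp
      also have "\<dots> = exp (1 / 2) * exp (- (lam i * \<Delta> i / 8))" by (rule exp_add)
      also have "\<dots> \<le> 3 * exp (- (lam i * \<Delta> i / 8))"
      proof -
        have "exp (1 / 2 :: real) \<le> exp 1" by simp
        also have "\<dots> \<le> 3" by (rule exp_le)
        finally show ?thesis by (rule mult_right_mono) simp
      qed
      finally have "5 * ?w i \<le> 15 * exp (- (lam i * \<Delta> i / 8))" by simp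
      also have "\<dots> \<le> 16 * exp (- (lam i * \<Delta> i / 8))" by (rule mult_right_mono) auto
      finally show ?thesis using pb[OF i lt] True by simp
    next
      case False
      then show ?thesis using pb0[OF i] by (simp only: if_False mult_zero_right)
    qed
  qed
  finally show ?thesis .
qed

end

section \<open>Sparse tree aggregation\<close>

text \<open>
  A complete binary tree of height \<open>H\<close> in heap numbering (the children of \<open>x\<close> are \<open>2 * x\<close> and
  \<open>2 * x + 1\<close>), of which only the ancestors of the leaves \<open>leaf e\<close> with \<open>e < E\<close> are ever touched.
  Exclusive writes are ensured by appointing an owner \<open>own x - 1\<close> among the entries below a node \<open>x\<close>;
  the value \<open>0\<close> marks the nodes with no entries below them.
\<close>

definition lev :: "nat \<Rightarrow> nat \<Rightarrow> nat set" where
  "lev H c = {2 ^ (H - c)..<2 * 2 ^ (H - c)}"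

lemma lev_div: "\<lbrakk>x \<in> lev H 0; c \<le> H\<rbrakk> \<Longrightarrow> x div 2 ^ c \<in> lev H c"
proof -
  assume x: "x \<in> lev H 0" and c: "c \<le> H"
  have e: "(2::nat) ^ H = 2 ^ (H - c) * 2 ^ c" using c by (simp flip: power_add)
  have "2 ^ (H - c) * 2 ^ c \<le> x" "x < 2 * 2 ^ (H - c) * 2 ^ c" using x e by (auto simp: lev_def)
  then show ?thesis by (auto simp: lev_def less_eq_div_iff_mult_less_eq div_less_iff_less_mult)
qed

lemma lev_child: "c < H \<Longrightarrow> y \<in> lev H (Suc c) \<longleftrightarrow> 2 * y \<in> lev H c"
proof -
  assume "c < H"
  then have "(2::nat) ^ (H - c) = 2 * 2 ^ (H - Suc c)" by (metis Suc_diff_Suc power_Suc)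
  then show ?thesis by (auto simp: lev_def)
qed

lemma lev_child1: "c < H \<Longrightarrow> y \<in> lev H (Suc c) \<longleftrightarrow> 2 * y + 1 \<in> lev H c"
proof -
  assume "c < H"
  then have "(2::nat) ^ (H - c) = 2 * 2 ^ (H - Suc c)" by (metis Suc_diff_Suc power_Suc)
  then show ?thesis by (auto simp: lev_def)
qed

lemma lev_bound: "x \<in> lev H c \<Longrightarrow> 1 \<le> x \<and> x < 2 * 2 ^ H"
proof -
  assume "x \<in> lev H c"
  then have "2 ^ (H - c) \<le> x" "x < 2 * 2 ^ (H - c)" by (auto simp: lev_def)
  moreover have "(1::nat) \<le> 2 ^ (H - c)" by simp
  moreover have "(2::nat) ^ (H - c) \<le> 2 ^ H" by (intro power_increasing) auto
  ultimately show ?thesis by linarith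
qed

text \<open>Tests offer only strict comparison; since subtraction on words truncates at 0, the two
  differences sum to 0 exactly for equal words.\<close>

definition teq :: "wexp \<Rightarrow> wexp \<Rightarrow> texp" where
  "teq a b = TW (WB WAdd (WB WSub a b) (WB WSub b a)) (WC 1)"

lemma tv_teq [simp]: "tv h (teq a b) \<longleftrightarrow> wv h a = wv h b"
  by (auto simp: teq_def)

lemma trd_teq [simp]: "trd h (teq a b) = wrd h a \<union> wrd h b"
  by (auto simp: teq_def)

lemma tok_teq:
  "\<lbrakk>wok B Z h a; wok B Z h b; wv h a + wv h b < B; 1 < B\<rbrakk> \<Longrightarrow> tok B Z h (teq a b)"
  by (auto simp: teq_def)

abbreviation "true \<equiv> TW (WC 0) (WC 1)"
abbreviation "idx \<equiv> WR 10"
abbreviation "leafe \<equiv> WA 0 idx"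

definition parent :: "nat \<Rightarrow> wexp" where
  "parent v = WB WDiv leafe (WB WMul (WC 2) (WR v))"

text \<open>All entries run, but only the owner of its own ancestor stores. Register
  \<open>v\<close> holds 2^c and makes the ancestor that of height c + 1. The register
  \<open>sr\<close> holds the sign of the right child; register 1 permanently contains 1 and gives
  plain sums.\<close>

definition levelc :: "nat \<Rightarrow> nat \<Rightarrow> nat \<Rightarrow> com" where
  "levelc A v sr = ParFor 10 7 (gbody (teq (WA 1 (parent v)) (WB WAdd idx (WC 1)))
     (SRA A (parent v) (RB RAdd (RA A (WB WMul (WC 2) (parent v)))
        (RB RMul (RR sr) (RA A (WB WAdd (WB WMul (WC 2) (parent v)) (WC 1)))))))"

definition sumup :: "nat \<Rightarrow> com" where
  "sumup A = While (WLess 12 6) (Seq (levelc A 12 1) (wset 12 (WB WMul (WC 2) (WR 12))))"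

definition lvl_fold :: "nat \<Rightarrow> nat \<Rightarrow> real \<Rightarrow> (nat \<Rightarrow> real) \<Rightarrow> nat \<Rightarrow> real" where
  "lvl_fold H c s f y = (if y \<in> lev H (Suc c) then f (2 * y) + s * f (2 * y + 1) else f y)"

locale tree =
  fixes B Z X H E :: nat and leaf own :: "nat \<Rightarrow> nat"
  assumes X: "1 \<le> X" "E \<le> X"
    and leaf: "\<And>e. e < E \<Longrightarrow> leaf e \<in> lev H 0"
    and own_sound: "\<And>c x. \<lbrakk>c \<le> H; x \<in> lev H c; own x \<noteq> 0\<rbrakk> \<Longrightarrow> own x \<le> E \<and> leaf (own x - 1) div 2 ^ c = x"
    and own_up: "\<And>y. \<lbrakk>1 \<le> y; y < 2 ^ H; own y = 0\<rbrakk> \<Longrightarrow> own (2 * y) = 0 \<and> own (2 * y + 1) = 0"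
    and Bbig: "Z + 64 * 2 ^ H + 1000 \<le> B" "E \<le> 2 ^ H"
begin

definition treest :: "hst \<Rightarrow> bool" where
  "treest h \<longleftrightarrow> hw h 0 = Z \<and> hw h 6 = 2 ^ H \<and> hw h 7 = E \<and> wa h 0 = leaf \<and> wa h 1 = own \<and> hr h 1 = 1"

text \<open>Unowned nodes are never written but may be read as siblings. Holding 0 there is the
  invariant that makes such reads correct, and it lets arrays be reused from step to step without
  being cleared.\<close>

definition sparse :: "(nat \<Rightarrow> real) \<Rightarrow> bool" where
  "sparse f \<longleftrightarrow> (\<forall>x. 1 \<le> x \<longrightarrow> x < 2 * 2 ^ H \<longrightarrow> own x = 0 \<longrightarrow> f x = 0)"

lemma sparse_lvl_fold:
  assumes "sparse f" "c < H" shows "sparse (lvl_fold H c s f)"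
  unfolding sparse_def
proof (intro allI impI)
  fix x assume x: "1 \<le> x" "x < 2 * 2 ^ H" "own x = 0"
  show "lvl_fold H c s f x = 0"
  proof (cases "x \<in> lev H (Suc c)")
    case True
    have "2 * x \<in> lev H c" "2 * x + 1 \<in> lev H c" using True lev_child lev_child1 assms(2) by auto
    then have b: "1 \<le> 2 * x" "2 * x < 2 * 2 ^ H" "1 \<le> 2 * x + 1" "2 * x + 1 < 2 * 2 ^ H"
      using lev_bound by blast+
    then have "own (2 * x) = 0" "own (2 * x + 1) = 0" using own_up[of x] x by auto
    then show ?thesis using assms(1) b True unfolding sparse_def lvl_fold_def by simp
  next
    case False
    then show ?thesis using assms(1) x unfolding sparse_def lvl_fold_def by simp
  qed
qed

lemma parent_eval:
  assumes h: "treest h" and c: "c < H" and v: "hw h v = 2 ^ c" "v < 20" "v \<noteq> 10" and e: "e < E"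
  shows "wv (ini h 10 e) (parent v) = leaf e div 2 ^ Suc c" "wok B Z (ini h 10 e) (parent v)"
proof -
  note st = h[unfolded treest_def]
  have pw: "(2::nat) ^ c \<le> 2 ^ H" "2 * (2::nat) ^ c \<le> 2 ^ H"
    using c by (auto intro: power_increasing simp: Suc_leI simp flip: power_Suc)
  have lf: "leaf e < 2 * 2 ^ H" using leaf[OF e] lev_bound by blast
  have pb: "leaf e div 2 ^ Suc c < 2 * 2 ^ H"
    using lev_bound[OF lev_div[OF leaf[OF e], of "Suc c"]] c by simp
  show "wv (ini h 10 e) (parent v) = leaf e div 2 ^ Suc c" using st v by (simp add: parent_def)
  show "wok B Z (ini h 10 e) (parent v)"
    using st v lf Bbig pw pb e by (simp add: parent_def)
qed

text \<open>A node determines its owner, so two distinct iterations cannot both pass the guard for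
  the same node; an unowned node has no writer, which is why \<open>F\<close> must leave it
  alone.\<close>

lemma hx_owner_par:
  assumes h: "treest h" and c: "c < H" and v: "hw h v = 2 ^ c" "v < 20" "v \<noteq> 10"
    and A: "A < 16"
    and F: "\<And>e. \<lbrakk>e < E; own (leaf e div 2 ^ Suc c) = e + 1\<rbrakk> \<Longrightarrow> rv (ini h 10 e) ve = F (leaf e div 2 ^ Suc c)"
    and Fout: "\<And>y. y \<notin> lev H (Suc c) \<Longrightarrow> F y = ra h A y"
    and Fempty: "\<And>y. \<lbrakk>y \<in> lev H (Suc c); own y = 0\<rbrakk> \<Longrightarrow> F y = ra h A y"
    and ok: "\<And>e. \<lbrakk>e < E; leaf e div 2 ^ Suc c \<in> lev H (Suc c); leaf e < 2 * 2 ^ H\<rbrakk> \<Longrightarrow> rok B Z (ini h 10 e) ve"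
    and rd: "\<And>e y. \<lbrakk>e < E; y \<in> lev H (Suc c)\<rbrakk> \<Longrightarrow> RArr A y \<notin> rrd (ini h 10 e) ve"
    and Q: "Q (h\<lparr>ra := (ra h)(A := F)\<rparr>)"
  shows "hx B Z X (ParFor 10 7 (gbody (teq (WA 1 (parent v)) (WB WAdd idx (WC 1))) (SRA A (parent v) ve))) h
     (1 + gcost (teq (WA 1 (parent v)) (WB WAdd idx (WC 1))) (SRA A (parent v) ve)) Q"
proof (rule hx_par_real[where N = E and G = "\<lambda>e. own (leaf e div 2 ^ Suc c) = e + 1"
      and g = "\<lambda>e. leaf e div 2 ^ Suc c" and F = F])
  note st = h[unfolded treest_def]
  have pw: "(2::nat) ^ c \<le> 2 ^ H" "2 * (2::nat) ^ c \<le> 2 ^ H"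
    using c by (auto intro: power_increasing simp: Suc_leI simp flip: power_Suc)
  have lf: "leaf e < 2 * 2 ^ H" if "e < E" for e using leaf[OF that] lev_bound by blast
  have ps: "leaf e div 2 ^ Suc c \<in> lev H (Suc c)" if "e < E" for e
    using lev_div[OF leaf[OF that], of "Suc c"] c by simp
  have pv: "wv (ini h 10 e) (parent v) = leaf e div 2 ^ Suc c" if "e < E" for e
    using parent_eval[OF h c v that] by simp
  have pb: "leaf e div 2 ^ Suc c < 2 * 2 ^ H" if "e < E" for e using lev_bound[OF ps[OF that]] by simp
  have po: "wok B Z (ini h 10 e) (parent v)" if "e < E" for e
    using parent_eval[OF h c v that] by simp
  have ob: "own (leaf e div 2 ^ Suc c) \<le> E" if "e < E" for e
    using own_sound[OF _ ps[OF that]] c by (cases "own (leaf e div 2 ^ Suc c) = 0") auto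
  show "hw h 7 = E" using st by simp
  show "E \<le> X" "1 \<le> X" using X by auto
  fix e assume e: "e < E"
  show "tv (ini h 10 e) (teq (WA 1 (parent v)) (WB WAdd idx (WC 1))) = (own (leaf e div 2 ^ Suc c) = e + 1)"
    using st pv[OF e] by simp
  show "tok B Z (ini h 10 e) (teq (WA 1 (parent v)) (WB WAdd idx (WC 1)))"
    by (rule tok_teq) (use st po[OF e] pv[OF e] pb[OF e] ob[OF e] e Bbig in \<open>simp_all\<close>)
  show "wv (ini h 10 e) (parent v) = leaf e div 2 ^ Suc c" by (rule pv[OF e])
  show "sok B Z (ini h 10 e) (SRA A (parent v) ve)"
    using po[OF e] pv[OF e] ok[OF e ps[OF e] lf[OF e]] pb[OF e] A Bbig by simp
  { fix e' assume e': "e' < E"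
    have "RArr A (leaf e div 2 ^ Suc c) \<notin> wrd (ini h 10 e') (parent v)" by (simp add: parent_def)
    then show "RArr A (leaf e div 2 ^ Suc c) \<notin> trd (ini h 10 e') (teq (WA 1 (parent v)) (WB WAdd idx (WC 1)))"
       "RArr A (leaf e div 2 ^ Suc c) \<notin> wrd (ini h 10 e') (parent v) \<union> rrd (ini h 10 e') ve"
      using rd[OF e' ps[OF e]] by simp_all }
next
  fix y assume y: "\<And>e. \<lbrakk>e < E; own (leaf e div 2 ^ Suc c) = e + 1\<rbrakk> \<Longrightarrow> leaf e div 2 ^ Suc c \<noteq> y"
  show "F y = ra h A y"
  proof (cases "y \<in> lev H (Suc c)")
    case True
    have "own y = 0"
    proof (rule ccontr)
      assume "own y \<noteq> 0"
      then have s: "own y \<le> E" "leaf (own y - 1) div 2 ^ Suc c = y" "own y - 1 < E" "own y - 1 + 1 = own y"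
        using own_sound[OF _ True] c by auto
      show False using y[of "own y - 1"] s by metis
    qed
    then show ?thesis using Fempty True by simp
  qed (rule Fout)
next
  fix e e' assume "own (leaf e div 2 ^ Suc c) = e + 1" "own (leaf e' div 2 ^ Suc c) = e' + 1"
    "leaf e div 2 ^ Suc c = leaf e' div 2 ^ Suc c"
  then show "e = e'" by (metis add_right_cancel)
qed (simp, simp, simp, erule (1) F, rule Q)

lemma hx_level:
  assumes h: "treest h" and c: "c < H" and v: "hw h v = 2 ^ c" "v < 20" "v \<noteq> 10"
    and A: "A < 16" and sr: "sr < 20" and sp: "sparse (ra h A)"
    and Q: "Q (h\<lparr>ra := (ra h)(A := lvl_fold H c (hr h sr) (ra h A))\<rparr>)"
  shows "hx B Z X (levelc A v sr) h 200 Q"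
proof (rule hx_mono)
  note st = h[unfolded treest_def]
  have pw: "(2::nat) ^ c \<le> 2 ^ H" "2 * (2::nat) ^ c \<le> 2 ^ H"
    using c by (auto intro: power_increasing simp: Suc_leI simp flip: power_Suc)
  have pv: "wv (ini h 10 e) (parent v) = leaf e div 2 ^ Suc c" for e
    using st v by (simp add: parent_def)
  have ps: "leaf e div 2 ^ Suc c \<in> lev H (Suc c)" if "e < E" for e
    using lev_div[OF leaf[OF that], of "Suc c"] c by simp
  show "hx B Z X (levelc A v sr) h (1 + gcost (teq (WA 1 (parent v)) (WB WAdd idx (WC 1)))
     (SRA A (parent v) (RB RAdd (RA A (WB WMul (WC 2) (parent v)))
        (RB RMul (RR sr) (RA A (WB WAdd (WB WMul (WC 2) (parent v)) (WC 1))))))) Q"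
    unfolding levelc_def
  proof (rule hx_owner_par[OF h c v A, where F = "lvl_fold H c (hr h sr) (ra h A)"])
    fix e assume e: "e < E" "own (leaf e div 2 ^ Suc c) = e + 1"
    show "rv (ini h 10 e) (RB RAdd (RA A (WB WMul (WC 2) (parent v)))
        (RB RMul (RR sr) (RA A (WB WAdd (WB WMul (WC 2) (parent v)) (WC 1))))) =
      lvl_fold H c (hr h sr) (ra h A) (leaf e div 2 ^ Suc c)"
      using ps[OF e(1)] pv by (simp add: lvl_fold_def del: power_Suc)
  next
    fix y assume "y \<notin> lev H (Suc c)"
    then show "lvl_fold H c (hr h sr) (ra h A) y = ra h A y" by (simp add: lvl_fold_def)
  next
    fix y assume y: "y \<in> lev H (Suc c)" "own y = 0"
    have "sparse (lvl_fold H c (hr h sr) (ra h A))" by (rule sparse_lvl_fold[OF sp c])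
    then show "lvl_fold H c (hr h sr) (ra h A) y = ra h A y"
      using y lev_bound[OF y(1)] sp unfolding sparse_def by simp
  next
    fix e assume e: "e < E" "leaf e div 2 ^ Suc c \<in> lev H (Suc c)" "leaf e < 2 * 2 ^ H"
    have "2 * (leaf e div 2 ^ Suc c) \<in> lev H c" "2 * (leaf e div 2 ^ Suc c) + 1 \<in> lev H c"
      using e(2) lev_child lev_child1 c by auto
    then have "2 * (leaf e div 2 ^ Suc c) < 2 * 2 ^ H" "2 * (leaf e div 2 ^ Suc c) + 1 < 2 * 2 ^ H"
      using lev_bound by blast+
    moreover have "wok B Z (ini h 10 e) (parent v)"
      by (rule parent_eval[OF h c v e(1)])
    ultimately show "rok B Z (ini h 10 e) (RB RAdd (RA A (WB WMul (WC 2) (parent v)))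
        (RB RMul (RR sr) (RA A (WB WAdd (WB WMul (WC 2) (parent v)) (WC 1)))))"
      using pv A sr Bbig by (simp del: power_Suc)
  next
    fix e y assume e: "e < E" and y: "y \<in> lev H (Suc c)"
    have "2 * (leaf e div 2 ^ Suc c) \<in> lev H c" "2 * (leaf e div 2 ^ Suc c) + 1 \<in> lev H c"
      using ps[OF e] lev_child lev_child1 c by auto
    \<comment> \<open>Values are read one level below the cells that are written.\<close>
    moreover have "lev H c \<inter> lev H (Suc c) = {}"
    proof -
      have "(2::nat) ^ (H - c) = 2 * 2 ^ (H - Suc c)" using c by (metis Suc_diff_Suc power_Suc)
      then show ?thesis by (auto simp: lev_def)
    qed
    ultimately have "y \<noteq> 2 * (leaf e div 2 ^ Suc c)" "y \<noteq> 2 * (leaf e div 2 ^ Suc c) + 1" using y by auto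
    then show "RArr A y \<notin> rrd (ini h 10 e) (RB RAdd (RA A (WB WMul (WC 2) (parent v)))
        (RB RMul (RR sr) (RA A (WB WAdd (WB WMul (WC 2) (parent v)) (WC 1)))))"
      using pv by (simp add: parent_def del: power_Suc)
  qed (rule Q)
qed (simp_all add: gcost_def teq_def parent_def)

text \<open>The summation may start at any level \<open>c\<close>: cross terms live at inner nodes,
  and what the array holds below them must be ignored.\<close>

definition summed :: "nat \<Rightarrow> (nat \<Rightarrow> real) \<Rightarrow> (nat \<Rightarrow> real) \<Rightarrow> bool" where
  "summed c f F \<longleftrightarrow> sparse F \<and> (\<forall>x. 2 ^ (H - c) \<le> x \<longrightarrow> F x = f x) \<and>
     (\<forall>y. 1 \<le> y \<longrightarrow> y < 2 ^ (H - c) \<longrightarrow> F y = F (2 * y) + F (2 * y + 1))"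

lemma hx_sumup:
  assumes h: "treest h" and c: "c \<le> H" and v: "hw h 12 = 2 ^ c"
    and A: "A < 16" and sp: "sparse (ra h A)"
    and Q: "\<And>F. summed c (ra h A) F \<Longrightarrow> Q (h\<lparr>hw := (hw h)(12 := 2 ^ H), ra := (ra h)(A := F)\<rparr>)"
  shows "hx B Z X (sumup A) h (1 + H * 300) Q"
proof -
  let ?f = "ra h A"
  define Inv where "Inv i h' \<longleftrightarrow> (\<exists>F. h' = h\<lparr>hw := (hw h)(12 := 2 ^ (c + i)), ra := (ra h)(A := F)\<rparr> \<and>
     sparse F \<and> (\<forall>x. 2 ^ (H - c) \<le> x \<longrightarrow> F x = ?f x) \<and>
     (\<forall>y. 2 ^ (H - (c + i)) \<le> y \<longrightarrow> y < 2 ^ (H - c) \<longrightarrow> F y = F (2 * y) + F (2 * y + 1)))" for i h'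
  note st = h[unfolded treest_def]
  have "hx B Z X (sumup A) h (1 + (H - c) * (210 + 1)) (Inv (H - c))"
    unfolding sumup_def
  proof (rule hx_While)
    fix i h' assume i: "i < H - c" and I: "Inv i h'"
    obtain F where F: "h' = h\<lparr>hw := (hw h)(12 := 2 ^ (c + i)), ra := (ra h)(A := F)\<rparr>" "sparse F"
      "\<And>x. 2 ^ (H - c) \<le> x \<Longrightarrow> F x = ?f x"
      "\<And>y. \<lbrakk>2 ^ (H - (c + i)) \<le> y; y < 2 ^ (H - c)\<rbrakk> \<Longrightarrow> F y = F (2 * y) + F (2 * y + 1)"
      using I unfolding Inv_def by blast
    have ci: "c + i < H" using i by simp
    have t': "treest h'" using h F(1) by (simp add: treest_def)
    have lt: "hw h' 12 < hw h' 6" using F(1) st ci by simp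
    let ?F = "lvl_fold H (c + i) 1 F"
    have pp: "(2::nat) ^ (H - (c + i)) = 2 * 2 ^ (H - Suc (c + i))" using ci by (metis Suc_diff_Suc power_Suc)
    have mono: "(2::nat) ^ (H - (c + i)) \<le> 2 ^ (H - c)" by (intro power_increasing) auto
    have "hx B Z X (Seq (levelc A 12 1) (wset 12 (WB WMul (WC 2) (WR 12)))) h' (200 + (wcost (WB WMul (WC 2) (WR 12)) + 2)) (Inv (Suc i))"
    proof (rule hx_Seq)
      show "hx B Z X (levelc A 12 1) h' 200 (\<lambda>h1. h1 = h'\<lparr>ra := (ra h')(A := ?F)\<rparr>)"
        by (rule hx_level[OF t' ci]) (use F t' A in \<open>auto simp: treest_def\<close>)
    next
      fix h1 assume h1: "h1 = h'\<lparr>ra := (ra h')(A := ?F)\<rparr>"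
      have w12: "hw h1 12 = 2 ^ (c + i)" using h1 F(1) by simp
      have "2 * (2::nat) ^ (c + i) \<le> 2 ^ H" using ci by (metis Suc_leI one_le_numeral power_Suc power_increasing)
      then have b: "2 * (2::nat) ^ (c + i) < B" "(2::nat) ^ (c + i) < B" using Bbig by linarith+
      show "hx B Z X (wset 12 (WB WMul (WC 2) (WR 12))) h1 (wcost (WB WMul (WC 2) (WR 12)) + 2) (Inv (Suc i))"
      proof (rule hx_wset)
        have new: "?F y = ?F (2 * y) + ?F (2 * y + 1)" if y: "2 ^ (H - Suc (c + i)) \<le> y" "y < 2 ^ (H - c)" for y
        proof (cases "y < 2 ^ (H - (c + i))")
          case True
          then have "y \<in> lev H (Suc (c + i))" using y pp by (simp add: lev_def)
          moreover have "2 * y \<notin> lev H (Suc (c + i))" "2 * y + 1 \<notin> lev H (Suc (c + i))"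
            using y by (auto simp: lev_def)
          ultimately show ?thesis by (simp add: lvl_fold_def)
        next
          case False
          then have "y \<notin> lev H (Suc (c + i))" "2 * y \<notin> lev H (Suc (c + i))" "2 * y + 1 \<notin> lev H (Suc (c + i))"
            using pp by (auto simp: lev_def)
          then show ?thesis using F(4)[of y] False y by (simp add: lvl_fold_def)
        qed
        have old: "?F x = ?f x" if "2 ^ (H - c) \<le> x" for x
        proof -
          have "x \<notin> lev H (Suc (c + i))" using that pp mono by (auto simp: lev_def)
          then show ?thesis using F(3)[OF that] by (simp add: lvl_fold_def)
        qed
        have "h1\<lparr>hw := (hw h1)(12 := wv h1 (WB WMul (WC 2) (WR 12)))\<rparr> =
            h\<lparr>hw := (hw h)(12 := 2 ^ (c + Suc i)), ra := (ra h)(A := ?F)\<rparr>"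
          using h1 F(1) by simp
        then show "Inv (Suc i) (h1\<lparr>hw := (hw h1)(12 := wv h1 (WB WMul (WC 2) (WR 12)))\<rparr>)"
          unfolding Inv_def using sparse_lvl_fold[OF F(2) ci] new old by auto
      qed (use w12 b X Bbig in auto)
    qed
    then show "hw h' 12 < hw h' 6 \<and> hx B Z X (Seq (levelc A 12 1) (wset 12 (WB WMul (WC 2) (WR 12)))) h' 210 (Inv (Suc i))"
      using lt by (auto elim: hx_mono)
  next
    fix h' assume "Inv (H - c) h'"
    then show "\<not> hw h' 12 < hw h' 6" using st c by (auto simp: Inv_def)
  next
    show "Inv 0 h" unfolding Inv_def using v sp
      by (intro exI[of _ ?f]) (auto simp: fun_upd_idem)
  qed (use X in auto)
  then show ?thesis
  proof (rule hx_mono)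
    show "1 + (H - c) * (210 + 1) \<le> 1 + H * 300" by (simp add: mult_le_mono)
    fix h' assume "Inv (H - c) h'"
    then obtain F where F: "h' = h\<lparr>hw := (hw h)(12 := 2 ^ H), ra := (ra h)(A := F)\<rparr>" "sparse F"
      "\<forall>x. 2 ^ (H - c) \<le> x \<longrightarrow> F x = ?f x"
      "\<forall>y. 1 \<le> y \<longrightarrow> y < 2 ^ (H - c) \<longrightarrow> F y = F (2 * y) + F (2 * y + 1)"
      unfolding Inv_def using c by auto
    then show "Q h'" using Q[of F] unfolding summed_def by simp
  qed
qed

text \<open>Applied at level L it yields row sums, applied at the root the total over all
  rows.\<close>

lemma summed_block:
  assumes "summed c f F" "y \<in> lev H d" "c \<le> d" "d \<le> H"
  shows "F y = (\<Sum>j<2 ^ (d - c). f (y * 2 ^ (d - c) + j))"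
proof -
  have ylow: "2 ^ (H - d) \<le> y" and yup: "y + 1 \<le> 2 * 2 ^ (H - d)" using assms(2) by (auto simp: lev_def)
  have e: "2 ^ (H - d) * 2 ^ (d - c) = (2::nat) ^ (H - c)" using assms by (simp flip: power_add)
  have "F y = (\<Sum>j<2 ^ (d - c). F (y * 2 ^ (d - c) + j))"
  proof (rule sum_block)
    fix t z assume t: "t < d - c" "y * 2 ^ t \<le> z" "z < (y + 1) * 2 ^ t"
    have "1 * 1 \<le> y * 2 ^ t" using ylow by (intro mult_le_mono) (auto intro: order_trans[rotated])
    then have "1 \<le> z" using t by linarith
    moreover have "z < 2 ^ (H - c)"
    proof -
      have "(y + 1) * 2 ^ t \<le> 2 * 2 ^ (H - d) * 2 ^ t" using yup by (rule mult_le_mono1)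
      also have "\<dots> = 2 ^ (H - d) * 2 ^ Suc t" by simp
      also have "\<dots> \<le> 2 ^ (H - d) * 2 ^ (d - c)" using t(1) by (intro mult_le_mono2 power_increasing) auto
      finally show ?thesis using t(3) e by linarith
    qed
    ultimately show "F z = F (2 * z) + F (2 * z + 1)" using assms(1) unfolding summed_def by blast
  qed
  also have "\<dots> = (\<Sum>j<2 ^ (d - c). f (y * 2 ^ (d - c) + j))"
  proof (rule sum.cong[OF refl])
    fix j
    have "2 ^ (H - c) \<le> y * 2 ^ (d - c) + j" using mult_le_mono1[OF ylow, of "2 ^ (d - c)"] e by linarith
    then show "F (y * 2 ^ (d - c) + j) = f (y * 2 ^ (d - c) + j)" using assms(1) unfolding summed_def by blast
  qed
  finally show ?thesis .
qed

end

section \<open>The program\<close>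

declare power_increasing_iff [simp del] power_strict_increasing_iff [simp del]

abbreviation wadd (infixl "[+]" 65) where "a [+] b \<equiv> WB WAdd a b"
abbreviation wsub (infixl "[-]" 65) where "a [-] b \<equiv> WB WSub a b"
abbreviation wmul (infixl "[*]" 70) where "a [*] b \<equiv> WB WMul a b"
abbreviation wdiv (infixl "[div]" 70) where "a [div] b \<equiv> WB WDiv a b"
abbreviation wmod (infixl "[mod]" 70) where "a [mod] b \<equiv> WB WMod a b"
abbreviation radd (infixl "{+}" 65) where "a {+} b \<equiv> RB RAdd a b"
abbreviation rsub (infixl "{-}" 65) where "a {-} b \<equiv> RB RSub a b"
abbreviation rmul (infixl "{*}" 70) where "a {*} b \<equiv> RB RMul a b"
abbreviation rdiv (infixl "{div}" 70) where "a {div} b \<equiv> RB RDiv a b"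

abbreviation "rc c \<equiv> RW (WC c)"
abbreviation "vn \<equiv> WR 1"
abbreviation "vm \<equiv> WR 2"
abbreviation "vk \<equiv> WR 3"
abbreviation "vN \<equiv> WR 4"
abbreviation "vP \<equiv> WR 5"
abbreviation "vPP \<equiv> WR 6"
abbreviation "vK \<equiv> WR 9"
abbreviation "vL5 \<equiv> WR 16"
abbreviation "v2m \<equiv> WR 18"
abbreviation "v2N \<equiv> WR 19"

text \<open>
  Registers: \<open>7\<close> the number of tree entries, \<open>8\<close> the number of rows of the extended matrix,
  \<open>10\<close> the index of parallel loops, \<open>11\<close> and \<open>12\<close> powers of two that denote the current level,
  \<open>13\<close> and \<open>14\<close> counter and bound of the main loop, \<open>15\<close> the logarithm of register \<open>5\<close>.
  Real arrays: \<open>0\<close> coefficients, \<open>1\<close> folded values, \<open>2\<close> sums of squares, \<open>3\<close> cross terms, \<open>4\<close> row weights,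
  \<open>5\<close> normalised row weights, \<open>6\<close> the fractional solution, \<open>7\<close> its next change, \<open>8\<close> the scales of the rows.
  Word arrays: \<open>0\<close> leaves, \<open>1\<close> owners.
\<close>

lemma hx_wset_le:
  assumes "Q (h\<lparr>hw := (hw h)(x := wv h e)\<rparr>)" "wok B Z h e" "wv h e < B" "0 < x" "x < 20" "1 \<le> X" "wcost e + 2 \<le> D"
  shows "hx B Z X (wset x e) h D Q"
  using assms by (intro hx_mono[OF hx_wset]) auto

lemma hx_rset_le:
  assumes "Q (h\<lparr>hr := (hr h)(x := rv h e)\<rparr>)" "rok B Z h e" "0 < B" "x < 20" "1 \<le> X" "rcost e + 3 \<le> D"
  shows "hx B Z X (rset x e) h D Q"
  using assms by (intro hx_mono[OF hx_rset]) auto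

lemma hx_map:
  assumes x: "0 < x" "x < 20" "y < 20" and N: "hw h y = N" "N \<le> X" "1 \<le> X" and B: "1 < B" and a: "a < 16"
    and g: "\<And>i. i < N \<Longrightarrow> wv (ini h x i) ie = g i"
    and v: "\<And>i. i < N \<Longrightarrow> rv (ini h x i) ve = F (g i)"
    and ok: "\<And>i. i < N \<Longrightarrow> wok B Z (ini h x i) ie" "\<And>i. i < N \<Longrightarrow> rok B Z (ini h x i) ve"
      "\<And>i. i < N \<Longrightarrow> Z + 16 * g i + 16 < B"
    and inj: "\<And>i j. \<lbrakk>i < N; j < N; g i = g j\<rbrakk> \<Longrightarrow> i = j"
    and rd: "\<And>i j. \<lbrakk>i < N; j < N; g i \<noteq> g j\<rbrakk> \<Longrightarrow> RArr a (g i) \<notin> wrd (ini h x j) ie \<union> rrd (ini h x j) ve"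
    and rest: "\<And>l. (\<And>i. i < N \<Longrightarrow> g i \<noteq> l) \<Longrightarrow> F l = ra h a l"
    and Q: "Q (h\<lparr>ra := (ra h)(a := F)\<rparr>)" and D: "1 + gcost true (SRA a ie ve) \<le> D"
  shows "hx B Z X (ParFor x y (gbody true (SRA a ie ve))) h D Q"
proof (rule hx_mono[OF _ D])
  show "hx B Z X (ParFor x y (gbody true (SRA a ie ve))) h (1 + gcost true (SRA a ie ve)) Q"
  proof (rule hx_par_real[OF x N, where G = "\<lambda>_. True" and g = g and F = F])
    fix i j assume ij: "i < N" "j < N" "i \<noteq> j"
    then have "g i \<noteq> g j" using inj by blast
    then show "RArr a (g i) \<notin> wrd (ini h x j) ie \<union> rrd (ini h x j) ve" by (rule rd[OF ij(1,2)])
  qed (use B a g v ok inj rest Q in auto)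
qed

text \<open>Distinct children of one node are an odd number and its predecessor; this resolves
  conflicts in the election of owners.\<close>

lemma div2_siblings:
  fixes u v :: nat
  assumes "u div 2 = v div 2" "u \<noteq> v"
  shows "(u mod 2 = 1 \<and> u - u mod 2 = v) \<or> (v mod 2 = 1 \<and> v - v mod 2 = u)"
proof -
  have "u = 2 * (u div 2) + u mod 2" "v = 2 * (u div 2) + v mod 2"
    using assms(1) by (metis mult_div_mod_eq)+
  moreover have "u mod 2 < 2" "v mod 2 < 2" by simp_all
  ultimately show ?thesis using assms(2) by linarith
qed

definition leafexp :: wexp where
  "leafexp = WIf (TW idx vN) (vPP [+] WM (WC 4 [+] WC 2 [*] idx) [*] vP [+] (WM (WC 5 [+] WC 2 [*] idx) [+] WC 1))
    (WIf (TW idx v2N)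
      (vPP [+] (vm [+] WM (WC 4 [+] WC 2 [*] (idx [-] vN))) [*] vP [+] (WM (WC 5 [+] WC 2 [*] (idx [-] vN)) [+] WC 1))
      (WIf (TW idx (v2N [+] vn)) (vPP [+] (v2m [+] (idx [-] v2N)) [*] vP [+] (idx [-] v2N [+] WC 1))
        (vPP [+] (idx [-] (v2N [+] vn)) [*] vP)))"

definition c_leaf :: com where "c_leaf = ParFor 10 7 (gbody true (SWA 0 idx leafexp))"

definition c_own0 :: com where "c_own0 = ParFor 10 7 (gbody true (SWA 1 leafe (idx [+] WC 1)))"

definition node :: wexp where "node = leafe [div] WR 12"

text \<open>One inequality expresses two conditions: the entry owns its node, and the node is a left
  child or its left sibling has no owner. Multiplying by the parity turns the second condition off
  for left children.\<close>

definition own_test :: texp where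
  "own_test = TW (WA 1 node [-] (idx [+] WC 1) [+] (idx [+] WC 1 [-] WA 1 node) [+]
      (node [mod] WC 2) [*] WA 1 (node [-] (node [mod] WC 2))) (WC 1)"

definition c_ownlev :: com where
  "c_ownlev = ParFor 10 7 (gbody own_test (SWA 1 (node [div] WC 2) (idx [+] WC 1)))"

definition c_own :: com where
  "c_own = Seq c_own0 (Seq (wset 12 (WC 1)) (While (WLess 12 6) (Seq c_ownlev (wset 12 (WC 2 [*] WR 12)))))"

text \<open>\<open>Z\<close> exceeds the 4 + 2 N input words, the N + n + m input reals and the n +
  m output cells alike. Nodes are below 2 * 2^(2 L) and sixteen arrays are interleaved, so addresses
  stay below Z + 32 * 2^(2 L) plus a constant, well within \<open>B\<close>.\<close>

locale prog_data = rounding n m k L a p0 \<Delta> for n m k L a p0 \<Delta> +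
  fixes N E B Z X KN T :: nat and row col :: "nat \<Rightarrow> nat" and iw :: "nat \<Rightarrow> nat" and ir :: "nat \<Rightarrow> real"
  assumes rc: "\<And>e. e < N \<Longrightarrow> row e < m \<and> col e < n"
    and rc_inj: "\<And>e e'. \<lbrakk>e < N; e' < N; row e = row e'; col e = col e'\<rbrakk> \<Longrightarrow> e = e'"
    and cover: "\<And>i j. \<lbrakk>i < m; j < n; a i (j + 1) \<noteq> 0\<rbrakk> \<Longrightarrow> \<exists>e<N. row e = i \<and> col e = j"
    and iw: "\<And>e. e < N \<Longrightarrow> iw (4 + 2 * e) = row e \<and> iw (5 + 2 * e) = col e"
    and ir_a: "\<And>e. e < N \<Longrightarrow> ir e = a (row e) (col e + 1)"
    and ir_p: "\<And>j. j < n \<Longrightarrow> ir (N + j) = p0 (j + 1)"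
    and ir_D: "\<And>i. i < m \<Longrightarrow> ir (N + n + i) = \<Delta> i"
    and E_eq: "E = 2 * N + n + (2 * m + n)"
    and Z_eq: "Z = 4 + 2 * N + n + m"
    and BB: "Z + 64 * 2 ^ (2 * L) + 1000 \<le> B" "T + 1 < B" "2 * KN < B" "k < B"
    and XX: "E \<le> X"
    and KN_eq: "KN = 2 * (k + 4 * (L + 5))" and T_eq: "T = 128 * KN * KN * L"
begin

text \<open>
  Entry \<open>e\<close> of the extended matrix lies in row \<open>rw e\<close> and column \<open>cl e\<close>: first the nonzero entries of
  \<open>A\<close>, then those of its negation (in the rows from \<open>m\<close> on), then a diagonal that belongs to the variables, and
  finally a column \<open>0\<close> with a constant entry in every row. Hence variables are numbered from \<open>1\<close>.
\<close>

definition rw :: "nat \<Rightarrow> nat" where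
  "rw e = (if e < N then row e else if e < 2 * N then m + row (e - N)
     else if e < 2 * N + n then 2 * m + (e - 2 * N) else e - (2 * N + n))"

definition cl :: "nat \<Rightarrow> nat" where
  "cl e = (if e < N then col e + 1 else if e < 2 * N then col (e - N) + 1
     else if e < 2 * N + n then e - 2 * N + 1 else 0)"

text \<open>After the leading 1, the upper L bits are the row and the lower L bits the column; node
  2^L + r of level L is then the root of row r. The value 0 beyond \<open>E\<close> agrees with the
  initially empty array.\<close>

definition leaf :: "nat \<Rightarrow> nat" where
  "leaf e = (if e < E then 2 ^ (2 * L) + rw e * 2 ^ L + cl e else 0)"

lemma rc2: "\<lbrakk>N \<le> e; e < 2 * N\<rbrakk> \<Longrightarrow> row (e - N) < m \<and> col (e - N) < n"
  by (rule rc) simp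

lemma rw_less: "e < E \<Longrightarrow> rw e < 2 * m + n"
  using rc[of e] rc2[of e] by (auto simp: rw_def E_eq)

lemma cl_le: "e < E \<Longrightarrow> cl e \<le> n"
  using rc[of e] rc2[of e] by (auto simp: cl_def)

lemma PP: "2 ^ (2 * L) = 2 ^ L * (2 ^ L :: nat)"
  by (simp add: mult_2 power_add)

lemma row_room: "r < 2 * m + n \<Longrightarrow> r * 2 ^ L + 2 ^ L \<le> 2 ^ (2 * L)"
proof -
  assume "r < 2 * m + n"
  then have "(r + 1) * 2 ^ L \<le> 2 ^ L * 2 ^ L" using size by (intro mult_le_mono1) auto
  then show ?thesis by (simp add: PP)
qed

lemma P_le_PP: "2 ^ L \<le> (2::nat) ^ (2 * L)"
  by (rule power_increasing) auto

lemma leaf_lev: "e < E \<Longrightarrow> leaf e \<in> lev (2 * L) 0"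
  using row_room[OF rw_less] cl_le[of e] size by (fastforce simp: leaf_def lev_def)

lemma leaf_parts: "e < E \<Longrightarrow> leaf e div 2 ^ L = 2 ^ L + rw e \<and> leaf e mod 2 ^ L = cl e"
proof -
  assume e: "e < E"
  have c: "cl e < 2 ^ L" using cl_le[OF e] size by simp
  have "leaf e = cl e + (2 ^ L + rw e) * 2 ^ L" using e by (simp add: leaf_def PP distrib_right)
  then show ?thesis using c by simp
qed

lemma rw_cl_inj: "\<lbrakk>e < E; e' < E; rw e = rw e'; cl e = cl e'\<rbrakk> \<Longrightarrow> e = e'"
proof -
  assume h: "e < E" "e' < E" "rw e = rw e'" "cl e = cl e'"
  note r = rc[of e] rc[of e'] rc2[of e] rc2[of e']
  consider "e < N" | "N \<le> e" "e < 2 * N" | "2 * N \<le> e" "e < 2 * N + n" | "2 * N + n \<le> e" by linarith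
  then show ?thesis
  proof cases
    case 1
    then have "e' < N" using h r by (auto simp: rw_def cl_def split: if_splits)
    then show ?thesis using 1 h rc_inj[of e e'] by (auto simp: rw_def cl_def)
  next
    case 2
    then have "N \<le> e'" "e' < 2 * N" using h r by (auto simp: rw_def cl_def split: if_splits)
    moreover have "row (e - N) = row (e' - N)" "col (e - N) = col (e' - N)"
      using h(3,4) 2 calculation by (simp_all add: rw_def cl_def)
    moreover have "e - N < N" "e' - N < N" using 2 calculation by linarith+
    ultimately have "e - N = e' - N" by (intro rc_inj[of "e - N" "e' - N"])
    then show ?thesis using 2(1) \<open>N \<le> e'\<close> by linarith
  next
    case 3
    then have "2 * N \<le> e'" "e' < 2 * N + n" using h r by (auto simp: rw_def cl_def split: if_splits)
    then show ?thesis using 3 h by (auto simp: rw_def cl_def)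
  next
    case 4
    then have "2 * N + n \<le> e'" using h r by (auto simp: rw_def cl_def split: if_splits)
    then show ?thesis using 4 h by (auto simp: rw_def cl_def E_eq)
  qed
qed

lemma leaf_inj: "\<lbrakk>e < E; e' < E; leaf e = leaf e'\<rbrakk> \<Longrightarrow> e = e'"
  using leaf_parts[of e] leaf_parts[of e'] rw_cl_inj[of e e'] by auto

lemma N_le: "N \<le> n * m"
proof -
  have "inj_on (\<lambda>e. (row e, col e)) {..<N}" by (auto intro!: inj_onI rc_inj)
  moreover have "(\<lambda>e. (row e, col e)) ` {..<N} \<subseteq> {..<m} \<times> {..<n}" using rc by auto
  ultimately have "card {..<N} \<le> card ({..<m} \<times> {..<n})" by (intro card_inj_on_le) auto
  then show ?thesis by (simp add: mult.commute)
qed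

lemma E_le: "E \<le> 2 ^ (2 * L)"
proof -
  have "(2 * m + n + 2) * (2 * m + n + 2) \<le> 2 ^ L * 2 ^ L" using size by (intro mult_le_mono)
  moreover have "2 * (n * m) + n + (2 * m + n) \<le> (2 * m + n + 2) * (2 * m + n + 2)" by (simp add: algebra_simps)
  ultimately show ?thesis using N_le unfolding PP E_eq by linarith
qed

definition scal :: "hst \<Rightarrow> bool" where
  "scal h \<longleftrightarrow> hw h 0 = Z \<and> hw h 1 = n \<and> hw h 2 = m \<and> hw h 3 = k \<and> hw h 4 = N \<and> hw h 5 = 2 ^ L \<and>
     hw h 6 = 2 ^ (2 * L) \<and> hw h 7 = E \<and> hw h 8 = 2 * m + n \<and> hw h 9 = KN \<and> hw h 14 = T \<and> hw h 15 = L \<and>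
     hw h 16 = L + 5 \<and> hw h 18 = 2 * m \<and> hw h 19 = 2 * N \<and> hr h 1 = 1 \<and> wraw h = iw \<and> rraw h = ir"

lemma X1: "1 \<le> X" "E \<le> X" "2 * N \<le> X" "2 * m \<le> X" "2 * m + n \<le> X" "n \<le> X" "m \<le> X"
  using XX n1 by (auto simp: E_eq)

lemma hx_leaf:
  assumes h: "scal h" and z: "wa h 0 = (\<lambda>_. 0)" and Q: "Q (h\<lparr>wa := (wa h)(0 := leaf)\<rparr>)"
  shows "hx B Z X c_leaf h 1000 Q"
proof (rule hx_mono)
  note st = h[unfolded scal_def One_nat_def]
  show "hx B Z X c_leaf h (1 + gcost true (SWA 0 idx leafexp)) Q"
    unfolding c_leaf_def
  proof (rule hx_par_word[where N = E and G = "\<lambda>_. True" and g = "\<lambda>e. e" and F = leaf])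
    fix e assume e: "e < E"
    have io: "e < N \<Longrightarrow> iw (4 + 2 * e) = row e \<and> iw (5 + 2 * e) = col e"
      "N \<le> e \<Longrightarrow> e < 2 * N \<Longrightarrow> iw (4 + 2 * (e - N)) = row (e - N) \<and> iw (5 + 2 * (e - N)) = col (e - N)"
      using iw[of e] iw[of "e - N"] by auto
    have ef: "e < 2 ^ (2 * L)" using e E_le by simp
    show "wv (ini h 10 e) leafexp = leaf e"
      using st e io by (simp add: leafexp_def leaf_def rw_def cl_def)
    have room: "rw e * 2 ^ L + 2 ^ L \<le> 2 ^ (2 * L)" "cl e \<le> n" "rw e < 2 * m + n"
      using row_room rw_less[OF e] cl_le[OF e] by auto
    have NZ: "2 * N + n + m < Z" using Z_eq by simp
    have PPB: "Z + 64 * 2 ^ (2 * L) + 1000 \<le> B" "2 * m + n + 2 \<le> 2 ^ L" "2 ^ L \<le> (2::nat) ^ (2 * L)"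
      using BB size P_le_PP by auto
    consider "e < N" | "N \<le> e" "e < 2 * N" | "2 * N \<le> e" "e < 2 * N + n" | "2 * N + n \<le> e" by linarith
    then have "wok B Z (ini h 10 e) leafexp"
    proof cases
      case 1
      then have f: "iw (4 + 2 * e) = rw e" "iw (5 + 2 * e) = col e" "col e < n" "4 + 2 * e < Z" "5 + 2 * e < Z"
        using io(1) rc[of e] Z_eq by (auto simp: rw_def)
      show ?thesis using 1 f(3-5) room(1) PPB NZ ef by (simp add: leafexp_def st f(1,2))
    next
      case 2
      define d where "d = e - N"
      have f: "iw (4 + 2 * d) = row d" "iw (5 + 2 * d) = col d" "col d < n" "row d < m" "4 + 2 * d < Z" "5 + 2 * d < Z"
        "rw e = m + row d" "\<not> e < N" "d \<le> e" "e - N = d"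
        using 2 io(2) rc2[of e] Z_eq by (auto simp: rw_def d_def)
      have g: "(m + row d) * 2 ^ L + 2 ^ L \<le> 2 ^ (2 * L)" using room(1) f(7) by simp
      show ?thesis using f(3-6) f(8) 2(2) g PPB NZ ef f(9) by (simp add: leafexp_def st f(1,2,10))
    next
      case 3
      define d where "d = e - 2 * N"
      have f: "d < n" "rw e = 2 * m + d" "\<not> e < N" "\<not> e < 2 * N" "e - 2 * N = d" "d \<le> e"
        using 3 by (auto simp: rw_def d_def)
      have g: "(2 * m + d) * 2 ^ L + 2 ^ L \<le> 2 ^ (2 * L)" using room(1) f(2) by simp
      show ?thesis using 3(2) f(1,3,4,6) g PPB NZ ef by (simp add: leafexp_def st f(5))
    next
      case 4
      define d where "d = e - (2 * N + n)"
      have f: "rw e = d" "\<not> e < N" "\<not> e < 2 * N" "\<not> e < 2 * N + n" "e - (2 * N + n) = d" "d \<le> e"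
        using 4 by (auto simp: rw_def d_def)
      have g: "d * 2 ^ L + 2 ^ L \<le> 2 ^ (2 * L)" using room(1) f(1) by simp
      show ?thesis using f(2,3,4,6) g PPB NZ ef by (simp add: leafexp_def st f(5))
    qed
    then show "sok B Z (ini h 10 e) (SWA 0 idx leafexp)" using BB ef st by simp
  next
    fix i j :: nat assume "i \<noteq> j"
    then show "WArr 0 i \<notin> wrd (ini h 10 j) idx \<union> wrd (ini h 10 j) leafexp" by (simp add: leafexp_def)
  next
    fix e assume "\<And>i. \<lbrakk>i < E; True\<rbrakk> \<Longrightarrow> i \<noteq> e"
    then have "\<not> e < E" by blast
    then show "leaf e = wa h 0 e" using z by (simp add: leaf_def)
  qed (use st X1 BB Q in auto)
qed (simp_all add: gcost_def leafexp_def)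

section \<open>Election of owners\<close>

definition own0 :: "nat \<Rightarrow> nat" where
  "own0 x = (if x \<in> leaf ` {..<E} then Suc (inv_into {..<E} leaf x) else 0)"

lemma leaf_inj_on: "inj_on leaf {..<E}"
  using leaf_inj by (auto intro: inj_onI)

lemma own0_leaf: "e < E \<Longrightarrow> own0 (leaf e) = e + 1"
  using leaf_inj_on by (simp add: own0_def)

lemma own0_sound: "own0 x \<noteq> 0 \<Longrightarrow> own0 x \<le> E \<and> leaf (own0 x - 1) = x"
  by (auto simp: own0_def leaf_inj_on Suc_leI split: if_splits)

lemma hx_own0:
  assumes h: "scal h" "wa h 0 = leaf" and z: "wa h 1 = (\<lambda>_. 0)" and Q: "Q (h\<lparr>wa := (wa h)(1 := own0)\<rparr>)"
  shows "hx B Z X c_own0 h 1000 Q"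
proof (rule hx_mono)
  note st = h(1)[unfolded scal_def One_nat_def]
  show "hx B Z X c_own0 h (1 + gcost true (SWA 1 leafe (idx [+] WC 1))) Q"
    unfolding c_own0_def
  proof (rule hx_par_word[where N = E and G = "\<lambda>_. True" and g = leaf and F = own0])
    fix e assume e: "e < E"
    show "wv (ini h 10 e) leafe = leaf e" using h by simp
    show "wv (ini h 10 e) (idx [+] WC 1) = own0 (leaf e)" using own0_leaf[OF e] by simp
    have "leaf e < 2 * 2 ^ (2 * L)" using leaf_lev[OF e] lev_bound by blast
    then show "sok B Z (ini h 10 e) (SWA 1 leafe (idx [+] WC 1))" using BB h e E_le by simp
  next
    fix x assume "\<And>i. \<lbrakk>i < E; True\<rbrakk> \<Longrightarrow> leaf i \<noteq> x"
    then have "x \<notin> leaf ` {..<E}" by auto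
    then show "own0 x = wa h 1 x" using z by (simp add: own0_def)
  next
    fix e e' assume "e < E" "e' < E" "leaf e = leaf e'"
    then show "e = e'" by (rule leaf_inj)
  qed (use st X1 BB Q in auto)
qed (simp_all add: gcost_def)

text \<open>Owners of left children take precedence over those of right children. The last clause
  records that levels above \<open>c\<close> are still empty, which is what a parent without entries
  has to retain.\<close>

definition owned :: "nat \<Rightarrow> (nat \<Rightarrow> nat) \<Rightarrow> bool" where
  "owned c F \<longleftrightarrow> (\<forall>x\<in>lev (2 * L) 0. F x = own0 x) \<and>
     (\<forall>y. 2 ^ (2 * L - c) \<le> y \<longrightarrow> y < 2 ^ (2 * L) \<longrightarrow> F y = (if F (2 * y) \<noteq> 0 then F (2 * y) else F (2 * y + 1))) \<and>
     (\<forall>y<2 ^ (2 * L - c). F y = 0)"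

lemma owned_sound:
  assumes "owned c F" "d \<le> c" "c \<le> 2 * L" "x \<in> lev (2 * L) d" "F x \<noteq> 0"
  shows "F x \<le> E \<and> leaf (F x - 1) div 2 ^ d = x"
  using assms(2,4,5)
proof (induction d arbitrary: x)
  case 0
  then have "F x = own0 x" using assms(1) unfolding owned_def by blast
  then show ?case using 0 own0_sound[of x] by simp
next
  case (Suc d)
  have d: "d < 2 * L" using Suc assms(3) by simp
  have x: "2 * x \<in> lev (2 * L) d" "2 * x + 1 \<in> lev (2 * L) d" using Suc.prems lev_child[OF d] lev_child1[OF d] by auto
  have lo: "2 ^ (2 * L - c) \<le> x"
  proof -
    have "(2::nat) ^ (2 * L - c) \<le> 2 ^ (2 * L - Suc d)" using Suc.prems by (intro power_increasing) auto
    moreover have "2 ^ (2 * L - Suc d) \<le> x" using Suc.prems(2) by (simp add: lev_def)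
    ultimately show ?thesis by (rule order_trans)
  qed
  have hi: "x < 2 ^ (2 * L)" using lev_bound[OF x(1)] by simp
  have F: "F x = (if F (2 * x) \<noteq> 0 then F (2 * x) else F (2 * x + 1))"
    using assms(1) lo hi unfolding owned_def by blast
  show ?case
  proof (cases "F (2 * x) \<noteq> 0")
    case True
    then have "F (2 * x) \<le> E" "leaf (F (2 * x) - 1) div 2 ^ d = 2 * x" using Suc.IH[OF _ x(1)] Suc.prems by auto
    then show ?thesis using F True by (simp add: div_mult2_eq mult.commute[of 2 "2 ^ d"])
  next
    case False
    then have "F (2 * x + 1) \<noteq> 0" using F Suc.prems by simp
    then have "F (2 * x + 1) \<le> E" "leaf (F (2 * x + 1) - 1) div 2 ^ d = 2 * x + 1"
      using Suc.IH[OF _ x(2)] Suc.prems by auto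
    then show ?thesis using F False by (simp add: div_mult2_eq mult.commute[of 2 "2 ^ d"])
  qed
qed

text \<open>Two winners with a common parent would own siblings, but the owner of the right one only
  wins if the left one is unowned. A parent without a winner has two unowned children and correctly
  keeps 0.\<close>

lemma hx_ownlev:
  assumes h: "scal h" "wa h 0 = leaf" and c: "c < 2 * L" and v: "hw h 12 = 2 ^ c" and O: "owned c (wa h 1)"
    and Q: "\<And>F. owned (Suc c) F \<Longrightarrow> Q (h\<lparr>wa := (wa h)(1 := F)\<rparr>)"
  shows "hx B Z X c_ownlev h 1000 Q"
proof (rule hx_mono)
  note st = h(1)[unfolded scal_def One_nat_def]
  let ?O = "wa h 1"
  let ?H = "2 * L"
  define F where "F y = (if y \<in> lev ?H (Suc c) then (if ?O (2 * y) \<noteq> 0 then ?O (2 * y) else ?O (2 * y + 1)) else ?O y)" for y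
  have pp: "(2::nat) ^ (?H - c) = 2 * 2 ^ (?H - Suc c)" using c by (metis Suc_diff_Suc power_Suc)
  define x where "x e = leaf e div 2 ^ c" for e
  have xl: "x e \<in> lev ?H c" if "e < E" for e unfolding x_def using lev_div[OF leaf_lev[OF that]] c by simp
  have xb: "x e < 2 * 2 ^ ?H" if "e < E" for e using lev_bound[OF xl[OF that]] by simp
  have pw: "(2::nat) ^ c \<le> 2 ^ ?H" using c by (intro power_increasing) auto
  have ob: "?O y \<le> E" if "y \<in> lev ?H c" for y
    using owned_sound[OF O _ _ that] c by (cases "?O y = 0") auto
  have x2l: "x e - x e mod 2 \<in> lev ?H c" if "e < E" for e
  proof -
    have "x e - x e mod 2 = 2 * (x e div 2)" by (simp add: minus_mod_eq_mult_div)
    moreover have "2 ^ (?H - Suc c) \<le> x e div 2" "x e div 2 < 2 * 2 ^ (?H - Suc c)" using xl[OF that] pp by (auto simp: lev_def)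
    ultimately show ?thesis using pp by (auto simp: lev_def)
  qed
  have nv: "wv (ini h 10 e) node = x e" if "e < E" for e using h v by (simp add: node_def x_def)
  have lf: "leaf e < 2 * 2 ^ ?H" if "e < E" for e using leaf_lev[OF that] lev_bound by blast
  have nok: "wok B Z (ini h 10 e) node" if "e < E" for e
    using h v that lf[OF that] xb[OF that] pw BB E_le by (simp add: node_def x_def)
  define G where "G e \<longleftrightarrow> ?O (x e) = e + 1 \<and> (x e mod 2 = 0 \<or> ?O (x e - x e mod 2) = 0)" for e
  have x2: "x e div 2 \<in> lev ?H (Suc c)" if "e < E" for e
    using xl[OF that] pp by (auto simp: lev_def)
  show "hx B Z X c_ownlev h (1 + gcost own_test (SWA 1 (node [div] WC 2) (idx [+] WC 1))) Q"
    unfolding c_ownlev_def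
  proof (rule hx_par_word[where N = E and G = G and g = "\<lambda>e. x e div 2" and F = F])
    fix e assume e: "e < E"
    show "tv (ini h 10 e) own_test = G e"
      using nv[OF e] by (auto simp: own_test_def G_def)
    define u where "u = x e mod 2"
    define y where "y = x e - u"
    have o1: "?O (x e) \<le> E" and o2: "?O y \<le> E" using ob xl[OF e] x2l[OF e] by (auto simp: y_def u_def)
    have "u * ?O y \<le> 1 * ?O y" by (intro mult_le_mono1) (auto simp: u_def)
    then have o3: "u * ?O y \<le> E" using o2 by linarith
    have o4: "y \<le> x e" "u < 2" by (simp_all add: y_def u_def)
    have o5: "?O (x e) - Suc e \<le> E" "Suc e - ?O (x e) \<le> E" "?O (x e) - Suc e + (Suc e - ?O (x e)) \<le> E"
      using o1 e by linarith+
    show "tok B Z (ini h 10 e) own_test"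
      using nok[OF e] xb[OF e] e BB(1) E_le o1 o3 o4 o5
      by (simp add: own_test_def nv[OF e] u_def[symmetric] y_def[symmetric])
    show "wv (ini h 10 e) (node [div] WC 2) = x e div 2" using nv[OF e] by simp
    show "sok B Z (ini h 10 e) (SWA 1 (node [div] WC 2) (idx [+] WC 1))"
      using nok[OF e] xb[OF e] e BB(1) E_le lev_bound[OF x2[OF e]] by (simp add: nv[OF e])
    { assume G: "G e"
      show "wv (ini h 10 e) (idx [+] WC 1) = F (x e div 2)"
      proof (cases "x e mod 2 = 0")
        case True
        then have "2 * (x e div 2) = x e" by auto
        then show ?thesis using G x2[OF e] by (simp add: F_def G_def)
      next
        case False
        then have "x e - x e mod 2 = 2 * (x e div 2)" "2 * (x e div 2) + 1 = x e" by presburger+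
        then show ?thesis using G False x2[OF e] by (simp add: F_def G_def)
      qed
    }
    { fix e' assume e': "e' < E"
      have d: "x e div 2 \<noteq> x e'" "x e div 2 \<noteq> x e' - x e' mod 2"
        using x2[OF e] xl[OF e'] x2l[OF e'] pp by (auto simp: lev_def)
      have nrd: "WArr 1 (x e div 2) \<notin> wrd (ini h 10 e') node" by (simp add: node_def)
      show "WArr 1 (x e div 2) \<notin> trd (ini h 10 e') own_test"
        using d nrd nv[OF e'] by (simp add: own_test_def)
      show "WArr 1 (x e div 2) \<notin> wrd (ini h 10 e') (node [div] WC 2) \<union> wrd (ini h 10 e') (idx [+] WC 1)"
        using nrd by simp }
  next
    fix e e' assume e: "e < E" "e' < E" "G e" "G e'" "x e div 2 = x e' div 2"
    show "e = e'"
    proof (cases "x e = x e'")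
      case True
      then show ?thesis using e by (simp add: G_def)
    next
      case False
      then have "(x e mod 2 = 1 \<and> x e - x e mod 2 = x e') \<or> (x e' mod 2 = 1 \<and> x e' - x e' mod 2 = x e)"
        using div2_siblings[OF e(5)] by blast
      then show ?thesis
      proof (elim disjE conjE)
        assume o: "x e mod 2 = 1" "x e - x e mod 2 = x e'"
        have "?O (x e') = 0" using e(3) o(1) unfolding G_def o(2) by simp
        then show ?thesis using e(4) unfolding G_def by linarith
      next
        assume o: "x e' mod 2 = 1" "x e' - x e' mod 2 = x e"
        have "?O (x e) = 0" using e(4) o(1) unfolding G_def o(2) by simp
        then show ?thesis using e(3) unfolding G_def by linarith
      qed
    qed
  next
    fix y assume y: "\<And>e. \<lbrakk>e < E; G e\<rbrakk> \<Longrightarrow> x e div 2 \<noteq> y"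
    show "F y = ?O y"
    proof (cases "y \<in> lev ?H (Suc c)")
      case True
      have yl: "2 * y \<in> lev ?H c" "2 * y + 1 \<in> lev ?H c" using True lev_child[OF c] lev_child1[OF c] by auto
      have z: "?O y = 0" using O True pp unfolding owned_def by (auto simp: lev_def)
      have a1: "?O (2 * y) = 0"
      proof (rule ccontr)
        assume nz: "?O (2 * y) \<noteq> 0"
        let ?e = "?O (2 * y) - 1"
        have s: "?O (2 * y) \<le> E" "x ?e = 2 * y" using owned_sound[OF O _ _ yl(1) nz] c by (auto simp: x_def)
        have "?e < E" using s nz by linarith
        moreover have "G ?e" using s nz by (simp add: G_def)
        ultimately show False using y[of ?e] s by simp
      qed
      have a2: "?O (2 * y + 1) = 0"
      proof (rule ccontr)
        assume nz: "?O (2 * y + 1) \<noteq> 0"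
        let ?e = "?O (2 * y + 1) - 1"
        have s: "?O (2 * y + 1) \<le> E" "x ?e = 2 * y + 1" using owned_sound[OF O _ _ yl(2) nz] c by (auto simp: x_def)
        have "?e < E" using s nz by linarith
        moreover have "G ?e" using s nz a1 by (simp add: G_def)
        ultimately show False using y[of ?e] s by simp
      qed
      show ?thesis using a1 a2 z True by (simp add: F_def)
    qed (simp add: F_def)
  next
    show "Q (h\<lparr>wa := (wa h)(1 := F)\<rparr>)"
    proof (rule Q)
      have up: "(2::nat) ^ (?H - c) \<le> 2 ^ ?H" by (intro power_increasing) auto
      show "owned (Suc c) F" unfolding owned_def
      proof (intro conjI ballI allI impI)
        fix x assume "x \<in> lev ?H 0"
        moreover from this have "x \<notin> lev ?H (Suc c)" using up pp by (auto simp: lev_def)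
        ultimately show "F x = own0 x" using O unfolding owned_def F_def by auto
      next
        fix y :: nat assume y: "2 ^ (?H - Suc c) \<le> y" "y < 2 ^ ?H"
        have nl: "2 * y \<notin> lev ?H (Suc c)" "2 * y + 1 \<notin> lev ?H (Suc c)" using y by (auto simp: lev_def)
        show "F y = (if F (2 * y) \<noteq> 0 then F (2 * y) else F (2 * y + 1))"
        proof (cases "y \<in> lev ?H (Suc c)")
          case True
          then show ?thesis using nl by (simp add: F_def)
        next
          case False
          then have "2 ^ (?H - c) \<le> y" using y pp by (auto simp: lev_def)
          then show ?thesis using O y nl False unfolding owned_def by (simp add: F_def)
        qed
      next
        fix y :: nat assume y: "y < 2 ^ (?H - Suc c)"
        then have "y \<notin> lev ?H (Suc c)" "y < 2 ^ (?H - c)" using pp by (auto simp: lev_def)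
        then show "F y = 0" using O unfolding owned_def by (simp add: F_def)
      qed
    qed
  qed (use st X1 in auto)
qed (simp_all add: gcost_def own_test_def node_def)

lemma tree_of_owned:
  assumes "owned (2 * L) F"
  shows "tree B Z X (2 * L) E leaf F"
proof
  show "1 \<le> X" "E \<le> X" using X1 by auto
  show "leaf e \<in> lev (2 * L) 0" if "e < E" for e using leaf_lev[OF that] .
  show "F x \<le> E \<and> leaf (F x - 1) div 2 ^ c = x" if "c \<le> 2 * L" "x \<in> lev (2 * L) c" "F x \<noteq> 0" for c x
    using owned_sound[OF assms] that by blast
  show "F (2 * y) = 0 \<and> F (2 * y + 1) = 0" if "1 \<le> y" "y < 2 ^ (2 * L)" "F y = 0" for y
    using assms that unfolding owned_def by (auto split: if_splits)
  show "Z + 64 * 2 ^ (2 * L) + 1000 \<le> B" "E \<le> 2 ^ (2 * L)" using BB E_le by auto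
qed

lemma hx_own:
  assumes h: "scal h" "wa h 0 = leaf" and z: "wa h 1 = (\<lambda>_. 0)"
    and Q: "\<And>F. \<lbrakk>owned (2 * L) F\<rbrakk> \<Longrightarrow> Q (h\<lparr>hw := (hw h)(12 := 2 ^ (2 * L)), wa := (wa h)(1 := F)\<rparr>)"
  shows "hx B Z X c_own h (2000 + 2 * L * 2000) Q"
proof -
  note st = h(1)[unfolded scal_def One_nat_def]
  define Inv where "Inv i h' \<longleftrightarrow> (\<exists>F. h' = h\<lparr>hw := (hw h)(12 := 2 ^ i), wa := (wa h)(1 := F)\<rparr> \<and> owned i F)" for i h'
  have "hx B Z X c_own h (1000 + (3 + (1 + 2 * L * (1010 + 1)))) Q"
    unfolding c_own_def
  proof (rule hx_Seq[OF hx_own0[OF h z, where Q = "\<lambda>h'. h' = h\<lparr>wa := (wa h)(1 := own0)\<rparr>"]])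
    fix h1 assume h1: "h1 = h\<lparr>wa := (wa h)(1 := own0)\<rparr>"
    show "hx B Z X (Seq (wset 12 (WC 1)) (While (WLess 12 6) (Seq c_ownlev (wset 12 (WC 2 [*] WR 12))))) h1
      (3 + (1 + 2 * L * (1010 + 1))) Q"
    proof (rule hx_Seq[where ?Q1.0 = "Inv 0"])
      have "owned 0 own0"
      proof -
        have "own0 y = 0" if "y < 2 ^ (2 * L)" for y
        proof (rule ccontr)
          assume nz: "own0 y \<noteq> 0"
          then have "own0 y - 1 < E" "leaf (own0 y - 1) = y" using own0_sound[OF nz] by auto
          then show False using leaf_lev[of "own0 y - 1"] that by (simp add: lev_def)
        qed
        then show ?thesis unfolding owned_def by simp
      qed
      then have "Inv 0 (h1\<lparr>hw := (hw h1)(12 := wv h1 (WC 1))\<rparr>)" unfolding Inv_def using h1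
        by (intro exI[of _ own0]) simp
      then show "hx B Z X (wset 12 (WC 1)) h1 3 (Inv 0)"
        using BB X1 by (intro hx_wset_le) simp_all
    next
      fix h2 assume "Inv 0 h2"
      then have "hx B Z X (While (WLess 12 6) (Seq c_ownlev (wset 12 (WC 2 [*] WR 12)))) h2
         (1 + 2 * L * (1010 + 1)) (Inv (2 * L))"
      proof (rule hx_While[rotated -1])
        fix i h' assume i: "i < 2 * L" and I: "Inv i h'"
        obtain F where F: "h' = h\<lparr>hw := (hw h)(12 := 2 ^ i), wa := (wa h)(1 := F)\<rparr>" "owned i F"
          using I unfolding Inv_def by blast
        have lt: "hw h' 12 < hw h' 6" using F st i by (simp add: power_strict_increasing_iff)
        have s': "scal h'" using h(1) F by (simp add: scal_def)
        let ?Q1 = "\<lambda>h1. \<exists>F'. owned (Suc i) F' \<and> h1 = h'\<lparr>wa := (wa h')(1 := F')\<rparr>"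
        have "hx B Z X c_ownlev h' 1000 ?Q1"
          by (rule hx_ownlev[OF s' _ i]) (use F h in auto)
        then have "hx B Z X (Seq c_ownlev (wset 12 (WC 2 [*] WR 12))) h' (1000 + (wcost (WC 2 [*] WR 12) + 2)) (Inv (Suc i))"
        proof (rule hx_Seq)
          fix h1 assume "?Q1 h1"
          then obtain F' where F': "owned (Suc i) F'" "h1 = h'\<lparr>wa := (wa h')(1 := F')\<rparr>" by blast
          have "2 * (2::nat) ^ i \<le> 2 ^ (2 * L)" using i by (metis Suc_leI one_le_numeral power_Suc power_increasing)
          then have b: "2 * (2::nat) ^ i < B" "(2::nat) ^ i < B" "2 < B" using BB by linarith+
          show "hx B Z X (wset 12 (WC 2 [*] WR 12)) h1 (wcost (WC 2 [*] WR 12) + 2) (Inv (Suc i))"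
          proof (rule hx_wset)
            show "Inv (Suc i) (h1\<lparr>hw := (hw h1)(12 := wv h1 (WC 2 [*] WR 12))\<rparr>)"
              unfolding Inv_def using F' F by (intro exI[of _ F']) simp
          qed (use F F' b X1 in auto)
        qed
        then show "hw h' 12 < hw h' 6 \<and> hx B Z X (Seq c_ownlev (wset 12 (WC 2 [*] WR 12))) h' 1010 (Inv (Suc i))"
          using lt by (auto elim: hx_mono)
      next
        fix h' assume "Inv (2 * L) h'"
        then show "\<not> hw h' 12 < hw h' 6" using st by (auto simp: Inv_def)
      qed (use X1 in auto)
      then show "hx B Z X (While (WLess 12 6) (Seq c_ownlev (wset 12 (WC 2 [*] WR 12)))) h2
         (1 + 2 * L * (1010 + 1)) Q"
        by (rule hx_mono) (use Q in \<open>auto simp: Inv_def\<close>)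
    qed
  qed simp
  then show ?thesis by (rule hx_mono) auto
qed

end

section \<open>Setup: fractional solution, scales, coefficients and initial weights\<close>

abbreviation "rowx \<equiv> vP [+] idx"
text \<open>Entries e and N + e are the two signed copies of one input entry, hence the
  remainder.\<close>

abbreviation "aexp \<equiv> RM (idx [mod] vN)"
abbreviation "Dexp \<equiv> RM (vN [+] vn [+] (idx [mod] vm))"
abbreviation "halfexp \<equiv> rc 1 {div} rc 2"

definition c_p :: com where
  "c_p = ParFor 10 1 (gbody true (SRA 6 (idx [+] WC 1) (RM (vN [+] idx))))"

definition c_a2 :: com where
  "c_a2 = ParFor 10 19 (gbody true (SRA 2 leafe (aexp {*} aexp)))"

definition c_pa :: com where
  "c_pa = ParFor 10 19 (gbody true (SRA 3 leafe (RA 6 (leafe [mod] vP) {*} aexp)))"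

definition l0exp :: rexp where "l0exp = RW (WC 4 [*] vL5) {div} Dexp"

definition l1exp :: rexp where
  "l1exp = RIf (TR Dexp (rc 128 {*} l0exp {*} RA 2 rowx)) (Dexp {div} (rc 128 {*} RA 2 rowx)) l0exp"

definition lexp :: rexp where
  "lexp = RIf (TR (RW vk) (l1exp {*} RA 3 rowx)) (RW vk {div} RA 3 rowx) l1exp"

definition c_lam :: com where
  "c_lam = ParFor 10 18 (gbody true (SRA 8 rowx lexp))"

definition coefexp :: rexp where
  "coefexp = RIf (TR (rc 1 {div} rc 16) (RA 8 (leafe [div] vP) {*} aexp)) (rc 0)
     (RIf (TW idx vN) (RA 8 (leafe [div] vP) {*} aexp) (rc 0 {-} RA 8 (leafe [div] vP) {*} aexp))"

definition c_coef :: com where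
  "c_coef = ParFor 10 19 (gbody true (SRA 0 leafe coefexp))"

definition c_W0 :: com where
  "c_W0 = ParFor 10 8 (gbody true (SRA 4 rowx (RIf (TW idx v2m) (rc 1) (rc 1 {div} RW (WC 2 [*] vP)))))"

definition c_halve :: com where
  "c_halve = ParFor 10 18 (gbody true (SRA 4 rowx
     (RIf (TR (RA 8 rowx {*} Dexp) (RW (WC 4 [*] WR 17))) (RA 4 rowx) (RA 4 rowx {div} rc 2))))"

text \<open>The counter is incremented before the halving pass, so the passes see d = 1, ..., L +
  5.\<close>

definition c_weights :: com where
  "c_weights = Seq c_W0 (Seq (wset 17 (WC 0)) (While (WLess 17 16) (Seq (wset 17 (WR 17 [+] WC 1)) c_halve)))"

definition c_sums :: com where
  "c_sums = Seq c_a2 (Seq (wset 12 (WC 1)) (Seq (sumup 2) (Seq c_pa (Seq (wset 12 (WC 1)) (sumup 3)))))"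

definition c_setup :: com where
  "c_setup = Seq c_p (Seq c_sums (Seq c_lam (Seq c_coef c_weights)))"

locale prog_own = prog_data n m k L a p0 \<Delta> N E B Z X KN T row col iw ir
  for n m k L a p0 \<Delta> N E B Z X KN T row col iw ir +
  fixes own :: "nat \<Rightarrow> nat"
  assumes own: "owned (2 * L) own"

sublocale prog_own \<subseteq> tree B Z X "2 * L" E leaf own
  by (rule tree_of_owned[OF own])

context prog_own
begin

definition stat :: "hst \<Rightarrow> bool" where
  "stat h \<longleftrightarrow> scal h \<and> wa h 0 = leaf \<and> wa h 1 = own"

lemma stat_treest: "stat h \<Longrightarrow> treest h"
  by (simp add: stat_def scal_def treest_def)

lemma own_leaf: "e < E \<Longrightarrow> own (leaf e) = e + 1"
  using own leaf_lev[of e] own0_leaf[of e] unfolding owned_def by auto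

lemma own_none: "\<lbrakk>x \<in> lev (2 * L) 0; x \<notin> leaf ` {..<E}\<rbrakk> \<Longrightarrow> own x = 0"
  using own unfolding owned_def own0_def by auto

definition upd_leaf :: "nat \<Rightarrow> (nat \<Rightarrow> real) \<Rightarrow> (nat \<Rightarrow> nat \<Rightarrow> real) \<Rightarrow> nat \<Rightarrow> real" where
  "upd_leaf M f V x = (if x \<in> leaf ` {..<M} then V (x div 2 ^ L - 2 ^ L) (x mod 2 ^ L) else f x)"

definition upd_rows :: "nat \<Rightarrow> (nat \<Rightarrow> real) \<Rightarrow> (nat \<Rightarrow> real) \<Rightarrow> nat \<Rightarrow> real" where
  "upd_rows M f V x = (if 2 ^ L \<le> x \<and> x < 2 ^ L + M then V (x - 2 ^ L) else f x)"

definition upd_cols :: "(nat \<Rightarrow> real) \<Rightarrow> (nat \<Rightarrow> real) \<Rightarrow> nat \<Rightarrow> real" where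
  "upd_cols f V j = (if 1 \<le> j \<and> j \<le> n then V j else f j)"

lemma upd_leaf_at: "\<lbrakk>e < M; M \<le> E\<rbrakk> \<Longrightarrow> upd_leaf M f V (leaf e) = V (rw e) (cl e)"
  using leaf_parts[of e] by (auto simp: upd_leaf_def)

lemma sparse_upd_leaf: "\<lbrakk>sparse f; M \<le> E\<rbrakk> \<Longrightarrow> sparse (upd_leaf M f V)"
  unfolding sparse_def upd_leaf_def by (auto simp: own_leaf)

lemma sparse_zero: "sparse (\<lambda>_. 0)"
  by (simp add: sparse_def)

lemma lt_B: "Z + 16 * (2 * 2 ^ (2 * L)) + 16 < B" "1 < B" "2 * 2 ^ (2 * L) < B" "128 < B"
  using BB by auto

lemma L5_lt: "4 * L + 20 < B"
  using BB(3) unfolding KN_eq by simp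

lemma leaf_lt: "e < E \<Longrightarrow> leaf e < 2 * 2 ^ (2 * L)"
  using lev_bound[OF leaf_lev] by simp

lemma hx_cols:
  assumes h: "stat h" and A: "A < 16"
    and v: "\<And>j. j < n \<Longrightarrow> rv (ini h 10 j) ve = V (j + 1)"
    and ok: "\<And>j. j < n \<Longrightarrow> rok B Z (ini h 10 j) ve"
    and rd: "\<And>i j. \<lbrakk>i < n; j < n; i \<noteq> j\<rbrakk> \<Longrightarrow> RArr A (i + 1) \<notin> rrd (ini h 10 j) ve"
    and Q: "Q (h\<lparr>ra := (ra h)(A := upd_cols (ra h A) V)\<rparr>)"
    and D: "1 + gcost true (SRA A (idx [+] WC 1) ve) \<le> D"
  shows "hx B Z X (ParFor 10 1 (gbody true (SRA A (idx [+] WC 1) ve))) h D Q"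
proof (rule hx_map[where N = n and g = "\<lambda>j. j + 1" and F = "upd_cols (ra h A) V"])
  have st: "scal h" using h by (simp add: stat_def)
  note st = st[unfolded scal_def One_nat_def]
  have nB: "n + 1 < 2 * 2 ^ (2 * L)" using size P_le_PP by linarith
  fix j assume j: "j < n"
  show "rv (ini h 10 j) ve = upd_cols (ra h A) V (j + 1)" using v[OF j] j by (simp add: upd_cols_def)
  show "wok B Z (ini h 10 j) (idx [+] WC 1)" "Z + 16 * (j + 1) + 16 < B" using j nB lt_B by simp_all
next
  have st: "scal h" using h by (simp add: stat_def)
  then show "hw h 1 = n" by (simp add: scal_def)
next
  fix l assume l: "\<And>j. j < n \<Longrightarrow> j + 1 \<noteq> l"
  have "\<not> (1 \<le> l \<and> l \<le> n)"
  proof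
    assume "1 \<le> l \<and> l \<le> n"
    then have "l - 1 < n" "l - 1 + 1 = l" by auto
    then show False using l[of "l - 1"] by simp
  qed
  then show "upd_cols (ra h A) V l = ra h A l" by (auto simp: upd_cols_def)
next
  fix i j assume "i < n" "j < n" "i + 1 \<noteq> j + 1"
  then show "RArr A (i + 1) \<notin> wrd (ini h 10 j) (idx [+] WC 1) \<union> rrd (ini h 10 j) ve" using rd[of i j] by simp
qed (use X1 lt_B A ok Q D in auto)

lemma hx_rows:
  assumes h: "stat h" and A: "A < 16" and y: "hw h y = M" "y < 20" "M \<le> 2 * m + n"
    and v: "\<And>r. r < M \<Longrightarrow> rv (ini h 10 r) ve = V r"
    and ok: "\<And>r. r < M \<Longrightarrow> rok B Z (ini h 10 r) ve"
    and rd: "\<And>i j. \<lbrakk>i < M; j < M; i \<noteq> j\<rbrakk> \<Longrightarrow> RArr A (2 ^ L + i) \<notin> rrd (ini h 10 j) ve"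
    and Q: "Q (h\<lparr>ra := (ra h)(A := upd_rows M (ra h A) V)\<rparr>)"
    and D: "1 + gcost true (SRA A rowx ve) \<le> D"
  shows "hx B Z X (ParFor 10 y (gbody true (SRA A rowx ve))) h D Q"
proof (rule hx_map[where N = M and g = "\<lambda>r. 2 ^ L + r" and F = "upd_rows M (ra h A) V"])
  have st: "scal h" using h by (simp add: stat_def)
  note st = st[unfolded scal_def One_nat_def]
  fix r assume r: "r < M"
  have b: "2 ^ L + r < 2 * 2 ^ (2 * L)" "r < 2 * 2 ^ (2 * L)" "2 ^ L < B"
    using r y(3) size P_le_PP lt_B by linarith+
  show "wv (ini h 10 r) rowx = 2 ^ L + r" by (simp add: st)
  show "rv (ini h 10 r) ve = upd_rows M (ra h A) V (2 ^ L + r)" using v[OF r] r by (simp add: upd_rows_def)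
  show "wok B Z (ini h 10 r) rowx" "Z + 16 * (2 ^ L + r) + 16 < B" using r b lt_B by (simp_all add: st)
next
  fix l assume l: "\<And>r. r < M \<Longrightarrow> 2 ^ L + r \<noteq> l"
  have "\<not> (2 ^ L \<le> l \<and> l < 2 ^ L + M)"
  proof
    assume "2 ^ L \<le> l \<and> l < 2 ^ L + M"
    then have "l - 2 ^ L < M" "2 ^ L + (l - 2 ^ L) = l" by auto
    then show False using l[of "l - 2 ^ L"] by simp
  qed
  then show "upd_rows M (ra h A) V l = ra h A l" by (auto simp: upd_rows_def)
next
  fix i j assume "i < M" "j < M" "2 ^ L + i \<noteq> 2 ^ L + j"
  then show "RArr A (2 ^ L + i) \<notin> wrd (ini h 10 j) rowx \<union> rrd (ini h 10 j) ve" using rd[of i j] by simp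
qed (use X1 lt_B A y ok Q D in auto)

lemma hx_leaves:
  assumes h: "stat h" and A: "A < 16" and y: "hw h y = M" "y < 20" "M \<le> E"
    and v: "\<And>e. e < M \<Longrightarrow> rv (ini h 10 e) ve = V (rw e) (cl e)"
    and ok: "\<And>e. e < M \<Longrightarrow> rok B Z (ini h 10 e) ve"
    and rd: "\<And>i j. \<lbrakk>i < M; j < M; leaf i \<noteq> leaf j\<rbrakk> \<Longrightarrow> RArr A (leaf i) \<notin> rrd (ini h 10 j) ve"
    and Q: "Q (h\<lparr>ra := (ra h)(A := upd_leaf M (ra h A) V)\<rparr>)"
    and D: "1 + gcost true (SRA A leafe ve) \<le> D"
  shows "hx B Z X (ParFor 10 y (gbody true (SRA A leafe ve))) h D Q"
proof (rule hx_map[where N = M and g = leaf and F = "upd_leaf M (ra h A) V"])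
  have st: "scal h" "wa h 0 = leaf" using h by (simp_all add: stat_def)
  fix e assume e: "e < M"
  have b: "leaf e < 2 * 2 ^ (2 * L)" "e < 2 ^ (2 * L)" using leaf_lt[of e] e y(3) E_le by auto
  show "wv (ini h 10 e) leafe = leaf e" by (simp add: st)
  show "rv (ini h 10 e) ve = upd_leaf M (ra h A) V (leaf e)" using v[OF e] e y upd_leaf_at by simp
  show "wok B Z (ini h 10 e) leafe" "Z + 16 * leaf e + 16 < B" using b lt_B by simp_all
next
  fix l assume "\<And>e. e < M \<Longrightarrow> leaf e \<noteq> l"
  then show "upd_leaf M (ra h A) V l = ra h A l" by (auto simp: upd_leaf_def)
next
  fix i j assume "i < M" "j < M" "leaf i = leaf j"
  then show "i = j" using leaf_inj[of i j] y by simp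
next
  fix i j assume "i < M" "j < M" "leaf i \<noteq> leaf j"
  then show "RArr A (leaf i) \<notin> wrd (ini h 10 j) leafe \<union> rrd (ini h 10 j) ve" using rd[of i j] by simp
qed (use X1 lt_B A y ok Q D in auto)

lemma leaf_block_index: "(2 ^ L + r) * 2 ^ L + j = 2 ^ (2 * L) + r * 2 ^ L + (j :: nat)"
  by (simp add: PP distrib_right)

text \<open>Completeness of the entry list: every position of the extended matrix that can be
  nonzero is occupied. The last conjunct locates the nonconstant entries of matrix rows among the
  first 2 N, the only ones filled during setup.\<close>

lemma leaf_hit:
  assumes r: "r < 2 * m + n" and j: "j < 2 ^ L"
    and hit: "j = 0 \<or> (j \<le> n \<and> r < 2 * m \<and> a (r mod m) j \<noteq> 0) \<or> (2 * m \<le> r \<and> j = r - 2 * m + 1)"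
  shows "\<exists>e<E. rw e = r \<and> cl e = j \<and> (1 \<le> j \<longrightarrow> r < 2 * m \<longrightarrow> e < 2 * N)"
proof -
  consider "j = 0" | "1 \<le> j" "j \<le> n" "r < m" "a r j \<noteq> 0" | "1 \<le> j" "j \<le> n" "m \<le> r" "r < 2 * m" "a (r - m) j \<noteq> 0" |
    "2 * m \<le> r" "j = r - 2 * m + 1"
  proof -
    have "r mod m = r - m" if "m \<le> r" "r < 2 * m" using that by (simp add: mod_if)
    then show ?thesis using hit that by (cases "j = 0"; cases "r < m") (auto simp: not_less)
  qed
  then show ?thesis
  proof cases
    case 1
    then show ?thesis using r by (intro exI[of _ "2 * N + n + r"]) (simp add: rw_def cl_def E_eq)
  next
    case 2
    then have "j - 1 < n" "j - 1 + 1 = j" by auto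
    then obtain e where "e < N" "row e = r" "col e = j - 1" using cover[of r "j - 1"] 2 by auto
    then show ?thesis using 2 by (intro exI[of _ e]) (simp add: rw_def cl_def E_eq)
  next
    case 3
    then have "j - 1 < n" "j - 1 + 1 = j" "r - m < m" by auto
    then obtain e where "e < N" "row e = r - m" "col e = j - 1" using cover[of "r - m" "j - 1"] 3 by auto
    then show ?thesis using 3 by (intro exI[of _ "N + e"]) (simp add: rw_def cl_def E_eq)
  next
    case 4
    then obtain d where "r = 2 * m + d" using le_Suc_ex by blast
    then show ?thesis using r 4 by (intro exI[of _ "2 * N + d"]) (simp add: rw_def cl_def E_eq)
  qed
qed

lemma block_lev: "\<lbrakk>r < 2 * m + n; j < 2 ^ L\<rbrakk> \<Longrightarrow> (2 ^ L + r) * 2 ^ L + j \<in> lev (2 * L) 0"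
  using row_room[of r] unfolding leaf_block_index by (simp add: lev_def)

lemma block_parts:
  fixes r j :: nat
  assumes "j < 2 ^ L"
  shows "((2 ^ L + r) * 2 ^ L + j) div 2 ^ L = 2 ^ L + r" "((2 ^ L + r) * 2 ^ L + j) mod 2 ^ L = j"
  using assms by simp_all

lemma leaf_eq_block: "\<lbrakk>e < E; rw e = r; cl e = j\<rbrakk> \<Longrightarrow> leaf e = (2 ^ L + r) * 2 ^ L + j"
  unfolding leaf_block_index by (simp add: leaf_def)

text \<open>Row sums run over all 2^L leaves of a block. A leaf without an entry is unowned, so it
  stores 0 by sparsity, and completeness of the entry list makes \<open>V\<close> vanish there as
  well.\<close>

lemma upd_leaf_block:
  assumes f: "sparse f" and r: "r < 2 * m + n" and j: "j < 2 ^ L"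
    and V: "\<lbrakk>1 \<le> j; j \<le> n; r < 2 * m; a (r mod m) j = 0\<rbrakk> \<Longrightarrow> V r j = 0"
      "\<lbrakk>1 \<le> j; j \<le> n; 2 * m \<le> r; j \<noteq> r - 2 * m + 1\<rbrakk> \<Longrightarrow> V r j = 0"
  shows "upd_leaf E f V ((2 ^ L + r) * 2 ^ L + j) = (if j \<le> n then V r j else 0)"
proof (cases "(2 ^ L + r) * 2 ^ L + j \<in> leaf ` {..<E}")
  case True
  then obtain e where "e < E" "leaf e = (2 ^ L + r) * 2 ^ L + j" by auto
  then have "cl e = j" using leaf_parts[of e] block_parts[OF j, of r] by simp
  then have "j \<le> n" using cl_le[OF \<open>e < E\<close>] by simp
  then show ?thesis using True block_parts[OF j, of r] by (simp add: upd_leaf_def)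
next
  case False
  have "f ((2 ^ L + r) * 2 ^ L + j) = 0"
    using f own_none[OF block_lev[OF r j] False] lev_bound[OF block_lev[OF r j]] unfolding sparse_def by blast
  moreover have "V r j = 0" if "j \<le> n"
  proof (rule ccontr)
    assume "V r j \<noteq> 0"
    then have "j = 0 \<or> (j \<le> n \<and> r < 2 * m \<and> a (r mod m) j \<noteq> 0) \<or> (2 * m \<le> r \<and> j = r - 2 * m + 1)"
      using V that by force
    from leaf_hit[OF r j this] show False using False leaf_eq_block by (metis imageI lessThan_iff)
  qed
  ultimately show ?thesis using False by (simp add: upd_leaf_def)
qed

text \<open>The analogue for setup, where only matrix entries are filled in and column 0 must still
  contribute 0.\<close>

lemma upd_leaf_block2:
  assumes f: "\<And>x. f x = 0" and r: "r < 2 * m" and j: "j < 2 ^ L"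
    and V: "\<lbrakk>1 \<le> j; j \<le> n; a (r mod m) j = 0\<rbrakk> \<Longrightarrow> V r j = 0"
  shows "upd_leaf (2 * N) f V ((2 ^ L + r) * 2 ^ L + j) = (if 1 \<le> j \<and> j \<le> n then V r j else 0)"
proof (cases "(2 ^ L + r) * 2 ^ L + j \<in> leaf ` {..<2 * N}")
  case True
  then obtain e where e: "e < 2 * N" "leaf e = (2 ^ L + r) * 2 ^ L + j" by auto
  then have eE: "e < E" by (simp add: E_eq)
  then have "cl e = j" using leaf_parts[of e] block_parts[OF j, of r] e by simp
  then have "j \<le> n" "1 \<le> j" using cl_le[OF eE] e by (auto simp: cl_def split: if_splits)
  then show ?thesis using True block_parts[OF j, of r] by (simp add: upd_leaf_def)
next
  case False
  have "V r j = 0" if jn: "1 \<le> j" "j \<le> n"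
  proof (rule ccontr)
    assume "V r j \<noteq> 0"
    then have "j = 0 \<or> (j \<le> n \<and> r < 2 * m \<and> a (r mod m) j \<noteq> 0) \<or> (2 * m \<le> r \<and> j = r - 2 * m + 1)"
      using V jn r by force
    then obtain e where "e < E" "rw e = r" "cl e = j" "e < 2 * N"
      using leaf_hit[of r j] r j jn by (metis trans_less_add1)
    then show False using False leaf_eq_block by (metis imageI lessThan_iff)
  qed
  then show ?thesis using False f by (auto simp: upd_leaf_def)
qed

lemma sum_cols:
  assumes "\<And>j. j < 2 ^ L \<Longrightarrow> g j = (if 1 \<le> j \<and> j \<le> n then (w j :: real) else 0)"
  shows "(\<Sum>j<2 ^ L. g j) = (\<Sum>j=1..n. w j)"
proof -
  have "(\<Sum>j<2 ^ L. g j) = (\<Sum>j\<in>{..<2 ^ L}. if j \<in> {1..n} then w j else 0)"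
    by (rule sum.cong) (use assms in auto)
  also have "\<dots> = (\<Sum>j\<in>{..<2 ^ L} \<inter> {1..n}. w j)" by (simp add: sum.inter_restrict)
  also have "{..<2 ^ L} \<inter> {1..n} = {1..n}" using size by auto
  finally show ?thesis .
qed

lemma sum_cols0:
  assumes "\<And>j. j < 2 ^ L \<Longrightarrow> g j = (if j \<le> n then (w j :: real) else 0)"
  shows "(\<Sum>j<2 ^ L. g j) = w 0 + (\<Sum>j=1..n. w j)"
proof -
  have "(\<Sum>j<2 ^ L. g j) = (\<Sum>j\<in>{..<2 ^ L}. if j \<in> {..n} then w j else 0)"
    by (rule sum.cong) (use assms in auto)
  also have "\<dots> = (\<Sum>j\<in>{..<2 ^ L} \<inter> {..n}. w j)" by (simp add: sum.inter_restrict)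
  also have "{..<2 ^ L} \<inter> {..n} = insert 0 {1..n}" using size by auto
  finally show ?thesis by simp
qed

lemma row_lev: "r < 2 * m + n \<Longrightarrow> 2 ^ L + r \<in> lev (2 * L) L"
  using size by (simp add: lev_def)

lemma entry:
  assumes "e < 2 * N"
  shows "ir (e mod N) = a (rw e mod m) (cl e)" "rw e < 2 * m" "1 \<le> cl e" "cl e \<le> n" "e mod N < Z" "rw e < m \<longleftrightarrow> e < N"
proof -
  have N: "0 < N" using assms by simp
  have em: "e mod N < N" using N by simp
  show "e mod N < Z" using em Z_eq by linarith
  show "cl e \<le> n" using cl_le[of e] assms by (simp add: E_eq)
  have "ir (e mod N) = a (rw e mod m) (cl e) \<and> rw e < 2 * m \<and> 1 \<le> cl e \<and> (rw e < m \<longleftrightarrow> e < N)"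
  proof (cases "e < N")
    case True
    then show ?thesis using ir_a[of e] rc[of e] by (simp add: rw_def cl_def)
  next
    case False
    then have "e mod N = e - N" using assms by (simp add: mod_if)
    then show ?thesis using False assms ir_a[of "e - N"] rc2[of e] by (simp add: rw_def cl_def)
  qed
  then show "ir (e mod N) = a (rw e mod m) (cl e)" "rw e < 2 * m" "1 \<le> cl e" "rw e < m \<longleftrightarrow> e < N" by auto
qed

lemma hx_p:
  assumes h: "stat h" and Q: "Q (h\<lparr>ra := (ra h)(6 := upd_cols (ra h 6) p0)\<rparr>)"
  shows "hx B Z X c_p h 1000 Q"
  unfolding c_p_def
proof (rule hx_cols[OF h])
  have st: "scal h" using h by (simp add: stat_def)
  note st = st[unfolded scal_def One_nat_def]
  fix j assume j: "j < n"
  show "rv (ini h 10 j) (RM (vN [+] idx)) = p0 (j + 1)" using ir_p[OF j] by (simp add: st)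
  show "rok B Z (ini h 10 j) (RM (vN [+] idx))" using j lt_B Z_eq by (simp add: st)
qed (use Q in \<open>auto simp: gcost_def\<close>)

lemma hx_a2:
  assumes h: "stat h" and Q: "Q (h\<lparr>ra := (ra h)(2 := upd_leaf (2 * N) (ra h 2) (\<lambda>r j. a (r mod m) j * a (r mod m) j))\<rparr>)"
  shows "hx B Z X c_a2 h 1000 Q"
  unfolding c_a2_def
proof (rule hx_leaves[OF h])
  have st: "scal h" using h by (simp add: stat_def)
  note st = st[unfolded scal_def One_nat_def]
  show "hw h 19 = 2 * N" by (simp add: st)
  fix e assume e: "e < 2 * N"
  show "rv (ini h 10 e) (aexp {*} aexp) = a (rw e mod m) (cl e) * a (rw e mod m) (cl e)"
    using entry(1)[OF e] by (simp add: st)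
  show "rok B Z (ini h 10 e) (aexp {*} aexp)" using e lt_B entry(5)[OF e] Z_eq by (simp add: st)
qed (use Q in \<open>auto simp: gcost_def E_eq\<close>)

lemma hx_pa:
  assumes h: "stat h" and p: "ra h 6 = upd_cols f p0"
    and Q: "Q (h\<lparr>ra := (ra h)(3 := upd_leaf (2 * N) (ra h 3) (\<lambda>r j. p0 j * a (r mod m) j))\<rparr>)"
  shows "hx B Z X c_pa h 1000 Q"
  unfolding c_pa_def
proof (rule hx_leaves[OF h])
  have st: "scal h" "wa h 0 = leaf" using h by (simp_all add: stat_def)
  note st = st(1)[unfolded scal_def One_nat_def] st(2)
  show "hw h 19 = 2 * N" by (simp add: st)
  fix e assume e: "e < 2 * N"
  then have eE: "e < E" by (simp add: E_eq)
  note lp = leaf_parts[OF eE]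
  show "rv (ini h 10 e) (RA 6 (leafe [mod] vP) {*} aexp) = p0 (cl e) * a (rw e mod m) (cl e)"
    using entry[OF e] lp by (simp add: st p upd_cols_def)
  have "cl e < 2 * 2 ^ (2 * L)" "2 ^ L < B" "cl e < B" using cl_le[OF eE] size P_le_PP lt_B by linarith+
  then show "rok B Z (ini h 10 e) (RA 6 (leafe [mod] vP) {*} aexp)"
    using e eE E_le lt_B entry(5)[OF e] Z_eq leaf_lt[OF eE] lp by (simp add: st)
qed (use Q in \<open>auto simp: gcost_def E_eq\<close>)

lemma upd_rows_at [simp]: "r < M \<Longrightarrow> upd_rows M f V (2 ^ L + r) = V r"
  by (simp add: upd_rows_def)

lemma hx_sums:
  assumes h: "stat h" and p: "ra h 6 = upd_cols f p0" and z: "ra h 2 = (\<lambda>_. 0)" "ra h 3 = (\<lambda>_. 0)"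
    and Q: "\<And>F2 F3. \<lbrakk>sparse F2; sparse F3; \<And>r. r < 2 * m \<Longrightarrow> F2 (2 ^ L + r) = A2 (r mod m);
       \<And>r. r < 2 * m \<Longrightarrow> F3 (2 ^ L + r) = mu (r mod m)\<rbrakk> \<Longrightarrow>
       Q (h\<lparr>hw := (hw h)(12 := 2 ^ (2 * L)), ra := (ra h)(2 := F2, 3 := F3)\<rparr>)"
  shows "hx B Z X c_sums h (1000 + (3 + ((1 + 2 * L * 300) + (1000 + (3 + (1 + 2 * L * 300)))))) Q"
proof -
  let ?V2 = "\<lambda>r j. a (r mod m) j * a (r mod m) j" and ?V3 = "\<lambda>r j. p0 j * a (r mod m) j"
  let ?f2 = "upd_leaf (2 * N) (\<lambda>_. 0) ?V2" and ?f3 = "upd_leaf (2 * N) (\<lambda>_. 0) ?V3"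
  let ?h1 = "h\<lparr>ra := (ra h)(2 := ?f2)\<rparr>"
  let ?h2 = "?h1\<lparr>hw := (hw h)(12 := 1)\<rparr>"
  have NE: "2 * N \<le> E" by (simp add: E_eq)
  have sp: "sparse ?f2" "sparse ?f3" using sparse_upd_leaf[OF sparse_zero NE] by auto
  have st1: "stat ?h1" "stat ?h2" using h by (simp_all add: stat_def scal_def)
  have rowsum: "F (2 ^ L + r) = (\<Sum>j=1..n. V r j)"
    if s: "summed 0 (upd_leaf (2 * N) (\<lambda>_. 0) V) F" and r: "r < 2 * m"
      and V: "\<And>r j. a (r mod m) j = 0 \<Longrightarrow> V r j = 0" for F V r
  proof -
    have "F (2 ^ L + r) = (\<Sum>j<2 ^ (L - 0). upd_leaf (2 * N) (\<lambda>_. 0) V ((2 ^ L + r) * 2 ^ (L - 0) + j))"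
      by (rule summed_block[OF s row_lev]) (use r in auto)
    also have "\<dots> = (\<Sum>j<2 ^ L. upd_leaf (2 * N) (\<lambda>_. 0) V ((2 ^ L + r) * 2 ^ L + j))" by simp
    also have "\<dots> = (\<Sum>j=1..n. V r j)"
      by (rule sum_cols) (use upd_leaf_block2[of "\<lambda>_. 0" r _ V] r V in auto)
    finally show ?thesis .
  qed
  show ?thesis unfolding c_sums_def
  proof (rule hx_Seq)
  let ?c4 = "Seq (wset 12 (WC 1)) (sumup 3)"
  let ?d4 = "3 + (1 + 2 * L * 300) :: nat"
  let ?c3 = "Seq c_pa ?c4"
  let ?d3 = "1000 + ?d4"
  let ?c2 = "Seq (sumup 2) ?c3"
  let ?d2 = "(1 + 2 * L * 300) + ?d3"
  let ?c1 = "Seq (wset 12 (WC 1)) ?c2"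
  let ?d1 = "3 + ?d2"
    show "hx B Z X c_a2 h 1000 (\<lambda>h'. h' = ?h1)" by (rule hx_a2[OF h]) (simp add: z)
    fix h1 assume h1: "h1 = ?h1"
    show "hx B Z X ?c1 h1 ?d1 Q"
    proof (rule hx_Seq)
      show "hx B Z X (wset 12 (WC 1)) h1 3 (\<lambda>h'. h' = ?h2)"
        by (rule hx_wset_le) (use X1 lt_B h1 in auto)
      fix h2 assume h2: "h2 = ?h2"
      let ?Q3 = "\<lambda>h3. \<exists>F2. summed 0 ?f2 F2 \<and> h3 = h\<lparr>hw := (hw h)(12 := 2 ^ (2 * L)), ra := (ra h)(2 := F2)\<rparr>"
      show "hx B Z X ?c2 h2 ?d2 Q"
      proof (rule hx_Seq)
        show "hx B Z X (sumup 2) h2 (1 + 2 * L * 300) ?Q3"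
        proof (rule hx_sumup[where c = 0])
          show "treest h2" using stat_treest[OF st1(2)] h2 by simp
          fix F assume "summed 0 (ra h2 2) F"
          then show "?Q3 (h2\<lparr>hw := (hw h2)(12 := 2 ^ (2 * L)), ra := (ra h2)(2 := F)\<rparr>)"
            using h2 by (intro exI[of _ F]) simp
        qed (use h2 sp in simp_all)
        fix h3 assume "?Q3 h3"
        then obtain F2 where F2: "summed 0 ?f2 F2"
          "h3 = h\<lparr>hw := (hw h)(12 := 2 ^ (2 * L)), ra := (ra h)(2 := F2)\<rparr>" by blast
        have st3: "stat h3" using h F2(2) by (simp add: stat_def scal_def)
        let ?h4 = "h3\<lparr>ra := (ra h3)(3 := ?f3)\<rparr>"
        show "hx B Z X ?c3 h3 ?d3 Q"
        proof (rule hx_Seq)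
          show "hx B Z X c_pa h3 1000 (\<lambda>h'. h' = ?h4)"
            by (rule hx_pa[OF st3, where f = f]) (use F2(2) p z in simp_all)
          fix h4 assume h4: "h4 = ?h4"
          let ?h5 = "h4\<lparr>hw := (hw h4)(12 := 1)\<rparr>"
          show "hx B Z X ?c4 h4 ?d4 Q"
          proof (rule hx_Seq)
            show "hx B Z X (wset 12 (WC 1)) h4 3 (\<lambda>h'. h' = ?h5)"
              by (rule hx_wset_le) (use X1 lt_B in auto)
            fix h5 assume h5: "h5 = ?h5"
            have st5: "stat h5" using st3 h4 h5 by (simp add: stat_def scal_def)
            show "hx B Z X (sumup 3) h5 (1 + 2 * L * 300) Q"
            proof (rule hx_sumup[where c = 0])
              show "treest h5" using stat_treest[OF st5] .
              fix F assume "summed 0 (ra h5 3) F"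
              then have F3: "summed 0 ?f3 F" using h5 h4 by simp
              have "Q (h\<lparr>hw := (hw h)(12 := 2 ^ (2 * L)), ra := (ra h)(2 := F2, 3 := F)\<rparr>)"
              proof (rule Q)
                show "sparse F2" "sparse F" using F2(1) F3 by (simp_all add: summed_def)
                show "F2 (2 ^ L + r) = A2 (r mod m)" if "r < 2 * m" for r
                  using rowsum[OF F2(1) that] by (simp add: A2_def)
                show "F (2 ^ L + r) = mu (r mod m)" if "r < 2 * m" for r
                  using rowsum[OF F3 that] by (simp add: mu_def)
              qed
              moreover have "h5\<lparr>hw := (hw h5)(12 := 2 ^ (2 * L)), ra := (ra h5)(3 := F)\<rparr> =
                  h\<lparr>hw := (hw h)(12 := 2 ^ (2 * L)), ra := (ra h)(2 := F2, 3 := F)\<rparr>"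
                unfolding h5 h4 F2(2) by simp
              ultimately show "Q (h5\<lparr>hw := (hw h5)(12 := 2 ^ (2 * L)), ra := (ra h5)(3 := F)\<rparr>)" by simp
            qed (use h5 h4 sp in simp_all)
          qed
        qed
      qed
    qed
  qed
qed

lemma D_addr: "r < 2 * m \<Longrightarrow> N + n + r mod m < Z \<and> r mod m < m"
  using Z_eq m1 by (simp add: add_strict_mono less_imp_le_nat trans_less_add2)

lemma hx_lam:
  assumes h: "stat h" and F: "\<And>r. r < 2 * m \<Longrightarrow> ra h 2 (2 ^ L + r) = A2 (r mod m)"
      "\<And>r. r < 2 * m \<Longrightarrow> ra h 3 (2 ^ L + r) = mu (r mod m)"
    and Q: "Q (h\<lparr>ra := (ra h)(8 := upd_rows (2 * m) (ra h 8) (\<lambda>r. lam (r mod m)))\<rparr>)"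
  shows "hx B Z X c_lam h 1000 Q"
  unfolding c_lam_def
proof (rule hx_rows[OF h])
  have st: "scal h" using h by (simp add: stat_def)
  note st = st[unfolded scal_def One_nat_def]
  show "hw h 18 = 2 * m" by (simp add: st)
  fix r assume r: "r < 2 * m"
  show "rv (ini h 10 r) lexp = lam (r mod m)"
    using F[OF r] ir_D[of "r mod m"] D_addr[OF r]
    by (simp add: lexp_def l1exp_def l0exp_def lam_def lam1_def st)
  have "2 ^ L + r < 2 * 2 ^ (2 * L)" "2 ^ L < B" "2 * m < B" "N + n + m < Z" "Z < B" "4 * L + 20 < B"
    using r size P_le_PP lt_B Z_eq L5_lt by linarith+
  then show "rok B Z (ini h 10 r) lexp"
    using r lt_B D_addr[OF r] BB(4)
    by (simp add: lexp_def l1exp_def l0exp_def st)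
qed (use Q in \<open>auto simp: gcost_def lexp_def l1exp_def l0exp_def\<close>)

lemma hx_coef:
  assumes h: "stat h" and l: "ra h 8 = upd_rows (2 * m) f (\<lambda>r. lam (r mod m))"
    and Q: "Q (h\<lparr>ra := (ra h)(0 := upd_leaf (2 * N) (ra h 0) coef)\<rparr>)"
  shows "hx B Z X c_coef h 1000 Q"
  unfolding c_coef_def
proof (rule hx_leaves[OF h])
  have st: "scal h" "wa h 0 = leaf" using h by (simp_all add: stat_def)
  note st = st(1)[unfolded scal_def One_nat_def] st(2)
  show "hw h 19 = 2 * N" by (simp add: st)
  fix e assume e: "e < 2 * N"
  then have eE: "e < E" by (simp add: E_eq)
  note lp = leaf_parts[OF eE]
  show "rv (ini h 10 e) coefexp = coef (rw e) (cl e)"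
    using entry[OF e] lp by (cases "e < N") (simp_all add: st l coefexp_def coef_def)
  have "2 ^ L + rw e < 2 * 2 ^ (2 * L)" "2 ^ L < B" "2 * N < B" "N < Z"
    using entry(2)[OF e] size P_le_PP lt_B Z_eq by linarith+
  then show "rok B Z (ini h 10 e) coefexp"
    using e eE E_le lt_B entry(5)[OF e] leaf_lt[OF eE] lp by (simp add: st coefexp_def)
qed (use Q in \<open>auto simp: gcost_def E_eq coefexp_def\<close>)

lemma hx_W0:
  assumes h: "stat h"
    and Q: "Q (h\<lparr>ra := (ra h)(4 := upd_rows (2 * m + n) (ra h 4) (\<lambda>r. if r < 2 * m then 1 else 1 / real (2 * 2 ^ L)))\<rparr>)"
  shows "hx B Z X c_W0 h 1000 Q"
  unfolding c_W0_def
proof (rule hx_rows[OF h])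
  have st: "scal h" using h by (simp add: stat_def)
  note st = st[unfolded scal_def One_nat_def]
  show "hw h 8 = 2 * m + n" by (simp add: st)
  fix r assume r: "r < 2 * m + n"
  show "rv (ini h 10 r) (RIf (TW idx v2m) (rc 1) (rc 1 {div} RW (WC 2 [*] vP))) = (if r < 2 * m then 1 else 1 / real (2 * 2 ^ L))"
    by (simp add: st)
  have "2 * m + n < B" "2 * 2 ^ L < B" using size P_le_PP lt_B by linarith+
  then show "rok B Z (ini h 10 r) (RIf (TW idx v2m) (rc 1) (rc 1 {div} RW (WC 2 [*] vP)))"
    using r lt_B by (simp add: st)
qed (use Q in \<open>auto simp: gcost_def\<close>)

lemma hx_halve:
  assumes h: "stat h" and d: "hw h 17 = d" "d \<le> L + 5"
    and l: "\<And>r. r < 2 * m \<Longrightarrow> ra h 8 (2 ^ L + r) = lam (r mod m)"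
    and Q: "Q (h\<lparr>ra := (ra h)(4 := upd_rows (2 * m) (ra h 4) (\<lambda>r. if lam (r mod m) * \<Delta> (r mod m) < real (4 * d)
       then ra h 4 (2 ^ L + r) else ra h 4 (2 ^ L + r) / 2))\<rparr>)"
  shows "hx B Z X c_halve h 1000 Q"
  unfolding c_halve_def
proof (rule hx_rows[OF h])
  have st: "scal h" using h by (simp add: stat_def)
  note st = st[unfolded scal_def One_nat_def]
  show "hw h 18 = 2 * m" by (simp add: st)
  fix r assume r: "r < 2 * m"
  show "rv (ini h 10 r) (RIf (TR (RA 8 rowx {*} Dexp) (RW (WC 4 [*] WR 17))) (RA 4 rowx) (RA 4 rowx {div} rc 2)) =
    (if lam (r mod m) * \<Delta> (r mod m) < real (4 * d) then ra h 4 (2 ^ L + r) else ra h 4 (2 ^ L + r) / 2)"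
    using l[OF r] ir_D[of "r mod m"] D_addr[OF r] by (simp add: st d)
  have "2 ^ L + r < 2 * 2 ^ (2 * L)" "2 ^ L < B" "2 * m < B" "N + n + m < Z" "Z < B" "4 * d < B"
    using r size P_le_PP lt_B Z_eq L5_lt d by linarith+
  then show "rok B Z (ini h 10 r) (RIf (TR (RA 8 rowx {*} Dexp) (RW (WC 4 [*] WR 17))) (RA 4 rowx) (RA 4 rowx {div} rc 2))"
    using r lt_B D_addr[OF r] by (simp add: st d(1))
next
  have st: "scal h" using h by (simp add: stat_def)
  note st = st[unfolded scal_def One_nat_def]
  fix i j assume "i < 2 * m" "j < 2 * m" "i \<noteq> j"
  then show "RArr 4 (2 ^ L + i) \<notin> rrd (ini h 10 j)
    (RIf (TR (RA 8 rowx {*} Dexp) (RW (WC 4 [*] WR 17))) (RA 4 rowx) (RA 4 rowx {div} rc 2))" by (simp add: st)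
qed (use Q in \<open>auto simp: gcost_def\<close>)

lemma hx_weights:
  assumes h: "stat h" and l: "\<And>r. r < 2 * m \<Longrightarrow> ra h 8 (2 ^ L + r) = lam (r mod m)"
    and Q: "Q (h\<lparr>hw := (hw h)(17 := L + 5), ra := (ra h)(4 := upd_rows (2 * m + n) (ra h 4) wgt)\<rparr>)"
  shows "hx B Z X c_weights h (1000 + (3 + (1 + (L + 5) * (1010 + 1)))) Q"
proof -
  \<comment> \<open>The closed form of the weights after i halving passes; for i = L + 5 it is
    \<open>wgt\<close>.\<close>
  define V where "V i r = (if r < 2 * m then (1 / 2 :: real) ^ card {d \<in> {1..i}. \<not> lam (r mod m) * \<Delta> (r mod m) < real (4 * d)}
     else 1 / real (2 * 2 ^ L))" for i r
  let ?S = "\<lambda>i. h\<lparr>hw := (hw h)(17 := i), ra := (ra h)(4 := upd_rows (2 * m + n) (ra h 4) (V i))\<rparr>"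
  have stS: "stat (?S i)" for i using h by (simp add: stat_def scal_def)
  have VS: "V (Suc i) r = (if lam (r mod m) * \<Delta> (r mod m) < real (4 * Suc i) then V i r else V i r / 2)" if "r < 2 * m" for i r
  proof -
    let ?P = "\<lambda>d. \<not> lam (r mod m) * \<Delta> (r mod m) < real (4 * d)"
    have "{d \<in> {1..Suc i}. ?P d} = (if ?P (Suc i) then insert (Suc i) {d \<in> {1..i}. ?P d} else {d \<in> {1..i}. ?P d})"
      by (auto simp: le_Suc_eq)
    moreover have "Suc i \<notin> {d \<in> {1..i}. ?P d}" "finite {d \<in> {1..i}. ?P d}" by auto
    ultimately have "card {d \<in> {1..Suc i}. ?P d} = (if ?P (Suc i) then Suc (card {d \<in> {1..i}. ?P d}) else card {d \<in> {1..i}. ?P d})"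
      by (simp only: card_insert_disjoint split: if_split) simp
    then show ?thesis using that unfolding V_def by (auto simp only: if_True if_False power_Suc split: if_split)
  qed
  have V0: "V 0 = (\<lambda>r. if r < 2 * m then 1 else 1 / real (2 * 2 ^ L))"
    by (auto simp: V_def fun_eq_iff)
  have st: "scal h" using h by (simp add: stat_def)
  note st = st[unfolded scal_def One_nat_def]
  show ?thesis unfolding c_weights_def
  proof (rule hx_Seq)
    show "hx B Z X c_W0 h 1000 (\<lambda>h'. h' = h\<lparr>ra := (ra h)(4 := upd_rows (2 * m + n) (ra h 4) (V 0))\<rparr>)"
      by (rule hx_W0[OF h]) (simp only: V0)
    fix h1 assume h1: "h1 = h\<lparr>ra := (ra h)(4 := upd_rows (2 * m + n) (ra h 4) (V 0))\<rparr>"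
    show "hx B Z X (Seq (wset 17 (WC 0)) (While (WLess 17 16) (Seq (wset 17 (WR 17 [+] WC 1)) c_halve))) h1
       (3 + (1 + (L + 5) * (1010 + 1))) Q"
    proof (rule hx_Seq)
      show "hx B Z X (wset 17 (WC 0)) h1 3 (\<lambda>h'. h' = ?S 0)"
        by (rule hx_wset_le) (use X1 lt_B h1 in auto)
      fix h2 assume h2: "h2 = ?S 0"
      have "hx B Z X (While (WLess 17 16) (Seq (wset 17 (WR 17 [+] WC 1)) c_halve)) h2
         (1 + (L + 5) * (1010 + 1)) (\<lambda>h'. h' = ?S (L + 5))"
      proof (rule hx_While[where Inv = "\<lambda>i h'. h' = ?S i"])
        fix i h' assume i: "i < L + 5" and h': "h' = ?S i"
        have lt: "hw h' 17 < hw h' 16" using i h' by (simp add: st)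
        have iB: "i + 1 < B" using i L5_lt by linarith
        have "hx B Z X (Seq (wset 17 (WR 17 [+] WC 1)) c_halve) h' (10 + 1000) (\<lambda>h''. h'' = ?S (Suc i))"
        proof (rule hx_Seq)
          show "hx B Z X (wset 17 (WR 17 [+] WC 1)) h' 10 (\<lambda>h''. h'' = h'\<lparr>hw := (hw h')(17 := Suc i)\<rparr>)"
            by (rule hx_wset_le) (use X1 lt_B h' iB in auto)
          fix h3 assume h3: "h3 = h'\<lparr>hw := (hw h')(17 := Suc i)\<rparr>"
          show "hx B Z X c_halve h3 1000 (\<lambda>h''. h'' = ?S (Suc i))"
          proof (rule hx_halve[where d = "Suc i"])
            show "stat h3" using stS[of "Suc i"] h3 h' by (simp add: stat_def scal_def)
            show "ra h3 8 (2 ^ L + r) = lam (r mod m)" if "r < 2 * m" for r using l[OF that] h3 h' by simp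
            have "upd_rows (2 * m) (ra h3 4) (\<lambda>r. if lam (r mod m) * \<Delta> (r mod m) < real (4 * Suc i)
                then ra h3 4 (2 ^ L + r) else ra h3 4 (2 ^ L + r) / 2) = upd_rows (2 * m + n) (ra h 4) (V (Suc i))"
            proof
              fix x
              show "upd_rows (2 * m) (ra h3 4) (\<lambda>r. if lam (r mod m) * \<Delta> (r mod m) < real (4 * Suc i)
                then ra h3 4 (2 ^ L + r) else ra h3 4 (2 ^ L + r) / 2) x = upd_rows (2 * m + n) (ra h 4) (V (Suc i)) x"
                using VS[of "x - 2 ^ L" i] h3 h' by (auto simp: upd_rows_def V_def)
            qed
            then show "h3\<lparr>ra := (ra h3)(4 := upd_rows (2 * m) (ra h3 4) (\<lambda>r. if lam (r mod m) * \<Delta> (r mod m) < real (4 * Suc i)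
                then ra h3 4 (2 ^ L + r) else ra h3 4 (2 ^ L + r) / 2))\<rparr> = ?S (Suc i)"
              using h3 h' by simp
          qed (use h3 i in auto)
        qed
        then show "hw h' 17 < hw h' 16 \<and> hx B Z X (Seq (wset 17 (WR 17 [+] WC 1)) c_halve) h' 1010 (\<lambda>h''. h'' = ?S (Suc i))"
          using lt by simp
      next
        fix h' assume "h' = ?S (L + 5)"
        then show "\<not> hw h' 17 < hw h' 16" by (simp add: st)
      qed (use X1 h2 in auto)
      moreover have "V (L + 5) = wgt" by (auto simp: V_def wgt_def halvings_def fun_eq_iff)
      ultimately show "hx B Z X (While (WLess 17 16) (Seq (wset 17 (WR 17 [+] WC 1)) c_halve)) h2
         (1 + (L + 5) * (1010 + 1)) Q"
        using Q by (auto elim: hx_mono)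
    qed
  qed
qed

definition ready :: "hst \<Rightarrow> bool" where
  "ready h \<longleftrightarrow> stat h \<and> sparse (ra h 1) \<and> sparse (ra h 2) \<and> sparse (ra h 3) \<and>
     ra h 0 = upd_leaf (2 * N) (\<lambda>_. 0) coef"

lemma hx_setup:
  assumes h: "stat h" and z: "\<And>i. ra h i = (\<lambda>_. 0)"
    and Q: "\<And>h'. \<lbrakk>ready h'; \<And>r. r < 2 * m + n \<Longrightarrow> ra h' 4 (2 ^ L + r) = wgt r;
       \<And>j. \<lbrakk>1 \<le> j; j \<le> n\<rbrakk> \<Longrightarrow> ra h' 6 j = p0 j\<rbrakk> \<Longrightarrow> Q h'"
  shows "hx B Z X c_setup h (20000 + L * 5000) Q"
proof -
  let ?h1 = "h\<lparr>ra := (ra h)(6 := upd_cols (\<lambda>_. 0) p0)\<rparr>"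
  have "hx B Z X c_setup h (1000 + ((1000 + (3 + ((1 + 2 * L * 300) + (1000 + (3 + (1 + 2 * L * 300)))))) +
     (1000 + (1000 + (1000 + (3 + (1 + (L + 5) * (1010 + 1)))))))) Q"
    unfolding c_setup_def
  proof (rule hx_Seq)
  let ?c3 = "Seq c_coef c_weights"
  let ?d3 = "1000 + (1000 + (3 + (1 + (L + 5) * (1010 + 1)))) :: nat"
  let ?c2 = "Seq c_lam ?c3"
  let ?d2 = "1000 + ?d3"
  let ?c1 = "Seq c_sums ?c2"
  let ?d1 = "(1000 + (3 + ((1 + 2 * L * 300) + (1000 + (3 + (1 + 2 * L * 300)))))) + ?d2"
    show "hx B Z X c_p h 1000 (\<lambda>h'. h' = ?h1)" by (rule hx_p[OF h]) (simp add: z)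
    fix h1 assume h1: "h1 = ?h1"
    have st1: "stat h1" using h h1 by (simp add: stat_def scal_def)
    let ?Q2 = "\<lambda>h2. stat h2 \<and> sparse (ra h2 2) \<and> sparse (ra h2 3) \<and> ra h2 0 = (\<lambda>_. 0) \<and> ra h2 1 = (\<lambda>_. 0) \<and>
      ra h2 6 = upd_cols (\<lambda>_. 0) p0 \<and> (\<forall>r<2 * m. ra h2 2 (2 ^ L + r) = A2 (r mod m)) \<and>
      (\<forall>r<2 * m. ra h2 3 (2 ^ L + r) = mu (r mod m))"
    show "hx B Z X ?c1 h1 ?d1 Q"
    proof (rule hx_Seq)
      show "hx B Z X c_sums h1 (1000 + (3 + ((1 + 2 * L * 300) + (1000 + (3 + (1 + 2 * L * 300)))))) ?Q2"
        by (rule hx_sums[OF st1, where f = "\<lambda>_. 0"]) (use h1 z st1 in \<open>auto simp: stat_def scal_def\<close>)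
      fix h2 assume h2: "?Q2 h2"
      let ?h3 = "h2\<lparr>ra := (ra h2)(8 := upd_rows (2 * m) (ra h2 8) (\<lambda>r. lam (r mod m)))\<rparr>"
      show "hx B Z X ?c2 h2 ?d2 Q"
      proof (rule hx_Seq)
        show "hx B Z X c_lam h2 1000 (\<lambda>h'. h' = ?h3)" by (rule hx_lam) (use h2 in auto)
        fix h3 assume h3: "h3 = ?h3"
        have st3: "stat h3" using h2 h3 by (simp add: stat_def scal_def)
        let ?h4 = "h3\<lparr>ra := (ra h3)(0 := upd_leaf (2 * N) (\<lambda>_. 0) coef)\<rparr>"
        show "hx B Z X ?c3 h3 ?d3 Q"
        proof (rule hx_Seq)
          show "hx B Z X c_coef h3 1000 (\<lambda>h'. h' = ?h4)"
            by (rule hx_coef[OF st3, where f = "ra h2 8"]) (use h2 h3 in simp_all)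
          fix h4 assume h4: "h4 = ?h4"
          have st4: "stat h4" using st3 h4 by (simp add: stat_def scal_def)
          show "hx B Z X c_weights h4 (1000 + (3 + (1 + (L + 5) * (1010 + 1)))) Q"
          proof (rule hx_weights[OF st4])
            show "ra h4 8 (2 ^ L + r) = lam (r mod m)" if "r < 2 * m" for r using h4 h3 that by simp
            show "Q (h4\<lparr>hw := (hw h4)(17 := L + 5), ra := (ra h4)(4 := upd_rows (2 * m + n) (ra h4 4) wgt)\<rparr>)"
              by (rule Q) (use st4 h4 h3 h2 in \<open>auto simp: ready_def stat_def scal_def upd_cols_def sparse_zero\<close>)
          qed
        qed
      qed
    qed
  qed
  then show ?thesis by (rule hx_mono) (auto simp: algebra_simps)
qed

end

section \<open>A step of the walk\<close>

abbreviation "colx \<equiv> leafe [mod] vP"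
abbreviation "rowd \<equiv> leafe [div] vP"
abbreviation "pexp \<equiv> RA 6 colx"
abbreviation "bexp \<equiv> RA 0 leafe"
abbreviation "qexp \<equiv> RA 6 (idx [+] WC 1)"
abbreviation "tqexp \<equiv> rc 3 {div} rc 4"

text \<open>The column test comes first because column 0 holds a constant in every row. Rows appear
  as 2^L + r, so comparison with 2^L + 2 m separates matrix rows from those of variables, whose only
  other entry is diagonal.\<close>

definition valexp :: rexp where
  "valexp = RIf (TW colx (WC 1)) halfexp (RIf (TW rowd (vP [+] v2m))
     (RIf (TR (RA 4 rowd) (rc 1)) (pexp {*} (rc 1 {-} pexp) {div} RW vK {*} (bexp {-} rc 4 {*} (bexp {*} bexp) {*} pexp)) (rc 0))
     ((rc 1 {-} rc 2 {*} pexp) {div} (rc 2 {*} RW vK)))"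

definition c_val :: com where "c_val = ParFor 10 7 (gbody true (SRA 1 leafe valexp))"

definition c_sq :: com where "c_sq = ParFor 10 7 (gbody true (SRA 2 leafe (RA 1 leafe {*} RA 1 leafe)))"

definition c_om :: com where
  "c_om = ParFor 10 8 (gbody true (SRA 5 rowx (RA 4 rowx {div} (tqexp {+} RA 2 rowx))))"

definition c_ds :: com where
  "c_ds = ParFor 10 1 (gbody true (SRA 7 (idx [+] WC 1) (qexp {*} (rc 1 {-} qexp) {div} RW vK)))"

text \<open>Up to a factor 2 this is the coefficient of the next sign in the weighted sum of
  squares. The row of the leaf is also the row of the parent, since the first L levels stay within a
  row.\<close>

definition crossexp :: rexp where
  "crossexp = RA 5 rowd {*} RA 1 (WC 2 [*] parent 11) {*} RA 1 (WC 2 [*] parent 11 [+] WC 1)"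

definition c_cross :: com where
  "c_cross = ParFor 10 7 (gbody (teq (WA 1 (parent 11)) (idx [+] WC 1)) (SRA 3 (parent 11) crossexp))"

definition c_flip :: com where
  "c_flip = ParFor 10 1 (gbody true (SRA 7 (idx [+] WC 1)
     (RIf (TW (WC 0) ((idx [+] WC 1) [div] WR 11 [mod] WC 2)) (RA 7 (idx [+] WC 1) {*} RR 0) (RA 7 (idx [+] WC 1)))))"

text \<open>The root of array 3 holds the total cross term; the sign is chosen against it.\<close>

definition sgnexp :: rexp where "sgnexp = RIf (TR (rc 0) (RA 3 (WC 1))) (rc 0 {-} rc 1) (rc 1)"

text \<open>Register 12 starts at 2^(c + 1), so that exactly the fresh cross terms are summed; the
  summation continues past the rows up to the root because one sign serves all rows.\<close>

definition c_foldlev :: com where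
  "c_foldlev = Seq c_cross (Seq (wset 12 (WC 2 [*] WR 11)) (Seq (sumup 3) (Seq (rset 0 sgnexp)
     (Seq (levelc 1 11 0) (Seq c_flip (wset 11 (WC 2 [*] WR 11)))))))"

text \<open>The loop stops at level L: only column bits are folded, and each row keeps a value of
  its own.\<close>

definition c_fold :: com where "c_fold = While (WLess 11 5) c_foldlev"

definition c_W :: com where
  "c_W = ParFor 10 8 (gbody true (SRA 4 rowx (RA 5 rowx {*} (tqexp {+} RA 1 rowx {*} RA 1 rowx))))"

definition c_pp :: com where
  "c_pp = ParFor 10 1 (gbody true (SRA 6 (idx [+] WC 1) (qexp {+} RA 7 (idx [+] WC 1))))"

definition c_iter :: com where
  "c_iter = Seq c_val (Seq c_sq (Seq (wset 12 (WC 1)) (Seq (sumup 2) (Seq c_om (Seq c_ds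
     (Seq (wset 11 (WC 1)) (Seq c_fold (Seq c_W (Seq c_pp (wset 13 (WR 13 [+] WC 1)))))))))))"

abbreviation fold_depth :: "nat \<Rightarrow> nat" where
  "fold_depth L \<equiv> 1 + L * ((1000 + (10 + ((1 + 2 * L * 300) + (100 + (200 + (1000 + 10)))))) + 1)"

abbreviation iter_depth :: "nat \<Rightarrow> nat" where
  "iter_depth L \<equiv> 1000 + (1000 + (3 + ((1 + 2 * L * 300) + (1000 + (1000 + (3 + (fold_depth L + (1000 + (1000 + 10)))))))))"

context prog_own
begin

definition bval :: "(nat \<Rightarrow> real) \<Rightarrow> (nat \<Rightarrow> real) \<Rightarrow> nat \<Rightarrow> nat \<Rightarrow> real" where
  "bval W p r j = (if r < 2 * m then if W r < 1 then p j * (1 - p j) / real KN * (coef r j - 4 * (coef r j)\<^sup>2 * p j) else 0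
     else if j = r - 2 * m + 1 then (1 - 2 * p j) / (2 * real KN) else 0)"

text \<open>
  The constant \<open>1/2\<close> in column \<open>0\<close> turns the factor \<open>1 + y + y\<^sup>2 = 3/4 + (1/2 + y)\<^sup>2\<close> of the weight
  update into a square of a folded row plus a constant.
\<close>

definition bval0 :: "(nat \<Rightarrow> real) \<Rightarrow> (nat \<Rightarrow> real) \<Rightarrow> nat \<Rightarrow> nat \<Rightarrow> real" where
  "bval0 W p r j = (if j = 0 then 1 / 2 else bval W p r j)"

text \<open>What one pass of the main loop owes to the assumptions of \<open>walk\<close>; the last
  clause is the derandomised inequality.\<close>

definition step_ok :: "(nat \<Rightarrow> real) \<Rightarrow> (nat \<Rightarrow> real) \<Rightarrow> (nat \<Rightarrow> real) \<Rightarrow> (nat \<Rightarrow> real) \<Rightarrow> (nat \<Rightarrow> real) \<Rightarrow> bool" where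
  "step_ok p W p' W' s \<longleftrightarrow>
     (\<forall>j. 1 \<le> j \<longrightarrow> j \<le> n \<longrightarrow> (s j = 1 \<or> s j = - 1) \<and> p' j = p j + s j * (p j * (1 - p j) / real KN)) \<and>
     (\<forall>r<2 * m + n. W' r = W r / (3/4 + (1/4 + (\<Sum>j=1..n. (bval W p r j)\<^sup>2))) *
        (3/4 + (1/2 + (\<Sum>j=1..n. s j * bval W p r j))\<^sup>2)) \<and>
     (\<Sum>r<2 * m + n. W' r) \<le> (\<Sum>r<2 * m + n. W r)"

abbreviation Wof :: "hst \<Rightarrow> nat \<Rightarrow> real" where "Wof h \<equiv> (\<lambda>r. ra h 4 (2 ^ L + r))"

lemma KN_lt: "KN < B"
  using BB(3) by simp

lemma entry_kind:
  assumes "e < E" "1 \<le> cl e"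
  shows "rw e < 2 * m \<Longrightarrow> e < 2 * N" "2 * m \<le> rw e \<Longrightarrow> cl e = rw e - 2 * m + 1"
proof -
  have c: "e < 2 * N + n" using assms by (auto simp: cl_def split: if_splits)
  show "e < 2 * N" if "rw e < 2 * m"
    using that c by (auto simp: rw_def split: if_splits)
  show "cl e = rw e - 2 * m + 1" if "2 * m \<le> rw e"
    using that c entry(2)[of e] by (cases "e < 2 * N") (auto simp: rw_def cl_def)
qed

lemma hx_val:
  assumes h: "ready h" and Q: "Q (h\<lparr>ra := (ra h)(1 := upd_leaf E (ra h 1) (bval0 (Wof h) (ra h 6)))\<rparr>)"
  shows "hx B Z X c_val h 1000 Q"
  unfolding c_val_def
proof (rule hx_leaves[where M = E])
  have st: "scal h" "wa h 0 = leaf" and cf: "ra h 0 = upd_leaf (2 * N) (\<lambda>_. 0) coef"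
    using h by (simp_all add: ready_def stat_def)
  note st = st(1)[unfolded scal_def One_nat_def] st(2)
  show "stat h" using h by (simp add: ready_def)
  show "hw h 7 = E" by (simp add: st)
  fix e assume e: "e < E"
  note lp = leaf_parts[OF e]
  have cfe: "ra h 0 (leaf e) = coef (rw e) (cl e)" if "1 \<le> cl e" "rw e < 2 * m"
    unfolding cf by (rule upd_leaf_at) (use entry_kind(1)[OF e that] in \<open>simp_all add: E_eq\<close>)
  show "rv (ini h 10 e) valexp = bval0 (Wof h) (ra h 6) (rw e) (cl e)"
  proof (cases "cl e = 0")
    case True
    then show ?thesis using lp by (simp add: valexp_def bval0_def st)
  next
    case False
    then have c1: "1 \<le> cl e" by simp
    show ?thesis
    proof (cases "rw e < 2 * m")
      case True
      then show ?thesis using lp False cfe[OF c1 True]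
        by (simp add: valexp_def bval0_def bval_def st power2_eq_square)
    next
      case nr: False
      then have "cl e = rw e - 2 * m + 1" using entry_kind(2)[OF e c1] by simp
      then show ?thesis using lp False nr by (simp add: valexp_def bval0_def bval_def st)
    qed
  qed
  have b: "2 ^ L + rw e < 2 * 2 ^ (2 * L)" "2 ^ L < B" "cl e < 2 * 2 ^ (2 * L)" "2 ^ L + 2 * m < B" "2 * m < B"
    using rw_less[OF e] cl_le[OF e] size P_le_PP lt_B by linarith+
  show "rok B Z (ini h 10 e) valexp"
    using e E_le lt_B leaf_lt[OF e] b KN_lt by (simp add: valexp_def st lp)
qed (use Q in \<open>auto simp: gcost_def valexp_def\<close>)

lemma hx_sq:
  assumes h: "stat h" and f: "ra h 1 = upd_leaf E f V"
    and Q: "Q (h\<lparr>ra := (ra h)(2 := upd_leaf E (ra h 2) (\<lambda>r j. V r j * V r j))\<rparr>)"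
  shows "hx B Z X c_sq h 1000 Q"
  unfolding c_sq_def
proof (rule hx_leaves[OF h, where M = E])
  have st: "scal h" "wa h 0 = leaf" using h by (simp_all add: stat_def)
  note st = st(1)[unfolded scal_def One_nat_def] st(2)
  show "hw h 7 = E" by (simp add: st)
  fix e assume e: "e < E"
  show "rv (ini h 10 e) (RA 1 leafe {*} RA 1 leafe) = V (rw e) (cl e) * V (rw e) (cl e)"
    using upd_leaf_at[OF e, of f V] f by (simp add: st)
  show "rok B Z (ini h 10 e) (RA 1 leafe {*} RA 1 leafe)"
    using e E_le lt_B leaf_lt[OF e] by (simp add: st)
qed (use Q in \<open>auto simp: gcost_def\<close>)

lemma row_ok: "r < 2 * m + n \<Longrightarrow> 2 ^ L + r < 2 * 2 ^ (2 * L) \<and> 2 ^ L < B \<and> r < B"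
  using size P_le_PP lt_B by linarith

lemma hx_om:
  assumes h: "stat h"
    and Q: "Q (h\<lparr>ra := (ra h)(5 := upd_rows (2 * m + n) (ra h 5) (\<lambda>r. Wof h r / (3/4 + ra h 2 (2 ^ L + r))))\<rparr>)"
  shows "hx B Z X c_om h 1000 Q"
  unfolding c_om_def
proof (rule hx_rows[OF h])
  have st: "scal h" using h by (simp add: stat_def)
  note st = st[unfolded scal_def One_nat_def]
  show "hw h 8 = 2 * m + n" by (simp add: st)
  fix r assume r: "r < 2 * m + n"
  show "rv (ini h 10 r) (RA 4 rowx {div} (tqexp {+} RA 2 rowx)) = Wof h r / (3/4 + ra h 2 (2 ^ L + r))"
    by (simp add: st)
  show "rok B Z (ini h 10 r) (RA 4 rowx {div} (tqexp {+} RA 2 rowx))"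
    using row_ok[OF r] lt_B by (simp add: st)
qed (use Q in \<open>auto simp: gcost_def\<close>)

lemma col_ok: "j < n \<Longrightarrow> j + 1 < 2 * 2 ^ (2 * L) \<and> j + 1 < B"
  using size P_le_PP lt_B by linarith

lemma hx_ds:
  assumes h: "stat h"
    and Q: "Q (h\<lparr>ra := (ra h)(7 := upd_cols (ra h 7) (\<lambda>j. ra h 6 j * (1 - ra h 6 j) / real KN))\<rparr>)"
  shows "hx B Z X c_ds h 1000 Q"
  unfolding c_ds_def
proof (rule hx_cols[OF h])
  have st: "scal h" using h by (simp add: stat_def)
  note st = st[unfolded scal_def One_nat_def]
  fix j assume j: "j < n"
  show "rv (ini h 10 j) (qexp {*} (rc 1 {-} qexp) {div} RW vK) = ra h 6 (j + 1) * (1 - ra h 6 (j + 1)) / real KN"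
    by (simp add: st)
  show "rok B Z (ini h 10 j) (qexp {*} (rc 1 {-} qexp) {div} RW vK)"
    using col_ok[OF j] lt_B KN_lt by (simp add: st)
qed (use Q in \<open>auto simp: gcost_def\<close>)

lemma hx_W:
  assumes h: "stat h"
    and Q: "Q (h\<lparr>ra := (ra h)(4 := upd_rows (2 * m + n) (ra h 4)
      (\<lambda>r. ra h 5 (2 ^ L + r) * (3/4 + ra h 1 (2 ^ L + r) * ra h 1 (2 ^ L + r))))\<rparr>)"
  shows "hx B Z X c_W h 1000 Q"
  unfolding c_W_def
proof (rule hx_rows[OF h])
  have st: "scal h" using h by (simp add: stat_def)
  note st = st[unfolded scal_def One_nat_def]
  show "hw h 8 = 2 * m + n" by (simp add: st)
  fix r assume r: "r < 2 * m + n"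
  show "rv (ini h 10 r) (RA 5 rowx {*} (tqexp {+} RA 1 rowx {*} RA 1 rowx)) =
     ra h 5 (2 ^ L + r) * (3/4 + ra h 1 (2 ^ L + r) * ra h 1 (2 ^ L + r))"
    by (simp add: st)
  show "rok B Z (ini h 10 r) (RA 5 rowx {*} (tqexp {+} RA 1 rowx {*} RA 1 rowx))"
    using row_ok[OF r] lt_B by (simp add: st)
qed (use Q in \<open>auto simp: gcost_def\<close>)

lemma hx_pp:
  assumes h: "stat h"
    and Q: "Q (h\<lparr>ra := (ra h)(6 := upd_cols (ra h 6) (\<lambda>j. ra h 6 j + ra h 7 j))\<rparr>)"
  shows "hx B Z X c_pp h 1000 Q"
  unfolding c_pp_def
proof (rule hx_cols[OF h])
  have st: "scal h" using h by (simp add: stat_def)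
  note st = st[unfolded scal_def One_nat_def]
  fix j assume j: "j < n"
  show "rv (ini h 10 j) (qexp {+} RA 7 (idx [+] WC 1)) = ra h 6 (j + 1) + ra h 7 (j + 1)"
    by simp
  show "rok B Z (ini h 10 j) (qexp {+} RA 7 (idx [+] WC 1))"
    using col_ok[OF j] lt_B by simp
qed (use Q in \<open>auto simp: gcost_def\<close>)

lemma hx_flip:
  assumes h: "stat h" and c: "hw h 11 = 2 ^ c" "c < L"
    and Q: "Q (h\<lparr>ra := (ra h)(7 := upd_cols (ra h 7) (\<lambda>j. if odd (j div 2 ^ c) then ra h 7 j * hr h 0 else ra h 7 j))\<rparr>)"
  shows "hx B Z X c_flip h 1000 Q"
  unfolding c_flip_def
proof (rule hx_cols[OF h])
  have st: "scal h" using h by (simp add: stat_def)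
  note st = st[unfolded scal_def One_nat_def]
  fix j assume j: "j < n"
  show "rv (ini h 10 j) (RIf (TW (WC 0) ((idx [+] WC 1) [div] WR 11 [mod] WC 2)) (RA 7 (idx [+] WC 1) {*} RR 0) (RA 7 (idx [+] WC 1))) =
     (if odd ((j + 1) div 2 ^ c) then ra h 7 (j + 1) * hr h 0 else ra h 7 (j + 1))"
    using c by (simp add: odd_iff_mod_2_eq_one)
  have "2 ^ c \<le> (2::nat) ^ L" using c by (intro power_increasing) auto
  then have "2 ^ c < B" "(j + 1) div 2 ^ c < B" "(j + 1) div 2 ^ c mod 2 < B"
    using P_le_PP lt_B col_ok[OF j] div_le_dividend[of "j + 1" "2 ^ c"] mod_less_eq_dividend[of "(j + 1) div 2 ^ c" 2]
    by linarith+
  then show "rok B Z (ini h 10 j) (RIf (TW (WC 0) ((idx [+] WC 1) [div] WR 11 [mod] WC 2)) (RA 7 (idx [+] WC 1) {*} RR 0) (RA 7 (idx [+] WC 1)))"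
    using col_ok[OF j] lt_B c by simp
qed (use Q in \<open>auto simp: gcost_def\<close>)

definition cross :: "nat \<Rightarrow> (nat \<Rightarrow> real) \<Rightarrow> (nat \<Rightarrow> real) \<Rightarrow> (nat \<Rightarrow> real) \<Rightarrow> nat \<Rightarrow> real" where
  "cross c w f g y = (if y \<in> lev (2 * L) (Suc c) then w (y div 2 ^ (L - Suc c)) * f (2 * y) * f (2 * y + 1) else g y)"

lemma sparse_cross:
  assumes f: "sparse f" and g: "sparse g" and c: "c < 2 * L"
  shows "sparse (cross c w f g)"
  unfolding sparse_def
proof (intro allI impI)
  fix x assume x: "1 \<le> x" "x < 2 * 2 ^ (2 * L)" "own x = 0"
  show "cross c w f g x = 0"
  proof (cases "x \<in> lev (2 * L) (Suc c)")
    case True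
    then have "2 * x \<in> lev (2 * L) c" using lev_child[OF c] by simp
    then have b: "1 \<le> 2 * x" "2 * x < 2 * 2 ^ (2 * L)" using lev_bound by blast+
    then have "own (2 * x) = 0" using own_up[of x] x by simp
    then have "f (2 * x) = 0" using f b unfolding sparse_def by blast
    then show ?thesis by (simp add: cross_def True)
  next
    case False
    then show ?thesis using g x unfolding sparse_def by (simp add: cross_def)
  qed
qed

lemma hx_cross:
  assumes h: "stat h" and c: "c < L" and v: "hw h 11 = 2 ^ c" and sp: "sparse (ra h 1)" "sparse (ra h 3)"
    and Q: "Q (h\<lparr>ra := (ra h)(3 := cross c (ra h 5) (ra h 1) (ra h 3))\<rparr>)"
  shows "hx B Z X c_cross h 1000 Q"
proof (rule hx_mono)
  let ?F = "cross c (ra h 5) (ra h 1) (ra h 3)"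
  have t: "treest h" using stat_treest[OF h] .
  have st: "scal h" "wa h 0 = leaf" using h by (simp_all add: stat_def)
  note st = st(1)[unfolded scal_def One_nat_def] st(2)
  have c2: "c < 2 * L" using c by simp
  have spF: "sparse ?F" by (rule sparse_cross[OF sp c2])
  have v11: "(11::nat) < 20" "(11::nat) \<noteq> 10" by simp_all
  note pe = parent_eval[OF t c2 v v11]
  show "hx B Z X c_cross h (1 + gcost (teq (WA 1 (parent 11)) (idx [+] WC 1)) (SRA 3 (parent 11) crossexp)) Q"
    unfolding c_cross_def
  proof (rule hx_owner_par[OF t c2 v v11, where F = ?F])
    fix e assume e: "e < E"
    have yl: "leaf e div 2 ^ Suc c \<in> lev (2 * L) (Suc c)"
      by (rule lev_div[OF leaf_lev[OF e]]) (use c in simp)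
    have "leaf e div 2 ^ Suc c div 2 ^ (L - Suc c) = leaf e div (2 ^ Suc c * 2 ^ (L - Suc c))"
      by (simp only: div_mult2_eq)
    also have "(2::nat) ^ Suc c * 2 ^ (L - Suc c) = 2 ^ L" using c by (simp only: power_add[symmetric]) simp
    finally have dd: "leaf e div 2 ^ Suc c div 2 ^ (L - Suc c) = leaf e div 2 ^ L" .
    show "rv (ini h 10 e) crossexp = ?F (leaf e div 2 ^ Suc c)"
      using yl pe(1)[OF e] dd by (simp add: crossexp_def cross_def st del: power_Suc)
    have "2 * (leaf e div 2 ^ Suc c) \<in> lev (2 * L) c" "2 * (leaf e div 2 ^ Suc c) + 1 \<in> lev (2 * L) c"
      using yl lev_child[OF c2] lev_child1[OF c2] by auto
    then have b: "2 * (leaf e div 2 ^ Suc c) < 2 * 2 ^ (2 * L)" "2 * (leaf e div 2 ^ Suc c) + 1 < 2 * 2 ^ (2 * L)"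
      using lev_bound by blast+
    show "rok B Z (ini h 10 e) crossexp"
      using b pe[OF e] row_ok[OF rw_less[OF e]] lt_B leaf_lt[OF e] e E_le leaf_parts[OF e]
      by (simp add: crossexp_def st del: power_Suc)
    fix y assume "y \<in> lev (2 * L) (Suc c)"
    show "RArr 3 y \<notin> rrd (ini h 10 e) crossexp" by (simp add: crossexp_def parent_def)
  next
    fix y assume "y \<notin> lev (2 * L) (Suc c)"
    then show "?F y = ra h 3 y" by (simp add: cross_def)
  next
    fix y assume y: "y \<in> lev (2 * L) (Suc c)" "own y = 0"
    then show "?F y = ra h 3 y" using spF sp(2) lev_bound[OF y(1)] unfolding sparse_def by simp
  qed (use Q in simp_all)
qed (simp_all add: gcost_def teq_def parent_def crossexp_def)

lemma hx_foldlev: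
  assumes h: "stat h" and c: "c < L" and v: "hw h 11 = 2 ^ c" and sp: "sparse (ra h 1)" "sparse (ra h 3)"
    and Q: "\<And>G s. \<lbrakk>sparse G; s = 1 \<or> s = - 1;
        s * (\<Sum>y\<in>lev (2 * L) (Suc c). ra h 5 (y div 2 ^ (L - Suc c)) * ra h 1 (2 * y) * ra h 1 (2 * y + 1)) \<le> 0\<rbrakk> \<Longrightarrow>
      Q (h\<lparr>hw := (hw h)(11 := 2 ^ Suc c, 12 := 2 ^ (2 * L)), hr := (hr h)(0 := s),
        ra := (ra h)(1 := lvl_fold (2 * L) c s (ra h 1), 3 := G,
          7 := upd_cols (ra h 7) (\<lambda>j. if odd (j div 2 ^ c) then ra h 7 j * s else ra h 7 j))\<rparr>)"
  shows "hx B Z X c_foldlev h (1000 + (10 + ((1 + 2 * L * 300) + (100 + (200 + (1000 + 10)))))) Q"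
  unfolding c_foldlev_def
proof (rule hx_Seq)
  let ?c5 = "Seq c_flip (wset 11 (WC 2 [*] WR 11))"
  let ?d5 = "1000 + 10 :: nat"
  let ?c4 = "Seq (levelc 1 11 0) ?c5"
  let ?d4 = "200 + ?d5"
  let ?c3 = "Seq (rset 0 sgnexp) ?c4"
  let ?d3 = "100 + ?d4"
  let ?c2 = "Seq (sumup 3) ?c3"
  let ?d2 = "(1 + 2 * L * 300) + ?d3"
  let ?c1 = "Seq (wset 12 (WC 2 [*] WR 11)) ?c2"
  let ?d1 = "10 + ?d2"
  have c2: "c < 2 * L" "Suc c \<le> 2 * L" using c by auto
  have pw: "2 * 2 ^ c \<le> (2::nat) ^ (2 * L)" using c2 by (metis one_le_numeral power_Suc power_increasing)
  then have pB: "2 * 2 ^ c < B" "(2::nat) ^ c < B" using lt_B by linarith+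
  let ?C = "cross c (ra h 5) (ra h 1) (ra h 3)"
  let ?h1 = "h\<lparr>ra := (ra h)(3 := ?C)\<rparr>"
  show "hx B Z X c_cross h 1000 (\<lambda>h'. h' = ?h1)" by (rule hx_cross[OF h c v sp]) simp
  fix h1 assume h1: "h1 = ?h1"
  show "hx B Z X ?c1 h1 ?d1 Q"
  proof (rule hx_Seq)
    show "hx B Z X (wset 12 (WC 2 [*] WR 11)) h1 10 (\<lambda>h'. h' = h1\<lparr>hw := (hw h1)(12 := 2 ^ Suc c)\<rparr>)"
      by (rule hx_wset_le) (use h1 v pB lt_B X1 in auto)
    fix h2 assume h2: "h2 = h1\<lparr>hw := (hw h1)(12 := 2 ^ Suc c)\<rparr>"
    let ?Q3 = "\<lambda>h3. \<exists>G. summed (Suc c) ?C G \<and> h3 = h\<lparr>hw := (hw h)(12 := 2 ^ (2 * L)), ra := (ra h)(3 := G)\<rparr>"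
    show "hx B Z X ?c2 h2 ?d2 Q"
    proof (rule hx_Seq)
      show "hx B Z X (sumup 3) h2 (1 + 2 * L * 300) ?Q3"
      proof (rule hx_sumup[where c = "Suc c"])
        have "stat h2" using h h2 h1 by (simp add: stat_def scal_def)
        then show "treest h2" by (rule stat_treest)
        have r3: "ra h2 3 = ?C" using h2 h1 by simp
        show "sparse (ra h2 3)" unfolding r3 by (rule sparse_cross[OF sp c2(1)])
        fix G assume "summed (Suc c) (ra h2 3) G"
        then show "?Q3 (h2\<lparr>hw := (hw h2)(12 := 2 ^ (2 * L)), ra := (ra h2)(3 := G)\<rparr>)"
          unfolding r3 using h2 h1 by (intro exI[of _ G]) simp
      qed (use h2 c2 in simp_all)
      fix h3 assume "?Q3 h3"
      then obtain G where G: "summed (Suc c) ?C G"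
        and h3: "h3 = h\<lparr>hw := (hw h)(12 := 2 ^ (2 * L)), ra := (ra h)(3 := G)\<rparr>" by blast
      define cs where "cs = (\<Sum>y\<in>lev (2 * L) (Suc c). ra h 5 (y div 2 ^ (L - Suc c)) * ra h 1 (2 * y) * ra h 1 (2 * y + 1))"
      \<comment> \<open>The summation started at level c + 1, whose descendants of the root are the
        entire level, so the root value is the cross term that decides the sign.\<close>
      have G1: "G 1 = cs"
      proof -
        let ?M = "2 ^ (2 * L - Suc c) :: nat"
        have "(1::nat) \<in> lev (2 * L) (2 * L)" by (simp add: lev_def)
        from summed_block[OF G this c2(2) order_refl]
        have "G 1 = (\<Sum>j<?M. ?C (?M + j))" by simp
        also have "\<dots> = (\<Sum>y\<in>{?M..<?M + ?M}. ?C y)"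
          by (simp add: sum.shift_bounds_nat_ivl[of _ 0 ?M ?M, simplified] atLeast0LessThan add.commute)
        also have "{?M..<?M + ?M} = lev (2 * L) (Suc c)" by (simp add: lev_def mult_2)
        also have "(\<Sum>y\<in>lev (2 * L) (Suc c). ?C y) = cs"
          unfolding cs_def by (rule sum.cong) (auto simp: cross_def)
        finally show ?thesis .
      qed
      define s where "s = (if 0 < cs then - 1 else 1 :: real)"
      have s: "s = 1 \<or> s = - 1" "s * cs \<le> 0" by (auto simp: s_def)
      show "hx B Z X ?c3 h3 ?d3 Q"
      proof (rule hx_Seq)
        show "hx B Z X (rset 0 sgnexp) h3 100 (\<lambda>h'. h' = h3\<lparr>hr := (hr h3)(0 := s)\<rparr>)"
          by (rule hx_rset_le) (use h3 G1 lt_B BB(1) X1 in \<open>simp_all add: sgnexp_def s_def\<close>)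
        fix h4 assume h4: "h4 = h3\<lparr>hr := (hr h3)(0 := s)\<rparr>"
        have st4: "stat h4" using h h4 h3 by (simp add: stat_def scal_def)
        let ?h5 = "h4\<lparr>ra := (ra h4)(1 := lvl_fold (2 * L) c s (ra h 1))\<rparr>"
        show "hx B Z X ?c4 h4 ?d4 Q"
        proof (rule hx_Seq)
          show "hx B Z X (levelc 1 11 0) h4 200 (\<lambda>h'. h' = ?h5)"
            by (rule hx_level[OF stat_treest[OF st4] c2(1)]) (use h4 h3 v sp in simp_all)
          fix h5 assume h5: "h5 = ?h5"
          have st5: "stat h5" using st4 h5 by (simp add: stat_def scal_def)
          let ?D = "upd_cols (ra h 7) (\<lambda>j. if odd (j div 2 ^ c) then ra h 7 j * s else ra h 7 j)"
          let ?h6 = "h5\<lparr>ra := (ra h5)(7 := ?D)\<rparr>"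
          show "hx B Z X ?c5 h5 ?d5 Q"
          proof (rule hx_Seq)
            show "hx B Z X c_flip h5 1000 (\<lambda>h'. h' = ?h6)"
              by (rule hx_flip[OF st5 _ c]) (use h5 h4 h3 v in \<open>simp_all cong: if_cong\<close>)
            fix h6 assume h6: "h6 = ?h6"
            show "hx B Z X (wset 11 (WC 2 [*] WR 11)) h6 10 Q"
            proof (rule hx_wset_le)
              have "Q (h\<lparr>hw := (hw h)(11 := 2 ^ Suc c, 12 := 2 ^ (2 * L)), hr := (hr h)(0 := s),
                  ra := (ra h)(1 := lvl_fold (2 * L) c s (ra h 1), 3 := G, 7 := ?D)\<rparr>)"
                by (rule Q) (use G s in \<open>auto simp: summed_def cs_def\<close>)
              moreover have "h6\<lparr>hw := (hw h6)(11 := wv h6 (WC 2 [*] WR 11))\<rparr> =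
                  h\<lparr>hw := (hw h)(11 := 2 ^ Suc c, 12 := 2 ^ (2 * L)), hr := (hr h)(0 := s),
                  ra := (ra h)(1 := lvl_fold (2 * L) c s (ra h 1), 3 := G, 7 := ?D)\<rparr>"
                unfolding h6 h5 h4 h3 using v by (simp add: fun_upd_twist)
              ultimately show "Q (h6\<lparr>hw := (hw h6)(11 := wv h6 (WC 2 [*] WR 11))\<rparr>)" by simp
            qed (use h6 h5 h4 h3 v pB lt_B X1 in auto)
          qed
        qed
      qed
    qed
  qed
qed

text \<open>The left side of the last clause is the conditional mean of the weighted squares of the
  rows once the first \<open>c\<close> signs are fixed, by orthogonality of the Walsh functions in
  the remaining signs; the right side is the mean before any sign is fixed.\<close>

definition folded :: "nat \<Rightarrow> (nat \<Rightarrow> real) \<Rightarrow> (nat \<Rightarrow> real) \<Rightarrow> (nat \<Rightarrow> real) \<Rightarrow> (nat \<Rightarrow> real) \<Rightarrow> bool" where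
  "folded c w f \<sigma> F \<longleftrightarrow> sparse F \<and> (\<forall>b<c. \<sigma> b = 1 \<or> \<sigma> b = - 1) \<and> (\<forall>x\<in>lev (2 * L) 0. F x = f x) \<and>
     (\<forall>b<c. \<forall>y\<in>lev (2 * L) (Suc b). F y = F (2 * y) + \<sigma> b * F (2 * y + 1)) \<and>
     (\<Sum>y\<in>lev (2 * L) c. w (y div 2 ^ (L - c)) * (F y)\<^sup>2) \<le> (\<Sum>x\<in>lev (2 * L) 0. w (x div 2 ^ L) * (f x)\<^sup>2)"

lemma lev_disjoint: "\<lbrakk>b < c; c \<le> 2 * L; y \<in> lev (2 * L) b\<rbrakk> \<Longrightarrow> y \<notin> lev (2 * L) c"
proof
  assume bc: "b < c" "c \<le> 2 * L" "y \<in> lev (2 * L) b" "y \<in> lev (2 * L) c"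
  have "2 * (2::nat) ^ (2 * L - c) = 2 ^ (2 * L - c + 1)" by simp
  also have "\<dots> \<le> 2 ^ (2 * L - b)" using bc by (intro power_increasing) auto
  finally show False using bc by (simp add: lev_def)
qed

text \<open>Fixing sign c changes only level c + 1. Lower levels keep their recursion, and
  \<open>fold_level\<close> bounds the new conditional mean by the old one.\<close>

lemma folded_Suc:
  assumes F: "folded c w f \<sigma> F" and c: "c < L" and s: "s = 1 \<or> s = - 1"
    and cr: "s * (\<Sum>y\<in>lev (2 * L) (Suc c). w (y div 2 ^ (L - Suc c)) * F (2 * y) * F (2 * y + 1)) \<le> 0"
  shows "folded (Suc c) w f (\<sigma>(c := s)) (lvl_fold (2 * L) c s F)"
proof -
  let ?F = "lvl_fold (2 * L) c s F" and ?H = "2 * L"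
  have c2: "c < 2 * L" using c by simp
  have same: "?F x = F x" if "b \<le> c" "x \<in> lev ?H b" for x b
    using lev_disjoint[of b "Suc c" x] that c by (simp add: lvl_fold_def)
  have new: "?F y = ?F (2 * y) + s * ?F (2 * y + 1)" if "y \<in> lev ?H (Suc c)" for y
    using that same[of c "2 * y"] same[of c "2 * y + 1"] lev_child[OF c2, of y] lev_child1[OF c2, of y]
    by (simp add: lvl_fold_def)
  let ?M = "2 ^ (?H - Suc c) :: nat"
  have pp: "(2::nat) ^ (?H - c) = 2 * ?M" using c2 by (metis Suc_diff_Suc power_Suc)
  have lv: "lev ?H (Suc c) = {?M..<2 * ?M}" "lev ?H c = {2 * ?M..<2 * (2 * ?M)}" using pp by (simp_all add: lev_def)
  have pl: "(2::nat) ^ (L - c) = 2 * 2 ^ (L - Suc c)" using c by (metis Suc_diff_Suc power_Suc)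
  have "(\<Sum>y\<in>{?M..<2 * ?M}. w (y div 2 ^ (L - Suc c)) * (?F y)\<^sup>2) \<le>
      (\<Sum>x\<in>{2 * ?M..<2 * (2 * ?M)}. w (x div 2 ^ (L - c)) * (?F x)\<^sup>2)"
  proof (rule fold_level[OF s])
    have "(\<Sum>y\<in>{?M..<2 * ?M}. w (y div 2 ^ (L - Suc c)) * ?F (2 * y) * ?F (2 * y + 1)) =
       (\<Sum>y\<in>lev ?H (Suc c). w (y div 2 ^ (L - Suc c)) * F (2 * y) * F (2 * y + 1))"
      unfolding lv(1)[symmetric]
      by (rule sum.cong) (use same[of c] lev_child[OF c2] lev_child1[OF c2] in auto)
    then show "s * (\<Sum>y\<in>{?M..<2 * ?M}. w (y div 2 ^ (L - Suc c)) * ?F (2 * y) * ?F (2 * y + 1)) \<le> 0"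
      using cr by simp
    show "?F y = ?F (2 * y) + s * ?F (2 * y + 1)" if "y \<in> {?M..<2 * ?M}" for y using new that lv(1) by blast
    \<comment> \<open>Both children lie in the row of their parent and therefore carry its
      weight.\<close>
    show "w ((2 * y) div 2 ^ (L - c)) = w (y div 2 ^ (L - Suc c)) \<and>
        w ((2 * y + 1) div 2 ^ (L - c)) = w (y div 2 ^ (L - Suc c))" for y
      unfolding pl div_mult2_eq by simp
  qed
  also have "\<dots> = (\<Sum>x\<in>lev ?H c. w (x div 2 ^ (L - c)) * (F x)\<^sup>2)"
    unfolding lv(2)[symmetric] by (rule sum.cong) (use same[of c] in auto)
  finally have pot: "(\<Sum>y\<in>lev ?H (Suc c). w (y div 2 ^ (L - Suc c)) * (?F y)\<^sup>2) \<le>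
      (\<Sum>x\<in>lev ?H c. w (x div 2 ^ (L - c)) * (F x)\<^sup>2)" unfolding lv(1) .
  have old: "?F y = ?F (2 * y) + (\<sigma>(c := s)) b * ?F (2 * y + 1)" if "b < c" "y \<in> lev ?H (Suc b)" for b y
  proof -
    have b2: "b < ?H" using that c by simp
    have "F y = F (2 * y) + \<sigma> b * F (2 * y + 1)" using F that unfolding folded_def by blast
    moreover have "2 * y \<in> lev ?H b" "2 * y + 1 \<in> lev ?H b" using that lev_child[OF b2] lev_child1[OF b2] by auto
    ultimately show ?thesis using same[of "Suc b" y] same[of b "2 * y"] same[of b "2 * y + 1"] that by simp
  qed
  have sp: "sparse ?F" using F sparse_lvl_fold[OF _ c2] unfolding folded_def by blast
  show ?thesis unfolding folded_def
  proof (intro conjI)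
    show "\<forall>b<Suc c. (\<sigma>(c := s)) b = 1 \<or> (\<sigma>(c := s)) b = - 1" using F s unfolding folded_def by auto
    show "\<forall>x\<in>lev ?H 0. ?F x = f x" using F same[of 0] unfolding folded_def by auto
    show "\<forall>b<Suc c. \<forall>y\<in>lev ?H (Suc b). ?F y = ?F (2 * y) + (\<sigma>(c := s)) b * ?F (2 * y + 1)"
    proof (intro allI impI ballI)
      fix b y assume b: "b < Suc c" and y: "y \<in> lev ?H (Suc b)"
      show "?F y = ?F (2 * y) + (\<sigma>(c := s)) b * ?F (2 * y + 1)"
      proof (cases "b = c")
        case True
        then show ?thesis using new[of y] y by simp
      next
        case False
        then show ?thesis using old[of b y] b y by simp
      qed
    qed
    show "(\<Sum>y\<in>lev ?H (Suc c). w (y div 2 ^ (L - Suc c)) * (?F y)\<^sup>2) \<le> (\<Sum>x\<in>lev ?H 0. w (x div 2 ^ L) * (f x)\<^sup>2)"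
      using pot F unfolding folded_def by linarith
  qed (rule sp)
qed

lemma hx_fold:
  assumes h: "stat h" and v: "hw h 11 = 1" and sp: "sparse (ra h 1)" "sparse (ra h 3)"
    and Q: "\<And>F G \<sigma> x12 x0. \<lbrakk>folded L (ra h 5) (ra h 1) \<sigma> F; sparse G\<rbrakk> \<Longrightarrow>
      Q (h\<lparr>hw := (hw h)(11 := 2 ^ L, 12 := x12), hr := (hr h)(0 := x0),
        ra := (ra h)(1 := F, 3 := G, 7 := upd_cols (ra h 7) (\<lambda>j. ra h 7 j * chi \<sigma> L j))\<rparr>)"
  shows "hx B Z X c_fold h (fold_depth L) Q"
proof -
  define Inv where "Inv c h' \<longleftrightarrow> (\<exists>F G \<sigma> x12 x0. h' = h\<lparr>hw := (hw h)(11 := 2 ^ c, 12 := x12), hr := (hr h)(0 := x0),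
      ra := (ra h)(1 := F, 3 := G, 7 := upd_cols (ra h 7) (\<lambda>j. ra h 7 j * chi \<sigma> c j))\<rparr> \<and>
      folded c (ra h 5) (ra h 1) \<sigma> F \<and> sparse G)" for c h'
  have st: "scal h" using h by (simp add: stat_def)
  note st = st[unfolded scal_def One_nat_def]
  have "hx B Z X c_fold h (1 + L * ((1000 + (10 + ((1 + 2 * L * 300) + (100 + (200 + (1000 + 10)))))) + 1)) (Inv L)"
    unfolding c_fold_def
  proof (rule hx_While)
    fix c h' assume c: "c < L" and "Inv c h'"
    then obtain F G \<sigma> x12 x0 where h': "h' = h\<lparr>hw := (hw h)(11 := 2 ^ c, 12 := x12), hr := (hr h)(0 := x0),
      ra := (ra h)(1 := F, 3 := G, 7 := upd_cols (ra h 7) (\<lambda>j. ra h 7 j * chi \<sigma> c j))\<rparr>"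
      and F: "folded c (ra h 5) (ra h 1) \<sigma> F" and G: "sparse G" unfolding Inv_def by blast
    have lt: "hw h' 11 < hw h' 5" using h' c by (simp add: st power_strict_increasing_iff)
    have "hx B Z X c_foldlev h' (1000 + (10 + ((1 + 2 * L * 300) + (100 + (200 + (1000 + 10)))))) (Inv (Suc c))"
    proof (rule hx_foldlev[OF _ c])
      show "stat h'" using h h' by (simp add: stat_def scal_def)
      show "hw h' 11 = 2 ^ c" "sparse (ra h' 3)" using h' G by simp_all
      show "sparse (ra h' 1)" using h' F by (simp add: folded_def)
      fix G' s assume s: "sparse G'" "s = 1 \<or> s = - 1"
        "s * (\<Sum>y\<in>lev (2 * L) (Suc c). ra h' 5 (y div 2 ^ (L - Suc c)) * ra h' 1 (2 * y) * ra h' 1 (2 * y + 1)) \<le> 0"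
      have F': "folded (Suc c) (ra h 5) (ra h 1) (\<sigma>(c := s)) (lvl_fold (2 * L) c s F)"
        by (rule folded_Suc[OF F c s(2)]) (use s(3) h' in simp)
      have chi': "chi (\<sigma>(c := s)) (Suc c) j = chi \<sigma> c j * (if odd (j div 2 ^ c) then s else 1)" for j
      proof -
        have "chi (\<sigma>(c := s)) c j = chi \<sigma> c j" unfolding chi_def by (rule prod.cong) auto
        then show ?thesis unfolding chi_def by (simp only: prod.lessThan_Suc fun_upd_same)
      qed
      have D: "upd_cols (ra h' 7) (\<lambda>j. if odd (j div 2 ^ c) then ra h' 7 j * s else ra h' 7 j) =
          upd_cols (ra h 7) (\<lambda>j. ra h 7 j * chi (\<sigma>(c := s)) (Suc c) j)"
        unfolding chi' using h' by (auto simp: upd_cols_def fun_eq_iff)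
      have "h'\<lparr>hw := (hw h')(11 := 2 ^ Suc c, 12 := 2 ^ (2 * L)), hr := (hr h')(0 := s),
        ra := (ra h')(1 := lvl_fold (2 * L) c s (ra h' 1), 3 := G',
          7 := upd_cols (ra h 7) (\<lambda>j. ra h 7 j * chi (\<sigma>(c := s)) (Suc c) j))\<rparr> =
        h\<lparr>hw := (hw h)(11 := 2 ^ Suc c, 12 := 2 ^ (2 * L)), hr := (hr h)(0 := s),
        ra := (ra h)(1 := lvl_fold (2 * L) c s F, 3 := G',
          7 := upd_cols (ra h 7) (\<lambda>j. ra h 7 j * chi (\<sigma>(c := s)) (Suc c) j))\<rparr>"
        unfolding h' by (simp add: fun_upd_twist)
      then show "Inv (Suc c) (h'\<lparr>hw := (hw h')(11 := 2 ^ Suc c, 12 := 2 ^ (2 * L)), hr := (hr h')(0 := s),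
        ra := (ra h')(1 := lvl_fold (2 * L) c s (ra h' 1), 3 := G',
          7 := upd_cols (ra h' 7) (\<lambda>j. if odd (j div 2 ^ c) then ra h' 7 j * s else ra h' 7 j))\<rparr>)"
        unfolding Inv_def D using F' s(1) by blast
    qed
    then show "hw h' 11 < hw h' 5 \<and> hx B Z X c_foldlev h' (1000 + (10 + ((1 + 2 * L * 300) + (100 + (200 + (1000 + 10)))))) (Inv (Suc c))"
      using lt by blast
  next
    fix h' assume "Inv L h'"
    then show "\<not> hw h' 11 < hw h' 5" by (auto simp: Inv_def st)
  next
    have "folded 0 (ra h 5) (ra h 1) (\<lambda>_. 1) (ra h 1)" using sp by (simp add: folded_def)
    moreover have "h = h\<lparr>hw := (hw h)(11 := 2 ^ 0, 12 := hw h 12), hr := (hr h)(0 := hr h 0),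
        ra := (ra h)(1 := ra h 1, 3 := ra h 3, 7 := upd_cols (ra h 7) (\<lambda>j. ra h 7 j * chi (\<lambda>_. 1) 0 j))\<rparr>"
    proof -
      have "upd_cols (ra h 7) (\<lambda>j. ra h 7 j * chi (\<lambda>_. 1) 0 j) = ra h 7" by (auto simp: upd_cols_def chi_def)
      moreover have "(hw h)(11 := 1) = hw h" using v by (simp add: fun_upd_idem_iff)
      ultimately show ?thesis by simp
    qed
    ultimately show "Inv 0 h" unfolding Inv_def using sp(2) by blast
  qed (use X1 in auto)
  then show ?thesis
    by (rule hx_mono) (use Q in \<open>auto simp: Inv_def\<close>)
qed

section \<open>From the folded tree to one step of the walk\<close>

lemma lev_sum: "(\<Sum>y\<in>lev H c. g y) = (\<Sum>j<2 ^ (H - c). g (2 ^ (H - c) + j))" for g :: "nat \<Rightarrow> real"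
proof -
  let ?M = "2 ^ (H - c) :: nat"
  have "(\<Sum>y\<in>{?M..<?M + ?M}. g y) = (\<Sum>j<?M. g (?M + j))"
    by (simp add: sum.shift_bounds_nat_ivl[of _ 0 ?M ?M, simplified] atLeast0LessThan add.commute)
  then show ?thesis by (simp add: lev_def mult_2)
qed

lemma sum_lessThan_mult: "(\<Sum>x<C * M. g x) = (\<Sum>y<C. \<Sum>j<M. g (y * M + j))" for g :: "nat \<Rightarrow> real"
proof (induction C)
  case (Suc C)
  have "(\<Sum>x<Suc C * M. g x) = (\<Sum>x<C * M + M. g x)" by (simp add: add.commute)
  then show ?case using Suc by (simp only: sum_lessThan_add sum.lessThan_Suc)
qed simp

lemma lev0_sum: "(\<Sum>x\<in>lev (2 * L) 0. g x) = (\<Sum>r<2 ^ L. \<Sum>j<2 ^ L. g ((2 ^ L + r) * 2 ^ L + j))" for g :: "nat \<Rightarrow> real"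
proof -
  have "(\<Sum>x\<in>lev (2 * L) 0. g x) = (\<Sum>x<2 ^ L * 2 ^ L. g (2 ^ L * 2 ^ L + x))"
    unfolding lev_sum by (simp add: PP)
  also have "\<dots> = (\<Sum>r<2 ^ L. \<Sum>j<2 ^ L. g (2 ^ L * 2 ^ L + (r * 2 ^ L + j)))" by (rule sum_lessThan_mult)
  finally show ?thesis by (simp add: distrib_right add.assoc)
qed

text \<open>Blocks beyond row 2 m + n contain no entries; this cuts sums over all 2^L blocks down to
  the genuine rows.\<close>

lemma upd_leaf_out:
  assumes f: "sparse f" and r: "2 * m + n \<le> r" "r < 2 ^ L" and j: "j < 2 ^ L"
  shows "upd_leaf E f V ((2 ^ L + r) * 2 ^ L + j) = 0"
proof -
  let ?x = "(2 ^ L + r) * 2 ^ L + j"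
  have nl: "?x \<notin> leaf ` {..<E}"
  proof
    assume "?x \<in> leaf ` {..<E}"
    then obtain e where e: "e < E" "leaf e = ?x" by auto
    then have "rw e = r" using leaf_parts[OF e(1)] block_parts(1)[OF j, of r] by simp
    then show False using rw_less[OF e(1)] r by simp
  qed
  have "(r + 1) * 2 ^ L \<le> 2 ^ L * 2 ^ L" using r by (intro mult_le_mono1) simp
  then have "?x \<in> lev (2 * L) 0" unfolding leaf_block_index using j by (simp add: lev_def PP)
  then have "own ?x = 0" "1 \<le> ?x" "?x < 2 * 2 ^ (2 * L)" using own_none[OF _ nl] lev_bound by blast+
  then have "f ?x = 0" using f unfolding sparse_def by blast
  then show ?thesis using nl by (simp add: upd_leaf_def)
qed

lemma bval0_zero:
  "\<lbrakk>1 \<le> j; r < 2 * m; a (r mod m) j = 0\<rbrakk> \<Longrightarrow> bval0 W p r j = 0"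
  "\<lbrakk>1 \<le> j; 2 * m \<le> r; j \<noteq> r - 2 * m + 1\<rbrakk> \<Longrightarrow> bval0 W p r j = 0"
  by (auto simp: bval0_def bval_def coef_def)

text \<open>At level L every node is a whole row. Column 0 always has sign 1 and contributes its
  constant 1/2, so the square is (1/2 + y)^2, with mean 1/4 + \<Sum> \<beta>^2; the chosen signs do
  no worse than this mean.\<close>

lemma fold_result:
  assumes F: "folded L w (upd_leaf E f (bval0 W p)) \<sigma> F" and f: "sparse f"
  shows "\<And>r. r < 2 * m + n \<Longrightarrow> F (2 ^ L + r) = 1 / 2 + (\<Sum>j=1..n. chi \<sigma> L j * bval W p r j)"
    and "(\<Sum>r<2 * m + n. w (2 ^ L + r) * (F (2 ^ L + r))\<^sup>2) \<le>
      (\<Sum>r<2 * m + n. w (2 ^ L + r) * (1 / 4 + (\<Sum>j=1..n. (bval W p r j)\<^sup>2)))"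
proof -
  let ?f = "upd_leaf E f (bval0 W p)"
  have blk: "F (2 ^ L + r) = (\<Sum>j<2 ^ L. chi \<sigma> L j * ?f ((2 ^ L + r) * 2 ^ L + j))" if r: "r < 2 ^ L" for r
  proof -
    have "F (2 ^ L + r) = (\<Sum>j<2 ^ L. chi \<sigma> L j * F ((2 ^ L + r) * 2 ^ L + j))"
    proof (rule fold_block)
      fix t z assume t: "t < L" "(2 ^ L + r) * 2 ^ (L - Suc t) \<le> z" "z < (2 ^ L + r + 1) * 2 ^ (L - Suc t)"
      have e: "2 ^ L * 2 ^ (L - Suc t) = (2::nat) ^ (2 * L - Suc t)" using t(1) by (simp flip: power_add)
      have "2 ^ L * 2 ^ (L - Suc t) \<le> (2 ^ L + r) * (2::nat) ^ (L - Suc t)" by (intro mult_le_mono1) simp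
      moreover have "(2 ^ L + r + 1) * 2 ^ (L - Suc t) \<le> 2 * 2 ^ L * (2::nat) ^ (L - Suc t)"
        using r by (intro mult_le_mono1) simp
      ultimately have "z \<in> lev (2 * L) (Suc t)" using t e by (simp add: lev_def)
      then show "F z = F (2 * z) + \<sigma> t * F (2 * z + 1)" using F t(1) unfolding folded_def by blast
    qed
    also have "\<dots> = (\<Sum>j<2 ^ L. chi \<sigma> L j * ?f ((2 ^ L + r) * 2 ^ L + j))"
    proof (rule sum.cong[OF refl])
      fix j :: nat assume j: "j \<in> {..<2 ^ L}"
      have "(r + 1) * 2 ^ L \<le> 2 ^ L * 2 ^ L" using r by (intro mult_le_mono1) simp
      then have "(2 ^ L + r) * 2 ^ L + j \<in> lev (2 * L) 0" unfolding leaf_block_index using j by (simp add: lev_def PP)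
      then show "chi \<sigma> L j * F ((2 ^ L + r) * 2 ^ L + j) = chi \<sigma> L j * ?f ((2 ^ L + r) * 2 ^ L + j)"
        using F unfolding folded_def by simp
    qed
    finally show ?thesis .
  qed
  have fb: "?f ((2 ^ L + r) * 2 ^ L + j) = (if j \<le> n then bval0 W p r j else 0)" if "r < 2 * m + n" "j < 2 ^ L" for r j
    by (rule upd_leaf_block[OF f that]) (auto intro: bval0_zero)
  have RL: "2 * m + n \<le> 2 ^ L" using size by simp
  show "F (2 ^ L + r) = 1 / 2 + (\<Sum>j=1..n. chi \<sigma> L j * bval W p r j)" if r: "r < 2 * m + n" for r
  proof -
    have "r < 2 ^ L" using r RL by simp
    from blk[OF this] have "F (2 ^ L + r) = (\<Sum>j<2 ^ L. chi \<sigma> L j * ?f ((2 ^ L + r) * 2 ^ L + j))" .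
    also have "\<dots> = chi \<sigma> L 0 * bval0 W p r 0 + (\<Sum>j=1..n. chi \<sigma> L j * bval0 W p r j)"
      by (rule sum_cols0) (use fb[OF r] in auto)
    also have "(\<Sum>j=1..n. chi \<sigma> L j * bval0 W p r j) = (\<Sum>j=1..n. chi \<sigma> L j * bval W p r j)"
      by (rule sum.cong) (auto simp: bval0_def)
    also have "chi \<sigma> L 0 * bval0 W p r 0 = 1 / 2" by (simp add: bval0_def chi_def)
    finally show ?thesis .
  qed
  have Fout: "F (2 ^ L + r) = 0" if "2 * m + n \<le> r" "r < 2 ^ L" for r
    unfolding blk[OF that(2)] using upd_leaf_out[OF f that] by simp
  have "(\<Sum>y\<in>lev (2 * L) L. w (y div 2 ^ (L - L)) * (F y)\<^sup>2) = (\<Sum>r<2 ^ L. w (2 ^ L + r) * (F (2 ^ L + r))\<^sup>2)"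
    unfolding lev_sum by simp
  also have "\<dots> = (\<Sum>r<2 * m + n. w (2 ^ L + r) * (F (2 ^ L + r))\<^sup>2)"
    by (rule sum.mono_neutral_right) (use RL Fout in auto)
  finally have lhs: "(\<Sum>y\<in>lev (2 * L) L. w (y div 2 ^ (L - L)) * (F y)\<^sup>2) =
      (\<Sum>r<2 * m + n. w (2 ^ L + r) * (F (2 ^ L + r))\<^sup>2)" .
  let ?g = "\<lambda>r. \<Sum>j<2 ^ L. w (((2 ^ L + r) * 2 ^ L + j) div 2 ^ L) * (?f ((2 ^ L + r) * 2 ^ L + j))\<^sup>2"
  have "(\<Sum>x\<in>lev (2 * L) 0. w (x div 2 ^ L) * (?f x)\<^sup>2) = (\<Sum>r<2 ^ L. ?g r)" by (rule lev0_sum)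
  also have "\<dots> = (\<Sum>r<2 * m + n. ?g r)"
    by (rule sum.mono_neutral_right) (use RL upd_leaf_out[OF f] in auto)
  also have "\<dots> = (\<Sum>r<2 * m + n. w (2 ^ L + r) * (1 / 4 + (\<Sum>j=1..n. (bval W p r j)\<^sup>2)))"
  proof (rule sum.cong[OF refl])
    fix r assume "r \<in> {..<2 * m + n}"
    then have r: "r < 2 * m + n" by simp
    have "?g r = w (2 ^ L + r) * (bval0 W p r 0)\<^sup>2 + (\<Sum>j=1..n. w (2 ^ L + r) * (bval0 W p r j)\<^sup>2)"
      by (rule sum_cols0) (use fb[OF r] block_parts(1) in auto)
    then show "?g r = w (2 ^ L + r) * (1 / 4 + (\<Sum>j=1..n. (bval W p r j)\<^sup>2))"
      by (simp add: bval0_def sum_distrib_left distrib_left power2_eq_square)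
  qed
  finally show "(\<Sum>r<2 * m + n. w (2 ^ L + r) * (F (2 ^ L + r))\<^sup>2) \<le>
      (\<Sum>r<2 * m + n. w (2 ^ L + r) * (1 / 4 + (\<Sum>j=1..n. (bval W p r j)\<^sup>2)))"
    using F lhs unfolding folded_def by simp
qed

lemma square_sum:
  assumes S: "summed 0 (upd_leaf E f (\<lambda>r j. bval0 W p r j * bval0 W p r j)) S" and f: "sparse f" and r: "r < 2 * m + n"
  shows "S (2 ^ L + r) = 1 / 4 + (\<Sum>j=1..n. (bval W p r j)\<^sup>2)"
proof -
  let ?f = "upd_leaf E f (\<lambda>r j. bval0 W p r j * bval0 W p r j)"
  have "S (2 ^ L + r) = (\<Sum>j<2 ^ L. ?f ((2 ^ L + r) * 2 ^ L + j))"
    using summed_block[OF S row_lev[OF r]] by simp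
  also have "\<dots> = bval0 W p r 0 * bval0 W p r 0 + (\<Sum>j=1..n. bval0 W p r j * bval0 W p r j)"
  proof (rule sum_cols0)
    fix j :: nat assume "j < 2 ^ L"
    then show "?f ((2 ^ L + r) * 2 ^ L + j) = (if j \<le> n then bval0 W p r j * bval0 W p r j else 0)"
      by (rule upd_leaf_block[OF f r]) (use bval0_zero in auto)
  qed
  also have "(\<Sum>j=1..n. bval0 W p r j * bval0 W p r j) = (\<Sum>j=1..n. (bval W p r j)\<^sup>2)"
    by (rule sum.cong) (auto simp: bval0_def power2_eq_square)
  finally show ?thesis by (simp add: bval0_def)
qed

text \<open>The normalised weight w is W divided by 3/4 + 1/4 + \<Sum> \<beta>^2. Adding 3/4 w on
  both sides of the folded inequality turns its right side into the old total weight, its left side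
  into the new one.\<close>

lemma step_ok_fold:
  assumes F: "folded L w (upd_leaf E f (bval0 W p)) \<sigma> F" and f: "sparse f"
    and w: "\<And>r. r < 2 * m + n \<Longrightarrow> w (2 ^ L + r) = W r / (3/4 + (1/4 + (\<Sum>j=1..n. (bval W p r j)\<^sup>2)))"
    and p': "\<And>j. \<lbrakk>1 \<le> j; j \<le> n\<rbrakk> \<Longrightarrow> p' j = p j + p j * (1 - p j) / real KN * chi \<sigma> L j"
    and W': "\<And>r. r < 2 * m + n \<Longrightarrow> W' r = w (2 ^ L + r) * (3/4 + F (2 ^ L + r) * F (2 ^ L + r))"
  shows "step_ok p W p' W' (chi \<sigma> L)"
  unfolding step_ok_def
proof (intro conjI allI impI)
  fix j assume j: "1 \<le> j" "j \<le> n"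
  show "chi \<sigma> L j = 1 \<or> chi \<sigma> L j = - 1" by (rule chi_square) (use F in \<open>auto simp: folded_def\<close>)
  show "p' j = p j + chi \<sigma> L j * (p j * (1 - p j) / real KN)" using p'[OF j] by (simp add: mult.commute)
next
  fix r assume r: "r < 2 * m + n"
  show "W' r = W r / (3/4 + (1/4 + (\<Sum>j=1..n. (bval W p r j)\<^sup>2))) *
      (3/4 + (1/2 + (\<Sum>j=1..n. chi \<sigma> L j * bval W p r j))\<^sup>2)"
    unfolding W'[OF r] w[OF r] fold_result(1)[OF F f r] power2_eq_square ..
next
  have "(\<Sum>r<2 * m + n. W' r) = (\<Sum>r<2 * m + n. 3/4 * w (2 ^ L + r)) + (\<Sum>r<2 * m + n. w (2 ^ L + r) * (F (2 ^ L + r))\<^sup>2)"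
    unfolding sum.distrib[symmetric] by (rule sum.cong) (auto simp: W' power2_eq_square distrib_left)
  also have "\<dots> \<le> (\<Sum>r<2 * m + n. 3/4 * w (2 ^ L + r)) +
      (\<Sum>r<2 * m + n. w (2 ^ L + r) * (1 / 4 + (\<Sum>j=1..n. (bval W p r j)\<^sup>2)))"
    using fold_result(2)[OF F f] by simp
  also have "\<dots> = (\<Sum>r<2 * m + n. W r)"
    unfolding sum.distrib[symmetric]
  proof (rule sum.cong[OF refl])
    fix r assume "r \<in> {..<2 * m + n}"
    then have r: "r < 2 * m + n" by simp
    let ?S = "\<Sum>j=1..n. (bval W p r j)\<^sup>2"
    have S: "0 \<le> ?S" by (intro sum_nonneg) simp
    have "3/4 * w (2 ^ L + r) + w (2 ^ L + r) * (1/4 + ?S) = w (2 ^ L + r) * (3/4 + (1/4 + ?S))"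
      by (simp add: algebra_simps)
    also have "\<dots> = W r" unfolding w[OF r] using S by simp
    finally show "3/4 * w (2 ^ L + r) + w (2 ^ L + r) * (1/4 + ?S) = W r" .
  qed
  finally show "(\<Sum>r<2 * m + n. W' r) \<le> (\<Sum>r<2 * m + n. W r)" .
qed

lemma hx_iter:
  assumes h: "ready h" and t: "hw h 13 = t" "t + 1 < B"
    and Q: "\<And>h' s. \<lbrakk>ready h'; hw h' 13 = t + 1; step_ok (ra h 6) (Wof h) (ra h' 6) (Wof h') s\<rbrakk> \<Longrightarrow> Q h'"
  shows "hx B Z X c_iter h (iter_depth L) Q"
  unfolding c_iter_def
proof (rule hx_Seq)
  let ?c9 = "Seq c_pp (wset 13 (WR 13 [+] WC 1))"
  let ?d9 = "1000 + 10 :: nat"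
  let ?c8 = "Seq c_W ?c9"
  let ?d8 = "1000 + ?d9"
  let ?c7 = "Seq c_fold ?c8"
  let ?d7 = "fold_depth L + ?d8"
  let ?c6 = "Seq (wset 11 (WC 1)) ?c7"
  let ?d6 = "3 + ?d7"
  let ?c5 = "Seq c_ds ?c6"
  let ?d5 = "1000 + ?d6"
  let ?c4 = "Seq c_om ?c5"
  let ?d4 = "1000 + ?d5"
  let ?c3 = "Seq (sumup 2) ?c4"
  let ?d3 = "(1 + 2 * L * 300) + ?d4"
  let ?c2 = "Seq (wset 12 (WC 1)) ?c3"
  let ?d2 = "3 + ?d3"
  let ?c1 = "Seq c_sq ?c2"
  let ?d1 = "1000 + ?d2"
  let ?b = "bval0 (Wof h) (ra h 6)"
  let ?f1 = "upd_leaf E (ra h 1) ?b" and ?f2 = "upd_leaf E (ra h 2) (\<lambda>r j. ?b r j * ?b r j)"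
  let ?h1 = "h\<lparr>ra := (ra h)(1 := ?f1)\<rparr>"
  have st: "stat h" and sp: "sparse (ra h 1)" "sparse (ra h 2)" "sparse (ra h 3)"
    and cf: "ra h 0 = upd_leaf (2 * N) (\<lambda>_. 0) coef" using h by (simp_all add: ready_def)
  have spf: "sparse ?f1" "sparse ?f2" using sp by (auto intro: sparse_upd_leaf)
  show "hx B Z X c_val h 1000 (\<lambda>h'. h' = ?h1)" by (rule hx_val[OF h]) simp
  fix h1 assume h1: "h1 = ?h1"
  have st1: "stat h1" using st h1 by (simp add: stat_def scal_def)
  let ?h2 = "h1\<lparr>ra := (ra h1)(2 := ?f2)\<rparr>"
  show "hx B Z X ?c1 h1 ?d1 Q"
  proof (rule hx_Seq)
    show "hx B Z X c_sq h1 1000 (\<lambda>h'. h' = ?h2)"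
      by (rule hx_sq[OF st1, where f = "ra h 1" and V = ?b]) (simp_all add: h1)
    fix h2 assume h2: "h2 = ?h2"
    let ?h3 = "h2\<lparr>hw := (hw h2)(12 := 1)\<rparr>"
    show "hx B Z X ?c2 h2 ?d2 Q"
    proof (rule hx_Seq)
      show "hx B Z X (wset 12 (WC 1)) h2 3 (\<lambda>h'. h' = ?h3)"
        by (rule hx_wset_le) (use X1 lt_B in auto)
      fix h3 assume h3: "h3 = ?h3"
      have st3: "stat h3" using st1 h3 h2 by (simp add: stat_def scal_def)
      let ?Q4 = "\<lambda>h'. \<exists>S. h' = h3\<lparr>hw := (hw h3)(12 := 2 ^ (2 * L)), ra := (ra h3)(2 := S)\<rparr> \<and> summed 0 ?f2 S"
      show "hx B Z X ?c3 h3 ?d3 Q"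
      proof (rule hx_Seq)
        show "hx B Z X (sumup 2) h3 (1 + 2 * L * 300) ?Q4"
        proof (rule hx_sumup[where c = 0])
          show "treest h3" by (rule stat_treest[OF st3])
          fix S assume "summed 0 (ra h3 2) S"
          then have "summed 0 ?f2 S" using h3 h2 by simp
          then show "?Q4 (h3\<lparr>hw := (hw h3)(12 := 2 ^ (2 * L)), ra := (ra h3)(2 := S)\<rparr>)" by blast
        qed (use h3 h2 spf in simp_all)
        fix h4 assume "?Q4 h4"
        then obtain S where h4: "h4 = h3\<lparr>hw := (hw h3)(12 := 2 ^ (2 * L)), ra := (ra h3)(2 := S)\<rparr>"
          and S: "summed 0 ?f2 S" by blast
        have st4: "stat h4" using st3 h4 by (simp add: stat_def scal_def)
        let ?om = "upd_rows (2 * m + n) (ra h 5) (\<lambda>r. Wof h r / (3/4 + S (2 ^ L + r)))"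
        let ?h5 = "h4\<lparr>ra := (ra h4)(5 := ?om)\<rparr>"
        show "hx B Z X ?c4 h4 ?d4 Q"
        proof (rule hx_Seq)
          show "hx B Z X c_om h4 1000 (\<lambda>h'. h' = ?h5)"
            by (rule hx_om[OF st4]) (simp add: h4 h3 h2 h1)
          fix h5 assume h5: "h5 = ?h5"
          have st5: "stat h5" using st4 h5 by (simp add: stat_def scal_def)
          let ?ds = "upd_cols (ra h 7) (\<lambda>j. ra h 6 j * (1 - ra h 6 j) / real KN)"
          let ?h6 = "h5\<lparr>ra := (ra h5)(7 := ?ds)\<rparr>"
          show "hx B Z X ?c5 h5 ?d5 Q"
          proof (rule hx_Seq)
            show "hx B Z X c_ds h5 1000 (\<lambda>h'. h' = ?h6)"
              by (rule hx_ds[OF st5]) (simp add: h5 h4 h3 h2 h1)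
            fix h6 assume h6: "h6 = ?h6"
            let ?h7 = "h6\<lparr>hw := (hw h6)(11 := 1)\<rparr>"
            show "hx B Z X ?c6 h6 ?d6 Q"
            proof (rule hx_Seq)
              show "hx B Z X (wset 11 (WC 1)) h6 3 (\<lambda>h'. h' = ?h7)"
                by (rule hx_wset_le) (use X1 lt_B in auto)
              fix h7 assume h7: "h7 = ?h7"
              have st7: "stat h7" using st5 h7 h6 by (simp add: stat_def scal_def)
              have r7: "ra h7 1 = ?f1" "ra h7 2 = S" "ra h7 3 = ra h 3" "ra h7 5 = ?om" "ra h7 7 = ?ds"
                "ra h7 6 = ra h 6" "ra h7 4 = ra h 4" "ra h7 0 = ra h 0" "hw h7 13 = t"
                using t by (simp_all add: h7 h6 h5 h4 h3 h2 h1)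
              let ?Q8 = "\<lambda>h'. stat h' \<and> sparse (ra h' 3) \<and> ra h' 0 = ra h 0 \<and> ra h' 2 = S \<and> ra h' 4 = ra h 4 \<and>
                ra h' 5 = ?om \<and> ra h' 6 = ra h 6 \<and> hw h' 13 = t \<and>
                (\<exists>\<sigma>. folded L ?om ?f1 \<sigma> (ra h' 1) \<and> ra h' 7 = upd_cols ?ds (\<lambda>j. ?ds j * chi \<sigma> L j))"
              show "hx B Z X ?c7 h7 ?d7 Q"
              proof (rule hx_Seq)
                show "hx B Z X c_fold h7 (fold_depth L) ?Q8"
                proof (rule hx_fold[OF st7])
                  show "hw h7 11 = 1" by (simp add: h7)
                  show "sparse (ra h7 1)" "sparse (ra h7 3)" unfolding r7 using spf sp by simp_all
                  fix F G \<sigma> x12 x0 assume FG: "folded L (ra h7 5) (ra h7 1) \<sigma> F" "sparse G"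
                  let ?h8 = "h7\<lparr>hw := (hw h7)(11 := 2 ^ L, 12 := x12), hr := (hr h7)(0 := x0),
                    ra := (ra h7)(1 := F, 3 := G, 7 := upd_cols (ra h7 7) (\<lambda>j. ra h7 7 j * chi \<sigma> L j))\<rparr>"
                  have "stat ?h8" using st7 by (simp add: stat_def scal_def)
                  moreover have "folded L ?om ?f1 \<sigma> (ra ?h8 1)" using FG(1) unfolding r7 by simp
                  ultimately show "?Q8 ?h8" using FG(2) by (auto simp: r7)
                qed
                fix h8 assume h8: "?Q8 h8"
                then obtain \<sigma> where F: "folded L ?om ?f1 \<sigma> (ra h8 1)"
                  and d8: "ra h8 7 = upd_cols ?ds (\<lambda>j. ?ds j * chi \<sigma> L j)" by blast
                let ?h9 = "h8\<lparr>ra := (ra h8)(4 := upd_rows (2 * m + n) (ra h8 4)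
                  (\<lambda>r. ra h8 5 (2 ^ L + r) * (3/4 + ra h8 1 (2 ^ L + r) * ra h8 1 (2 ^ L + r))))\<rparr>"
                show "hx B Z X ?c8 h8 ?d8 Q"
                proof (rule hx_Seq)
                  show "hx B Z X c_W h8 1000 (\<lambda>h'. h' = ?h9)" by (rule hx_W) (use h8 in simp_all)
                  fix h9 assume h9: "h9 = ?h9"
                  have st9: "stat h9" using h8 h9 by (simp add: stat_def scal_def)
                  let ?h10 = "h9\<lparr>ra := (ra h9)(6 := upd_cols (ra h9 6) (\<lambda>j. ra h9 6 j + ra h9 7 j))\<rparr>"
                  show "hx B Z X ?c9 h9 ?d9 Q"
                  proof (rule hx_Seq)
                    show "hx B Z X c_pp h9 1000 (\<lambda>h'. h' = ?h10)" by (rule hx_pp[OF st9]) simp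
                    fix h10 assume h10: "h10 = ?h10"
                    let ?h11 = "h10\<lparr>hw := (hw h10)(13 := t + 1)\<rparr>"
                    have t10: "hw h10 13 = t" using h8 by (simp add: h10 h9)
                    have "Q ?h11"
                    proof (rule Q)
                      have "stat ?h11" using st9 by (simp add: h10 stat_def scal_def)
                      moreover have "sparse S" using S by (simp add: summed_def)
                      moreover have "sparse (ra h8 1)" using F by (simp add: folded_def)
                      ultimately show "ready ?h11" unfolding ready_def using h8 cf by (simp add: h10 h9)
                      show "hw ?h11 13 = t + 1" by simp
                      show "step_ok (ra h 6) (Wof h) (ra ?h11 6) (Wof ?h11) (chi \<sigma> L)"
                      proof (rule step_ok_fold[OF F sp(1)])
                        fix r assume r: "r < 2 * m + n"
                        show "?om (2 ^ L + r) = Wof h r / (3/4 + (1/4 + (\<Sum>j=1..n. (bval (Wof h) (ra h 6) r j)\<^sup>2)))"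
                          using r square_sum[OF S sp(2) r] by (simp add: upd_rows_def)
                        show "Wof ?h11 r = ?om (2 ^ L + r) * (3/4 + ra h8 1 (2 ^ L + r) * ra h8 1 (2 ^ L + r))"
                          using r h8 by (simp add: h10 h9 upd_rows_def)
                      next
                        fix j assume j: "1 \<le> j" "j \<le> n"
                        show "ra ?h11 6 j = ra h 6 j + ra h 6 j * (1 - ra h 6 j) / real KN * chi \<sigma> L j"
                          using j h8 d8 by (simp add: h10 h9 upd_cols_def)
                      qed
                    qed
                    then show "hx B Z X (wset 13 (WR 13 [+] WC 1)) h10 10 Q"
                      using t10 t lt_B X1 by (intro hx_wset_le) simp_all
                  qed
                qed
              qed
            qed
          qed
        qed
      qed
    qed
  qed
qed

end

definition c_loop :: com where "c_loop = Seq (wset 13 (WC 0)) (While (WLess 13 14) c_iter)"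

definition qout :: wexp where "qout = WIf (TR (RA 6 (idx [+] WC 1)) halfexp) (WC 0) (WC 1)"

definition bout :: wexp where
  "bout = WIf (TR (RA 4 (vP [+] idx)) (rc 1)) (WIf (TR (RA 4 (vP [+] (vm [+] idx))) (rc 1)) (WC 0) (WC 1)) (WC 1)"

definition c_out :: com where
  "c_out = Seq (ParFor 10 1 (gbody true (SWM idx qout))) (ParFor 10 2 (gbody true (SWM (vn [+] idx) bout)))"

context prog_data
begin

text \<open>Quantifying over all admissible bounds \<open>pb\<close> keeps the analysis of the
  program free of the extended reals in the target probability, which is inserted only at the
  end.\<close>

definition solved :: "(nat \<Rightarrow> nat) \<Rightarrow> bool" where
  "solved w \<longleftrightarrow> (\<forall>j<n. w j = 0 \<or> w j = 1) \<and>
     (\<forall>i<m. w (n + i) = 0 \<longrightarrow> \<bar>\<Sum>j<n. a i (j + 1) * (p0 (j + 1) - real (w j))\<bar> \<le> \<Delta> i) \<and>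
     (\<forall>pb. (\<forall>i<m. 0 \<le> pb i) \<longrightarrow> (\<forall>i<m. lam i * \<Delta> i < real (4 * (L + 5)) \<longrightarrow> 16 * exp (- (lam i * \<Delta> i / 8)) \<le> pb i) \<longrightarrow>
       real (card {i. i < m \<and> w (n + i) \<noteq> 0}) \<le> (\<Sum>i<m. pb i))"

end

context prog_own
begin

text \<open>The analysis of the walk speaks about the entire history, of which memory keeps only the
  last state; the history is existentially quantified and extended by one entry per pass.\<close>

definition rounded :: "(nat \<Rightarrow> real) \<Rightarrow> (nat \<Rightarrow> real) \<Rightarrow> bool" where
  "rounded p W \<longleftrightarrow> (\<exists>ps Ws ss. rounding_run n m k L a p0 \<Delta> KN T ps Ws ss (\<lambda>t r j. bval (Ws t) (ps t) r j) \<and>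
     ps T = p \<and> Ws T = W)"

lemma rounding_run_steps:
  assumes p: "\<And>j. \<lbrakk>1 \<le> j; j \<le> n\<rbrakk> \<Longrightarrow> ps 0 j = p0 j" and W: "\<And>r. r < 2 * m + n \<Longrightarrow> Ws 0 r = wgt r"
    and st: "\<And>t. t < T \<Longrightarrow> step_ok (ps t) (Ws t) (ps (Suc t)) (Ws (Suc t)) (ss t)"
  shows "rounding_run n m k L a p0 \<Delta> KN T ps Ws ss (\<lambda>t r j. bval (Ws t) (ps t) r j)"
proof unfold_locales
  show "3 \<le> real KN" by (simp add: KN_eq)
  show "2 * (real k + real (4 * (L + 5))) \<le> real KN" by (simp add: KN_eq)
  fix t assume t: "t < T"
  note s = st[OF t, unfolded step_ok_def]
  show "(\<Sum>r<2 * m + n. Ws (Suc t) r) \<le> (\<Sum>r<2 * m + n. Ws t r)" using s by blast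
  { fix j assume j: "1 \<le> j" "j \<le> n"
    show "ss t j = 1 \<or> ss t j = - 1" "ps (Suc t) j = ps t j + ss t j * (ps t j * (1 - ps t j) / real KN)"
      using s j by blast+
    fix r
    show "bval (Ws t) (ps t) r j =
      (if r < 2 * m then if Ws t r < 1 then ps t j * (1 - ps t j) / real KN * (coef r j - 4 * (coef r j)\<^sup>2 * ps t j) else 0
       else if j = r - 2 * m + 1 then (1 - 2 * ps t j) / (2 * real KN) else 0)"
      by (simp add: bval_def) }
  fix r assume "r < 2 * m + n"
  then show "Ws (Suc t) r = Ws t r / (3/4 + (1/4 + (\<Sum>j=1..n. (bval (Ws t) (ps t) r j)\<^sup>2))) *
      (3/4 + (1/2 + (\<Sum>j=1..n. ss t j * bval (Ws t) (ps t) r j))\<^sup>2)" using s by blast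
next
  fix r assume "r < 2 * m + n"
  then show "0 < Ws 0 r" using W[of r] by (simp add: wgt_def)
qed (use p p01 W coef_abs KN_eq T_eq in auto)

lemma hx_loop:
  assumes h: "ready h" and W: "\<And>r. r < 2 * m + n \<Longrightarrow> Wof h r = wgt r"
    and p: "\<And>j. \<lbrakk>1 \<le> j; j \<le> n\<rbrakk> \<Longrightarrow> ra h 6 j = p0 j"
    and Q: "\<And>h'. \<lbrakk>ready h'; rounded (ra h' 6) (Wof h')\<rbrakk> \<Longrightarrow> Q h'"
  shows "hx B Z X c_loop h (3 + (1 + T * (iter_depth L + 1))) Q"
  unfolding c_loop_def
proof (rule hx_Seq)
  let ?h1 = "h\<lparr>hw := (hw h)(13 := 0)\<rparr>"
  show "hx B Z X (wset 13 (WC 0)) h 3 (\<lambda>h'. h' = ?h1)"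
    by (rule hx_wset_le) (use X1 lt_B in auto)
  fix h1 assume h1: "h1 = ?h1"
  define Inv where "Inv t h' \<longleftrightarrow> ready h' \<and> hw h' 13 = t \<and> (\<exists>ps Ws ss. (\<forall>j. 1 \<le> j \<longrightarrow> j \<le> n \<longrightarrow> ps 0 j = p0 j) \<and>
     (\<forall>r<2 * m + n. Ws 0 r = wgt r) \<and> ps t = ra h' 6 \<and> Ws t = Wof h' \<and>
     (\<forall>u<t. step_ok (ps u) (Ws u) (ps (Suc u)) (Ws (Suc u)) (ss u)))" for t h'
  have T14: "hw h' 14 = T" if "ready h'" for h' using that by (simp add: ready_def stat_def scal_def)
  have "hx B Z X (While (WLess 13 14) c_iter) h1 (1 + T * (iter_depth L + 1)) (Inv T)"
  proof (rule hx_While)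
    fix t h' assume t: "t < T" and I: "Inv t h'"
    then obtain ps Ws ss where r: "ready h'" "hw h' 13 = t"
      and ps: "\<And>j. 1 \<le> j \<Longrightarrow> j \<le> n \<Longrightarrow> ps 0 j = p0 j" "\<And>r. r < 2 * m + n \<Longrightarrow> Ws 0 r = wgt r"
        "ps t = ra h' 6" "Ws t = Wof h'"
      and st: "\<And>u. u < t \<Longrightarrow> step_ok (ps u) (Ws u) (ps (Suc u)) (Ws (Suc u)) (ss u)"
      unfolding Inv_def by blast
    have lt: "hw h' 13 < hw h' 14" using t r T14[OF r(1)] by simp
    have tB: "t + 1 < B" using t BB(2) by linarith
    have "hx B Z X c_iter h' (iter_depth L) (Inv (Suc t))"
    proof (rule hx_iter[OF r tB])
      fix h'' s assume h'': "ready h''" "hw h'' 13 = t + 1" "step_ok (ra h' 6) (Wof h') (ra h'' 6) (Wof h'') s"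
      show "Inv (Suc t) h''" unfolding Inv_def
      proof (rule conjI, rule h'', rule conjI, use h'' in simp, rule exI[of _ "ps(Suc t := ra h'' 6)"],
          rule exI[of _ "Ws(Suc t := Wof h'')"], rule exI[of _ "ss(t := s)"], intro conjI allI impI)
        fix u assume u: "u < Suc t"
        show "step_ok ((ps(Suc t := ra h'' 6)) u) ((Ws(Suc t := Wof h'')) u) ((ps(Suc t := ra h'' 6)) (Suc u))
           ((Ws(Suc t := Wof h'')) (Suc u)) ((ss(t := s)) u)"
          using u h''(3) st[of u] ps(3,4) by (cases "u = t") simp_all
      qed (use h'' ps in simp_all)
    qed
    then show "hw h' 13 < hw h' 14 \<and> hx B Z X c_iter h' (iter_depth L) (Inv (Suc t))" using lt by blast
  next
    fix h' assume "Inv T h'"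
    then show "\<not> hw h' 13 < hw h' 14" using T14[of h'] unfolding Inv_def by simp
  next
    have "ready h1" using h by (simp add: h1 ready_def stat_def scal_def)
    then show "Inv 0 h1" unfolding Inv_def using W p
      by (intro conjI exI[of _ "\<lambda>_. ra h1 6"] exI[of _ "\<lambda>_. Wof h1"]) (simp_all add: h1)
  qed (use X1 in auto)
  then show "hx B Z X (While (WLess 13 14) c_iter) h1 (1 + T * (iter_depth L + 1)) Q"
  proof (rule hx_mono)
    fix h' assume "Inv T h'"
    then obtain ps Ws ss where r: "ready h'"
      and ps: "\<And>j. 1 \<le> j \<Longrightarrow> j \<le> n \<Longrightarrow> ps 0 j = p0 j" "\<And>r. r < 2 * m + n \<Longrightarrow> Ws 0 r = wgt r"
        "ps T = ra h' 6" "Ws T = Wof h'"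
      and st: "\<And>u. u < T \<Longrightarrow> step_ok (ps u) (Ws u) (ps (Suc u)) (Ws (Suc u)) (ss u)"
      unfolding Inv_def by blast
    have "rounding_run n m k L a p0 \<Delta> KN T ps Ws ss (\<lambda>t r j. bval (Ws t) (ps t) r j)"
      by (rule rounding_run_steps[OF ps(1,2) st])
    then show "Q h'" using Q[OF r] ps(3,4) unfolding rounded_def by blast
  qed simp
qed

lemma solvedI:
  assumes "rounded p W"
    and q: "\<And>j. j < n \<Longrightarrow> w j = (if p (j + 1) < 1 / 2 then 0 else 1)"
    and b: "\<And>i. i < m \<Longrightarrow> w (n + i) = (if W i < 1 \<and> W (m + i) < 1 then 0 else 1)"
  shows "solved w"
proof -
  obtain ps Ws ss where run: "rounding_run n m k L a p0 \<Delta> KN T ps Ws ss (\<lambda>t r j. bval (Ws t) (ps t) r j)"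
    and T: "ps T = p" "Ws T = W" using assms(1) unfolding rounded_def by blast
  interpret run: rounding_run n m k L a p0 \<Delta> KN T ps Ws ss "\<lambda>t r j. bval (Ws t) (ps t) r j" by (rule run)
  have wq: "run.q (j + 1) = real (w j)" if "j < n" for j
    using q[OF that] by (simp add: run.q_def T)
  have S: "(\<Sum>j=1..n. a i j * (p0 j - run.q j)) = (\<Sum>j<n. a i (j + 1) * (p0 (j + 1) - real (w j)))" for i
  proof -
    have "(\<Sum>j=1..n. a i j * (p0 j - run.q j)) = (\<Sum>j<n. a i (j + 1) * (p0 (j + 1) - run.q (j + 1)))"
      by (simp add: sum.atLeast1_atMost_eq)
    also have "\<dots> = (\<Sum>j<n. a i (j + 1) * (p0 (j + 1) - real (w j)))"
      by (rule sum.cong) (use wq in auto)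
    finally show ?thesis .
  qed
  have set: "{i. i < m \<and> w (n + i) \<noteq> 0} = {i. i < m \<and> \<not> (Ws T i < 1 \<and> Ws T (m + i) < 1)}"
    using b by (auto simp: T)
  show ?thesis unfolding solved_def
  proof (intro conjI allI impI)
    fix j assume "j < n"
    then show "w j = 0 \<or> w j = 1" using q by simp
  next
    fix i assume i: "i < m" "w (n + i) = 0"
    then have "Ws T i < 1" "Ws T (m + i) < 1" using b[of i] by (auto simp: T split: if_splits)
    then show "\<bar>\<Sum>j<n. a i (j + 1) * (p0 (j + 1) - real (w j))\<bar> \<le> \<Delta> i"
      using run.good_row[OF i(1)] unfolding S by blast
  next
    fix pb :: "nat \<Rightarrow> real"
    assume "\<forall>i<m. 0 \<le> pb i" "\<forall>i<m. lam i * \<Delta> i < real (4 * (L + 5)) \<longrightarrow> 16 * exp (- (lam i * \<Delta> i / 8)) \<le> pb i"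
    then show "real (card {i. i < m \<and> w (n + i) \<noteq> 0}) \<le> (\<Sum>i<m. pb i)"
      unfolding set by (intro run.bad_count) auto
  qed
qed

lemma hx_out:
  assumes h: "ready h" and r: "rounded (ra h 6) (Wof h)" and Q: "\<And>w. solved w \<Longrightarrow> Q (h\<lparr>wraw := w\<rparr>)"
  shows "hx B Z X c_out h (1000 + 1000) Q"
  unfolding c_out_def
proof (rule hx_Seq)
  have st: "scal h" using h by (simp add: ready_def stat_def)
  note st = st[unfolded scal_def One_nat_def]
  let ?w = "\<lambda>j. if j < n then if ra h 6 (j + 1) < 1 / 2 then 0 else 1 else wraw h j"
  let ?h1 = "h\<lparr>wraw := ?w\<rparr>"
  show "hx B Z X (ParFor 10 1 (gbody true (SWM idx qout))) h 1000 (\<lambda>h'. h' = ?h1)"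
  proof (rule hx_mono[OF hx_par_raw[where N = n and g = "\<lambda>j. j" and F = ?w]])
    fix j assume j: "j < n"
    show "wv (ini h 10 j) qout = ?w j" using j by (simp add: qout_def)
    show "sok B Z (ini h 10 j) (SWM idx qout)" using col_ok[OF j] lt_B j Z_eq by (simp add: qout_def)
    fix i :: nat
    show "WRaw i \<notin> trd (ini h 10 j) true \<union> wrd (ini h 10 j) idx \<union> wrd (ini h 10 j) qout" by (simp add: qout_def)
  next
    fix l assume "\<And>i. i < n \<Longrightarrow> i \<noteq> l"
    then have "\<not> l < n" by blast
    then show "?w l = wraw h l" by simp
  qed (use st X1 lt_B in \<open>auto simp: gcost_def qout_def\<close>)
  fix h1 assume h1: "h1 = ?h1"
  let ?v = "\<lambda>x. if n \<le> x \<and> x < n + m then if Wof h (x - n) < 1 \<and> Wof h (m + (x - n)) < 1 then 0 else 1 else ?w x"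
  have Qv: "Q (h1\<lparr>wraw := ?v\<rparr>)"
  proof -
    have "solved ?v" by (rule solvedI[OF r]) auto
    then show ?thesis using Q[of ?v] h1 by simp
  qed
  show "hx B Z X (ParFor 10 2 (gbody true (SWM (vn [+] idx) bout))) h1 1000 Q"
  proof (rule hx_mono[OF hx_par_raw[where N = m and g = "\<lambda>i. n + i" and F = ?v]])
    show "hw h1 2 = m" using st h1 by simp
    fix i assume i: "i < m"
    show "wv (ini h1 10 i) (vn [+] idx) = n + i" using h1 st by simp
    show "wv (ini h1 10 i) bout = ?v (n + i)" using i h1 st by (simp add: bout_def)
    have "n + m < Z" using Z_eq by simp
    then show "sok B Z (ini h1 10 i) (SWM (vn [+] idx) bout)"
      using row_ok[of i] row_ok[of "m + i"] lt_B i h1 by (simp add: bout_def st)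
    fix j :: nat
    show "WRaw (n + j) \<notin> trd (ini h1 10 i) true \<union> wrd (ini h1 10 i) (vn [+] idx) \<union> wrd (ini h1 10 i) bout" by (simp add: bout_def)
  next
    fix l assume l: "\<And>i. i < m \<Longrightarrow> n + i \<noteq> l"
    have "\<not> (n \<le> l \<and> l < n + m)"
    proof
      assume "n \<le> l \<and> l < n + m"
      then have "l - n < m" "n + (l - n) = l" by auto
      then show False using l by blast
    qed
    then show "?v l = wraw h1 l" using h1 by auto
  qed (use X1 lt_B Qv in \<open>auto simp: gcost_def bout_def\<close>)
qed

end

section \<open>The complete algorithm\<close>

lemma hx_wset_Seq:
  assumes "wv h e = v" "wok B Z h e" "v < B" "0 < x" "x < 20" "1 \<le> X" "wcost e + 2 \<le> D1"
    "hx B Z X c (h\<lparr>hw := (hw h)(x := v)\<rparr>) D2 Q"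
  shows "hx B Z X (Seq (wset x e) c) h (D1 + D2) Q"
proof (rule hx_Seq)
  show "hx B Z X (wset x e) h D1 (\<lambda>h'. h' = h\<lparr>hw := (hw h)(x := v)\<rparr>)"
    by (rule hx_wset_le) (use assms in simp_all)
qed (use assms in simp)

text \<open>Doubling stops at the first power of two that is at least 2 m + n + 2; counting the
  doublings supplies the logarithm.\<close>

definition c_log :: com where
  "c_log = While (WLess 5 17) (Seq (wset 5 (WC 2 [*] vP)) (wset 15 (WR 15 [+] WC 1)))"

definition c_regs :: com where
  "c_regs = Seq (wset 8 (WC 2 [*] vm [+] vn)) (Seq (wset 17 (WR 8 [+] WC 2)) (Seq (wset 5 (WC 1)) (Seq (wset 15 (WC 0)) (Seq c_log
     (Seq (wset 6 (vP [*] vP)) (Seq (wset 16 (WR 15 [+] WC 5)) (Seq (wset 9 (WC 2 [*] (vk [+] WC 4 [*] vL5)))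
     (Seq (wset 14 (WC 128 [*] vK [*] vK [*] WR 15)) (Seq (wset 18 (WC 2 [*] vm)) (Seq (wset 19 (WC 2 [*] vN))
     (Seq (wset 7 (v2N [+] vn [+] WR 8)) (rset 1 (rc 1)))))))))))))"

definition c_main :: com where
  "c_main = Seq c_regs (Seq c_leaf (Seq c_own (Seq c_setup (Seq c_loop c_out))))"

text \<open>Nested exactly as sequential composition produces it, so that the assembly of the
  program needs no arithmetic.\<close>

definition main_depth :: "nat \<Rightarrow> nat \<Rightarrow> nat" where
  "main_depth L T = (50 + (50 + (50 + (50 + ((1 + L * (100 + 1)) + (50 + (50 + (50 + (50 + (50 + (50 + (50 + 50)))))))))))) +
     (1000 + ((2000 + 2 * L * 2000) + ((20000 + L * 5000) + ((3 + (1 + T * (iter_depth L + 1))) + (1000 + 1000)))))"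

context prog_data
begin

lemma hx_log:
  assumes L: "\<And>l. l < L \<Longrightarrow> 2 ^ l < 2 * m + n + 2"
    and h: "hw h 5 = 1" "hw h 15 = 0" "hw h 17 = 2 * m + n + 2"
    and Q: "Q (h\<lparr>hw := (hw h)(5 := 2 ^ L, 15 := L)\<rparr>)"
  shows "hx B Z X c_log h (1 + L * (100 + 1)) Q"
proof -
  let ?S = "\<lambda>i. h\<lparr>hw := (hw h)(5 := 2 ^ i, 15 := i)\<rparr>"
  have "hx B Z X c_log h (1 + L * (100 + 1)) (\<lambda>h'. h' = ?S L)"
    unfolding c_log_def
  proof (rule hx_While)
    fix i h' assume i: "i < L" and h': "h' = ?S i"
    have "2 ^ i \<le> (2::nat) ^ L" "2 ^ L \<le> (2::nat) ^ (2 * L)" using i by (auto intro: power_increasing)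
    then have b: "2 * 2 ^ i < B" "(2::nat) ^ i < B" "2 < B" using BB(1) by linarith+
    have "i < 2 ^ i" by simp
    then have ib: "i + 1 < B" using b by linarith
    have "hx B Z X (Seq (wset 5 (WC 2 [*] vP)) (wset 15 (WR 15 [+] WC 1))) h' (50 + 50) (\<lambda>h''. h'' = ?S (Suc i))"
    proof (rule hx_wset_Seq[where v = "2 ^ Suc i"])
      show "hx B Z X (wset 15 (WR 15 [+] WC 1)) (h'\<lparr>hw := (hw h')(5 := 2 ^ Suc i)\<rparr>) 50 (\<lambda>h''. h'' = ?S (Suc i))"
        by (rule hx_wset_le) (use h' ib b X1 in \<open>simp_all add: fun_upd_twist\<close>)
    qed (use h' b X1 in simp_all)
    then show "hw h' 5 < hw h' 17 \<and> hx B Z X (Seq (wset 5 (WC 2 [*] vP)) (wset 15 (WR 15 [+] WC 1))) h' 100 (\<lambda>h''. h'' = ?S (Suc i))"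
      using L[OF i] h h' by simp
  next
    fix h' assume "h' = ?S L"
    then show "\<not> hw h' 5 < hw h' 17" using size h by simp
  next
    have "(hw h)(5 := Suc 0, 15 := 0) = hw h" using h by (simp add: fun_upd_idem)
    then show "h = ?S 0" by simp
  qed (use X1 in auto)
  then show ?thesis by (rule hx_mono) (use Q in auto)
qed

lemma L_pos: "1 \<le> L"
proof (rule ccontr)
  assume "\<not> 1 \<le> L"
  then have "L = 0" by simp
  then show False using size n1 by simp
qed

lemma hx_regs:
  assumes L: "\<And>l. l < L \<Longrightarrow> 2 ^ l < 2 * m + n + 2"
    and h: "hw h 0 = Z" "hw h 1 = n" "hw h 2 = m" "hw h 3 = k" "hw h 4 = N" "wraw h = iw" "rraw h = ir"
    and Q: "\<And>f g. scal (h\<lparr>hw := f, hr := g\<rparr>) \<Longrightarrow> Q (h\<lparr>hw := f, hr := g\<rparr>)"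
  shows "hx B Z X c_regs h
    (50 + (50 + (50 + (50 + ((1 + L * (100 + 1)) + (50 + (50 + (50 + (50 + (50 + (50 + (50 + 50)))))))))))) Q"
proof -
  define f1 where "f1 = (hw h)(8 := 2 * m + n)"
  define f2 where "f2 = f1(17 := 2 * m + n + 2)"
  define f3 where "f3 = f2(5 := 1)"
  define f4 where "f4 = f3(15 := 0)"
  define f5 where "f5 = f4(5 := 2 ^ L, 15 := L)"
  define f6 where "f6 = f5(6 := 2 ^ (2 * L))"
  define f7 where "f7 = f6(16 := L + 5)"
  define f8 where "f8 = f7(9 := KN)"
  define f9 where "f9 = f8(14 := T)"
  define f10 where "f10 = f9(18 := 2 * m)"
  define f11 where "f11 = f10(19 := 2 * N)"
  define f12 where "f12 = f11(7 := E)"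
  note fs = f1_def f2_def f3_def f4_def f5_def f6_def f7_def f8_def f9_def f10_def f11_def f12_def
  note h' = h[unfolded One_nat_def]
  have P: "2 * m + n + 2 \<le> 2 ^ L" "2 ^ L \<le> (2::nat) ^ (2 * L)" "Z + 64 * 2 ^ (2 * L) + 1000 \<le> B"
    using size BB(1) by (auto intro: power_increasing)
  have N: "2 * N + n + m < Z" using Z_eq by simp
  have E: "E < B" using E_le P by linarith
  have "L < 2 ^ L" by simp
  then have LB: "L + 5 < B" using P by linarith
  \<comment> \<open>The factors of T are multiplied one after the other; since L >= 1, all
    intermediate products are at most T and hence fit into a word.\<close>
  have K1: "1 * KN \<le> KN * KN" unfolding KN_eq by (intro mult_le_mono1) simp
  have K2: "KN * KN * 1 \<le> KN * KN * L" using L_pos by (intro mult_le_mono2)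
  have KT: "T < B" "KN < B" using BB by auto
  have T': "T = 128 * (KN * KN * L)" by (simp add: T_eq)
  have KK: "128 * KN < B" "128 * KN * KN < B" using K1 K2 T' KT by linarith+
  have K4: "KN = 2 * k + (8 * L + 40)" by (simp add: KN_eq)
  let ?c13 = "rset 1 (rc 1)"
  let ?c12 = "Seq (wset 7 (v2N [+] vn [+] WR 8)) ?c13"
  let ?c11 = "Seq (wset 19 (WC 2 [*] vN)) ?c12"
  let ?c10 = "Seq (wset 18 (WC 2 [*] vm)) ?c11"
  let ?c9 = "Seq (wset 14 (WC 128 [*] vK [*] vK [*] WR 15)) ?c10"
  let ?c8 = "Seq (wset 9 (WC 2 [*] (vk [+] WC 4 [*] vL5))) ?c9"
  let ?c7 = "Seq (wset 16 (WR 15 [+] WC 5)) ?c8"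
  let ?c6 = "Seq (wset 6 (vP [*] vP)) ?c7"
  let ?c5 = "Seq c_log ?c6"
  let ?c4 = "Seq (wset 15 (WC 0)) ?c5"
  let ?c3 = "Seq (wset 5 (WC 1)) ?c4"
  let ?c2 = "Seq (wset 17 (WR 8 [+] WC 2)) ?c3"
  let ?d6 = "50 + (50 + (50 + (50 + (50 + (50 + (50 + 50))))))"
  let ?d5 = "(1 + L * (100 + 1)) + ?d6"
  have s13: "hx B Z X ?c13 (h\<lparr>hw := f12\<rparr>) 50 Q"
  proof (rule hx_rset_le)
    have "scal (h\<lparr>hw := f12, hr := (hr h)(1 := 1)\<rparr>)" unfolding scal_def using h by (simp add: fs E_eq)
    then show "Q (h\<lparr>hw := f12, hr := (hr (h\<lparr>hw := f12\<rparr>))(1 := rv (h\<lparr>hw := f12\<rparr>) (rc 1))\<rparr>)" using Q by simp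
  qed (use P X1 in simp_all)
  have s12: "hx B Z X ?c12 (h\<lparr>hw := f11\<rparr>) (50 + 50) Q"
    by (rule hx_wset_Seq[where v = E]) (use s13 E P N X1 in \<open>simp_all add: fs h' E_eq\<close>)
  have s11: "hx B Z X ?c11 (h\<lparr>hw := f10\<rparr>) (50 + (50 + 50)) Q"
    by (rule hx_wset_Seq[where v = "2 * N"]) (use s12 P N X1 in \<open>simp_all add: fs h'\<close>)
  have s10: "hx B Z X ?c10 (h\<lparr>hw := f9\<rparr>) (50 + (50 + (50 + 50))) Q"
    by (rule hx_wset_Seq[where v = "2 * m"]) (use s11 P N X1 in \<open>simp_all add: fs h'\<close>)
  have s9: "hx B Z X ?c9 (h\<lparr>hw := f8\<rparr>) (50 + (50 + (50 + (50 + 50)))) Q"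
  proof (rule hx_wset_Seq[where v = T])
    show "wv (h\<lparr>hw := f8\<rparr>) (WC 128 [*] vK [*] vK [*] WR 15) = T" by (simp add: fs T_eq)
    have "128 * KN * KN * L < B" using KT by (simp add: T_eq)
    then show "wok B Z (h\<lparr>hw := f8\<rparr>) (WC 128 [*] vK [*] vK [*] WR 15)"
      using KK KT P LB by (simp add: fs)
  qed (use s10 KT X1 in \<open>simp_all add: f9_def\<close>)
  have s8: "hx B Z X ?c8 (h\<lparr>hw := f7\<rparr>) (50 + (50 + (50 + (50 + (50 + 50))))) Q"
    by (rule hx_wset_Seq[where v = KN]) (use s9 K4 P KT X1 in \<open>simp_all add: fs h'\<close>)
  have s7: "hx B Z X ?c7 (h\<lparr>hw := f6\<rparr>) (50 + (50 + (50 + (50 + (50 + (50 + 50)))))) Q"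
    by (rule hx_wset_Seq[where v = "L + 5"]) (use s8 LB P X1 in \<open>simp_all add: fs\<close>)
  have s6: "hx B Z X ?c6 (h\<lparr>hw := f5\<rparr>) ?d6 Q"
  proof (rule hx_wset_Seq[where v = "2 ^ (2 * L)"])
    have "2 ^ L * (2::nat) ^ L < B" using P PP by linarith
    then show "wok B Z (h\<lparr>hw := f5\<rparr>) (vP [*] vP)" using P by (simp add: fs)
  qed (use s7 P X1 in \<open>simp_all add: fs PP\<close>)
  have s5: "hx B Z X ?c5 (h\<lparr>hw := f4\<rparr>) ?d5 Q"
  proof (rule hx_Seq)
    show "hx B Z X c_log (h\<lparr>hw := f4\<rparr>) (1 + L * (100 + 1)) (\<lambda>h'. h' = h\<lparr>hw := f5\<rparr>)"
      by (rule hx_log[OF L]) (simp_all add: f5_def f4_def f3_def f2_def)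
  qed (use s6 in simp)
  have s4: "hx B Z X ?c4 (h\<lparr>hw := f3\<rparr>) (50 + ?d5) Q"
    by (rule hx_wset_Seq[where v = 0]) (use s5 P X1 in \<open>simp_all add: f4_def\<close>)
  have s3: "hx B Z X ?c3 (h\<lparr>hw := f2\<rparr>) (50 + (50 + ?d5)) Q"
    by (rule hx_wset_Seq[where v = 1]) (use s4 P X1 in \<open>simp_all add: f3_def\<close>)
  have s2: "hx B Z X ?c2 (h\<lparr>hw := f1\<rparr>) (50 + (50 + (50 + ?d5))) Q"
    by (rule hx_wset_Seq[where v = "2 * m + n + 2"]) (use s3 P X1 in \<open>simp_all add: f2_def f1_def\<close>)
  show ?thesis unfolding c_regs_def
    by (rule hx_wset_Seq[where v = "2 * m + n"]) (use s2 P X1 in \<open>simp_all add: f1_def h'\<close>)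
qed

lemma hx_main:
  assumes L: "\<And>l. l < L \<Longrightarrow> 2 ^ l < 2 * m + n + 2"
    and h: "hw h 0 = Z" "hw h 1 = n" "hw h 2 = m" "hw h 3 = k" "hw h 4 = N" "wraw h = iw" "rraw h = ir"
      "wa h = (\<lambda>_ _. 0)" "ra h = (\<lambda>_ _. 0)"
    and Q: "\<And>h'. solved (wraw h') \<Longrightarrow> Q h'"
  shows "hx B Z X c_main h (main_depth L T) Q"
  unfolding c_main_def main_depth_def
proof (rule hx_Seq)
  let ?c4 = "Seq c_loop c_out"
  let ?d4 = "(3 + (1 + T * (iter_depth L + 1))) + (1000 + 1000) :: nat"
  let ?c3 = "Seq c_setup ?c4"
  let ?d3 = "(20000 + L * 5000) + ?d4"
  let ?c2 = "Seq c_own ?c3"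
  let ?d2 = "(2000 + 2 * L * 2000) + ?d3"
  let ?c1 = "Seq c_leaf ?c2"
  let ?d1 = "1000 + ?d2"
  let ?Q1 = "\<lambda>h'. scal h' \<and> wa h' = (\<lambda>_ _. 0) \<and> ra h' = (\<lambda>_ _. 0)"
  show "hx B Z X c_regs h
    (50 + (50 + (50 + (50 + ((1 + L * (100 + 1)) + (50 + (50 + (50 + (50 + (50 + (50 + (50 + 50)))))))))))) ?Q1"
    by (rule hx_regs[OF L]) (use h in simp_all)
  fix h1 assume h1: "?Q1 h1"
  let ?h2 = "h1\<lparr>wa := (wa h1)(0 := leaf)\<rparr>"
  show "hx B Z X ?c1 h1 ?d1 Q"
  proof (rule hx_Seq)
    show "hx B Z X c_leaf h1 1000 (\<lambda>h'. h' = ?h2)" by (rule hx_leaf) (use h1 in simp_all)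
    fix h2 assume h2: "h2 = ?h2"
    let ?Q3 = "\<lambda>h'. \<exists>F. owned (2 * L) F \<and> scal h' \<and> wa h' 0 = leaf \<and> wa h' 1 = F \<and> ra h' = (\<lambda>_ _. 0)"
    show "hx B Z X ?c2 h2 ?d2 Q"
    proof (rule hx_Seq)
      show "hx B Z X c_own h2 (2000 + 2 * L * 2000) ?Q3"
        by (rule hx_own) (use h1 h2 in \<open>auto simp: scal_def\<close>)
      fix h3 assume "?Q3 h3"
      then obtain F where F: "owned (2 * L) F" and h3: "scal h3" "wa h3 0 = leaf" "wa h3 1 = F" "ra h3 = (\<lambda>_ _. 0)"
        by blast
      interpret O: prog_own n m k L a p0 \<Delta> N E B Z X KN T row col iw ir F
        by unfold_locales (rule F)
      let ?Q4 = "\<lambda>h'. O.ready h' \<and> (\<forall>r<2 * m + n. ra h' 4 (2 ^ L + r) = wgt r) \<and>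
        (\<forall>j. 1 \<le> j \<longrightarrow> j \<le> n \<longrightarrow> ra h' 6 j = p0 j)"
      show "hx B Z X ?c3 h3 ?d3 Q"
      proof (rule hx_Seq)
        show "hx B Z X c_setup h3 (20000 + L * 5000) ?Q4"
          by (rule O.hx_setup) (use h3 in \<open>auto simp: O.stat_def\<close>)
        fix h4 assume h4: "?Q4 h4"
        let ?Q5 = "\<lambda>h'. O.ready h' \<and> O.rounded (ra h' 6) (\<lambda>r. ra h' 4 (2 ^ L + r))"
        show "hx B Z X ?c4 h4 ?d4 Q"
        proof (rule hx_Seq)
          show "hx B Z X c_loop h4 (3 + (1 + T * (iter_depth L + 1))) ?Q5"
            by (rule O.hx_loop) (use h4 in auto)
          fix h5 assume h5: "?Q5 h5"
          show "hx B Z X c_out h5 (1000 + 1000) Q"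
            by (rule O.hx_out) (use h5 Q in auto)
        qed
      qed
    qed
  qed
qed

end

text \<open>This prefix is machine code because the abstract states presuppose that register 0
  contains \<open>Z\<close>, which must first be computed from the input. Register 5 serves as an
  address and is left with the value 3.\<close>

definition c_init :: com where
  "c_init = Seq (WLoad 1 0) (Seq (WConst 5 1) (Seq (WLoad 2 5) (Seq (WConst 5 2) (Seq (WLoad 3 5)
     (Seq (WConst 5 3) (Seq (WLoad 4 5) (Seq (WConst 0 4) (Seq (WOp WAdd 0 0 4) (Seq (WOp WAdd 0 0 4)
     (Seq (WOp WAdd 0 0 1) (WOp WAdd 0 0 2)))))))))))"

text \<open>For n = 0 or m = 0 the zero output is correct; it must be written explicitly, as the
  output cells initially hold input.\<close>

definition c_zero :: com where
  "c_zero = Seq (wset 17 (vn [+] vm)) (ParFor 10 17 (gbody true (SWM idx (WC 0))))"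

definition h_init :: "nat \<Rightarrow> nat \<Rightarrow> nat \<Rightarrow> nat \<Rightarrow> nat \<Rightarrow> state \<Rightarrow> hst" where
  "h_init Z n m k N s = \<lparr>hw = (\<lambda>_. 0)(0 := Z, 1 := n, 2 := m, 3 := k, 4 := N, 5 := 3), hr = (\<lambda>_. 0),
     wraw = wmem s, rraw = rmem s, wa = (\<lambda>_ _. 0), ra = (\<lambda>_ _. 0)\<rparr>"

definition straight :: "nat \<Rightarrow> com \<Rightarrow> state \<Rightarrow> state \<Rightarrow> nat \<Rightarrow> bool" where
  "straight B c s t i \<longleftrightarrow> (\<exists>rs ws. exec B c s t rs ws i i)"

lemma straight_Seq: "\<lbrakk>straight B c1 s s1 1; straight B c2 s1 t i\<rbrakk> \<Longrightarrow> straight B (Seq c1 c2) s t (1 + i)"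
  unfolding straight_def using exec.Seq by blast

lemma straight_WLoad:
  "\<lbrakk>wreg s y = a; wmem s a = v; t = s\<lparr>wreg := (wreg s)(x := v)\<rparr>\<rbrakk> \<Longrightarrow> straight B (WLoad x y) s t 1"
  unfolding straight_def using exec.WLoad[of B x y s] by auto

lemma straight_WConst:
  "\<lbrakk>v < B; t = s\<lparr>wreg := (wreg s)(x := v)\<rparr>\<rbrakk> \<Longrightarrow> straight B (WConst x v) s t 1"
  unfolding straight_def using exec.WConst[of v B x s] by auto

lemma straight_WAdd:
  "\<lbrakk>wreg s y + wreg s z = v; v < B; t = s\<lparr>wreg := (wreg s)(x := v)\<rparr>\<rbrakk> \<Longrightarrow> straight B (WOp WAdd x y z) s t 1"
  unfolding straight_def using exec.WOp[of WAdd s y z B x] by auto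

lemma exec_init:
  assumes s: "wreg s = (\<lambda>_. 0)" "rreg s = (\<lambda>_. 0)" "wmem s 0 = n" "wmem s 1 = m" "wmem s 2 = k" "wmem s 3 = N"
    and z: "\<And>x. Z \<le> x \<Longrightarrow> wmem s x = 0 \<and> rmem s x = 0"
    and Z: "Z = 4 + 2 * N + n + m" "Z < B"
  shows "\<exists>t rs ws. exec B c_init s t rs ws 12 12 \<and> rel Z (h_init Z n m k N s) t"
proof -
  let ?f = "\<lambda>z a b c d e. (\<lambda>_::nat. 0::nat)(0 := z, 1 := a, 2 := b, 3 := c, 4 := d, 5 := e)"
  let ?S = "\<lambda>z a b c d e. s\<lparr>wreg := ?f z a b c d e\<rparr>"
  have u: "(?f z a b c d e)(5 := v) = ?f z a b c d v" "(?f z a b c d e)(4 := v) = ?f z a b c v e"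
    "(?f z a b c d e)(3 := v) = ?f z a b v d e" "(?f z a b c d e)(2 := v) = ?f z a v c d e"
    "(?f z a b c d e)(1 := v) = ?f z v b c d e" "(?f z a b c d e)(0 := v) = ?f v a b c d e" for z a b c d e v :: nat
    by (auto simp: fun_eq_iff)
  have "straight B c_init s (?S Z n m k N 3) (1 + (1 + (1 + (1 + (1 + (1 + (1 + (1 + (1 + (1 + (1 + 1)))))))))))"
    unfolding c_init_def
  proof (intro straight_Seq)
    have "?f 0 0 0 0 0 0 = (\<lambda>_. 0 :: nat)" by (auto simp: fun_eq_iff)
    then have s0: "s = ?S 0 0 0 0 0 0" using s(1) by simp
    have "straight B (WLoad 1 0) (?S 0 0 0 0 0 0) (?S 0 n 0 0 0 0) 1"
      by (rule straight_WLoad[where a = 0 and v = n]) (use s u in simp_all)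
    then show "straight B (WLoad 1 0) s (?S 0 n 0 0 0 0) 1" using s0 by simp
    show "straight B (WConst 5 1) (?S 0 n 0 0 0 0) (?S 0 n 0 0 0 1) 1"
      by (rule straight_WConst) (use Z in simp_all)
    show "straight B (WLoad 2 5) (?S 0 n 0 0 0 1) (?S 0 n m 0 0 1) 1"
      by (rule straight_WLoad[where a = 1 and v = m]) (use s u in simp_all)
    show "straight B (WConst 5 2) (?S 0 n m 0 0 1) (?S 0 n m 0 0 2) 1"
      by (rule straight_WConst) (use Z in simp_all)
    show "straight B (WLoad 3 5) (?S 0 n m 0 0 2) (?S 0 n m k 0 2) 1"
      by (rule straight_WLoad[where a = 2 and v = k]) (use s u in simp_all)
    show "straight B (WConst 5 3) (?S 0 n m k 0 2) (?S 0 n m k 0 3) 1"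
      by (rule straight_WConst) (use Z in simp_all)
    show "straight B (WLoad 4 5) (?S 0 n m k 0 3) (?S 0 n m k N 3) 1"
      by (rule straight_WLoad[where a = 3 and v = N]) (use s u in simp_all)
    show "straight B (WConst 0 4) (?S 0 n m k N 3) (?S 4 n m k N 3) 1"
      by (rule straight_WConst) (use Z u in simp_all)
    show "straight B (WOp WAdd 0 0 4) (?S 4 n m k N 3) (?S (4 + N) n m k N 3) 1"
      by (rule straight_WAdd[where v = "4 + N"]) (use Z u in simp_all)
    show "straight B (WOp WAdd 0 0 4) (?S (4 + N) n m k N 3) (?S (4 + 2 * N) n m k N 3) 1"
      by (rule straight_WAdd[where v = "4 + 2 * N"]) (use Z u in simp_all)
    show "straight B (WOp WAdd 0 0 1) (?S (4 + 2 * N) n m k N 3) (?S (4 + 2 * N + n) n m k N 3) 1"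
      by (rule straight_WAdd[where v = "4 + 2 * N + n"]) (use Z u in simp_all)
    show "straight B (WOp WAdd 0 0 2) (?S (4 + 2 * N + n) n m k N 3) (?S Z n m k N 3) 1"
      by (rule straight_WAdd[where v = Z]) (use Z u in simp_all)
  qed
  moreover have "1 + (1 + (1 + (1 + (1 + (1 + (1 + (1 + (1 + (1 + (1 + 1)))))))))) = (12::nat)" by simp
  ultimately have "straight B c_init s (?S Z n m k N 3) 12" by metis
  moreover have "rel Z (h_init Z n m k N s) (?S Z n m k N 3)"
    unfolding rel_def using s z by (simp add: h_init_def)
  ultimately show ?thesis unfolding straight_def by blast
qed

lemma hx_zero:
  assumes h: "hw h 1 = n" "hw h 2 = m" and B: "n + m < Z" "Z + 10 < B" and X: "n + m \<le> X" "1 \<le> X"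
    and Q: "\<And>h'. (\<And>x. x < n + m \<Longrightarrow> wraw h' x = 0) \<Longrightarrow> Q h'"
  shows "hx B Z X c_zero h (50 + 50) Q"
  unfolding c_zero_def
proof (rule hx_wset_Seq[where v = "n + m"])
  let ?h = "h\<lparr>hw := (hw h)(17 := n + m)\<rparr>"
  let ?F = "\<lambda>x. if x < n + m then 0 else wraw h x"
  show "hx B Z X (ParFor 10 17 (gbody true (SWM idx (WC 0)))) ?h 50 Q"
  proof (rule hx_mono[OF hx_par_raw[where N = "n + m" and g = "\<lambda>j. j" and F = ?F]])
    show "Q (?h\<lparr>wraw := ?F\<rparr>)" by (rule Q) simp
    fix l assume "\<And>i. i < n + m \<Longrightarrow> i \<noteq> l"
    then have "\<not> l < n + m" by blast
    then show "?F l = wraw ?h l" by simp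
  qed (use B X in \<open>auto simp: gcost_def\<close>)
qed (use h B X in simp_all)

definition c_alg :: com where
  "c_alg = Seq c_init (condc (TW (vn [*] vm) (WC 1)) c_zero c_main)"

section \<open>Layout of the input\<close>

lemma nth_concat_pairs:
  "e < length es \<Longrightarrow> concat (map (\<lambda>(i, j). [i, j]) es) ! (2 * e) = fst (es ! e) \<and>
     concat (map (\<lambda>(i, j). [i, j]) es) ! (2 * e + 1) = snd (es ! e)"
proof (induction es arbitrary: e)
  case (Cons x es)
  show ?case
  proof (cases e)
    case 0
    then show ?thesis by (cases x) simp
  next
    case (Suc d)
    then show ?thesis using Cons.IH[of d] Cons.prems by (cases x) simp
  qed
qed simp

lemma length_concat_pairs: "length (concat (map (\<lambda>(i, j). [i, j]) es)) = 2 * length es"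
  by (induction es) auto

lemma load_words:
  "load (input_words n m k es) 0 = n" "load (input_words n m k es) 1 = m"
  "load (input_words n m k es) 2 = k" "load (input_words n m k es) 3 = length es"
  by (simp_all add: load_def input_words_def)

lemma load_words_entry:
  assumes "e < length es"
  shows "load (input_words n m k es) (4 + 2 * e) = fst (es ! e) \<and> load (input_words n m k es) (5 + 2 * e) = snd (es ! e)"
proof -
  have app: "(xs @ ys) ! (4 + 2 * e) = ys ! (2 * e) \<and> (xs @ ys) ! (5 + 2 * e) = ys ! (2 * e + 1)"
    if "length xs = 4" for xs ys :: "nat list"
    using that by (simp add: nth_append)
  have "input_words n m k es ! (4 + 2 * e) = concat (map (\<lambda>(i, j). [i, j]) es) ! (2 * e) \<and>
      input_words n m k es ! (5 + 2 * e) = concat (map (\<lambda>(i, j). [i, j]) es) ! (2 * e + 1)"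
    unfolding input_words_def by (rule app) simp
  moreover have "length (input_words n m k es) = 4 + 2 * length es"
    by (simp add: input_words_def length_concat_pairs)
  ultimately show ?thesis using nth_concat_pairs[OF assms] assms by (simp add: load_def)
qed

lemma load_reals:
  "e < length es \<Longrightarrow> load (input_reals A p \<Delta> es) e = A $$ (fst (es ! e), snd (es ! e))"
  "j < dim_vec p \<Longrightarrow> load (input_reals A p \<Delta> es) (length es + j) = p $ j"
  "i < dim_vec \<Delta> \<Longrightarrow> load (input_reals A p \<Delta> es) (length es + dim_vec p + i) = \<Delta> $ i"
  by (simp_all add: load_def input_reals_def nth_append list_of_vec_index split_def)

lemma load_beyond:
  "\<lbrakk>4 + 2 * length es \<le> x\<rbrakk> \<Longrightarrow> load (input_words n m k es) x = 0"
  "\<lbrakk>length es + dim_vec p + dim_vec \<Delta> \<le> x\<rbrakk> \<Longrightarrow> load (input_reals A p \<Delta> es) x = 0"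
  by (simp_all add: load_def input_words_def input_reals_def length_concat_pairs)

section \<open>Bounds on word size and depth\<close>

lemma pow_bound_mult: "\<lbrakk>x \<le> b ^ i; y \<le> b ^ j\<rbrakk> \<Longrightarrow> x * y \<le> (b::nat) ^ (i + j)"
  by (simp add: power_add mult_le_mono)

lemma pow_bound_add:
  assumes "x \<le> b ^ i" "y \<le> b ^ j" "i < l" "j < l" "2 \<le> (b::nat)"
  shows "x + y \<le> b ^ l"
proof -
  obtain l' where l': "l = Suc l'" using assms(3) by (cases l) auto
  have "x \<le> b ^ l'" "y \<le> b ^ l'"
    using assms l' by (meson le_trans less_Suc_eq_le one_le_numeral power_increasing)+
  then have "x + y \<le> 2 * b ^ l'" by simp
  also have "\<dots> \<le> b * b ^ l'" using assms(5) by (rule mult_le_mono1)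
  finally show ?thesis using l' by simp
qed

text \<open>Everything is bounded by a power of b = n + m + k + 2. As b >= 2, numerals are absorbed
  by powers of b too, and each addition of smaller powers costs at most one more exponent. The
  largest exponent is 27, for T + 1.\<close>

lemma word_bounds:
  fixes n m k L N KN T Z C :: nat
  defines "b \<equiv> n + m + k + 2"
  assumes P: "2 ^ L \<le> 2 * (2 * m + n + 2)" and N: "N \<le> n * m" and KN: "KN = 2 * (k + 4 * (L + 5))"
    and T: "T = 128 * KN * KN * L" and Z: "Z = 4 + 2 * N + n + m" and C: "30 \<le> C"
  shows "Z + 64 * 2 ^ (2 * L) + 1000 \<le> b ^ C" "T + 1 < b ^ C" "2 * KN < b ^ C" "k < b ^ C"
proof -
  have b: "2 \<le> b" by (simp add: b_def)
  have c: "2 ^ i \<le> b ^ i" for i using b by (rule power_mono) simp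
  have up: "x \<le> b ^ C" if "x \<le> b ^ i" "i \<le> 30" for x i
    using that C b by (meson le_trans one_le_numeral power_increasing)
  have lt: "x < b ^ C" if "x \<le> b ^ i" "i < 30" for x i
  proof -
    have "b ^ i < b ^ C" using that C b by (intro power_strict_increasing) auto
    then show ?thesis using that by linarith
  qed
  have nb: "n \<le> b ^ 1" "m \<le> b ^ 1" "k \<le> b ^ 1" by (simp_all add: b_def)
  have "2 ^ L \<le> 4 * b" using P by (simp add: b_def)
  also have "\<dots> \<le> b ^ 2 * b" using c[of 2] by (intro mult_le_mono1) simp
  finally have P3: "2 ^ L \<le> b ^ 3" by (simp add: power2_eq_square power3_eq_cube)
  have "N \<le> b ^ (1 + 1)" using N pow_bound_mult[OF nb(1,2)] by simp
  then have "2 * N \<le> b ^ (1 + (1 + 1))" using c[of 1] by (intro pow_bound_mult) simp_all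
  then have "4 + 2 * N \<le> b ^ 4" using c[of 2] b pow_bound_add[of 4 b 2 "2 * N" 3 4] by (simp add: numeral_3_eq_3)
  then have "4 + 2 * N + n \<le> b ^ 5" using nb b pow_bound_add[of "4 + 2 * N" b 4 n 1 5] by simp
  then have "Z \<le> b ^ 6" using nb b pow_bound_add[of "4 + 2 * N + n" b 5 m 1 6] by (simp add: Z)
  moreover have "64 * 2 ^ (2 * L) \<le> b ^ (6 + (3 + 3))"
  proof (rule pow_bound_mult)
    show "64 \<le> b ^ 6" using c[of 6] by simp
    have "2 ^ L * 2 ^ L \<le> b ^ (3 + 3)" by (rule pow_bound_mult[OF P3 P3])
    then show "2 ^ (2 * L) \<le> b ^ (3 + 3)" by (simp add: mult_2 power_add)
  qed
  ultimately have "Z + 64 * 2 ^ (2 * L) \<le> b ^ 13" using b pow_bound_add[of Z b 6 "64 * 2 ^ (2 * L)" "6 + (3 + 3)" 13] by simp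
  then have "Z + 64 * 2 ^ (2 * L) + 1000 \<le> b ^ 14" using c[of 10] b pow_bound_add[of "Z + 64 * 2 ^ (2 * L)" b 13 1000 10 14] by simp
  then show "Z + 64 * 2 ^ (2 * L) + 1000 \<le> b ^ C" by (rule up) simp
  have "L < 2 ^ L" by simp
  then have L3: "L \<le> b ^ 3" using P3 by linarith
  have "L + 5 \<le> b ^ 4" using L3 c[of 3] b pow_bound_add[of L b 3 5 3 4] by simp
  then have "4 * (L + 5) \<le> b ^ (2 + 4)" using c[of 2] by (intro pow_bound_mult) simp_all
  then have "k + 4 * (L + 5) \<le> b ^ 7" using nb b pow_bound_add[of k b 1 "4 * (L + 5)" "2 + 4" 7] by simp
  then have K: "KN \<le> b ^ (1 + 7)" unfolding KN using c[of 1] by (intro pow_bound_mult) simp_all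
  have "2 * KN \<le> b ^ (1 + (1 + 7))" using K c[of 1] by (intro pow_bound_mult) simp_all
  then show "2 * KN < b ^ C" by (rule lt) simp
  have "128 * KN * KN * L \<le> b ^ (7 + (1 + 7) + (1 + 7) + 3)"
    using K L3 c[of 7] by (intro pow_bound_mult) simp_all
  then have "T + 1 \<le> b ^ 27" unfolding T using b
      pow_bound_add[of "128 * KN * KN * L" b "7 + (1 + 7) + (1 + 7) + 3" 1 0 27] by simp
  then show "T + 1 < b ^ C" by (rule lt) simp
  show "k < b ^ C" using nb(3) by (rule lt) simp
qed

lemma main_depth_le: "main_depth L T \<le> 26000 + 9200 * L + T * (7000 + 3000 * L + 600 * L * L)"
  by (simp add: main_depth_def algebra_simps)

text \<open>T is cubic in \<open>x\<close> and a single step quadratic, which explains the fifth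
  power. The parameter is left open because depth and work use different measures of the
  input.\<close>

lemma depth_bound:
  fixes x :: real
  assumes x: "1 \<le> x" and L: "real L \<le> 3 * x" and k: "real k \<le> x"
    and KN: "KN = 2 * (k + 4 * (L + 5))" and T: "T = 128 * KN * KN * L"
  shows "real (100 + main_depth L T) \<le> 10 ^ 11 * x ^ 5"
proof -
  have xp: "x ^ i \<le> x ^ j" if "i \<le> j" for i j using x that by (rule power_increasing[rotated])
  \<comment> \<open>66 = 2 (1 + 4 (3 + 5)); then 128 * 66^2 * 3 = 1672704, and 21400 = 7000 + 9000 +
    5400.\<close>
  have K: "real KN \<le> 66 * x" using x L k by (simp add: KN)
  have "real T = 128 * (real KN * real KN) * real L" by (simp add: T)
  also have "\<dots> \<le> 128 * ((66 * x) * (66 * x)) * (3 * x)" using K L x by (intro mult_mono) auto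
  finally have T3: "real T \<le> 1672704 * x ^ 3" by (simp add: power3_eq_cube)
  have "real L * real L \<le> (3 * x) * (3 * x)" using L x by (intro mult_mono) auto
  then have "real (7000 + 3000 * L + 600 * L * L) \<le> 7000 + 9000 * x + 5400 * x ^ 2"
    using L by (simp add: power2_eq_square)
  also have "\<dots> \<le> 21400 * x ^ 2" using xp[of 0 2] xp[of 1 2] by simp
  finally have I: "real (7000 + 3000 * L + 600 * L * L) \<le> 21400 * x ^ 2" .
  have "real (100 + main_depth L T) \<le> real (26100 + 9200 * L + T * (7000 + 3000 * L + 600 * L * L))"
    using main_depth_le[of L T] by (intro of_nat_mono) simp
  also have "\<dots> = 26100 + 9200 * real L + real T * real (7000 + 3000 * L + 600 * L * L)" by simp
  also have "\<dots> \<le> 26100 + 27600 * x + (1672704 * x ^ 3) * (21400 * x ^ 2)"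
  proof -
    have "real T * real (7000 + 3000 * L + 600 * L * L) \<le> (1672704 * x ^ 3) * (21400 * x ^ 2)"
      using T3 I x by (intro mult_mono) auto
    then show ?thesis using L by linarith
  qed
  also have "(1672704 * x ^ 3) * (21400 * x ^ 2) = 35795865600 * x ^ 5" by (simp add: power_numeral_reduce)
  also have "26100 + 27600 * x + 35795865600 * x ^ 5 \<le> 10 ^ 11 * x ^ 5" using xp[of 0 5] xp[of 1 5] by simp
  finally show ?thesis .
qed

lemma log_bound:
  assumes "2 ^ L \<le> q ^ 3" "1 \<le> q"
  shows "real L \<le> 3 * log 2 (real q)"
proof -
  have "(2::real) ^ L \<le> real q ^ 3" using assms(1) by (metis of_nat_le_iff of_nat_numeral of_nat_power)
  moreover have "0 < (2::real) ^ L" "0 < real q ^ 3" using assms(2) by simp_all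
  ultimately have "log 2 (2 ^ L) \<le> log 2 (real q ^ 3)" by (simp del: log_pow_cancel)
  then show ?thesis using assms(2) by (simp add: log_nat_power)
qed

section \<open>Comparison with the target probabilities\<close>

lemma exp_minus_ge: "\<lbrakk>0 \<le> x; x \<le> ereal y\<rbrakk> \<Longrightarrow> exp (- y) \<le> exp_minus x"
  by (cases x) (auto simp: exp_minus_def)

lemma exp_minus_nonneg: "0 \<le> exp_minus x"
  by (simp add: exp_minus_def)

lemma prob_bad_nonneg: "0 \<le> c \<Longrightarrow> 0 \<le> prob_bad c k A p \<Delta> i"
  by (simp add: prob_bad_def exp_minus_nonneg)

text \<open>A minimum is bounded as soon as one of its quotients is. Positivity of that denominator
  excludes the convention that reads the quotient as infinite.\<close>

lemma prob_bad_ge: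
  fixes A :: "real mat" and p \<Delta> :: "real vec" and i k :: nat and c v :: real
  defines "a \<equiv> (\<Sum>j<dim_col A. (A $$ (i, j))\<^sup>2)" and "b \<equiv> (\<Sum>j<dim_col A. p $ j * A $$ (i, j))"
  assumes c: "0 < c" and b: "0 \<le> b" and D: "0 < \<Delta> $ i"
    and v: "(0 < a \<and> (\<Delta> $ i)\<^sup>2 / a \<le> v) \<or> (0 < b \<and> \<Delta> $ i * real k / b \<le> v)"
  shows "c * exp (- (v / c)) \<le> prob_bad c k A p \<Delta> i"
proof -
  let ?M = "min (quot ((\<Delta> $ i)\<^sup>2) a) (quot (\<Delta> $ i * real k) b)"
  have a: "0 \<le> a" unfolding a_def by (intro sum_nonneg) simp
  have M0: "0 \<le> ?M" using a b D by (auto simp: quot_def)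
  have Mv: "?M \<le> ereal v" using v by (auto simp: quot_def min_le_iff_disj)
  have "ereal (1 / c) * ?M \<le> ereal (1 / c) * ereal v" using Mv c by (intro ereal_mult_left_mono) auto
  then have "ereal (1 / c) * ?M \<le> ereal (v / c)" by simp
  moreover have "0 \<le> ereal (1 / c) * ?M" using M0 c by (intro ereal_0_le_mult) auto
  ultimately have "exp (- (v / c)) \<le> exp_minus (ereal (1 / c) * ?M)" by (intro exp_minus_ge)
  then show ?thesis using c unfolding prob_bad_def a_def[symmetric] b_def[symmetric] by simp
qed

lemma exec_alg:
  assumes s: "wreg s = (\<lambda>_. 0)" "rreg s = (\<lambda>_. 0)" "wmem s 0 = n" "wmem s 1 = m" "wmem s 2 = k" "wmem s 3 = N"
    and z: "\<And>x. Z \<le> x \<Longrightarrow> wmem s x = 0 \<and> rmem s x = 0"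
    and Z: "Z = 4 + 2 * N + n + m" and B: "Z + 10 < B" "n * m < B" and X: "1 \<le> X"
    and zero: "n * m = 0 \<Longrightarrow> hx B Z X c_zero (h_init Z n m k N s) D Q"
    and main: "n * m \<noteq> 0 \<Longrightarrow> hx B Z X c_main (h_init Z n m k N s) D Q"
  shows "\<exists>h t work depth. runs B c_alg s t work depth \<and> work \<le> X * (D + 50) \<and> depth \<le> D + 50 \<and> rel Z h t \<and> Q h"
proof -
  let ?h = "h_init Z n m k N s" and ?b = "TW (vn [*] vm) (WC 1)"
  have ZB: "Z < B" using B by simp
  obtain s1 rs1 ws1 where 1: "exec B c_init s s1 rs1 ws1 12 12" "rel Z ?h s1"
    using exec_init[OF s z Z ZB] by blast
  have "hx B Z X (condc ?b c_zero c_main) ?h (tcost ?b + 1 + D) Q"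
    by (rule hx_condc) (use B Z X zero main in \<open>auto simp: h_init_def\<close>)
  then obtain h where h: "Q h" "\<forall>s. rel Z ?h s \<longrightarrow> (\<exists>s' rs ws w d. exec B (condc ?b c_zero c_main) s s' rs ws w d \<and>
      rel Z h s' \<and> w \<le> X * (tcost ?b + 1 + D) \<and> d \<le> tcost ?b + 1 + D)"
    unfolding hx_def by blast
  then obtain t rs2 ws2 w d where 2: "exec B (condc ?b c_zero c_main) s1 t rs2 ws2 w d" "rel Z h t"
      "w \<le> X * (tcost ?b + 1 + D)" "d \<le> tcost ?b + 1 + D"
    using 1(2) by blast
  have "runs B c_alg s t (12 + w) (12 + d)"
    unfolding runs_def c_alg_def using exec.Seq[OF 1(1) 2(1)] by blast
  moreover have "X * (tcost ?b + 1 + D) + X * 12 \<le> X * (D + 50)" by (simp add: algebra_simps)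
  then have "12 + w \<le> X * (D + 50)" using 2(3) X by linarith
  moreover have "12 + d \<le> D + 50" using 2(4) by simp
  ultimately show ?thesis using h(1) 2(2) by blast
qed

definition acceptable :: "nat \<Rightarrow> nat \<Rightarrow> nat \<Rightarrow> real mat \<Rightarrow> real vec \<Rightarrow> real vec \<Rightarrow> (nat \<Rightarrow> nat) \<Rightarrow> bool" where
  "acceptable n m k A p \<Delta> w \<longleftrightarrow> (\<forall>j<n. w j = 0 \<or> w j = 1) \<and>
     (\<forall>i<m. w (n + i) = 0 \<longrightarrow> \<bar>\<Sum>j<n. A $$ (i, j) * (p $ j - real (w j))\<bar> \<le> \<Delta> $ i) \<and>
     real (card {i. i < m \<and> w (n + i) \<noteq> 0}) \<le> (\<Sum>i<m. prob_bad 1024 k A p \<Delta> i)"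

lemma acceptable_outputs:
  assumes "acceptable n m k A p \<Delta> w" "\<And>x. x < n + m \<Longrightarrow> wmem t x = w x"
  shows "let q = output_vec n t; I_bad = output_set n m t in
            (\<forall>j<n. q $ j \<in> {0, 1}) \<and>
            I_bad \<subseteq> {..<m} \<and>
            real (card I_bad) \<le> (\<Sum>i<m. prob_bad 1024 k A p \<Delta> i) \<and>
            (\<forall>i\<in>{..<m} - I_bad. \<bar>\<Sum>j<n. A $$ (i, j) * (p $ j - q $ j)\<bar> \<le> \<Delta> $ i)"
proof -
  have q: "output_vec n t $ j = real (w j)" if "j < n" for j
    using that assms(2) by (simp add: output_vec_def)
  have I: "output_set n m t = {i. i < m \<and> w (n + i) \<noteq> 0}"
    using assms(2) by (auto simp: output_set_def)
  have S: "(\<Sum>j<n. A $$ (i, j) * (p $ j - output_vec n t $ j)) = (\<Sum>j<n. A $$ (i, j) * (p $ j - real (w j)))" for i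
    by (rule sum.cong) (auto simp: q)
  show ?thesis unfolding Let_def I S using assms(1) q by (auto simp: acceptable_def)
qed

text \<open>Without columns all row sums are empty and below the positive tolerances; without rows
  nothing is required of them.\<close>

lemma acceptable_zero:
  assumes "n * m = 0" "\<And>x. x < n + m \<Longrightarrow> w x = 0" "\<And>i. i < m \<Longrightarrow> 0 < \<Delta> $ i"
  shows "acceptable n m k A p \<Delta> w"
proof -
  have e: "{i. i < m \<and> w (n + i) \<noteq> 0} = {}" using assms(2) by auto
  have "0 \<le> (\<Sum>i<m. prob_bad 1024 k A p \<Delta> i)" by (intro sum_nonneg prob_bad_nonneg) simp
  moreover have "n = 0 \<or> m = 0" using assms(1) by simp
  ultimately show ?thesis using assms(2,3) unfolding acceptable_def e by (auto simp: less_imp_le)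
qed

context rounding
begin

text \<open>Below the cap the scale is not 4 (L + 5) / \<Delta>, so lam \<Delta> equals \<Delta>^2 /
  (128 A2) or \<Delta> k / mu. Hence one quotient is at most 128 lam \<Delta>, and the constant 1024
  = 8 * 128 produces the exponent lam \<Delta> / 8 of the counting argument.\<close>

lemma prob_bad_lam:
  assumes A: "dim_col A = n" "\<And>i j. \<lbrakk>i < m; j < n\<rbrakk> \<Longrightarrow> A $$ (i, j) = a i (j + 1)"
    and p: "\<And>j. j < n \<Longrightarrow> p $ j = p0 (j + 1)" and D: "\<And>i. i < m \<Longrightarrow> D $ i = \<Delta> i"
    and i: "i < m" "lam i * \<Delta> i < real (4 * (L + 5))"
  shows "16 * exp (- (lam i * \<Delta> i / 8)) \<le> prob_bad 1024 k A p D i"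
proof -
  let ?v = "128 * (lam i * \<Delta> i)"
  have d: "0 < \<Delta> i" using \<Delta>0 i by simp
  have a: "(\<Sum>j<dim_col A. (A $$ (i, j))\<^sup>2) = A2 i"
    unfolding A2_def A(1) by (simp add: sum.atLeast1_atMost_eq A(2)[OF i(1)] power2_eq_square)
  have b: "(\<Sum>j<dim_col A. p $ j * A $$ (i, j)) = mu i"
    unfolding mu_def A(1) by (simp add: sum.atLeast1_atMost_eq A(2)[OF i(1)] p)
  have v: "(0 < A2 i \<and> (D $ i)\<^sup>2 / A2 i \<le> ?v) \<or> (0 < mu i \<and> D $ i * real k / mu i \<le> ?v)"
  proof (cases "lam i = lam1 i")
    case True
    have "lam1 i \<noteq> real (4 * (L + 5)) / \<Delta> i" using i(2) d True by auto
    then have "0 < A2 i" "lam1 i = \<Delta> i / (128 * A2 i)" using lam1_props(4)[OF i(1)] by auto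
    then show ?thesis using True D[OF i(1)] by (simp add: power2_eq_square)
  next
    case False
    then have "0 < mu i" "lam i = real k / mu i" using lam_props(4)[OF i(1)] by auto
    moreover have "0 \<le> \<Delta> i * real k / mu i" using d \<open>0 < mu i\<close> by simp
    then have "\<Delta> i * real k / mu i \<le> 128 * (\<Delta> i * real k / mu i)" by linarith
    ultimately show ?thesis using D[OF i(1)] by (simp add: mult.commute)
  qed
  have e: "?v / 1024 = lam i * \<Delta> i / 8" by simp
  have "16 * exp (- (lam i * \<Delta> i / 8)) \<le> 1024 * exp (- (lam i * \<Delta> i / 8))" by (rule mult_right_mono) auto
  also have "\<dots> \<le> prob_bad 1024 k A p D i"
    unfolding e[symmetric] by (rule prob_bad_ge) (use a b v D[OF i(1)] d mu_nonneg[OF i(1)] in simp_all)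
  finally show ?thesis .
qed

end

text \<open>By minimality of L the previous power is still below q.\<close>

lemma pow_le_double: "\<lbrakk>\<And>l. l < L \<Longrightarrow> 2 ^ l < q; 1 \<le> q\<rbrakk> \<Longrightarrow> 2 ^ L \<le> 2 * (q::nat)"
  by (cases L) (auto simp: less_imp_le)

lemma card_support_le: "card (support A) \<le> dim_col A * dim_row A"
proof -
  have "support A \<subseteq> {..<dim_row A} \<times> {..<dim_col A}" by (auto simp: support_def)
  then have "card (support A) \<le> card ({..<dim_row A} \<times> {..<dim_col A})" by (intro card_mono) auto
  then show ?thesis by (simp add: mult.commute)
qed

lemma hx_main_input:
  fixes A :: "real mat" and p \<Delta> :: "real vec" and es :: "(nat \<times> nat) list" and n m k L C :: nat
  defines "KN \<equiv> 2 * (k + 4 * (L + 5))" and "Z \<equiv> 4 + 2 * length es + n + m"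
    and "h \<equiv> h_init (4 + 2 * length es + n + m) n m k (length es) (input_state k A p \<Delta> es)"
  defines "T \<equiv> 128 * KN * KN * L"
  assumes A: "A \<in> carrier_mat m n" "\<And>i j. \<lbrakk>i < m; j < n\<rbrakk> \<Longrightarrow> 0 \<le> A $$ (i, j)"
    and p: "p \<in> carrier_vec n" "\<And>j. j < n \<Longrightarrow> 0 \<le> p $ j \<and> p $ j \<le> 1"
    and D: "\<Delta> \<in> carrier_vec m" "\<And>i. i < m \<Longrightarrow> 0 < \<Delta> $ i"
    and es: "distinct es" "set es = support A" and nm: "n * m \<noteq> 0"
    and L: "2 * m + n + 2 \<le> 2 ^ L" "\<And>l. l < L \<Longrightarrow> 2 ^ l < 2 * m + n + 2"
    and C: "30 \<le> C" and X: "2 * length es + n + (2 * m + n) \<le> X"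
  shows "hx ((n + m + k + 2) ^ C) Z X c_main h (main_depth L T) (\<lambda>h'. acceptable n m k A p \<Delta> (wraw h'))"
proof -
  \<comment> \<open>Columns are shifted by one because column 0 of the extended matrix is reserved
    for the constant.\<close>
  let ?a = "\<lambda>i j. A $$ (i, j - 1)" and ?p = "\<lambda>j. p $ (j - 1)" and ?D = "\<lambda>i. \<Delta> $ i" and ?N = "length es"
  let ?B = "(n + m + k + 2) ^ C"
  have dims: "dim_row A = m" "dim_col A = n" "dim_vec p = n" "dim_vec \<Delta> = m" using A p D by auto
  have esd: "es ! e \<in> support A" if "e < ?N" for e using es(2) that nth_mem by blast
  have rc: "fst (es ! e) < m \<and> snd (es ! e) < n" if "e < ?N" for e
    using esd[OF that] dims by (auto simp: support_def)
  have N: "?N \<le> n * m" using card_support_le[of A] distinct_card[OF es(1)] dims es(2) by simp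
  have PL: "2 ^ L \<le> 2 * (2 * m + n + 2)" by (rule pow_le_double[OF L(2)]) simp_all
  note wb = word_bounds[OF PL N KN_def[THEN meta_eq_to_obj_eq] T_def[THEN meta_eq_to_obj_eq]
      Z_def[THEN meta_eq_to_obj_eq] C]
  interpret prog_data n m k L ?a ?p ?D ?N "2 * ?N + n + (2 * m + n)" ?B Z X KN T "\<lambda>e. fst (es ! e)" "\<lambda>e. snd (es ! e)"
    "load (input_words n m k es)" "load (input_reals A p \<Delta> es)"
  proof
    show "1 \<le> n" "1 \<le> m" using nm by (simp_all add: Suc_leI)
    show "2 * m + n + 2 \<le> 2 ^ L" by (rule L(1))
    show "0 \<le> A $$ (i, j - 1)" if "i < m" "1 \<le> j" "j \<le> n" for i j using A(2)[of i "j - 1"] that by simp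
    show "0 \<le> p $ (j - 1) \<and> p $ (j - 1) \<le> 1" if "1 \<le> j" "j \<le> n" for j using p(2)[of "j - 1"] that by simp
    show "0 < \<Delta> $ i" if "i < m" for i using D(2)[OF that] .
    show "fst (es ! e) < m \<and> snd (es ! e) < n" if "e < ?N" for e by (rule rc[OF that])
    show "e = e'" if "e < ?N" "e' < ?N" "fst (es ! e) = fst (es ! e')" "snd (es ! e) = snd (es ! e')" for e e'
      using nth_eq_iff_index_eq[OF es(1) that(1,2)] that(3,4) by (simp add: prod_eq_iff)
    show "\<exists>e<?N. fst (es ! e) = i \<and> snd (es ! e) = j" if "i < m" "j < n" "A $$ (i, j + 1 - 1) \<noteq> 0" for i j
    proof -
      have "(i, j) \<in> set es" using that dims unfolding es(2) by (simp add: support_def)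
      then show ?thesis by (metis fst_conv in_set_conv_nth snd_conv)
    qed
    show "load (input_words n m k es) (4 + 2 * e) = fst (es ! e) \<and> load (input_words n m k es) (5 + 2 * e) = snd (es ! e)"
      if "e < ?N" for e by (rule load_words_entry[OF that])
    show "load (input_reals A p \<Delta> es) e = A $$ (fst (es ! e), snd (es ! e) + 1 - 1)" if "e < ?N" for e
      using load_reals(1)[OF that] by simp
    show "load (input_reals A p \<Delta> es) (?N + j) = p $ (j + 1 - 1)" if "j < n" for j
      using load_reals(2)[of j p] that dims by simp
    show "load (input_reals A p \<Delta> es) (?N + n + i) = \<Delta> $ i" if "i < m" for i
      using load_reals(3)[of i \<Delta> A p es] that dims by simp
  qed (use wb X in \<open>simp_all add: Z_def KN_def T_def\<close>)
  show ?thesis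
  proof (rule hx_main[OF L(2)])
    fix h' assume s: "solved (wraw h')"
    have "0 \<le> prob_bad 1024 k A p \<Delta> i" for i by (rule prob_bad_nonneg) simp
    moreover have "16 * exp (- (lam i * \<Delta> $ i / 8)) \<le> prob_bad 1024 k A p \<Delta> i"
      if "i < m" "lam i * \<Delta> $ i < real (4 * (L + 5))" for i
      by (rule prob_bad_lam) (use that dims in simp_all)
    ultimately show "acceptable n m k A p \<Delta> (wraw h')"
      using s unfolding solved_def acceptable_def by simp
  qed (simp_all add: h_def h_init_def Z_def input_state_def dims)
qed

text \<open>The program and \<open>C\<close> are chosen before the input, so the algorithm is
  uniform; word values below a polynomial in n + m + k + 2 prevent large data from being packed into
  single words.\<close>

theorem theorem2:
  "\<exists>c::real. c > 0 \<and>
    (\<exists>(alg::com) (C::nat).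
      \<forall>(n::nat) (m::nat) (k::nat) (A::real mat) (p::real vec) (\<Delta>::real vec) (es::(nat \<times> nat) list).
        A \<in> carrier_mat m n \<and> (\<forall>i<m. \<forall>j<n. A $$ (i, j) \<ge> 0) \<and>
        p \<in> carrier_vec n \<and> (\<forall>j<n. 0 \<le> p $ j \<and> p $ j \<le> 1) \<and>
        \<Delta> \<in> carrier_vec m \<and> (\<forall>i<m. \<Delta> $ i > 0) \<and>
        distinct es \<and> set es = support A \<longrightarrow>
        (\<exists>t work depth.
          runs ((n + m + k + 2) ^ C) alg (input_state k A p \<Delta> es) t work depth \<and>
          real work \<le> real C * real (Max {nnz A, n, m, 1}) * (real k + 1) ^ C
                        * log 2 (real (n + m + 2)) ^ C \<and>
          real depth \<le> real C * (log 2 (real (n * m + 2)) + real k) ^ C \<and>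
          (let q = output_vec n t; I_bad = output_set n m t in
            (\<forall>j<n. q $ j \<in> {0, 1}) \<and>
            I_bad \<subseteq> {..<m} \<and>
            real (card I_bad) \<le> (\<Sum>i<m. prob_bad c k A p \<Delta> i) \<and>
            (\<forall>i\<in>{..<m} - I_bad. \<bar>\<Sum>j<n. A $$ (i, j) * (p $ j - q $ j)\<bar> \<le> \<Delta> $ i))))"
proof -
  \<comment> \<open>C must be at least 30 for the word bounds and at least 6 * 10^11 for the work
    bound. It is kept abstract because it also occurs as an exponent, where the numeral must not be
    evaluated.\<close>
  obtain C :: nat where C: "30 \<le> C" "real C = 10 ^ 13"
  proof
    show "real (10 ^ 13) = 10 ^ 13" by (rule of_nat_power[of 10 13, simplified of_nat_numeral])
  qed simp
  show ?thesis
  proof (intro exI[of _ "1024::real"] exI[of _ c_alg] exI[of _ C] conjI allI impI, simp)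
    fix n m k :: nat and A :: "real mat" and p \<Delta> :: "real vec" and es :: "(nat \<times> nat) list"
    assume asm: "A \<in> carrier_mat m n \<and> (\<forall>i<m. \<forall>j<n. A $$ (i, j) \<ge> 0) \<and>
        p \<in> carrier_vec n \<and> (\<forall>j<n. 0 \<le> p $ j \<and> p $ j \<le> 1) \<and>
        \<Delta> \<in> carrier_vec m \<and> (\<forall>i<m. \<Delta> $ i > 0) \<and>
        distinct es \<and> set es = support A"
    then have dims: "dim_row A = m" "dim_col A = n" "dim_vec p = n" "dim_vec \<Delta> = m" by auto
    define M where "M = Max {nnz A, n, m, 1}"
    have N: "length es = nnz A" using asm distinct_card[of es] by (simp add: nnz_def)
    have M: "nnz A \<le> M" "n \<le> M" "m \<le> M" "1 \<le> M" unfolding M_def by simp_all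
    let ?B = "(n + m + k + 2) ^ C" and ?N = "length es"
    \<comment> \<open>The longest loop runs over two signed copies of the nonzero entries, n
      diagonal entries and 2 m + n constants, at most 6 M in all.\<close>
    let ?Z = "4 + 2 * ?N + n + m" and ?X = "6 * M" and ?s = "input_state k A p \<Delta> es"
    \<comment> \<open>\<open>x\<close> measures depth and \<open>y\<close> work: the product form of
      \<open>y\<close> dominates the sum k + log (n + m + 2), so the same estimate of the depth
      serves both.\<close>
    define x where "x = log 2 (real (n * m + 2)) + real k"
    define y where "y = (real k + 1) * log 2 (real (n + m + 2))"
    have l1: "1 \<le> log 2 (real (n * m + 2))" "1 \<le> log 2 (real (n + m + 2))"
      by (simp_all add: le_log_iff del: of_nat_add of_nat_mult)
    have x1: "1 \<le> x" "real k \<le> x" using l1 by (simp_all add: x_def)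
    have "real k + log 2 (real (n + m + 2)) \<le> y"
      unfolding y_def distrib_right using l1(2) mult_left_mono[OF l1(2), of "real k"] by simp
    then have y1: "1 \<le> y" "real k \<le> y" "log 2 (real (n + m + 2)) \<le> y" using l1 by linarith+
    have "\<exists>D. (n * m = 0 \<longrightarrow> hx ?B ?Z ?X c_zero (h_init ?Z n m k ?N ?s) D (\<lambda>h'. acceptable n m k A p \<Delta> (wraw h'))) \<and>
       (n * m \<noteq> 0 \<longrightarrow> hx ?B ?Z ?X c_main (h_init ?Z n m k ?N ?s) D (\<lambda>h'. acceptable n m k A p \<Delta> (wraw h'))) \<and>
       real (D + 50) \<le> 10 ^ 11 * x ^ 5 \<and> real (D + 50) \<le> 10 ^ 11 * y ^ 5 \<and> ?Z + 10 < ?B \<and> n * m < ?B"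
    proof -
      \<comment> \<open>Instances with L = 0 suffice for what the prefix and the initial test
        compute, namely \<open>Z\<close> and n m.\<close>
      have "?Z + 64 * 2 ^ (2 * 0) + 1000 \<le> ?B"
        by (rule word_bounds(1)[OF _ _ refl refl refl C(1)]) (use card_support_le[of A] dims N in \<open>auto simp: nnz_def\<close>)
      then have ZB: "?Z + 10 < ?B" by simp
      have "4 + 2 * (n * m) + n + m + 64 * 2 ^ (2 * 0) + 1000 \<le> ?B"
        by (rule word_bounds(1)[OF _ _ refl refl refl C(1)]) auto
      then have nB: "n * m < ?B" by simp
      show ?thesis
      proof (cases "n * m = 0")
        case True
        have "hx ?B ?Z ?X c_zero (h_init ?Z n m k ?N ?s) (50 + 50) (\<lambda>h'. acceptable n m k A p \<Delta> (wraw h'))"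
          by (rule hx_zero[where n = n and m = m])
            (use ZB M asm True in \<open>auto simp: h_init_def intro!: acceptable_zero\<close>)
        moreover have "1 \<le> x ^ 5" "1 \<le> y ^ 5" using x1 y1 by (simp_all add: one_le_power)
        ultimately show ?thesis using True ZB nB by (intro exI[of _ "50 + 50"]) simp
      next
        case False
        define L where "L = (LEAST l. 2 * m + n + 2 \<le> 2 ^ l)"
        define KN where "KN = 2 * (k + 4 * (L + 5))"
        define T where "T = 128 * KN * KN * L"
        have "\<exists>l. 2 * m + n + 2 \<le> (2::nat) ^ l" using less_imp_le[OF less_exp] by blast
        then have L1: "2 * m + n + 2 \<le> 2 ^ L" unfolding L_def by (rule LeastI_ex)
        have L2: "2 ^ l < 2 * m + n + 2" if "l < L" for l
          using not_less_Least[OF that[unfolded L_def]] by (simp only: not_le)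
        have "hx ?B ?Z ?X c_main (h_init ?Z n m k ?N ?s) (main_depth L T) (\<lambda>h'. acceptable n m k A p \<Delta> (wraw h'))"
          unfolding T_def KN_def
          by (rule hx_main_input) (use asm False L1 L2 C(1) M N in auto)
        moreover have "2 ^ L \<le> 2 * (2 * m + n + 2)" by (rule pow_le_double[OF L2]) simp_all
        then have P: "2 ^ L \<le> 4 * m + 2 * n + 4" by simp
        have nm: "n \<le> n * m" "m \<le> n * m" "1 \<le> n" "1 \<le> m" using False by simp_all
        have "2 ^ L \<le> (n * m + 2) ^ 3"
        proof -
          \<comment> \<open>As n m >= 1, the base n m + 2 is at least 3 and its cube exceeds 6 (n m
            + 2), while 2^L <= 4 m + 2 n + 4 <= 6 n m + 12.\<close>
          have "3 * 3 \<le> (n * m + 2) * (n * m + 2)" using nm by (intro mult_le_mono) linarith+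
          then have "6 * (n * m + 2) \<le> (n * m + 2) * (n * m + 2) * (n * m + 2)" by (intro mult_le_mono1) linarith
          moreover have "2 ^ L \<le> 6 * (n * m) + 12" using P nm by linarith
          then have "2 ^ L \<le> 6 * (n * m + 2)" by simp
          ultimately show ?thesis unfolding power3_eq_cube by linarith
        qed
        then have Lx: "real L \<le> 3 * x" using log_bound[of L "n * m + 2"] by (simp add: x_def)
        have "2 ^ L \<le> (n + m + 2) ^ 3"
        proof -
          have "2 * 2 \<le> (n + m + 2) * (n + m + 2)" by (intro mult_le_mono) simp_all
          then have "4 * (n + m + 2) \<le> (n + m + 2) * (n + m + 2) * (n + m + 2)" by (intro mult_le_mono1) linarith
          moreover have "2 ^ L \<le> 4 * (n + m + 2)" using P by simp
          ultimately show ?thesis unfolding power3_eq_cube by linarith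
        qed
        then have Ly: "real L \<le> 3 * y" using log_bound[of L "n + m + 2"] y1(3) by simp
        have "real (100 + main_depth L T) \<le> 10 ^ 11 * x ^ 5" by (rule depth_bound[OF x1(1) Lx x1(2) KN_def T_def])
        moreover have "real (100 + main_depth L T) \<le> 10 ^ 11 * y ^ 5" by (rule depth_bound[OF y1(1) Ly y1(2) KN_def T_def])
        ultimately show ?thesis using False ZB nB by (intro exI[of _ "main_depth L T"]) simp
      qed
    qed
    then obtain D where D: "n * m = 0 \<longrightarrow> hx ?B ?Z ?X c_zero (h_init ?Z n m k ?N ?s) D (\<lambda>h'. acceptable n m k A p \<Delta> (wraw h'))"
       "n * m \<noteq> 0 \<longrightarrow> hx ?B ?Z ?X c_main (h_init ?Z n m k ?N ?s) D (\<lambda>h'. acceptable n m k A p \<Delta> (wraw h'))"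
       "real (D + 50) \<le> 10 ^ 11 * x ^ 5" "real (D + 50) \<le> 10 ^ 11 * y ^ 5" "?Z + 10 < ?B" "n * m < ?B"
      by (elim exE conjE) (rule that)
    have "\<exists>h t work depth. runs ?B c_alg ?s t work depth \<and> work \<le> ?X * (D + 50) \<and> depth \<le> D + 50 \<and> rel ?Z h t \<and>
        acceptable n m k A p \<Delta> (wraw h)"
    proof (rule exec_alg[where N = ?N])
      show "wmem ?s 0 = n" "wmem ?s 1 = m" "wmem ?s 2 = k" "wmem ?s 3 = ?N"
        by (simp_all only: input_state_def state.simps load_words dims)
      show "wmem ?s z = 0 \<and> rmem ?s z = 0" if "?Z \<le> z" for z
        using that dims load_beyond(1)[of es z] load_beyond(2)[of es p \<Delta> z] by (simp add: input_state_def)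
    qed (use D M in \<open>simp_all add: input_state_def\<close>)
    then obtain h t work depth where r: "runs ?B c_alg ?s t work depth" "work \<le> ?X * (D + 50)" "depth \<le> D + 50"
      "rel ?Z h t" "acceptable n m k A p \<Delta> (wraw h)" by blast
    have pw: "z ^ 5 \<le> z ^ C" if "1 \<le> z" for z :: real using that C(1) by (intro power_increasing) auto
    have "real work \<le> real (?X * (D + 50))" using r(2) by (rule of_nat_mono)
    also have "\<dots> = 6 * real M * real (D + 50)" by simp
    also have "\<dots> \<le> 6 * real M * (10 ^ 11 * y ^ 5)" using D(4) by (intro mult_left_mono) auto
    also have "\<dots> \<le> 6 * real M * (10 ^ 11 * y ^ C)" using pw[OF y1(1)] by (intro mult_left_mono) auto
    also have "\<dots> = 6 * 10 ^ 11 * (real M * y ^ C)" by simp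
    also have "\<dots> \<le> real C * (real M * y ^ C)" unfolding C(2) using y1 by (intro mult_right_mono) auto
    finally have work: "real work \<le> real C * real M * (real k + 1) ^ C * log 2 (real (n + m + 2)) ^ C"
      unfolding y_def by (simp only: power_mult_distrib mult.assoc)
    have "real depth \<le> real (D + 50)" using r(3) by (rule of_nat_mono)
    also have "\<dots> \<le> 10 ^ 11 * x ^ 5" by (rule D(3))
    also have "\<dots> \<le> 10 ^ 11 * x ^ C" using pw[OF x1(1)] by (intro mult_left_mono) auto
    also have "\<dots> \<le> real C * x ^ C" unfolding C(2) using x1 by (intro mult_right_mono) auto
    finally have depth: "real depth \<le> real C * (log 2 (real (n * m + 2)) + real k) ^ C" unfolding x_def .
    have "wmem t z = wraw h z" if "z < n + m" for z using r(4) that by (simp add: rel_def)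
    note out = acceptable_outputs[OF r(5) this]
    show "\<exists>t work depth.
          runs ((n + m + k + 2) ^ C) c_alg (input_state k A p \<Delta> es) t work depth \<and>
          real work \<le> real C * real (Max {nnz A, n, m, 1}) * (real k + 1) ^ C
                        * log 2 (real (n + m + 2)) ^ C \<and>
          real depth \<le> real C * (log 2 (real (n * m + 2)) + real k) ^ C \<and>
          (let q = output_vec n t; I_bad = output_set n m t in
            (\<forall>j<n. q $ j \<in> {0, 1}) \<and>
            I_bad \<subseteq> {..<m} \<and>
            real (card I_bad) \<le> (\<Sum>i<m. prob_bad 1024 k A p \<Delta> i) \<and>
            (\<forall>i\<in>{..<m} - I_bad. \<bar>\<Sum>j<n. A $$ (i, j) * (p $ j - q $ j)\<bar> \<le> \<Delta> $ i))"
      using r(1) work depth out unfolding M_def by blast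
  qed
qed

end
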